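(* Let $k$ be a field, let $H$ be a Hopf algebra over $k$ and let $A/B$ be an $H$-Galois extension of $k$-algebras. Let $A_B:=A/[A,B]$ with its left $H$-module structure (Ulbrich–Miyashita action) and its right $H$-comodule structure $\overline a\mapsto\sum \overline{a}_{\langle 0\rangle}\otimes a_{\langle 1\rangle}$. For $n\ge 0$ put $Z_n(H,A_B)=H^{\otimes(n+1)}\otimes_H A_B$ and, for $0\le i\le n$, $$\delta_i((h^0,\ldots,h^n)\otimes_H \overline a)=\varepsilon(h^i)(h^0,\ldots,\widehat{h^i},\ldots,h^n)\otimes_H\overline a\quad (n\ge 1),$$ $$\sigma_i((h^0,\ldots,h^n)\otimes_H\overline a)=(h^0,\ldots,\Delta(h^i),\ldots,h^n)\otimes_H\overline a,$$ $$\tau_n((h^0,\ldots,h^n)\otimes_H\overline a)=\sum(h^n a_{\langle1\rangle},h^0,\ldots,h^{n-1})\otimes_H\overline a_{\langle0\rangle}.$$ Then $(Z_*(H,A_B),\delta_*,\sigma_*,\tau_* )$ is a cyclic object and it is isomorphic, as a cyclic object, to $Z_*(A/B)$. In particular, the cyclic homology of $Z_*(H,A_B)$ is isomorphic to $\mathrm{HC}_*(A/B)$.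
   Context: All algebras are associative unital $k$-algebras, $\otimes=\otimes_k$. $H$ has comultiplication $\Delta(h)=\sum h_{(1)}\otimes h_{(2)}$, counit $\varepsilon$, antipode $S$. Elements $h^0\otimes\cdots\otimes h^n$ of $H^{\otimes(n+1)}$ are written $(h^0,\ldots,h^n)$, and $H^{\otimes(n+1)}$ is a right $H$-module by the diagonal action $(h^0,\ldots,h^n)h=\sum(h^0h_{(1)},\ldots,h^nh_{(n+1)})$. $\Delta(h^i)$ in $\sigma_i$ occupies two consecutive tensor positions. $A/B$ denotes a $k$-algebra $A$ with subalgebra $B$. For a $(B,B)$-bimodule $X$, $[X,B]$ is the subspace spanned by all $xb-bx$ and $X_B:=X/[X,B]$. $H$-Galois extension: $A$ is a right $H$-comodule via an algebra map $\rho:A\to A\otimes H$, $\rho(a)=\sum a_{\langle0\rangle}\otimes a_{\langle1\rangle}$, such that $B=\{a\in A\mid\rho(a)=a\otimes1\}$ and the map $\beta:A\otimes_BA\to A\otimes H$, $\beta(x\otimes_By)=\sum xy_{\langle0\rangle}\otimes y_{\langle1\rangle}$, is bijective. Write $\kappa(h)=\beta^{-1}(1\otimes h)=\sum\kappa^1(h)\otimes_B\kappa^2(h)$. The Ulbrich–Miyashita left action of $H$ on $A_B$ is $h\cdot\overline a=\sum\overline{\kappa^2(h)a\kappa^1(h)}$; the right coaction of $H$ on $A_B$ is induced by $\rho$. $Z_*(A/B)$ is the cyclic object with $Z_n(A/B)=A^{\widehat\otimes_B(n+1)}:=(A^{\otimes_B(n+1)})_B$ (class of $a^0\otimes_B\cdots\otimes_Ba^n$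 written $a^0\widehat\otimes_B\cdots\widehat\otimes_Ba^n$), faces $d_i$ multiplying the adjacent entries $a^i,a^{i+1}$ for $0\le i<n$ and $d_n(a^0\widehat\otimes_B\cdots\widehat\otimes_Ba^n)=a^na^0\widehat\otimes_Ba^1\widehat\otimes_B\cdots\widehat\otimes_Ba^{n-1}$, degeneracies $s_i$ inserting $1$ after $a^i$, and cyclic operator $t_n(a^0\widehat\otimes_B\cdots\widehat\otimes_Ba^n)=a^n\widehat\otimes_Ba^0\widehat\otimes_B\cdots\widehat\otimes_Ba^{n-1}$. $\mathrm{HC}_*(A/B)$ is the cyclic homology of $Z_*(A/B)$, i.e. the homology of the total complex of its Tsygan double complex. *)

theory Defs
  imports "HOL-Algebra.Module" "HOL-Algebra.AbelCoset" "HOL.Hull"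
begin

section \<open>Linear algebra over a commutative ring K\<close>

definition lin_hom ::
  "('k,'r) ring_scheme \<Rightarrow> ('k,'m,'s) module_scheme \<Rightarrow> ('k,'n,'t) module_scheme \<Rightarrow> ('m \<Rightarrow> 'n) set"
  where "lin_hom K M N = {f \<in> carrier M \<rightarrow> carrier N.
     (\<forall>x\<in>carrier M. \<forall>y\<in>carrier M. f (x \<oplus>\<^bsub>M\<^esub> y) = f x \<oplus>\<^bsub>N\<^esub> f y) \<and>
     (\<forall>c\<in>carrier K. \<forall>x\<in>carrier M. f (c \<odot>\<^bsub>M\<^esub> x) = c \<odot>\<^bsub>N\<^esub> f x)}"

definition lin_iso ::
  "('k,'r) ring_scheme \<Rightarrow> ('k,'m,'s) module_scheme \<Rightarrow> ('k,'n,'t) module_scheme \<Rightarrow> ('m \<Rightarrow> 'n) set"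
  where "lin_iso K M N = {f \<in> lin_hom K M N. bij_betw f (carrier M) (carrier N)}"

definition lin_span :: "('k,'r) ring_scheme \<Rightarrow> ('k,'m,'s) module_scheme \<Rightarrow> 'm set \<Rightarrow> 'm set"
  where "lin_span K M S = (\<lambda>W. submodule W K M) hull S"

text \<open>The quotient module \<open>M/N\<close>; its elements are cosets, its zero is \<open>N\<close>.
  A module record also has ring multiplication fields; they carry no meaning here and are filled
  in below where a tensor product of algebras is an algebra.\<close>

definition quot_module :: "('k,'m,'s) module_scheme \<Rightarrow> 'm set \<Rightarrow> ('k,'m set) module"
  where "quot_module M N =
    \<lparr>carrier = a_rcosets\<^bsub>M\<^esub> N, mult = undefined, one = undefined,
     zero = N, add = set_add M,
     smult = (\<lambda>c X. \<Union>x\<in>X. N +>\<^bsub>M\<^esub> (c \<odot>\<^bsub>M\<^esub> x))\<rparr>"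

text \<open>The map induced on cosets by a map constant on each of them.\<close>

definition quot_lift :: "('m \<Rightarrow> 'n) \<Rightarrow> 'm set \<Rightarrow> 'n"
  where "quot_lift g C = the_elem (g ` C)"

definition free_module :: "('k,'r) ring_scheme \<Rightarrow> 'x set \<Rightarrow> ('k,'x \<Rightarrow> 'k) module"
  where "free_module K X =
    \<lparr>carrier = {v. (\<forall>x\<in>X. v x \<in> carrier K) \<and> (\<forall>x. x \<notin> X \<longrightarrow> v x = \<zero>\<^bsub>K\<^esub>) \<and>
                   finite {x. v x \<noteq> \<zero>\<^bsub>K\<^esub>}},
     mult = undefined, one = undefined,
     zero = (\<lambda>x. \<zero>\<^bsub>K\<^esub>), add = (\<lambda>v w x. v x \<oplus>\<^bsub>K\<^esub> w x),
     smult = (\<lambda>c v x. c \<otimes>\<^bsub>K\<^esub> v x)\<rparr>"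

definition basis_vec :: "('k,'r) ring_scheme \<Rightarrow> 'x \<Rightarrow> 'x \<Rightarrow> 'k"
  where "basis_vec K x = (\<lambda>y. if y = x then \<one>\<^bsub>K\<^esub> else \<zero>\<^bsub>K\<^esub>)"

text \<open>Linear extension to the free module of a map \<open>f\<close> given on its basis.\<close>

definition lin_ext ::
  "('k,'r) ring_scheme \<Rightarrow> ('k,'n,'t) module_scheme \<Rightarrow> ('x \<Rightarrow> 'n) \<Rightarrow> ('x \<Rightarrow> 'k) \<Rightarrow> 'n"
  where "lin_ext K W f v = (\<Oplus>\<^bsub>W\<^esub>x\<in>{x. v x \<noteq> \<zero>\<^bsub>K\<^esub>}. v x \<odot>\<^bsub>W\<^esub> f x)"

text \<open>Modules given by generators \<open>X\<close> and relations \<open>R\<close>; tensor products are modules of this kind.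
  In \<open>gen K Q x\<close>, the class of the generator \<open>x\<close> in such a module \<open>Q\<close>, the submodule of relations
  is recovered as the zero of \<open>Q\<close>. \<open>gen_lift K W f\<close> is the linear map into \<open>W\<close> that sends
  the class of \<open>x\<close> to \<open>f x\<close>.\<close>

definition presented ::
  "('k,'r) ring_scheme \<Rightarrow> 'x set \<Rightarrow> ('x \<Rightarrow> 'k) set \<Rightarrow> ('k,('x \<Rightarrow> 'k) set) module"
  where "presented K X R = quot_module (free_module K X) (lin_span K (free_module K X) R)"

definition gen ::
  "('k,'r) ring_scheme \<Rightarrow> ('k,('x \<Rightarrow> 'k) set) module \<Rightarrow> 'x \<Rightarrow> ('x \<Rightarrow> 'k) set"
  where "gen K Q x = \<zero>\<^bsub>Q\<^esub> +>\<^bsub>free_module K UNIV\<^esub> basis_vec K x"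

definition gen_lift ::
  "('k,'r) ring_scheme \<Rightarrow> ('k,'n,'t) module_scheme \<Rightarrow> ('x \<Rightarrow> 'n) \<Rightarrow> ('x \<Rightarrow> 'k) set \<Rightarrow> 'n"
  where "gen_lift K W f = quot_lift (lin_ext K W f)"


section \<open>Tensor products\<close>

text \<open>\<open>M \<otimes>\<^sub>S N\<close> for an action \<open>ra\<close> of \<open>S\<close> on \<open>M\<close> from the right and \<open>la\<close> on \<open>N\<close> from
  the left.\<close>

definition bilinear_rels ::
  "('k,'r) ring_scheme \<Rightarrow> ('k,'m,'s) module_scheme \<Rightarrow> ('k,'n,'t) module_scheme \<Rightarrow> ('m \<times> 'n \<Rightarrow> 'k) set"
  where "bilinear_rels K M N =
    (let F = free_module K (carrier M \<times> carrier N); e = basis_vec K in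
      {e (x \<oplus>\<^bsub>M\<^esub> x', y) \<ominus>\<^bsub>F\<^esub> (e (x, y) \<oplus>\<^bsub>F\<^esub> e (x', y)) | x x' y.
          x \<in> carrier M \<and> x' \<in> carrier M \<and> y \<in> carrier N} \<union>
      {e (x, y \<oplus>\<^bsub>N\<^esub> y') \<ominus>\<^bsub>F\<^esub> (e (x, y) \<oplus>\<^bsub>F\<^esub> e (x, y')) | x y y'.
          x \<in> carrier M \<and> y \<in> carrier N \<and> y' \<in> carrier N} \<union>
      {e (c \<odot>\<^bsub>M\<^esub> x, y) \<ominus>\<^bsub>F\<^esub> (c \<odot>\<^bsub>F\<^esub> e (x, y)) | c x y.
          c \<in> carrier K \<and> x \<in> carrier M \<and> y \<in> carrier N} \<union>
      {e (x, c \<odot>\<^bsub>N\<^esub> y) \<ominus>\<^bsub>F\<^esub> (c \<odot>\<^bsub>F\<^esub> e (x, y)) | c x y.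
          c \<in> carrier K \<and> x \<in> carrier M \<and> y \<in> carrier N})"

definition tensor_over ::
  "('k,'r) ring_scheme \<Rightarrow> ('k,'m,'s) module_scheme \<Rightarrow> ('k,'n,'t) module_scheme \<Rightarrow>
   'b set \<Rightarrow> ('m \<Rightarrow> 'b \<Rightarrow> 'm) \<Rightarrow> ('b \<Rightarrow> 'n \<Rightarrow> 'n) \<Rightarrow> ('k,('m \<times> 'n \<Rightarrow> 'k) set) module"
  where "tensor_over K M N S ra la =
    (let F = free_module K (carrier M \<times> carrier N); e = basis_vec K in
      presented K (carrier M \<times> carrier N)
       (bilinear_rels K M N \<union>
        {e (ra x s, y) \<ominus>\<^bsub>F\<^esub> e (x, la s y) | x s y.
           x \<in> carrier M \<and> s \<in> S \<and> y \<in> carrier N}))"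

text \<open>\<open>M \<otimes>\<^sub>K N\<close>. The multiplication is the one of the tensor product of two algebras.\<close>

definition tensor ::
  "('k,'r) ring_scheme \<Rightarrow> ('k,'m,'s) module_scheme \<Rightarrow> ('k,'n,'t) module_scheme \<Rightarrow>
   ('k,('m \<times> 'n \<Rightarrow> 'k) set) module"
  where "tensor K M N =
    (let T = presented K (carrier M \<times> carrier N) (bilinear_rels K M N) in
      T\<lparr>mult := (\<lambda>X Y. gen_lift K T (\<lambda>(x, y). gen_lift K T
                   (\<lambda>(x', y'). gen K T (x \<otimes>\<^bsub>M\<^esub> x', y \<otimes>\<^bsub>N\<^esub> y')) Y) X),
        one := gen K T (\<one>\<^bsub>M\<^esub>, \<one>\<^bsub>N\<^esub>)\<rparr>)"

text \<open>Tensor powers have lists of length \<open>n\<close> as generators.\<close>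

definition tuples :: "('b,'m) partial_object_scheme \<Rightarrow> nat \<Rightarrow> 'b list set"
  where "tuples M n = {xs. set xs \<subseteq> carrier M \<and> length xs = n}"

definition multilinear_rels ::
  "('k,'r) ring_scheme \<Rightarrow> ('k,'m,'s) module_scheme \<Rightarrow> nat \<Rightarrow> ('m list \<Rightarrow> 'k) set"
  where "multilinear_rels K M n =
    (let F = free_module K (tuples M n); e = basis_vec K in
      {e (xs @ [x \<oplus>\<^bsub>M\<^esub> x'] @ ys) \<ominus>\<^bsub>F\<^esub> (e (xs @ [x] @ ys) \<oplus>\<^bsub>F\<^esub> e (xs @ [x'] @ ys)) | xs x x' ys.
          xs @ [x] @ ys \<in> tuples M n \<and> x' \<in> carrier M} \<union>
      {e (xs @ [c \<odot>\<^bsub>M\<^esub> x] @ ys) \<ominus>\<^bsub>F\<^esub> (c \<odot>\<^bsub>F\<^esub> e (xs @ [x] @ ys)) | xs c x ys.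
          c \<in> carrier K \<and> xs @ [x] @ ys \<in> tuples M n})"

text \<open>\<open>M\<^sup>\<otimes>\<^sup>n\<close> over \<open>K\<close>, with the multiplication of a tensor power of an algebra.\<close>

definition tensor_power ::
  "('k,'r) ring_scheme \<Rightarrow> ('k,'m,'s) module_scheme \<Rightarrow> nat \<Rightarrow> ('k,('m list \<Rightarrow> 'k) set) module"
  where "tensor_power K M n =
    (let T = presented K (tuples M n) (multilinear_rels K M n) in
      T\<lparr>mult := (\<lambda>X Y. gen_lift K T (\<lambda>xs. gen_lift K T
                   (\<lambda>ys. gen K T (map2 (mult M) xs ys)) Y) X),
        one := gen K T (replicate n \<one>\<^bsub>M\<^esub>)\<rparr>)"

text \<open>\<open>A \<otimes>\<^sub>B \<dots> \<otimes>\<^sub>B A\<close> with \<open>n\<close> factors (\<open>n \<ge> 1\<close>), for a subalgebra \<open>B\<close> of \<open>A\<close>.\<close>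

definition rel_tensor_power ::
  "('k,'r) ring_scheme \<Rightarrow> ('k,'a,'s) module_scheme \<Rightarrow> 'a set \<Rightarrow> nat \<Rightarrow>
   ('k,('a list \<Rightarrow> 'k) set) module"
  where "rel_tensor_power K A B n =
    (let F = free_module K (tuples A n); e = basis_vec K in
      presented K (tuples A n)
       (multilinear_rels K A n \<union>
        {e (xs @ [x \<otimes>\<^bsub>A\<^esub> b, y] @ ys) \<ominus>\<^bsub>F\<^esub> e (xs @ [x, b \<otimes>\<^bsub>A\<^esub> y] @ ys) | xs x b y ys.
           b \<in> B \<and> xs @ [x, y] @ ys \<in> tuples A n}))"


section \<open>Algebras and Hopf algebras\<close>

locale k_algebra =
  fixes K :: "('k,'r) ring_scheme" and A :: "('k,'a,'s) module_scheme"
  assumes field: "field K"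
    and ring: "ring A"
    and module: "module K A"
    and smult_mult_left: "\<lbrakk>c \<in> carrier K; x \<in> carrier A; y \<in> carrier A\<rbrakk>
          \<Longrightarrow> (c \<odot>\<^bsub>A\<^esub> x) \<otimes>\<^bsub>A\<^esub> y = c \<odot>\<^bsub>A\<^esub> (x \<otimes>\<^bsub>A\<^esub> y)"
    and smult_mult_right: "\<lbrakk>c \<in> carrier K; x \<in> carrier A; y \<in> carrier A\<rbrakk>
          \<Longrightarrow> x \<otimes>\<^bsub>A\<^esub> (c \<odot>\<^bsub>A\<^esub> y) = c \<odot>\<^bsub>A\<^esub> (x \<otimes>\<^bsub>A\<^esub> y)"

text \<open>The values of \<open>comult\<close> lie in \<open>tensor_power K H 2\<close>.\<close>

record ('k,'h) hopf = "('k,'h) module" +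
  comult :: "'h \<Rightarrow> ('h list \<Rightarrow> 'k) set"
  counit :: "'h \<Rightarrow> 'k"
  antipode :: "'h \<Rightarrow> 'h"

text \<open>\<open>comult_at K H n i\<close> and \<open>counit_at K H n i\<close> apply the comultiplication, respectively the
  counit, to the factor with index \<open>i < n\<close> (counting from 0) of \<open>H\<^sup>\<otimes>\<^sup>n\<close>; they take values
  in the tensor powers with exponents \<open>n + 1\<close> and \<open>n - 1\<close>.\<close>

definition comult_at ::
  "('k,'r) ring_scheme \<Rightarrow> ('k,'h) hopf \<Rightarrow> nat \<Rightarrow> nat \<Rightarrow> ('h list \<Rightarrow> 'k) set \<Rightarrow> ('h list \<Rightarrow> 'k) set"
  where "comult_at K H n i = (let T = tensor_power K H (n + 1) in
    gen_lift K T (\<lambda>hs. gen_lift K T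
      (\<lambda>gs. gen K T (take i hs @ gs @ drop (i + 1) hs)) (comult H (hs ! i))))"

definition counit_at ::
  "('k,'r) ring_scheme \<Rightarrow> ('k,'h) hopf \<Rightarrow> nat \<Rightarrow> nat \<Rightarrow> ('h list \<Rightarrow> 'k) set \<Rightarrow> ('h list \<Rightarrow> 'k) set"
  where "counit_at K H n i = (let T = tensor_power K H (n - 1) in
    gen_lift K T (\<lambda>hs. counit H (hs ! i) \<odot>\<^bsub>T\<^esub> gen K T (take i hs @ drop (i + 1) hs)))"

text \<open>\<open>h\<^sub>(\<^sub>1\<^sub>) \<otimes> \<dots> \<otimes> h\<^sub>(\<^sub>n\<^sub>+\<^sub>1\<^sub>)\<close>.\<close>

primrec iter_comult ::
  "('k,'r) ring_scheme \<Rightarrow> ('k,'h) hopf \<Rightarrow> nat \<Rightarrow> 'h \<Rightarrow> ('h list \<Rightarrow> 'k) set"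
  where
    "iter_comult K H 0 h = gen K (tensor_power K H 1) [h]"
  | "iter_comult K H (Suc n) h = comult_at K H (Suc n) 0 (iter_comult K H n h)"

definition diag_act ::
  "('k,'r) ring_scheme \<Rightarrow> ('k,'h) hopf \<Rightarrow> nat \<Rightarrow> ('h list \<Rightarrow> 'k) set \<Rightarrow> 'h \<Rightarrow> ('h list \<Rightarrow> 'k) set"
  where "diag_act K H n X h = X \<otimes>\<^bsub>tensor_power K H (n + 1)\<^esub> iter_comult K H n h"

locale hopf_algebra = k_algebra K H
  for K :: "('k,'r) ring_scheme" and H :: "('k,'h) hopf" +
  assumes comult_linear: "comult H \<in> lin_hom K H (tensor_power K H 2)"
    and comult_ring_hom: "comult H \<in> ring_hom H (tensor_power K H 2)"
    and counit_ring_hom: "counit H \<in> ring_hom H K"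
    and counit_smult: "\<lbrakk>c \<in> carrier K; h \<in> carrier H\<rbrakk>
          \<Longrightarrow> counit H (c \<odot>\<^bsub>H\<^esub> h) = c \<otimes>\<^bsub>K\<^esub> counit H h"
    and antipode_linear: "antipode H \<in> lin_hom K H H"
    and coassoc: "h \<in> carrier H \<Longrightarrow>
          comult_at K H 2 0 (comult H h) = comult_at K H 2 1 (comult H h)"
    and counit_left: "h \<in> carrier H \<Longrightarrow>
          gen_lift K H (\<lambda>hs. counit H (hs ! 0) \<odot>\<^bsub>H\<^esub> hs ! 1) (comult H h) = h"
    and counit_right: "h \<in> carrier H \<Longrightarrow>
          gen_lift K H (\<lambda>hs. counit H (hs ! 1) \<odot>\<^bsub>H\<^esub> hs ! 0) (comult H h) = h"
    and antipode_left: "h \<in> carrier H \<Longrightarrow>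
          gen_lift K H (\<lambda>hs. antipode H (hs ! 0) \<otimes>\<^bsub>H\<^esub> hs ! 1) (comult H h)
            = counit H h \<odot>\<^bsub>H\<^esub> \<one>\<^bsub>H\<^esub>"
    and antipode_right: "h \<in> carrier H \<Longrightarrow>
          gen_lift K H (\<lambda>hs. hs ! 0 \<otimes>\<^bsub>H\<^esub> antipode H (hs ! 1)) (comult H h)
            = counit H h \<odot>\<^bsub>H\<^esub> \<one>\<^bsub>H\<^esub>"


section \<open>Hopf-Galois extensions\<close>

definition galois_map ::
  "('k,'r) ring_scheme \<Rightarrow> ('k,'h) hopf \<Rightarrow> ('k,'a) module \<Rightarrow> ('a \<Rightarrow> ('a \<times> 'h \<Rightarrow> 'k) set) \<Rightarrow>
   ('a list \<Rightarrow> 'k) set \<Rightarrow> ('a \<times> 'h \<Rightarrow> 'k) set"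
  where "galois_map K H A \<rho> = (let T = tensor K A H in
    gen_lift K T (\<lambda>xs. gen_lift K T
      (\<lambda>(y\<^sub>0, y\<^sub>1). gen K T (xs ! 0 \<otimes>\<^bsub>A\<^esub> y\<^sub>0, y\<^sub>1)) (\<rho> (xs ! 1))))"

text \<open>In \<open>coaction_coassoc\<close> both sides lie in \<open>A \<otimes> (H \<otimes> H)\<close>. That \<open>B\<close> is a subalgebra
  of \<open>A\<close> follows from \<open>coinvariants\<close>.\<close>

locale galois_extension = H: hopf_algebra K H + A: k_algebra K A
  for K :: "('k,'r) ring_scheme" and H :: "('k,'h) hopf" and A :: "('k,'a) module"
    and B :: "'a set" and \<rho> :: "'a \<Rightarrow> ('a \<times> 'h \<Rightarrow> 'k) set" +
  assumes coaction_linear: "\<rho> \<in> lin_hom K A (tensor K A H)"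
    and coaction_ring_hom: "\<rho> \<in> ring_hom A (tensor K A H)"
    and coaction_coassoc: "a \<in> carrier A \<Longrightarrow>
      (let T = tensor K A (tensor_power K H 2) in
        gen_lift K T (\<lambda>(x, h). gen_lift K T
          (\<lambda>(x', g). gen K T (x', gen K (tensor_power K H 2) [g, h])) (\<rho> x)) (\<rho> a)
        = gen_lift K T (\<lambda>(x, h). gen K T (x, comult H h)) (\<rho> a))"
    and coaction_counit: "a \<in> carrier A \<Longrightarrow>
      gen_lift K A (\<lambda>(x, h). counit H h \<odot>\<^bsub>A\<^esub> x) (\<rho> a) = a"
    and coinvariants: "B = {a \<in> carrier A. \<rho> a = gen K (tensor K A H) (a, \<one>\<^bsub>H\<^esub>)}"
    and galois: "bij_betw (galois_map K H A \<rho>)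
          (carrier (rel_tensor_power K A B 2)) (carrier (tensor K A H))"

text \<open>\<open>X\<^sub>B = X/[X,B]\<close> for a bimodule \<open>X\<close> with left action \<open>la\<close> and right action \<open>ra\<close>.\<close>

definition bimod_quot ::
  "('k,'r) ring_scheme \<Rightarrow> ('k,'x,'s) module_scheme \<Rightarrow> 'b set \<Rightarrow>
   ('b \<Rightarrow> 'x \<Rightarrow> 'x) \<Rightarrow> ('x \<Rightarrow> 'b \<Rightarrow> 'x) \<Rightarrow> ('k,'x set) module"
  where "bimod_quot K X B la ra =
    quot_module X (lin_span K X {ra x b \<ominus>\<^bsub>X\<^esub> la b x | x b. x \<in> carrier X \<and> b \<in> B})"

definition alg_quot ::
  "('k,'r) ring_scheme \<Rightarrow> ('k,'a) module \<Rightarrow> 'a set \<Rightarrow> ('k,'a set) module"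
  where "alg_quot K A B = bimod_quot K A B (mult A) (mult A)"

definition alg_class ::
  "('k,'r) ring_scheme \<Rightarrow> ('k,'a) module \<Rightarrow> 'a set \<Rightarrow> 'a \<Rightarrow> 'a set"
  where "alg_class K A B a = \<zero>\<^bsub>alg_quot K A B\<^esub> +>\<^bsub>A\<^esub> a"

definition translation ::
  "('k,'r) ring_scheme \<Rightarrow> ('k,'h) hopf \<Rightarrow> ('k,'a) module \<Rightarrow> 'a set \<Rightarrow>
   ('a \<Rightarrow> ('a \<times> 'h \<Rightarrow> 'k) set) \<Rightarrow> 'h \<Rightarrow> ('a list \<Rightarrow> 'k) set"
  where "translation K H A B \<rho> h =
    inv_into (carrier (rel_tensor_power K A B 2)) (galois_map K H A \<rho>)
      (gen K (tensor K A H) (\<one>\<^bsub>A\<^esub>, h))"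

text \<open>The Ulbrich-Miyashita action of \<open>H\<close> on \<open>A\<^sub>B\<close>.\<close>

definition um_act ::
  "('k,'r) ring_scheme \<Rightarrow> ('k,'h) hopf \<Rightarrow> ('k,'a) module \<Rightarrow> 'a set \<Rightarrow>
   ('a \<Rightarrow> ('a \<times> 'h \<Rightarrow> 'k) set) \<Rightarrow> 'h \<Rightarrow> 'a set \<Rightarrow> 'a set"
  where "um_act K H A B \<rho> h = quot_lift (\<lambda>a. gen_lift K (alg_quot K A B)
    (\<lambda>xs. alg_class K A B (xs ! 1 \<otimes>\<^bsub>A\<^esub> a \<otimes>\<^bsub>A\<^esub> xs ! 0)) (translation K H A B \<rho> h))"

definition quot_coaction ::
  "('k,'r) ring_scheme \<Rightarrow> ('k,'h) hopf \<Rightarrow> ('k,'a) module \<Rightarrow> 'a set \<Rightarrow>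
   ('a \<Rightarrow> ('a \<times> 'h \<Rightarrow> 'k) set) \<Rightarrow> 'a set \<Rightarrow> ('a set \<times> 'h \<Rightarrow> 'k) set"
  where "quot_coaction K H A B \<rho> = (let T = tensor K (alg_quot K A B) H in
    quot_lift (\<lambda>a. gen_lift K T (\<lambda>(x, h). gen K T (alg_class K A B x, h)) (\<rho> a)))"


section \<open>Cyclic objects in K-vector spaces and their cyclic homology\<close>

text \<open>\<open>face Z n i\<close> goes from degree \<open>n\<close> to \<open>n - 1\<close> (for \<open>i \<le> n\<close>, \<open>n \<ge> 1\<close>), \<open>degen Z n i\<close> from
  degree \<open>n\<close> to \<open>n + 1\<close> (for \<open>i \<le> n\<close>), and \<open>cyc Z n\<close> is the cyclic operator in degree \<open>n\<close>.\<close>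

record ('k,'x) cyclic_data =
  space :: "nat \<Rightarrow> ('k,'x) module"
  face :: "nat \<Rightarrow> nat \<Rightarrow> 'x \<Rightarrow> 'x"
  degen :: "nat \<Rightarrow> nat \<Rightarrow> 'x \<Rightarrow> 'x"
  cyc :: "nat \<Rightarrow> 'x \<Rightarrow> 'x"

locale cyclic_object =
  fixes K :: "('k,'r) ring_scheme" and Z :: "('k,'x) cyclic_data"
  assumes space_module: "module K (space Z n)"
    and face_linear: "i \<le> n + 1 \<Longrightarrow> face Z (n + 1) i \<in> lin_hom K (space Z (n + 1)) (space Z n)"
    and degen_linear: "i \<le> n \<Longrightarrow> degen Z n i \<in> lin_hom K (space Z n) (space Z (n + 1))"
    and cyc_linear: "cyc Z n \<in> lin_hom K (space Z n) (space Z n)"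
    and face_face: "\<lbrakk>i < j; j \<le> n + 2; x \<in> carrier (space Z (n + 2))\<rbrakk> \<Longrightarrow>
          face Z (n + 1) i (face Z (n + 2) j x) = face Z (n + 1) (j - 1) (face Z (n + 2) i x)"
    and degen_degen: "\<lbrakk>i \<le> j; j \<le> n; x \<in> carrier (space Z n)\<rbrakk> \<Longrightarrow>
          degen Z (n + 1) i (degen Z n j x) = degen Z (n + 1) (j + 1) (degen Z n i x)"
    and face_degen_less: "\<lbrakk>i < j; j \<le> n + 1; x \<in> carrier (space Z (n + 1))\<rbrakk> \<Longrightarrow>
          face Z (n + 2) i (degen Z (n + 1) j x) = degen Z n (j - 1) (face Z (n + 1) i x)"
    and face_degen_eq: "\<lbrakk>i = j \<or> i = j + 1; j \<le> n; x \<in> carrier (space Z n)\<rbrakk> \<Longrightarrow>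
          face Z (n + 1) i (degen Z n j x) = x"
    and face_degen_greater: "\<lbrakk>j + 1 < i; i \<le> n + 2; x \<in> carrier (space Z (n + 1))\<rbrakk> \<Longrightarrow>
          face Z (n + 2) i (degen Z (n + 1) j x) = degen Z n j (face Z (n + 1) (i - 1) x)"
    and face_cyc: "\<lbrakk>1 \<le> i; i \<le> n + 1; x \<in> carrier (space Z (n + 1))\<rbrakk> \<Longrightarrow>
          face Z (n + 1) i (cyc Z (n + 1) x) = cyc Z n (face Z (n + 1) (i - 1) x)"
    and face_0_cyc: "x \<in> carrier (space Z (n + 1)) \<Longrightarrow>
          face Z (n + 1) 0 (cyc Z (n + 1) x) = face Z (n + 1) (n + 1) x"
    and degen_cyc: "\<lbrakk>1 \<le> i; i \<le> n; x \<in> carrier (space Z n)\<rbrakk> \<Longrightarrow>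
          degen Z n i (cyc Z n x) = cyc Z (n + 1) (degen Z n (i - 1) x)"
    and degen_0_cyc: "x \<in> carrier (space Z n) \<Longrightarrow>
          degen Z n 0 (cyc Z n x) = cyc Z (n + 1) (cyc Z (n + 1) (degen Z n n x))"
    and cyc_power: "x \<in> carrier (space Z n) \<Longrightarrow> (cyc Z n ^^ (n + 1)) x = x"

definition cyclic_isomorphic ::
  "('k,'r) ring_scheme \<Rightarrow> ('k,'x) cyclic_data \<Rightarrow> ('k,'y) cyclic_data \<Rightarrow> bool"
  where "cyclic_isomorphic K Z Z' \<longleftrightarrow>
    cyclic_object K Z \<and> cyclic_object K Z' \<and>
    (\<exists>\<phi>. (\<forall>n. \<phi> n \<in> lin_iso K (space Z n) (space Z' n)) \<and>
      (\<forall>n. \<forall>i\<le>n + 1. \<forall>x\<in>carrier (space Z (n + 1)).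
          \<phi> n (face Z (n + 1) i x) = face Z' (n + 1) i (\<phi> (n + 1) x)) \<and>
      (\<forall>n. \<forall>i\<le>n. \<forall>x\<in>carrier (space Z n).
          \<phi> (n + 1) (degen Z n i x) = degen Z' n i (\<phi> n x)) \<and>
      (\<forall>n. \<forall>x\<in>carrier (space Z n). \<phi> n (cyc Z n x) = cyc Z' n (\<phi> n x)))"

text \<open>Tsygan's double complex has \<open>Z\<^sub>q\<close> in bidegree \<open>(p, q)\<close>, \<open>p, q \<ge> 0\<close>. The vertical
  differential is \<open>b\<close> in the columns with \<open>p\<close> even and \<open>-b'\<close> in those with \<open>p\<close> odd; the horizontal
  one, from column \<open>p\<close> to \<open>p - 1\<close>, is \<open>1 - (-1)\<^sup>q t\<close> for \<open>p\<close> odd and the norm operator for \<open>p\<close> even.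
  \<open>hoch_b\<close> and \<open>hoch_b'\<close> are indexed by the degree of their target.\<close>

definition sign :: "('k,'r) ring_scheme \<Rightarrow> nat \<Rightarrow> 'k"
  where "sign K i = (\<ominus>\<^bsub>K\<^esub> \<one>\<^bsub>K\<^esub>) [^]\<^bsub>K\<^esub> i"

definition hoch_b :: "('k,'r) ring_scheme \<Rightarrow> ('k,'x) cyclic_data \<Rightarrow> nat \<Rightarrow> 'x \<Rightarrow> 'x"
  where "hoch_b K Z q x =
    (\<Oplus>\<^bsub>space Z q\<^esub>i\<in>{..q + 1}. sign K i \<odot>\<^bsub>space Z q\<^esub> face Z (q + 1) i x)"

definition hoch_b' :: "('k,'r) ring_scheme \<Rightarrow> ('k,'x) cyclic_data \<Rightarrow> nat \<Rightarrow> 'x \<Rightarrow> 'x"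
  where "hoch_b' K Z q x =
    (\<Oplus>\<^bsub>space Z q\<^esub>i\<in>{..q}. sign K i \<odot>\<^bsub>space Z q\<^esub> face Z (q + 1) i x)"

definition signed_cyc :: "('k,'r) ring_scheme \<Rightarrow> ('k,'x) cyclic_data \<Rightarrow> nat \<Rightarrow> 'x \<Rightarrow> 'x"
  where "signed_cyc K Z q x = sign K q \<odot>\<^bsub>space Z q\<^esub> cyc Z q x"

definition norm_op :: "('k,'r) ring_scheme \<Rightarrow> ('k,'x) cyclic_data \<Rightarrow> nat \<Rightarrow> 'x \<Rightarrow> 'x"
  where "norm_op K Z q x = (\<Oplus>\<^bsub>space Z q\<^esub>j\<in>{..q}. (signed_cyc K Z q ^^ j) x)"

text \<open>An element of the total complex in degree \<open>n\<close> is a family whose \<open>q\<close>-th member lies in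
  bidegree \<open>(n - q, q)\<close>.\<close>

definition total_space :: "('k,'x) cyclic_data \<Rightarrow> nat \<Rightarrow> ('k, nat \<Rightarrow> 'x) module"
  where "total_space Z n =
    \<lparr>carrier = (\<Pi>\<^sub>E q\<in>{..n}. carrier (space Z q)), mult = undefined, one = undefined,
     zero = (\<lambda>q\<in>{..n}. \<zero>\<^bsub>space Z q\<^esub>),
     add = (\<lambda>x y. \<lambda>q\<in>{..n}. x q \<oplus>\<^bsub>space Z q\<^esub> y q),
     smult = (\<lambda>c x. \<lambda>q\<in>{..n}. c \<odot>\<^bsub>space Z q\<^esub> x q)\<rparr>"

text \<open>The differential from degree \<open>n + 1\<close> to degree \<open>n\<close>.\<close>

definition total_diff ::
  "('k,'r) ring_scheme \<Rightarrow> ('k,'x) cyclic_data \<Rightarrow> nat \<Rightarrow> (nat \<Rightarrow> 'x) \<Rightarrow> nat \<Rightarrow> 'x"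
  where "total_diff K Z n x = (\<lambda>q\<in>{..n}.
    if even (n - q)
    then hoch_b K Z q (x (q + 1)) \<oplus>\<^bsub>space Z q\<^esub> (x q \<ominus>\<^bsub>space Z q\<^esub> signed_cyc K Z q (x q))
    else (\<ominus>\<^bsub>space Z q\<^esub> hoch_b' K Z q (x (q + 1))) \<oplus>\<^bsub>space Z q\<^esub> norm_op K Z q (x q))"

definition total_cycles ::
  "('k,'r) ring_scheme \<Rightarrow> ('k,'x) cyclic_data \<Rightarrow> nat \<Rightarrow> (nat \<Rightarrow> 'x) set"
  where "total_cycles K Z n = {x \<in> carrier (total_space Z n).
    n = 0 \<or> total_diff K Z (n - 1) x = \<zero>\<^bsub>total_space Z (n - 1)\<^esub>}"

definition total_boundaries ::
  "('k,'r) ring_scheme \<Rightarrow> ('k,'x) cyclic_data \<Rightarrow> nat \<Rightarrow> (nat \<Rightarrow> 'x) set"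
  where "total_boundaries K Z n = total_diff K Z n ` carrier (total_space Z (n + 1))"

definition cyclic_homology ::
  "('k,'r) ring_scheme \<Rightarrow> ('k,'x) cyclic_data \<Rightarrow> nat \<Rightarrow> ('k, (nat \<Rightarrow> 'x) set) module"
  where "cyclic_homology K Z n =
    quot_module ((total_space Z n)\<lparr>carrier := total_cycles K Z n\<rparr>) (total_boundaries K Z n)"


section \<open>The cyclic object \<open>Z\<^sub>*(A/B)\<close>\<close>

definition rel_left_act ::
  "('k,'r) ring_scheme \<Rightarrow> ('k,'a) module \<Rightarrow> 'a set \<Rightarrow> nat \<Rightarrow> 'a \<Rightarrow>
   ('a list \<Rightarrow> 'k) set \<Rightarrow> ('a list \<Rightarrow> 'k) set"
  where "rel_left_act K A B n b = (let T = rel_tensor_power K A B n in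
    gen_lift K T (\<lambda>as. gen K T ((b \<otimes>\<^bsub>A\<^esub> hd as) # tl as)))"

definition rel_right_act ::
  "('k,'r) ring_scheme \<Rightarrow> ('k,'a) module \<Rightarrow> 'a set \<Rightarrow> nat \<Rightarrow>
   ('a list \<Rightarrow> 'k) set \<Rightarrow> 'a \<Rightarrow> ('a list \<Rightarrow> 'k) set"
  where "rel_right_act K A B n X b = (let T = rel_tensor_power K A B n in
    gen_lift K T (\<lambda>as. gen K T (butlast as @ [last as \<otimes>\<^bsub>A\<^esub> b])) X)"

definition rel_space ::
  "('k,'r) ring_scheme \<Rightarrow> ('k,'a) module \<Rightarrow> 'a set \<Rightarrow> nat \<Rightarrow> ('k, ('a list \<Rightarrow> 'k) set set) module"
  where "rel_space K A B n = bimod_quot K (rel_tensor_power K A B (n + 1)) B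
    (rel_left_act K A B (n + 1)) (rel_right_act K A B (n + 1))"

text \<open>The class of \<open>a\<^sup>0 \<otimes>\<^sub>B \<dots> \<otimes>\<^sub>B a\<^sup>n\<close>, and the linear map given on these classes by \<open>f\<close>.\<close>

definition rel_class ::
  "('k,'r) ring_scheme \<Rightarrow> ('k,'a) module \<Rightarrow> 'a set \<Rightarrow> nat \<Rightarrow> 'a list \<Rightarrow> ('a list \<Rightarrow> 'k) set set"
  where "rel_class K A B n as = (let T = rel_tensor_power K A B (n + 1) in
    \<zero>\<^bsub>rel_space K A B n\<^esub> +>\<^bsub>T\<^esub> gen K T as)"

definition rel_lift ::
  "('k,'r) ring_scheme \<Rightarrow> ('k,'w) module \<Rightarrow> ('a list \<Rightarrow> 'w) \<Rightarrow> ('a list \<Rightarrow> 'k) set set \<Rightarrow> 'w"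
  where "rel_lift K W f = quot_lift (gen_lift K W f)"

definition rel_cyclic ::
  "('k,'r) ring_scheme \<Rightarrow> ('k,'a) module \<Rightarrow> 'a set \<Rightarrow> ('k, ('a list \<Rightarrow> 'k) set set) cyclic_data"
  where "rel_cyclic K A B =
    \<lparr>space = rel_space K A B,
     face = (\<lambda>n i. rel_lift K (rel_space K A B (n - 1)) (\<lambda>as. rel_class K A B (n - 1)
        (if i < n then take i as @ [as ! i \<otimes>\<^bsub>A\<^esub> as ! (i + 1)] @ drop (i + 2) as
         else (last as \<otimes>\<^bsub>A\<^esub> hd as) # tl (butlast as)))),
     degen = (\<lambda>n i. rel_lift K (rel_space K A B (n + 1)) (\<lambda>as. rel_class K A B (n + 1)
        (take (i + 1) as @ [\<one>\<^bsub>A\<^esub>] @ drop (i + 1) as))),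
     cyc = (\<lambda>n. rel_lift K (rel_space K A B n)
        (\<lambda>as. rel_class K A B n (last as # butlast as)))\<rparr>"


section \<open>The cyclic object \<open>Z\<^sub>*(H, A\<^sub>B)\<close>\<close>

definition hopf_space ::
  "('k,'r) ring_scheme \<Rightarrow> ('k,'h) hopf \<Rightarrow> ('k,'a) module \<Rightarrow> 'a set \<Rightarrow>
   ('a \<Rightarrow> ('a \<times> 'h \<Rightarrow> 'k) set) \<Rightarrow> nat \<Rightarrow> ('k, (('h list \<Rightarrow> 'k) set \<times> 'a set \<Rightarrow> 'k) set) module"
  where "hopf_space K H A B \<rho> n =
    tensor_over K (tensor_power K H (n + 1)) (alg_quot K A B) (carrier H)
      (diag_act K H n) (um_act K H A B \<rho>)"

definition hopf_cyclic ::
  "('k,'r) ring_scheme \<Rightarrow> ('k,'h) hopf \<Rightarrow> ('k,'a) module \<Rightarrow> 'a set \<Rightarrow>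
   ('a \<Rightarrow> ('a \<times> 'h \<Rightarrow> 'k) set) \<Rightarrow> ('k, (('h list \<Rightarrow> 'k) set \<times> 'a set \<Rightarrow> 'k) set) cyclic_data"
  where "hopf_cyclic K H A B \<rho> =
    \<lparr>space = hopf_space K H A B \<rho>,
     face = (\<lambda>n i. gen_lift K (hopf_space K H A B \<rho> (n - 1))
        (\<lambda>(X, m). gen K (hopf_space K H A B \<rho> (n - 1)) (counit_at K H (n + 1) i X, m))),
     degen = (\<lambda>n i. gen_lift K (hopf_space K H A B \<rho> (n + 1))
        (\<lambda>(X, m). gen K (hopf_space K H A B \<rho> (n + 1)) (comult_at K H (n + 1) i X, m))),
     cyc = (\<lambda>n. let T = tensor_power K H (n + 1); W = hopf_space K H A B \<rho> n in
        gen_lift K W (\<lambda>(X, m). gen_lift K W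
          (\<lambda>(m', g). gen K W
             (gen_lift K T (\<lambda>hs. gen K T ((last hs \<otimes>\<^bsub>H\<^esub> g) # butlast hs)) X, m'))
          (quot_coaction K H A B \<rho> m)))\<rparr>"

end

theory Submission imports Defs begin

text \<open>Both cyclic objects are quotients of the same spaces. Applying the Galois map again and again identifies
\<open>A \<otimes>\<^sub>B \<dots> \<otimes>\<^sub>B A\<close>, with \<open>n + 2\<close> factors, with \<open>H\<^sup>\<otimes>\<^sup>(\<^sup>n\<^sup>+\<^sup>1\<^sup>) \<otimes> A\<close>; the maps \<open>phi\<close> and \<open>psi\<close> do
this in both directions (\<open>psi_phi\<close>, \<open>phi_psi\<close>). Dividing \<open>A \<otimes>\<^sub>B \<dots> \<otimes>\<^sub>B A\<close> by all differences
\<open>w z - z w\<close> with \<open>z\<close> in \<open>A\<close> gives \<open>Z\<^sub>n(A/B)\<close>, because the last factor can be moved to the front and multiplied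
into the first one. Under the Galois map, multiplication by \<open>z\<close> from the right becomes the diagonal action
\<open>X \<otimes> c \<mapsto> \<Sum> X z\<^sub>1 \<otimes> c z\<^sub>0\<close> (\<open>psum_act\<close>), and multiplication from the left stays \<open>X \<otimes> c \<mapsto> X \<otimes> z c\<close>.
The relations \<open>\<Sum> X z\<^sub>1 \<otimes> c z\<^sub>0 = X \<otimes> z c\<close> so obtained are exactly those of
\<open>H\<^sup>\<otimes>\<^sup>(\<^sup>n\<^sup>+\<^sup>1\<^sup>) \<otimes>\<^sub>H A\<^sub>B\<close>. For \<open>z\<close> in \<open>B\<close> they divide by \<open>[A,B]\<close>. They hold in the tensor product over \<open>H\<close> since the
Ulbrich-Miyashita action satisfies \<open>\<Sum> z\<^sub>1 \<cdot> [c z\<^sub>0] = [z c]\<close> (\<open>um_act_coaction\<close>), and they imply all relations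
there since, by the Galois property, the elements \<open>c z\<^sub>0 \<otimes> z\<^sub>1\<close> span \<open>A \<otimes> H\<close> (\<open>SH_lift\<close>). This gives the
isomorphism \<open>Phi\<close>.

The operators are compared on \<open>A \<otimes>\<^sub>B \<dots> \<otimes>\<^sub>B A\<close> as well. Multiplying two neighbours applies the counit and inserting \<open>1\<close>
applies the comultiplication to one factor of \<open>H\<^sup>\<otimes>\<^sup>(\<^sup>n\<^sup>+\<^sup>1\<^sup>)\<close> (\<open>psum_mrg\<close>, \<open>psum_ins\<close>); the cyclic operator needs a
calculation with the coaction (\<open>psum_tau\<close>). A formula on \<open>H\<^sup>\<otimes>\<^sup>(\<^sup>n\<^sup>+\<^sup>1\<^sup>) \<otimes> A\<close> which corresponds in this way to an
operator of \<open>Z\<^sub>*(A/B)\<close> automatically respects the relations of the tensor product over \<open>H\<close>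
(\<open>op_transfer\<close>). In \<open>Z\<^sub>*(A/B)\<close> the cyclic identities are identities between operations on lists, and
\<open>Phi\<close> carries them over to \<open>Z\<^sub>*(H, A\<^sub>B)\<close>. An isomorphism of cyclic objects induces an isomorphism
of total complexes, hence of cyclic homology.

Sweedler notation is rendered by choosing, for each element of a tensor product that occurs, a list of generators
which it is the sum of. As such a list is not unique, an identity between elements of a tensor product is
stated as an identity between the sums of the values of an arbitrary multilinear map on both lists.\<close>

section \<open>Linear maps, quotients and presentations\<close>

lemma lin_homI:
  assumes "\<And>x. x \<in> carrier M \<Longrightarrow> f x \<in> carrier N"
    and "\<And>x y. x \<in> carrier M \<Longrightarrow> y \<in> carrier M \<Longrightarrow> f (x \<oplus>\<^bsub>M\<^esub> y) = f x \<oplus>\<^bsub>N\<^esub> f y"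
    and "\<And>c x. c \<in> carrier K \<Longrightarrow> x \<in> carrier M \<Longrightarrow> f (c \<odot>\<^bsub>M\<^esub> x) = c \<odot>\<^bsub>N\<^esub> f x"
  shows "f \<in> lin_hom K M N"
  using assms by (auto simp: lin_hom_def)

lemma lin_hom_closed: "f \<in> lin_hom K M N \<Longrightarrow> x \<in> carrier M \<Longrightarrow> f x \<in> carrier N"
  by (auto simp: lin_hom_def)

lemma lin_hom_add: "f \<in> lin_hom K M N \<Longrightarrow> x \<in> carrier M \<Longrightarrow> y \<in> carrier M \<Longrightarrow>
    f (x \<oplus>\<^bsub>M\<^esub> y) = f x \<oplus>\<^bsub>N\<^esub> f y"
  by (auto simp: lin_hom_def)

lemma lin_hom_smult: "f \<in> lin_hom K M N \<Longrightarrow> c \<in> carrier K \<Longrightarrow> x \<in> carrier M \<Longrightarrow>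
    f (c \<odot>\<^bsub>M\<^esub> x) = c \<odot>\<^bsub>N\<^esub> f x"
  by (auto simp: lin_hom_def)

lemma lin_hom_cong:
  assumes "module K M" "f \<in> lin_hom K M N" "\<And>x. x \<in> carrier M \<Longrightarrow> f x = g x"
  shows "g \<in> lin_hom K M N"
proof -
  interpret module K M by fact
  show ?thesis
    using assms by (auto simp: lin_hom_def Pi_def)
qed

lemma lin_hom_zero:
  assumes "module K M" "module K N" "f \<in> lin_hom K M N"
  shows "f \<zero>\<^bsub>M\<^esub> = \<zero>\<^bsub>N\<^esub>"
proof -
  interpret M: module K M by fact
  interpret N: module K N by fact
  have "f (\<zero>\<^bsub>K\<^esub> \<odot>\<^bsub>M\<^esub> \<zero>\<^bsub>M\<^esub>) = \<zero>\<^bsub>K\<^esub> \<odot>\<^bsub>N\<^esub> f \<zero>\<^bsub>M\<^esub>"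
    using assms by (intro lin_hom_smult) auto
  then show ?thesis using lin_hom_closed[OF assms(3)] by simp
qed

lemma lin_hom_minus:
  assumes "module K M" "module K N" "f \<in> lin_hom K M N" "x \<in> carrier M" "y \<in> carrier M"
  shows "f (x \<ominus>\<^bsub>M\<^esub> y) = f x \<ominus>\<^bsub>N\<^esub> f y"
proof -
  interpret M: module K M by fact
  interpret N: module K N by fact
  have "f (\<ominus>\<^bsub>M\<^esub> y) = \<ominus>\<^bsub>N\<^esub> f y"
    using lin_hom_smult[OF assms(3), of "\<ominus>\<^bsub>K\<^esub> \<one>\<^bsub>K\<^esub>" y] assms lin_hom_closed[OF assms(3)]
    by (simp add: M.smult_l_minus N.smult_l_minus)
  then show ?thesis using lin_hom_add[OF assms(3), of x "\<ominus>\<^bsub>M\<^esub> y"] assms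
    by (simp add: a_minus_def)
qed

lemma module_diff_zero:
  assumes "module K W" "x \<in> carrier W" "y \<in> carrier W"
  shows "x \<ominus>\<^bsub>W\<^esub> y = \<zero>\<^bsub>W\<^esub> \<longleftrightarrow> x = y"
proof -
  interpret W: module K W by fact
  show ?thesis using assms(2,3)
    by (metis W.M.add.inv_closed W.M.add.inv_solve_right W.M.l_zero W.M.r_neg W.M.zero_closed a_minus_def)
qed

lemma lin_hom_comp:
  "f \<in> lin_hom K M N \<Longrightarrow> g \<in> lin_hom K N P \<Longrightarrow> (\<lambda>x. g (f x)) \<in> lin_hom K M P"
  by (auto simp: lin_hom_def Pi_def)

lemma lin_hom_id: "(\<lambda>x. x) \<in> lin_hom K M M"
  by (auto simp: lin_hom_def)

text \<open>Only these four fields of a module record matter for its module structure.\<close>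

lemma module_record_cong:
  assumes "module K M" "carrier M' = carrier M" "add M' = add M" "zero M' = zero M"
    "smult M' = smult M"
  shows "module K M'"
proof -
  interpret module K M by fact
  show ?thesis
  proof (rule moduleI)
    show "abelian_group M'"
      by (rule abelian_groupI) (use assms M.l_neg in \<open>auto simp: M.a_assoc intro: M.a_comm\<close>)
  qed (use assms R.is_cring in \<open>auto simp: smult_l_distr smult_r_distr smult_assoc1\<close>)
qed

lemma lin_hom_record_cong:
  assumes "carrier M' = carrier M" "add M' = add M" "smult M' = smult M"
    "carrier N' = carrier N" "add N' = add N" "smult N' = smult N"
  shows "lin_hom K M' N' = lin_hom K M N"
  using assms by (auto simp: lin_hom_def)

lemma quot_module_facts:
  assumes "module K M" "submodule N K M"
  shows quot_module_module: "module K (quot_module M N)"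
    and quot_map_lin: "(\<lambda>x. N +>\<^bsub>M\<^esub> x) \<in> lin_hom K M (quot_module M N)"
    and quot_map_surj: "carrier (quot_module M N) = (\<lambda>x. N +>\<^bsub>M\<^esub> x) ` carrier M"
    and quot_map_zero: "x \<in> N \<Longrightarrow> N +>\<^bsub>M\<^esub> x = \<zero>\<^bsub>quot_module M N\<^esub>"
proof -
  interpret M: module K M by fact
  interpret N: submodule N K M by fact
  interpret N: abelian_subgroup N M
    by (intro abelian_subgroupI3 additive_subgroup.intro N.subgroup_axioms M.abelian_group_axioms)
  let ?Q = "quot_module M N"
  show surj: "carrier ?Q = (\<lambda>x. N +>\<^bsub>M\<^esub> x) ` carrier M"
    by (auto simp: quot_module_def A_RCOSETS_def')
  have add: "(N +>\<^bsub>M\<^esub> x) \<oplus>\<^bsub>?Q\<^esub> (N +>\<^bsub>M\<^esub> y) = N +>\<^bsub>M\<^esub> (x \<oplus>\<^bsub>M\<^esub> y)"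
    if "x \<in> carrier M" "y \<in> carrier M" for x y
    using that by (simp add: quot_module_def N.a_rcos_sum)
  have smult: "c \<odot>\<^bsub>?Q\<^esub> (N +>\<^bsub>M\<^esub> x) = N +>\<^bsub>M\<^esub> (c \<odot>\<^bsub>M\<^esub> x)"
    if c: "c \<in> carrier K" and x: "x \<in> carrier M" for c x
  proof -
    have "N +>\<^bsub>M\<^esub> (c \<odot>\<^bsub>M\<^esub> y) = N +>\<^bsub>M\<^esub> (c \<odot>\<^bsub>M\<^esub> x)" if "y \<in> N +>\<^bsub>M\<^esub> x" for y
    proof -
      obtain n where n: "n \<in> N" "y = n \<oplus>\<^bsub>M\<^esub> x" using \<open>y \<in> N +>\<^bsub>M\<^esub> x\<close> by (auto simp: a_r_coset_def')
      then have "c \<odot>\<^bsub>M\<^esub> y = c \<odot>\<^bsub>M\<^esub> n \<oplus>\<^bsub>M\<^esub> c \<odot>\<^bsub>M\<^esub> x" using c x N.a_subset by (auto simp: M.smult_r_distr)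
      moreover have "c \<odot>\<^bsub>M\<^esub> n \<in> N" using c n by simp
      ultimately have "c \<odot>\<^bsub>M\<^esub> y \<in> N +>\<^bsub>M\<^esub> (c \<odot>\<^bsub>M\<^esub> x)" by (auto simp: a_r_coset_def')
      then show ?thesis using N.a_repr_independence'[of "c \<odot>\<^bsub>M\<^esub> y" "c \<odot>\<^bsub>M\<^esub> x"] c x by auto
    qed
    moreover have "x \<in> N +>\<^bsub>M\<^esub> x" using x by (rule N.a_rcos_self)
    ultimately have "(\<Union>y\<in>N +>\<^bsub>M\<^esub> x. N +>\<^bsub>M\<^esub> (c \<odot>\<^bsub>M\<^esub> y)) = N +>\<^bsub>M\<^esub> (c \<odot>\<^bsub>M\<^esub> x)" by blast
    then show ?thesis by (simp add: quot_module_def)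
  qed
  have zero: "\<zero>\<^bsub>?Q\<^esub> = N +>\<^bsub>M\<^esub> \<zero>\<^bsub>M\<^esub>"
    using N.a_subset by (simp add: quot_module_def)
  have ab: "abelian_group ?Q"
  proof (rule abelian_groupI)
    fix X assume "X \<in> carrier ?Q"
    then obtain x where x: "x \<in> carrier M" "X = N +>\<^bsub>M\<^esub> x" by (auto simp: surj)
    then show "\<exists>Y\<in>carrier ?Q. Y \<oplus>\<^bsub>?Q\<^esub> X = \<zero>\<^bsub>?Q\<^esub>"
      by (intro bexI[of _ "N +>\<^bsub>M\<^esub> (\<ominus>\<^bsub>M\<^esub> x)"]) (auto simp: surj add zero M.l_neg)
  qed (auto simp: surj add zero M.a_assoc M.a_comm M.a_lcomm)
  show "module K ?Q"
    by (rule moduleI)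
      (use ab M.R.is_cring in \<open>auto simp: surj add smult M.smult_l_distr M.smult_r_distr M.smult_assoc1\<close>)
  show "(\<lambda>x. N +>\<^bsub>M\<^esub> x) \<in> lin_hom K M ?Q"
    by (rule lin_homI) (auto simp: surj add smult)
  show "N +>\<^bsub>M\<^esub> x = \<zero>\<^bsub>?Q\<^esub>" if "x \<in> N"
    using that N.a_subset
    by (simp add: quot_module_def M.a_coset_join2 N.additive_subgroup_axioms additive_subgroup.a_subgroup subsetD)
qed

lemma quot_lift_facts:
  assumes "module K M" "submodule N K M" "module K W" "f \<in> lin_hom K M W"
    and "\<And>x. x \<in> N \<Longrightarrow> f x = \<zero>\<^bsub>W\<^esub>"
  shows quot_lift_eq: "x \<in> carrier M \<Longrightarrow> quot_lift f (N +>\<^bsub>M\<^esub> x) = f x"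
    and quot_lift_lin: "quot_lift f \<in> lin_hom K (quot_module M N) W"
proof -
  interpret M: module K M by fact
  interpret W: module K W by fact
  interpret N: submodule N K M by fact
  interpret N: abelian_subgroup N M
    by (intro abelian_subgroupI3 additive_subgroup.intro N.subgroup_axioms M.abelian_group_axioms)
  have eq: "quot_lift f (N +>\<^bsub>M\<^esub> x) = f x" if x: "x \<in> carrier M" for x
  proof -
    have "f y = f x" if "y \<in> N +>\<^bsub>M\<^esub> x" for y
    proof -
      obtain n where "n \<in> N" "y = n \<oplus>\<^bsub>M\<^esub> x" using \<open>y \<in> N +>\<^bsub>M\<^esub> x\<close> by (auto simp: a_r_coset_def')
      then show ?thesis
        using x assms(5)[of n] lin_hom_add[OF assms(4), of n x] N.a_subset lin_hom_closed[OF assms(4), of x]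
        by auto
    qed
    moreover have "x \<in> N +>\<^bsub>M\<^esub> x" using x by (rule N.a_rcos_self)
    ultimately have "f ` (N +>\<^bsub>M\<^esub> x) = {f x}" by blast
    then show ?thesis by (simp add: quot_lift_def)
  qed
  then show "x \<in> carrier M \<Longrightarrow> quot_lift f (N +>\<^bsub>M\<^esub> x) = f x" .
  note q = quot_map_lin[OF assms(1,2)]
  show "quot_lift f \<in> lin_hom K (quot_module M N) W"
  proof (rule lin_homI)
    fix X assume "X \<in> carrier (quot_module M N)"
    then obtain x where x: "x \<in> carrier M" "X = N +>\<^bsub>M\<^esub> x" by (auto simp: quot_map_surj[OF assms(1,2)])
    then show "quot_lift f X \<in> carrier W" using lin_hom_closed[OF assms(4)] by (simp add: eq)
    show "quot_lift f (c \<odot>\<^bsub>quot_module M N\<^esub> X) = c \<odot>\<^bsub>W\<^esub> quot_lift f X" if "c \<in> carrier K" for c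
      unfolding x(2) lin_hom_smult[OF q that x(1), symmetric]
      using x that lin_hom_smult[OF assms(4), of c x] by (simp add: eq)
    fix Y assume "Y \<in> carrier (quot_module M N)"
    then obtain y where y: "y \<in> carrier M" "Y = N +>\<^bsub>M\<^esub> y" by (auto simp: quot_map_surj[OF assms(1,2)])
    show "quot_lift f (X \<oplus>\<^bsub>quot_module M N\<^esub> Y) = quot_lift f X \<oplus>\<^bsub>W\<^esub> quot_lift f Y"
      unfolding x(2) y(2) lin_hom_add[OF q x(1) y(1), symmetric]
      using x y lin_hom_add[OF assms(4), of x y] by (simp add: eq)
  qed
qed

lemma submodule_lin_span:
  assumes "module K M" "S \<subseteq> carrier M"
  shows "submodule (lin_span K M S) K M"
proof -
  interpret module K M by fact
  have "submodule (\<Inter>{W. submodule W K M \<and> S \<subseteq> W}) K M"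
  proof (rule submoduleI)
    show "\<Inter>{W. submodule W K M \<and> S \<subseteq> W} \<subseteq> carrier M"
      using carrier_is_submodule assms(2) by auto
    fix a assume "a \<in> \<Inter>{W. submodule W K M \<and> S \<subseteq> W}"
    then show "\<ominus>\<^bsub>M\<^esub> a \<in> \<Inter>{W. submodule W K M \<and> S \<subseteq> W}" using submoduleE(3) by blast
  next
    show "\<zero>\<^bsub>M\<^esub> \<in> \<Inter>{W. submodule W K M \<and> S \<subseteq> W}"
      using subgroup.one_closed submodule.axioms(1) by fastforce
  qed (use submoduleE(4,5) in blast)+
  then show ?thesis by (simp add: lin_span_def hull_def)
qed

lemma lin_span_superset: "S \<subseteq> lin_span K M S"
  by (simp add: lin_span_def hull_subset)

text \<open>A linear map that kills generators kills the submodule they span, its kernel being a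
  submodule.\<close>

lemma lin_span_kernel:
  assumes "module K M" "module K W" "f \<in> lin_hom K M W" "S \<subseteq> carrier M"
    and "\<And>s. s \<in> S \<Longrightarrow> f s = \<zero>\<^bsub>W\<^esub>" and x: "x \<in> lin_span K M S"
  shows "f x = \<zero>\<^bsub>W\<^esub>"
proof -
  interpret M: module K M by fact
  interpret W: module K W by fact
  have "submodule {x \<in> carrier M. f x = \<zero>\<^bsub>W\<^esub>} K M"
  proof (rule M.submoduleI)
    show "\<zero>\<^bsub>M\<^esub> \<in> {x \<in> carrier M. f x = \<zero>\<^bsub>W\<^esub>}"
      using lin_hom_zero[OF assms(1-3)] by auto
    fix a assume "a \<in> {x \<in> carrier M. f x = \<zero>\<^bsub>W\<^esub>}"
    then show "\<ominus>\<^bsub>M\<^esub> a \<in> {x \<in> carrier M. f x = \<zero>\<^bsub>W\<^esub>}"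
      using lin_hom_minus[OF assms(1-3), of "\<zero>\<^bsub>M\<^esub>" a] lin_hom_zero[OF assms(1-3)]
      by (auto simp: a_minus_def)
  qed (use assms(3) in \<open>auto simp: lin_hom_add lin_hom_smult\<close>)
  then have "lin_span K M S \<subseteq> {x \<in> carrier M. f x = \<zero>\<^bsub>W\<^esub>}"
    using assms(4,5) unfolding lin_span_def by (intro hull_minimal) auto
  then show ?thesis using x by auto
qed

lemma module_free:
  assumes "cring K" shows "module K (free_module K X)"
proof -
  let ?F = "free_module K X"
  interpret cring K by fact
  have fin: "finite {x. g x \<noteq> \<zero>\<^bsub>K\<^esub>}"
    if "finite {x. v x \<noteq> \<zero>\<^bsub>K\<^esub>}" "finite {x. w x \<noteq> \<zero>\<^bsub>K\<^esub>}"
      "\<And>x. v x = \<zero>\<^bsub>K\<^esub> \<Longrightarrow> w x = \<zero>\<^bsub>K\<^esub> \<Longrightarrow> g x = \<zero>\<^bsub>K\<^esub>" for v w g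
    using finite_subset[of "{x. g x \<noteq> \<zero>\<^bsub>K\<^esub>}" "{x. v x \<noteq> \<zero>\<^bsub>K\<^esub>} \<union> {x. w x \<noteq> \<zero>\<^bsub>K\<^esub>}"] that by auto
  have cl: "v x \<in> carrier K" if "v \<in> carrier ?F" for v x
    using that by (cases "x \<in> X") (auto simp: free_module_def)
  have ab: "abelian_group ?F"
  proof (rule abelian_groupI)
    fix v assume v: "v \<in> carrier ?F"
    have "(\<lambda>x. \<ominus>\<^bsub>K\<^esub> v x) \<in> carrier ?F"
      using v by (auto simp: free_module_def intro: fin[of v v])
    moreover have "(\<lambda>x. \<ominus>\<^bsub>K\<^esub> v x) \<oplus>\<^bsub>?F\<^esub> v = \<zero>\<^bsub>?F\<^esub>"
      using cl[OF v] by (simp add: free_module_def l_neg)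
    ultimately show "\<exists>w\<in>carrier ?F. w \<oplus>\<^bsub>?F\<^esub> v = \<zero>\<^bsub>?F\<^esub>"
      by blast
    show "\<zero>\<^bsub>?F\<^esub> \<oplus>\<^bsub>?F\<^esub> v = v"
      using cl[OF v] by (simp add: free_module_def)
  next
    fix v w assume v: "v \<in> carrier ?F" and w: "w \<in> carrier ?F"
    then show "v \<oplus>\<^bsub>?F\<^esub> w \<in> carrier ?F"
      by (auto simp: free_module_def intro: fin[of v w])
    show "v \<oplus>\<^bsub>?F\<^esub> w = w \<oplus>\<^bsub>?F\<^esub> v"
      using cl[OF v] cl[OF w] by (simp add: free_module_def a_comm)
  next
    fix u v w assume u: "u \<in> carrier ?F" and v: "v \<in> carrier ?F"
      and w: "w \<in> carrier ?F"
    show "u \<oplus>\<^bsub>?F\<^esub> v \<oplus>\<^bsub>?F\<^esub> w = u \<oplus>\<^bsub>?F\<^esub> (v \<oplus>\<^bsub>?F\<^esub> w)"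
      using cl[OF u] cl[OF v] cl[OF w] by (simp add: free_module_def a_assoc)
  qed (auto simp: free_module_def)
  show ?thesis
  proof (rule moduleI)
    fix v assume v: "v \<in> carrier ?F"
    show "\<one>\<^bsub>K\<^esub> \<odot>\<^bsub>?F\<^esub> v = v"
      using cl[OF v] by (simp add: free_module_def)
  next
    fix a v assume a: "a \<in> carrier K" and v: "v \<in> carrier ?F"
    then show "a \<odot>\<^bsub>?F\<^esub> v \<in> carrier ?F"
      by (auto simp: free_module_def intro: fin[of v v])
    fix b assume b: "b \<in> carrier K"
    show "(a \<oplus>\<^bsub>K\<^esub> b) \<odot>\<^bsub>?F\<^esub> v = a \<odot>\<^bsub>?F\<^esub> v \<oplus>\<^bsub>?F\<^esub> b \<odot>\<^bsub>?F\<^esub> v"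
      using cl[OF v] a b by (simp add: free_module_def l_distr)
    show "a \<otimes>\<^bsub>K\<^esub> b \<odot>\<^bsub>?F\<^esub> v = a \<odot>\<^bsub>?F\<^esub> (b \<odot>\<^bsub>?F\<^esub> v)"
      using cl[OF v] a b by (simp add: free_module_def m_assoc)
  next
    fix a v w assume a: "a \<in> carrier K" and v: "v \<in> carrier ?F" and w: "w \<in> carrier ?F"
    show "a \<odot>\<^bsub>?F\<^esub> (v \<oplus>\<^bsub>?F\<^esub> w) = a \<odot>\<^bsub>?F\<^esub> v \<oplus>\<^bsub>?F\<^esub> a \<odot>\<^bsub>?F\<^esub> w"
      using cl[OF v] cl[OF w] a by (simp add: free_module_def r_distr)
  qed (use ab assms in auto)
qed

lemma basis_vec_closed:
  assumes "cring K" "x \<in> X" shows "basis_vec K x \<in> carrier (free_module K X)"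
proof -
  interpret cring K by fact
  show ?thesis using assms(2)
    by (auto simp: free_module_def basis_vec_def intro: finite_subset[of _ "{x}"])
qed

lemma free_module_closed: "v \<in> carrier (free_module K X) \<Longrightarrow> cring K \<Longrightarrow> v x \<in> carrier K"
  by (cases "x \<in> X") (auto simp: free_module_def cring_def ring_def abelian_group_def
      intro: abelian_monoid.zero_closed)

text \<open>The sum that defines a linear extension ranges over the support of \<open>v\<close>; two extensions are added over a common
  finite superset.\<close>

lemma lin_ext_superset:
  assumes "module K W" "\<And>x. x \<in> X \<Longrightarrow> f x \<in> carrier W" "v \<in> carrier (free_module K X)"
    "finite S" "S \<subseteq> X" "{x. v x \<noteq> \<zero>\<^bsub>K\<^esub>} \<subseteq> S"
  shows "lin_ext K W f v = (\<Oplus>\<^bsub>W\<^esub>x\<in>S. v x \<odot>\<^bsub>W\<^esub> f x)"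
proof -
  interpret W: module K W by fact
  have v: "v x \<in> carrier K" for x using free_module_closed[OF assms(3) W.R.is_cring] .
  have f: "x \<in> S \<Longrightarrow> f x \<in> carrier W" for x using assms(2,5) by auto
  show ?thesis unfolding lin_ext_def
    by (rule W.M.add.finprod_mono_neutral_cong_left) (use assms(4,6) f v in auto)
qed

lemma lin_ext_lin:
  assumes "module K W" "\<And>x. x \<in> X \<Longrightarrow> f x \<in> carrier W"
  shows "lin_ext K W f \<in> lin_hom K (free_module K X) W"
    and lin_ext_basis: "x \<in> X \<Longrightarrow> lin_ext K W f (basis_vec K x) = f x"
proof -
  let ?F = "free_module K X"
  interpret W: module K W by fact
  note cl = free_module_closed[OF _ W.R.is_cring]
  note mod = module_free[OF W.R.is_cring, of X]
  interpret F: module K "free_module K X" by (rule mod)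
  let ?S = "\<lambda>v. {x. v x \<noteq> \<zero>\<^bsub>K\<^esub>}"
  have S: "finite (?S v)" "?S v \<subseteq> X" if "v \<in> carrier ?F" for v
    using that by (auto simp: free_module_def)
  have ext: "lin_ext K W f v = (\<Oplus>\<^bsub>W\<^esub>x\<in>S. v x \<odot>\<^bsub>W\<^esub> f x)"
    if "v \<in> carrier ?F" "finite S" "S \<subseteq> X" "?S v \<subseteq> S" for v S
    using lin_ext_superset[OF assms that] .
  show "lin_ext K W f \<in> lin_hom K ?F W"
  proof (rule lin_homI)
    fix v assume v: "v \<in> carrier ?F"
    show "lin_ext K W f v \<in> carrier W"
      unfolding lin_ext_def using S[OF v] cl[OF v] assms(2) by (intro W.M.finsum_closed) auto
    {
    fix c assume c: "c \<in> carrier K"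
    have "lin_ext K W f (c \<odot>\<^bsub>?F\<^esub> v) = (\<Oplus>\<^bsub>W\<^esub>x\<in>?S v. (c \<odot>\<^bsub>?F\<^esub> v) x \<odot>\<^bsub>W\<^esub> f x)"
      using S[OF v] F.smult_closed[OF c v] c by (intro ext) (auto simp: free_module_def)
    also have "\<dots> = (\<Oplus>\<^bsub>W\<^esub>x\<in>?S v. c \<odot>\<^bsub>W\<^esub> (v x \<odot>\<^bsub>W\<^esub> f x))"
      using S[OF v] cl[OF v] c assms(2)
      by (intro W.M.finsum_cong') (auto simp: free_module_def W.smult_assoc1 subset_iff)
    also have "\<dots> = c \<odot>\<^bsub>W\<^esub> lin_ext K W f v"
      unfolding lin_ext_def using S[OF v] cl[OF v] c assms(2)
      by (intro W.finsum_smult_ldistr[symmetric]) auto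
    finally show "lin_ext K W f (c \<odot>\<^bsub>?F\<^esub> v) = c \<odot>\<^bsub>W\<^esub> lin_ext K W f v" .
    }
    fix w assume w: "w \<in> carrier ?F"
    let ?T = "?S v \<union> ?S w"
    have T: "finite ?T" "?T \<subseteq> X" using S[OF v] S[OF w] by auto
    have "lin_ext K W f (v \<oplus>\<^bsub>?F\<^esub> w) = (\<Oplus>\<^bsub>W\<^esub>x\<in>?T. (v \<oplus>\<^bsub>?F\<^esub> w) x \<odot>\<^bsub>W\<^esub> f x)"
      using T F.M.a_closed[OF v w] by (intro ext) (auto simp: free_module_def)
    also have "\<dots> = (\<Oplus>\<^bsub>W\<^esub>x\<in>?T. v x \<odot>\<^bsub>W\<^esub> f x \<oplus>\<^bsub>W\<^esub> w x \<odot>\<^bsub>W\<^esub> f x)"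
      using T cl[OF v] cl[OF w] assms(2)
      by (intro W.M.finsum_cong') (auto simp: free_module_def W.smult_l_distr subset_iff)
    also have "\<dots> = (\<Oplus>\<^bsub>W\<^esub>x\<in>?T. v x \<odot>\<^bsub>W\<^esub> f x) \<oplus>\<^bsub>W\<^esub> (\<Oplus>\<^bsub>W\<^esub>x\<in>?T. w x \<odot>\<^bsub>W\<^esub> f x)"
      using T cl[OF v] cl[OF w] assms(2) by (intro W.M.finsum_addf) (auto simp: subset_iff)
    also have "\<dots> = lin_ext K W f v \<oplus>\<^bsub>W\<^esub> lin_ext K W f w"
      using ext[OF v T] ext[OF w T] by auto
    finally show "lin_ext K W f (v \<oplus>\<^bsub>?F\<^esub> w) = lin_ext K W f v \<oplus>\<^bsub>W\<^esub> lin_ext K W f w" .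
  qed
  show "lin_ext K W f (basis_vec K x) = f x" if x: "x \<in> X"
  proof -
    have sub: "{y. basis_vec K x y \<noteq> \<zero>\<^bsub>K\<^esub>} \<subseteq> {x}" by (auto simp: basis_vec_def)
    have "lin_ext K W f (basis_vec K x) = (\<Oplus>\<^bsub>W\<^esub>y\<in>{x}. basis_vec K x y \<odot>\<^bsub>W\<^esub> f y)"
      by (rule ext[OF basis_vec_closed[OF W.R.is_cring x] _ _ sub]) (simp_all add: x)
    also have "\<dots> = basis_vec K x x \<odot>\<^bsub>W\<^esub> f x \<oplus>\<^bsub>W\<^esub> (\<Oplus>\<^bsub>W\<^esub>y\<in>{}. basis_vec K x y \<odot>\<^bsub>W\<^esub> f y)"
      using assms(2)[OF x] by (intro W.M.finsum_insert) (auto simp: basis_vec_def)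
    also have "\<dots> = f x" using assms(2)[OF x] by (simp add: basis_vec_def)
    finally show ?thesis .
  qed
qed

lemma gen_alt: "gen K Q x = \<zero>\<^bsub>Q\<^esub> +>\<^bsub>free_module K X\<^esub> basis_vec K x"
  by (simp add: gen_def a_r_coset_def' free_module_def)

text \<open>The universal property of a module given by generators and relations.\<close>

lemma presented_facts:
  assumes "cring K" "R \<subseteq> carrier (free_module K X)"
  shows presented_module: "module K (presented K X R)"
    and presented_map: "(\<lambda>v. lin_span K (free_module K X) R +>\<^bsub>free_module K X\<^esub> v)
          \<in> lin_hom K (free_module K X) (presented K X R)"
    and presented_map_basis: "lin_span K (free_module K X) R +>\<^bsub>free_module K X\<^esub> basis_vec K x
          = gen K (presented K X R) x"
    and presented_map_rel: "r \<in> R \<Longrightarrow>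
          lin_span K (free_module K X) R +>\<^bsub>free_module K X\<^esub> r = \<zero>\<^bsub>presented K X R\<^esub>"
    and gen_closed: "x \<in> X \<Longrightarrow> gen K (presented K X R) x \<in> carrier (presented K X R)"
proof -
  note M = module_free[OF assms(1), of X]
  note N = submodule_lin_span[OF M assms(2)]
  show mod: "module K (presented K X R)"
    unfolding presented_def by (rule quot_module_module[OF M N])
  show lin: "(\<lambda>v. lin_span K (free_module K X) R +>\<^bsub>free_module K X\<^esub> v)
          \<in> lin_hom K (free_module K X) (presented K X R)"
    unfolding presented_def by (rule quot_map_lin[OF M N])
  show gen: "lin_span K (free_module K X) R +>\<^bsub>free_module K X\<^esub> basis_vec K x
          = gen K (presented K X R) x" for x
    by (simp add: gen_alt[of _ _ _ X] presented_def quot_module_def)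
  show "lin_span K (free_module K X) R +>\<^bsub>free_module K X\<^esub> r = \<zero>\<^bsub>presented K X R\<^esub>" if "r \<in> R"
    unfolding presented_def by (rule quot_map_zero[OF M N subsetD[OF lin_span_superset that]])
  show "gen K (presented K X R) x \<in> carrier (presented K X R)" if "x \<in> X"
    unfolding gen[symmetric] by (rule lin_hom_closed[OF lin basis_vec_closed[OF assms(1) that]])
qed

lemma gen_lift_facts:
  assumes "module K W" "R \<subseteq> carrier (free_module K X)" "\<And>x. x \<in> X \<Longrightarrow> f x \<in> carrier W"
    and "\<And>r. r \<in> R \<Longrightarrow> lin_ext K W f r = \<zero>\<^bsub>W\<^esub>"
  shows presented_lift_lin: "gen_lift K W f \<in> lin_hom K (presented K X R) W"
    and presented_lift_gen: "x \<in> X \<Longrightarrow> gen_lift K W f (gen K (presented K X R) x) = f x"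
proof -
  have cr: "cring K" using assms(1) by (simp add: module_def)
  note M = module_free[OF cr, of X]
  note N = submodule_lin_span[OF M assms(2)]
  have l: "lin_ext K W f \<in> lin_hom K (free_module K X) W"
    by (rule lin_ext_lin[OF assms(1)]) (rule assms(3))
  have k: "lin_ext K W f x = \<zero>\<^bsub>W\<^esub>" if "x \<in> lin_span K (free_module K X) R" for x
    by (rule lin_span_kernel[OF M assms(1) l assms(2) _ that]) (rule assms(4))
  have eq: "lin_ext K W f v = quot_lift (lin_ext K W f) (lin_span K (free_module K X) R +>\<^bsub>free_module K X\<^esub> v)"
    if "v \<in> carrier (free_module K X)" for v
    by (rule quot_lift_eq[OF M N assms(1) l _ that, symmetric]) (rule k)
  show "gen_lift K W f \<in> lin_hom K (presented K X R) W"
    unfolding gen_lift_def presented_def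
    by (rule quot_lift_lin[OF M N assms(1) l]) (rule k)
  show "gen_lift K W f (gen K (presented K X R) x) = f x" if "x \<in> X"
  proof -
    have "lin_ext K W f (basis_vec K x) = f x"
      using that by (rule lin_ext_basis[OF assms(1), rotated]) (rule assms(3))
    then show ?thesis
      using eq[OF basis_vec_closed[OF cr that]]
      by (simp add: gen_lift_def presented_map_basis[OF cr assms(2)])
  qed
qed

section \<open>Sums over lists and multilinear maps\<close>

text \<open>Elements of tensor products are written below as sums over lists of generators, the way
  Sweedler notation does.\<close>

definition lsum :: "('n,'s) ring_scheme \<Rightarrow> 'x list \<Rightarrow> ('x \<Rightarrow> 'n) \<Rightarrow> 'n"
  where "lsum W xs f = foldr (\<lambda>x s. f x \<oplus>\<^bsub>W\<^esub> s) xs \<zero>\<^bsub>W\<^esub>"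

lemma lsum_Nil [simp]: "lsum W [] f = \<zero>\<^bsub>W\<^esub>"
  and lsum_Cons [simp]: "lsum W (x # xs) f = f x \<oplus>\<^bsub>W\<^esub> lsum W xs f"
  by (simp_all add: lsum_def)

lemma lsum_cong: "(\<And>x. x \<in> set xs \<Longrightarrow> f x = g x) \<Longrightarrow> lsum W xs f = lsum W xs g"
  by (induction xs) auto

lemma lsum_map [simp]: "lsum W (map g xs) f = lsum W xs (\<lambda>x. f (g x))"
  by (induction xs) auto

lemma lsum_record_cong: "add W' = add W \<Longrightarrow> zero W' = zero W \<Longrightarrow> lsum W' xs f = lsum W xs f"
  by (induction xs) auto

context module begin

lemma lsum_closed: "(\<And>x. x \<in> set xs \<Longrightarrow> f x \<in> carrier M) \<Longrightarrow> lsum M xs f \<in> carrier M"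
  by (induction xs) auto

lemma lsum_single: "f x \<in> carrier M \<Longrightarrow> lsum M [x] f = f x"
  by simp

lemma lsum_append:
  "(\<And>x. x \<in> set xs \<Longrightarrow> f x \<in> carrier M) \<Longrightarrow> (\<And>x. x \<in> set ys \<Longrightarrow> f x \<in> carrier M) \<Longrightarrow>
   lsum M (xs @ ys) f = lsum M xs f \<oplus>\<^bsub>M\<^esub> lsum M ys f"
  by (induction xs) (auto simp: lsum_closed M.a_assoc)

lemma lsum_concat:
  "(\<And>x y. x \<in> set xs \<Longrightarrow> y \<in> set (g x) \<Longrightarrow> f y \<in> carrier M) \<Longrightarrow>
   lsum M (concat (map g xs)) f = lsum M xs (\<lambda>x. lsum M (g x) f)"
proof (induction xs)
  case (Cons a xs)
  have "lsum M (g a @ concat (map g xs)) f = lsum M (g a) f \<oplus>\<^bsub>M\<^esub> lsum M (concat (map g xs)) f"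
    by (rule lsum_append) (use Cons.prems in auto)
  moreover have "lsum M (concat (map g xs)) f = lsum M xs (\<lambda>x. lsum M (g x) f)"
    by (rule Cons.IH) (use Cons.prems in auto)
  ultimately show ?case by simp
qed simp

lemma lsum_add:
  "(\<And>x. x \<in> set xs \<Longrightarrow> f x \<in> carrier M) \<Longrightarrow> (\<And>x. x \<in> set xs \<Longrightarrow> g x \<in> carrier M) \<Longrightarrow>
   lsum M xs (\<lambda>x. f x \<oplus>\<^bsub>M\<^esub> g x) = lsum M xs f \<oplus>\<^bsub>M\<^esub> lsum M xs g"
  by (induction xs) (auto simp: lsum_closed M.a_ac)

lemma lsum_smult:
  "c \<in> carrier R \<Longrightarrow> (\<And>x. x \<in> set xs \<Longrightarrow> f x \<in> carrier M) \<Longrightarrow>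
   lsum M xs (\<lambda>x. c \<odot>\<^bsub>M\<^esub> f x) = c \<odot>\<^bsub>M\<^esub> lsum M xs f"
  by (induction xs) (auto simp: lsum_closed smult_r_distr)

lemma lsum_zero: "lsum M xs (\<lambda>x. \<zero>\<^bsub>M\<^esub>) = \<zero>\<^bsub>M\<^esub>"
  by (induction xs) auto

lemma lsum_swap:
  "(\<And>x y. x \<in> set xs \<Longrightarrow> y \<in> set ys \<Longrightarrow> f x y \<in> carrier M) \<Longrightarrow>
   lsum M xs (\<lambda>x. lsum M ys (f x)) = lsum M ys (\<lambda>y. lsum M xs (\<lambda>x. f x y))"
  by (induction xs) (auto simp: lsum_zero lsum_add lsum_closed)

lemma lin_lsum:
  assumes "\<And>p. p \<in> set L \<Longrightarrow> (\<lambda>x. F x p) \<in> lin_hom R N M"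
  shows "(\<lambda>x. lsum M L (F x)) \<in> lin_hom R N M"
proof (rule lin_homI)
  fix x assume x: "x \<in> carrier N"
  show "lsum M L (F x) \<in> carrier M"
    using x lin_hom_closed[OF assms] by (intro lsum_closed) auto
  { fix y assume y: "y \<in> carrier N"
    have "lsum M L (F (x \<oplus>\<^bsub>N\<^esub> y)) = lsum M L (\<lambda>p. F x p \<oplus>\<^bsub>M\<^esub> F y p)"
      using lin_hom_add[OF assms x y] by (intro lsum_cong) auto
    then show "lsum M L (F (x \<oplus>\<^bsub>N\<^esub> y)) = lsum M L (F x) \<oplus>\<^bsub>M\<^esub> lsum M L (F y)"
      using lin_hom_closed[OF assms x] lin_hom_closed[OF assms y] by (simp add: lsum_add) }
  fix c assume c: "c \<in> carrier R"
  have "lsum M L (F (c \<odot>\<^bsub>N\<^esub> x)) = lsum M L (\<lambda>p. c \<odot>\<^bsub>M\<^esub> F x p)"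
    using lin_hom_smult[OF assms c x] by (intro lsum_cong) auto
  then show "lsum M L (F (c \<odot>\<^bsub>N\<^esub> x)) = c \<odot>\<^bsub>M\<^esub> lsum M L (F x)"
    using lin_hom_closed[OF assms x] c by (simp add: lsum_smult)
qed

end

lemma lin_hom_lsum:
  assumes "module K M" "module K N" "f \<in> lin_hom K M N" "\<And>x. x \<in> set xs \<Longrightarrow> g x \<in> carrier M"
  shows "f (lsum M xs g) = lsum N xs (\<lambda>x. f (g x))"
proof -
  interpret M: module K M by fact
  show ?thesis
    using assms(4) by (induction xs) (auto simp: lin_hom_zero[OF assms(1-3)] lin_hom_add[OF assms(3)] M.lsum_closed)
qed

definition bilin ::
  "('k,'r) ring_scheme \<Rightarrow> ('k,'m,'s) module_scheme \<Rightarrow> ('k,'n,'t) module_scheme \<Rightarrow>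
   ('k,'w,'u) module_scheme \<Rightarrow> ('m \<Rightarrow> 'n \<Rightarrow> 'w) \<Rightarrow> bool"
  where "bilin K M N W F \<longleftrightarrow> (\<forall>x\<in>carrier M. (\<lambda>y. F x y) \<in> lin_hom K N W) \<and>
    (\<forall>y\<in>carrier N. (\<lambda>x. F x y) \<in> lin_hom K M W)"

lemma bilinI:
  "(\<And>x. x \<in> carrier M \<Longrightarrow> (\<lambda>y. F x y) \<in> lin_hom K N W) \<Longrightarrow>
   (\<And>y. y \<in> carrier N \<Longrightarrow> (\<lambda>x. F x y) \<in> lin_hom K M W) \<Longrightarrow> bilin K M N W F"
  by (auto simp: bilin_def)

lemma bilinD:
  assumes "bilin K M N W F"
  shows "x \<in> carrier M \<Longrightarrow> (\<lambda>y. F x y) \<in> lin_hom K N W"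
    and "y \<in> carrier N \<Longrightarrow> (\<lambda>x. F x y) \<in> lin_hom K M W"
    and "x \<in> carrier M \<Longrightarrow> y \<in> carrier N \<Longrightarrow> F x y \<in> carrier W"
  using assms by (auto simp: bilin_def lin_hom_def)

lemma tuples_0 [simp]: "tuples M 0 = {[]}"
  by (auto simp: tuples_def)

lemma tuples_Cons [simp]: "x # xs \<in> tuples M n \<longleftrightarrow> x \<in> carrier M \<and> xs \<in> tuples M (n - 1) \<and> n > 0"
  by (cases n) (auto simp: tuples_def)

lemma tuples_Suc: "xs \<in> tuples M (Suc n) \<longleftrightarrow> (\<exists>y ys. xs = y # ys \<and> y \<in> carrier M \<and> ys \<in> tuples M n)"
  by (cases xs) (auto simp: tuples_def)

text \<open>Multilinearity in the entries of lists of length \<open>n\<close>, by recursion on the list, since the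
  maps of interest are defined that way.\<close>

primrec mlin ::
  "('k,'r) ring_scheme \<Rightarrow> ('k,'m,'s) module_scheme \<Rightarrow> ('k,'w,'u) module_scheme \<Rightarrow> nat \<Rightarrow>
   ('m list \<Rightarrow> 'w) \<Rightarrow> bool"
  where
    "mlin K M W 0 f \<longleftrightarrow> f [] \<in> carrier W"
  | "mlin K M W (Suc n) f \<longleftrightarrow> (\<forall>x\<in>carrier M. mlin K M W n (\<lambda>xs. f (x # xs))) \<and>
      (\<forall>xs\<in>tuples M n. (\<lambda>x. f (x # xs)) \<in> lin_hom K M W)"

lemma mlin_closed: "mlin K M W n f \<Longrightarrow> xs \<in> tuples M n \<Longrightarrow> f xs \<in> carrier W"
  by (induction n arbitrary: f xs) (auto simp: tuples_Suc)

lemma mlin_slot: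
  assumes "mlin K M W n f" "xs @ [x] @ ys \<in> tuples M n"
  shows "(\<lambda>x. f (xs @ [x] @ ys)) \<in> lin_hom K M W"
  using assms
proof (induction n arbitrary: f xs)
  case (Suc n)
  show ?case
  proof (cases xs)
    case Nil then show ?thesis using Suc.prems by simp
  next
    case (Cons z zs)
    then show ?thesis using Suc.prems Suc.IH[of "\<lambda>xs. f (z # xs)" zs] by simp
  qed
qed simp

lemma mlinI_slot:
  assumes "\<And>xs. xs \<in> tuples M n \<Longrightarrow> f xs \<in> carrier W"
    and "\<And>xs ys. set xs \<subseteq> carrier M \<Longrightarrow> set ys \<subseteq> carrier M \<Longrightarrow> length xs + length ys + 1 = n \<Longrightarrow>
      (\<lambda>x. f (xs @ [x] @ ys)) \<in> lin_hom K M W"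
  shows "mlin K M W n f"
  using assms
proof (induction n arbitrary: f)
  case (Suc n)
  have "(\<lambda>x. f (x # xs)) \<in> lin_hom K M W" if "xs \<in> tuples M n" for xs
    using Suc.prems(2)[of "[]" xs] that by (simp add: tuples_def)
  moreover have "mlin K M W n (\<lambda>xs. f (x # xs))" if x: "x \<in> carrier M" for x
  proof (rule Suc.IH)
    show "f (x # xs) \<in> carrier W" if "xs \<in> tuples M n" for xs
      using Suc.prems(1) that x by simp
    show "(\<lambda>z. f (x # xs @ [z] @ ys)) \<in> lin_hom K M W"
      if "set xs \<subseteq> carrier M" "set ys \<subseteq> carrier M" "length xs + length ys + 1 = n" for xs ys
      using Suc.prems(2)[of "x # xs" ys] that x by simp
  qed
  ultimately show ?case by simp
qed simp

lemma mlin_cong: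
  assumes "module K M" "mlin K M W n f" "\<And>xs. xs \<in> tuples M n \<Longrightarrow> f xs = g xs"
  shows "mlin K M W n g"
  using assms(2,3)
proof (induction n arbitrary: f g)
  case (Suc n)
  have "mlin K M W n (\<lambda>xs. g (x # xs))" if "x \<in> carrier M" for x
    by (rule Suc.IH[of "\<lambda>xs. f (x # xs)"]) (use Suc.prems that in auto)
  moreover have "(\<lambda>x. g (x # xs)) \<in> lin_hom K M W" if "xs \<in> tuples M n" for xs
    by (rule lin_hom_cong[OF assms(1), of "\<lambda>x. f (x # xs)"]) (use Suc.prems that in auto)
  ultimately show ?case by simp
qed simp

lemma mlin_lin: "mlin K M W n f \<Longrightarrow> g \<in> lin_hom K W V \<Longrightarrow> mlin K M V n (\<lambda>xs. g (f xs))"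
  by (induction n arbitrary: f) (auto simp: lin_hom_closed intro: lin_hom_comp)

lemma mlin_lsum:
  assumes "module K W" "\<And>p. p \<in> set L \<Longrightarrow> mlin K M W n (\<lambda>xs. F xs p)"
  shows "mlin K M W n (\<lambda>xs. lsum W L (F xs))"
  using assms(2)
proof (induction n arbitrary: F)
  case 0 then show ?case by (simp add: module.lsum_closed[OF assms(1)])
next
  case (Suc n) then show ?case by (auto intro: module.lin_lsum[OF assms(1)])
qed

section \<open>Universal properties of the tensor products\<close>

lemma lin_ext_rels:
  assumes "module K W" "\<And>x. x \<in> X \<Longrightarrow> f x \<in> carrier W" "p \<in> X" "q \<in> X"
  shows lin_ext_diff: "lin_ext K W f (basis_vec K p \<ominus>\<^bsub>free_module K X\<^esub> basis_vec K q) = f p \<ominus>\<^bsub>W\<^esub> f q"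
    and lin_ext_add: "r \<in> X \<Longrightarrow> lin_ext K W f (basis_vec K p \<ominus>\<^bsub>free_module K X\<^esub>
          (basis_vec K q \<oplus>\<^bsub>free_module K X\<^esub> basis_vec K r)) = f p \<ominus>\<^bsub>W\<^esub> (f q \<oplus>\<^bsub>W\<^esub> f r)"
    and lin_ext_smult: "c \<in> carrier K \<Longrightarrow> lin_ext K W f (basis_vec K p \<ominus>\<^bsub>free_module K X\<^esub>
          (c \<odot>\<^bsub>free_module K X\<^esub> basis_vec K q)) = f p \<ominus>\<^bsub>W\<^esub> (c \<odot>\<^bsub>W\<^esub> f q)"
proof -
  interpret W: module K W by fact
  note cr = W.R.is_cring
  interpret F: module K "free_module K X" by (rule module_free[OF cr])
  have l: "lin_ext K W f \<in> lin_hom K (free_module K X) W"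
    by (rule lin_ext_lin[OF assms(1)]) (rule assms(2))
  have b: "lin_ext K W f (basis_vec K x) = f x" if "x \<in> X" for x
    using that by (rule lin_ext_basis[OF assms(1), rotated]) (rule assms(2))
  note c = basis_vec_closed[OF cr, of _ X]
  note m = lin_hom_minus[OF F.module_axioms assms(1) l]
  show "lin_ext K W f (basis_vec K p \<ominus>\<^bsub>free_module K X\<^esub> basis_vec K q) = f p \<ominus>\<^bsub>W\<^esub> f q"
    using assms(3,4) by (simp add: m b c)
  show "lin_ext K W f (basis_vec K p \<ominus>\<^bsub>free_module K X\<^esub>
          (basis_vec K q \<oplus>\<^bsub>free_module K X\<^esub> basis_vec K r)) = f p \<ominus>\<^bsub>W\<^esub> (f q \<oplus>\<^bsub>W\<^esub> f r)" if "r \<in> X"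
    using assms(3,4) that by (simp add: m b c lin_hom_add[OF l])
  show "lin_ext K W f (basis_vec K p \<ominus>\<^bsub>free_module K X\<^esub>
          (c \<odot>\<^bsub>free_module K X\<^esub> basis_vec K q)) = f p \<ominus>\<^bsub>W\<^esub> (c \<odot>\<^bsub>W\<^esub> f q)" if "c \<in> carrier K"
    using assms(3,4) that by (simp add: m b c lin_hom_smult[OF l])
qed

lemma free_rels_closed:
  assumes "cring K" "p \<in> X" "q \<in> X"
  shows "basis_vec K p \<ominus>\<^bsub>free_module K X\<^esub> basis_vec K q \<in> carrier (free_module K X)"
    and "r \<in> X \<Longrightarrow> basis_vec K p \<ominus>\<^bsub>free_module K X\<^esub>
          (basis_vec K q \<oplus>\<^bsub>free_module K X\<^esub> basis_vec K r) \<in> carrier (free_module K X)"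
    and "c \<in> carrier K \<Longrightarrow> basis_vec K p \<ominus>\<^bsub>free_module K X\<^esub>
          (c \<odot>\<^bsub>free_module K X\<^esub> basis_vec K q) \<in> carrier (free_module K X)"
proof -
  let ?F = "free_module K X"
  interpret F: module K "free_module K X" by (rule module_free[OF assms(1)])
  note c = basis_vec_closed[OF assms(1), of _ X]
  show "basis_vec K p \<ominus>\<^bsub>?F\<^esub> basis_vec K q \<in> carrier ?F"
    and "r \<in> X \<Longrightarrow> basis_vec K p \<ominus>\<^bsub>?F\<^esub>
          (basis_vec K q \<oplus>\<^bsub>?F\<^esub> basis_vec K r) \<in> carrier ?F"
    and "c \<in> carrier K \<Longrightarrow> basis_vec K p \<ominus>\<^bsub>?F\<^esub>
          (c \<odot>\<^bsub>?F\<^esub> basis_vec K q) \<in> carrier ?F"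
    using assms(2,3) c by auto
qed

lemma presented_gen_rels:
  assumes "cring K" "R \<subseteq> carrier (free_module K X)" "p \<in> X" "q \<in> X"
  shows presented_gen_eq: "basis_vec K p \<ominus>\<^bsub>free_module K X\<^esub> basis_vec K q \<in> R \<Longrightarrow>
          gen K (presented K X R) p = gen K (presented K X R) q"
    and presented_gen_add: "r \<in> X \<Longrightarrow> basis_vec K p \<ominus>\<^bsub>free_module K X\<^esub>
          (basis_vec K q \<oplus>\<^bsub>free_module K X\<^esub> basis_vec K r) \<in> R \<Longrightarrow>
          gen K (presented K X R) p
            = gen K (presented K X R) q \<oplus>\<^bsub>presented K X R\<^esub> gen K (presented K X R) r"
    and presented_gen_smult: "c \<in> carrier K \<Longrightarrow> basis_vec K p \<ominus>\<^bsub>free_module K X\<^esub>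
          (c \<odot>\<^bsub>free_module K X\<^esub> basis_vec K q) \<in> R \<Longrightarrow>
          gen K (presented K X R) p = c \<odot>\<^bsub>presented K X R\<^esub> gen K (presented K X R) q"
proof -
  let ?F = "free_module K X" and ?Q = "presented K X R"
  let ?pi = "\<lambda>v. lin_span K ?F R +>\<^bsub>?F\<^esub> v"
  interpret Q: module K ?Q by (rule presented_module[OF assms(1,2)])
  interpret F: module K ?F by (rule module_free[OF assms(1)])
  note l = presented_map[OF assms(1,2)]
  note b = presented_map_basis[OF assms(1,2)]
  note z = presented_map_rel[OF assms(1,2)]
  note c = basis_vec_closed[OF assms(1), of _ X]
  note g = gen_closed[OF assms(1,2)]
  note m = lin_hom_minus[OF F.module_axioms Q.module_axioms l]
  note e = module_diff_zero[OF Q.module_axioms]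
  show "gen K ?Q p = gen K ?Q q" if "basis_vec K p \<ominus>\<^bsub>?F\<^esub> basis_vec K q \<in> R"
    using z[OF that] m[OF c c, OF assms(3,4)] e[OF g g, OF assms(3,4)] by (simp add: b)
  show "gen K ?Q p = gen K ?Q q \<oplus>\<^bsub>?Q\<^esub> gen K ?Q r"
    if r: "r \<in> X" and R: "basis_vec K p \<ominus>\<^bsub>?F\<^esub> (basis_vec K q \<oplus>\<^bsub>?F\<^esub> basis_vec K r) \<in> R"
    using z[OF R] m[OF c F.M.a_closed[OF c c], OF assms(3,4) r]
      e[OF g Q.M.a_closed[OF g g], OF assms(3,4) r] lin_hom_add[OF l c c, OF assms(4) r] by (simp add: b)
  show "gen K ?Q p = c \<odot>\<^bsub>?Q\<^esub> gen K ?Q q"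
    if k: "c \<in> carrier K" and R: "basis_vec K p \<ominus>\<^bsub>?F\<^esub> (c \<odot>\<^bsub>?F\<^esub> basis_vec K q) \<in> R"
    using z[OF R] m[OF c F.smult_closed[OF k c], OF assms(3,4)]
      e[OF g Q.smult_closed[OF k g], OF assms(3,4)] lin_hom_smult[OF l k c, OF assms(4)]
    by (simp add: b)
qed

text \<open>When the set of generators is stable under scalars, no scalars are needed to write an
  element as a sum of generators.\<close>

lemma presented_rep:
  assumes "cring K" "R \<subseteq> carrier (free_module K X)"
    and sc: "\<And>c x. c \<in> carrier K \<Longrightarrow> x \<in> X \<Longrightarrow>
      \<exists>y\<in>X. c \<odot>\<^bsub>presented K X R\<^esub> gen K (presented K X R) x = gen K (presented K X R) y"
    and "q \<in> carrier (presented K X R)"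
  shows "\<exists>L. set L \<subseteq> X \<and> q = lsum (presented K X R) L (gen K (presented K X R))"
proof -
  let ?F = "free_module K X" and ?Q = "presented K X R"
  let ?pi = "\<lambda>v. lin_span K ?F R +>\<^bsub>?F\<^esub> v"
  interpret Q: module K ?Q by (rule presented_module[OF assms(1,2)])
  interpret F: module K ?F by (rule module_free[OF assms(1)])
  note l = presented_map[OF assms(1,2)]
  note b = presented_map_basis[OF assms(1,2)]
  note g = gen_closed[OF assms(1,2)]
  have *: "\<exists>L. set L \<subseteq> X \<and> ?pi v = lsum ?Q L (gen K ?Q)"
    if "finite S" "v \<in> carrier ?F" "{x. v x \<noteq> \<zero>\<^bsub>K\<^esub>} \<subseteq> S" "S \<subseteq> X" for S v
    using that
  proof (induction S arbitrary: v)
    case empty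
    then have "v = \<zero>\<^bsub>?F\<^esub>" by (auto simp: free_module_def)
    then have "?pi v = \<zero>\<^bsub>?Q\<^esub>"
      using lin_hom_zero[OF F.module_axioms Q.module_axioms l] by simp
    then show ?case by (intro exI[of _ "[]"]) simp
  next
    case (insert s S)
    let ?v = "v(s := \<zero>\<^bsub>K\<^esub>)"
    have cl: "v x \<in> carrier K" for x using free_module_closed[OF insert.prems(1) assms(1)] .
    have s: "s \<in> X" using insert.prems by auto
    have v1: "?v \<in> carrier ?F" using insert.prems(1)
      by (auto simp: free_module_def elim: rev_finite_subset)
    have v3: "{x. ?v x \<noteq> \<zero>\<^bsub>K\<^esub>} \<subseteq> S" using insert.prems(2) by auto
    have v2: "basis_vec K s \<in> carrier ?F" by (rule basis_vec_closed[OF assms(1) s])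
    have "v = ?v \<oplus>\<^bsub>?F\<^esub> (v s \<odot>\<^bsub>?F\<^esub> basis_vec K s)"
      using cl by (auto simp: free_module_def basis_vec_def fun_eq_iff)
    then have "?pi v = ?pi ?v \<oplus>\<^bsub>?Q\<^esub> (v s \<odot>\<^bsub>?Q\<^esub> gen K ?Q s)"
      using lin_hom_add[OF l v1 F.smult_closed[OF cl v2, of s]] lin_hom_smult[OF l cl v2, of s]
      by (simp add: b)
    moreover obtain y where y: "y \<in> X" "v s \<odot>\<^bsub>?Q\<^esub> gen K ?Q s = gen K ?Q y" using sc[OF cl s] by blast
    moreover obtain L where L: "set L \<subseteq> X" "?pi ?v = lsum ?Q L (gen K ?Q)"
      using insert.IH[OF v1] v3 insert.prems(3) by blast
    ultimately have "?pi v = lsum ?Q (y # L) (gen K ?Q)"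
      using g Q.lsum_closed[of L "gen K ?Q"] by (auto simp: Q.M.a_comm subset_iff)
    then show ?case using L y by (intro exI[of _ "y # L"]) auto
  qed
  obtain v where v: "v \<in> carrier ?F" "q = ?pi v"
    using assms(4) quot_map_surj[OF F.module_axioms submodule_lin_span[OF F.module_axioms assms(2)]]
    by (auto simp: presented_def)
  then show ?thesis using *[of "{x. v x \<noteq> \<zero>\<^bsub>K\<^esub>}" v] by (auto simp: free_module_def)
qed

text \<open>The bilinear tensor product with further relations \<open>E\<close>, which covers both the tensor
  product over the field and that over an algebra.\<close>

abbreviation pair_rels ::
  "('k,'r) ring_scheme \<Rightarrow> ('k,'m,'s) module_scheme \<Rightarrow> ('k,'n,'t) module_scheme \<Rightarrow>
   ('m \<times> 'n \<Rightarrow> 'k) set \<Rightarrow> ('k,('m \<times> 'n \<Rightarrow> 'k) set) module"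
  where "pair_rels K M N E \<equiv> presented K (carrier M \<times> carrier N) (bilinear_rels K M N \<union> E)"

lemma bilinear_relsI:
  fixes K M N
  defines "F \<equiv> free_module K (carrier M \<times> carrier N)" and "e \<equiv> basis_vec K"
  shows "x \<in> carrier M \<Longrightarrow> x' \<in> carrier M \<Longrightarrow> y \<in> carrier N \<Longrightarrow>
      e (x \<oplus>\<^bsub>M\<^esub> x', y) \<ominus>\<^bsub>F\<^esub> (e (x, y) \<oplus>\<^bsub>F\<^esub> e (x', y)) \<in> bilinear_rels K M N"
    and "x \<in> carrier M \<Longrightarrow> y \<in> carrier N \<Longrightarrow> y' \<in> carrier N \<Longrightarrow>
      e (x, y \<oplus>\<^bsub>N\<^esub> y') \<ominus>\<^bsub>F\<^esub> (e (x, y) \<oplus>\<^bsub>F\<^esub> e (x, y')) \<in> bilinear_rels K M N"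
    and "c \<in> carrier K \<Longrightarrow> x \<in> carrier M \<Longrightarrow> y \<in> carrier N \<Longrightarrow>
      e (c \<odot>\<^bsub>M\<^esub> x, y) \<ominus>\<^bsub>F\<^esub> (c \<odot>\<^bsub>F\<^esub> e (x, y)) \<in> bilinear_rels K M N"
    and "c \<in> carrier K \<Longrightarrow> x \<in> carrier M \<Longrightarrow> y \<in> carrier N \<Longrightarrow>
      e (x, c \<odot>\<^bsub>N\<^esub> y) \<ominus>\<^bsub>F\<^esub> (c \<odot>\<^bsub>F\<^esub> e (x, y)) \<in> bilinear_rels K M N"
  unfolding bilinear_rels_def Let_def F_def e_def by blast+

lemma bilinear_relsE [consumes 1, case_names add1 add2 smult1 smult2]:
  fixes K M N
  defines "F \<equiv> free_module K (carrier M \<times> carrier N)" and "e \<equiv> basis_vec K"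
  assumes "r \<in> bilinear_rels K M N"
  obtains x x' y where "r = e (x \<oplus>\<^bsub>M\<^esub> x', y) \<ominus>\<^bsub>F\<^esub> (e (x, y) \<oplus>\<^bsub>F\<^esub> e (x', y))"
      "x \<in> carrier M" "x' \<in> carrier M" "y \<in> carrier N"
    | x y y' where "r = e (x, y \<oplus>\<^bsub>N\<^esub> y') \<ominus>\<^bsub>F\<^esub> (e (x, y) \<oplus>\<^bsub>F\<^esub> e (x, y'))"
      "x \<in> carrier M" "y \<in> carrier N" "y' \<in> carrier N"
    | c x y where "r = e (c \<odot>\<^bsub>M\<^esub> x, y) \<ominus>\<^bsub>F\<^esub> (c \<odot>\<^bsub>F\<^esub> e (x, y))"
      "c \<in> carrier K" "x \<in> carrier M" "y \<in> carrier N"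
    | c x y where "r = e (x, c \<odot>\<^bsub>N\<^esub> y) \<ominus>\<^bsub>F\<^esub> (c \<odot>\<^bsub>F\<^esub> e (x, y))"
      "c \<in> carrier K" "x \<in> carrier M" "y \<in> carrier N"
  using assms(3) unfolding bilinear_rels_def Let_def F_def e_def by blast

lemma bilinear_rels_closed:
  assumes "module K M" "module K N"
  shows "bilinear_rels K M N \<subseteq> carrier (free_module K (carrier M \<times> carrier N))"
proof -
  interpret M: module K M by fact
  interpret N: module K N by fact
  note fr = free_rels_closed[OF M.R.is_cring, where X = "carrier M \<times> carrier N"]
  show ?thesis
  proof
    fix r assume "r \<in> bilinear_rels K M N"
    then show "r \<in> carrier (free_module K (carrier M \<times> carrier N))"
      by (cases rule: bilinear_relsE) (simp_all add: fr(2,3))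
  qed
qed

lemma pair_gen_bilin:
  assumes "module K M" "module K N" "E \<subseteq> carrier (free_module K (carrier M \<times> carrier N))"
  shows "bilin K M N (pair_rels K M N E) (\<lambda>x y. gen K (pair_rels K M N E) (x, y))"
proof -
  let ?P = "pair_rels K M N E"
  interpret M: module K M by fact
  interpret N: module K N by fact
  let ?R = "bilinear_rels K M N \<union> E"
  have R: "?R \<subseteq> carrier (free_module K (carrier M \<times> carrier N))"
    using bilinear_rels_closed[OF assms(1,2)] assms(3) by auto
  note g = gen_closed[OF M.R.is_cring R]
  note a = presented_gen_add[OF M.R.is_cring R]
    and s = presented_gen_smult[OF M.R.is_cring R]
  show ?thesis
  proof (intro bilinI lin_homI)
    fix x y assume x: "x \<in> carrier M" and y: "y \<in> carrier N"
    show "gen K ?P (x, y) \<in> carrier ?P"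
      and "gen K ?P (x, y) \<in> carrier ?P"
      using g x y by auto
    fix c assume c: "c \<in> carrier K"
    show "gen K ?P (c \<odot>\<^bsub>M\<^esub> x, y) = c \<odot>\<^bsub>?P\<^esub> gen K ?P (x, y)"
      by (rule s) (use x y c in \<open>simp_all add: bilinear_relsI\<close>)
    show "gen K ?P (x, c \<odot>\<^bsub>N\<^esub> y) = c \<odot>\<^bsub>?P\<^esub> gen K ?P (x, y)"
      by (rule s) (use x y c in \<open>simp_all add: bilinear_relsI\<close>)
  next
    fix x x' y assume x: "x \<in> carrier N" "x' \<in> carrier N" and y: "y \<in> carrier M"
    show "gen K ?P (y, x \<oplus>\<^bsub>N\<^esub> x') = gen K ?P (y, x)
        \<oplus>\<^bsub>?P\<^esub> gen K ?P (y, x')"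
      by (rule a) (use x y in \<open>simp_all add: bilinear_relsI\<close>)
  next
    fix x x' y assume x: "x \<in> carrier M" "x' \<in> carrier M" and y: "y \<in> carrier N"
    show "gen K ?P (x \<oplus>\<^bsub>M\<^esub> x', y) = gen K ?P (x, y)
        \<oplus>\<^bsub>?P\<^esub> gen K ?P (x', y)"
      by (rule a) (use x y in \<open>simp_all add: bilinear_relsI\<close>)
  qed
qed

lemma pair_rep:
  assumes "module K M" "module K N" "E \<subseteq> carrier (free_module K (carrier M \<times> carrier N))"
    "q \<in> carrier (pair_rels K M N E)"
  shows "\<exists>L. set L \<subseteq> carrier M \<times> carrier N \<and>
    q = lsum (pair_rels K M N E) L (\<lambda>p. gen K (pair_rels K M N E) (fst p, snd p))"
proof -
  interpret M: module K M by fact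
  have R: "bilinear_rels K M N \<union> E \<subseteq> carrier (free_module K (carrier M \<times> carrier N))"
    using bilinear_rels_closed[OF assms(1,2)] assms(3) by auto
  note b = pair_gen_bilin[OF assms(1-3)]
  have "\<exists>L. set L \<subseteq> carrier M \<times> carrier N \<and> q = lsum (pair_rels K M N E) L (gen K (pair_rels K M N E))"
  proof (rule presented_rep[OF M.R.is_cring R _ assms(4)])
    fix c p assume c: "c \<in> carrier K" and "p \<in> carrier M \<times> carrier N"
    then obtain x y where p: "p = (x, y)" "x \<in> carrier M" "y \<in> carrier N" by auto
    then show "\<exists>p'\<in>carrier M \<times> carrier N. c \<odot>\<^bsub>pair_rels K M N E\<^esub> gen K (pair_rels K M N E) p
        = gen K (pair_rels K M N E) p'"
      using lin_hom_smult[OF bilinD(2)[OF b p(3)] c p(2)] c by (intro bexI[of _ "(c \<odot>\<^bsub>M\<^esub> x, y)"]) auto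
  qed
  then show ?thesis by simp
qed

lemma pair_lift:
  assumes "module K M" "module K N" "E \<subseteq> carrier (free_module K (carrier M \<times> carrier N))"
    "module K W" "bilin K M N W F" "\<And>r. r \<in> E \<Longrightarrow> lin_ext K W (\<lambda>(x, y). F x y) r = \<zero>\<^bsub>W\<^esub>"
  shows "gen_lift K W (\<lambda>(x, y). F x y) \<in> lin_hom K (pair_rels K M N E) W"
    and "x \<in> carrier M \<Longrightarrow> y \<in> carrier N \<Longrightarrow>
      gen_lift K W (\<lambda>(x, y). F x y) (gen K (pair_rels K M N E) (x, y)) = F x y"
proof -
  interpret M: module K M by fact
  interpret N: module K N by fact
  interpret W: module K W by fact
  have R: "bilinear_rels K M N \<union> E \<subseteq> carrier (free_module K (carrier M \<times> carrier N))"
    using bilinear_rels_closed[OF assms(1,2)] assms(3) by auto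
  note F = bilinD[OF assms(5)]
  have f: "(\<lambda>(x, y). F x y) p \<in> carrier W" if "p \<in> carrier M \<times> carrier N" for p
    using that F(3) by auto
  note a = lin_ext_add[OF assms(4) f] and s = lin_ext_smult[OF assms(4) f]
  note z = module_diff_zero[OF assms(4)]
  have "lin_ext K W (\<lambda>(x, y). F x y) r = \<zero>\<^bsub>W\<^esub>" if "r \<in> bilinear_rels K M N" for r
    using that
    by (cases rule: bilinear_relsE)
      (simp_all add: a s F(3) z lin_hom_add[OF F(1)] lin_hom_add[OF F(2)]
        lin_hom_smult[OF F(1)] lin_hom_smult[OF F(2)])
  then have k: "lin_ext K W (\<lambda>(x, y). F x y) r = \<zero>\<^bsub>W\<^esub>" if "r \<in> bilinear_rels K M N \<union> E" for r
    using that assms(6) by auto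
  show "gen_lift K W (\<lambda>(x, y). F x y) \<in> lin_hom K (pair_rels K M N E) W"
    by (rule presented_lift_lin[OF assms(4) R]) (erule f k)+
  show "gen_lift K W (\<lambda>(x, y). F x y) (gen K (pair_rels K M N E) (x, y)) = F x y"
    if "x \<in> carrier M" "y \<in> carrier N"
  proof -
    have "gen_lift K W (\<lambda>(x, y). F x y) (gen K (pair_rels K M N E) (x, y)) = (\<lambda>(x, y). F x y) (x, y)"
      by (rule presented_lift_gen[OF assms(4) R]) (erule f k | use that in simp)+
    then show ?thesis by simp
  qed
qed

text \<open>The same for lists of generators, the further relations \<open>E\<close> being those over a subalgebra.\<close>

abbreviation list_rels ::
  "('k,'r) ring_scheme \<Rightarrow> ('k,'m,'s) module_scheme \<Rightarrow> nat \<Rightarrow> ('m list \<Rightarrow> 'k) set \<Rightarrow>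
   ('k,('m list \<Rightarrow> 'k) set) module"
  where "list_rels K M n E \<equiv> presented K (tuples M n) (multilinear_rels K M n \<union> E)"

lemma multilinear_relsI:
  fixes K M n
  defines "F \<equiv> free_module K (tuples M n)" and "e \<equiv> basis_vec K"
  shows "xs @ [x] @ ys \<in> tuples M n \<Longrightarrow> x' \<in> carrier M \<Longrightarrow>
      e (xs @ [x \<oplus>\<^bsub>M\<^esub> x'] @ ys) \<ominus>\<^bsub>F\<^esub> (e (xs @ [x] @ ys) \<oplus>\<^bsub>F\<^esub> e (xs @ [x'] @ ys))
        \<in> multilinear_rels K M n"
    and "c \<in> carrier K \<Longrightarrow> xs @ [x] @ ys \<in> tuples M n \<Longrightarrow>
      e (xs @ [c \<odot>\<^bsub>M\<^esub> x] @ ys) \<ominus>\<^bsub>F\<^esub> (c \<odot>\<^bsub>F\<^esub> e (xs @ [x] @ ys)) \<in> multilinear_rels K M n"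
  unfolding multilinear_rels_def Let_def F_def e_def by blast+

lemma multilinear_relsE [consumes 1, case_names add smult]:
  fixes K M n
  defines "F \<equiv> free_module K (tuples M n)" and "e \<equiv> basis_vec K"
  assumes "r \<in> multilinear_rels K M n"
  obtains xs x x' ys where
      "r = e (xs @ [x \<oplus>\<^bsub>M\<^esub> x'] @ ys) \<ominus>\<^bsub>F\<^esub> (e (xs @ [x] @ ys) \<oplus>\<^bsub>F\<^esub> e (xs @ [x'] @ ys))"
      "xs @ [x] @ ys \<in> tuples M n" "x' \<in> carrier M"
    | xs c x ys where "r = e (xs @ [c \<odot>\<^bsub>M\<^esub> x] @ ys) \<ominus>\<^bsub>F\<^esub> (c \<odot>\<^bsub>F\<^esub> e (xs @ [x] @ ys))"
      "c \<in> carrier K" "xs @ [x] @ ys \<in> tuples M n"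
  using assms(3) unfolding multilinear_rels_def Let_def F_def e_def by blast

lemma tuples_slot: "xs @ [x] @ ys \<in> tuples M n \<Longrightarrow> x' \<in> carrier M \<Longrightarrow> xs @ [x'] @ ys \<in> tuples M n"
  by (auto simp: tuples_def)

lemma tuples_slotD: "xs @ [x] @ ys \<in> tuples M n \<Longrightarrow> x \<in> carrier M"
  by (auto simp: tuples_def)

lemma multilinear_rels_closed:
  assumes "module K M"
  shows "multilinear_rels K M n \<subseteq> carrier (free_module K (tuples M n))"
proof -
  interpret M: module K M by fact
  note fr = free_rels_closed[OF M.R.is_cring, where X = "tuples M n"]
  show ?thesis
  proof
    fix r assume "r \<in> multilinear_rels K M n"
    then show "r \<in> carrier (free_module K (tuples M n))"
    proof (cases rule: multilinear_relsE)
      case (add xs x x' ys)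
      note t = tuples_slot[OF add(2)] tuples_slotD[OF add(2)]
      show ?thesis unfolding add(1) using add(2,3) t by (intro fr(2)) auto
    next
      case (smult xs c x ys)
      note t = tuples_slot[OF smult(3)] tuples_slotD[OF smult(3)]
      show ?thesis unfolding smult(1) using smult(2,3) t by (intro fr(3)) auto
    qed
  qed
qed

lemma list_gen_mlin:
  assumes "module K M" "E \<subseteq> carrier (free_module K (tuples M n))"
  shows "mlin K M (list_rels K M n E) n (gen K (list_rels K M n E))"
proof (rule mlinI_slot)
  interpret M: module K M by fact
  let ?R = "multilinear_rels K M n \<union> E"
  have R: "?R \<subseteq> carrier (free_module K (tuples M n))"
    using multilinear_rels_closed[OF assms(1)] assms(2) by auto
  note g = gen_closed[OF M.R.is_cring R]
  note a = presented_gen_add[OF M.R.is_cring R]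
    and s = presented_gen_smult[OF M.R.is_cring R]
  show "gen K (list_rels K M n E) xs \<in> carrier (list_rels K M n E)" if "xs \<in> tuples M n" for xs
    using g[OF that] .
  fix xs ys assume "set xs \<subseteq> carrier M" "set ys \<subseteq> carrier M" "length xs + length ys + 1 = n"
  then have t: "xs @ [x] @ ys \<in> tuples M n" if "x \<in> carrier M" for x
    using that by (auto simp: tuples_def)
  show "(\<lambda>x. gen K (list_rels K M n E) (xs @ [x] @ ys)) \<in> lin_hom K M (list_rels K M n E)"
  proof (rule lin_homI)
    fix x assume x: "x \<in> carrier M"
    show "gen K (list_rels K M n E) (xs @ [x] @ ys) \<in> carrier (list_rels K M n E)"
      by (rule g[OF t[OF x]])
    { fix c assume c: "c \<in> carrier K"
      show "gen K (list_rels K M n E) (xs @ [c \<odot>\<^bsub>M\<^esub> x] @ ys)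
          = c \<odot>\<^bsub>list_rels K M n E\<^esub> gen K (list_rels K M n E) (xs @ [x] @ ys)"
        by (rule s) (intro t x c M.smult_closed UnI1 multilinear_relsI)+ }
    fix y assume y: "y \<in> carrier M"
    show "gen K (list_rels K M n E) (xs @ [x \<oplus>\<^bsub>M\<^esub> y] @ ys) = gen K (list_rels K M n E) (xs @ [x] @ ys)
        \<oplus>\<^bsub>list_rels K M n E\<^esub> gen K (list_rels K M n E) (xs @ [y] @ ys)"
      by (rule a) (intro t x y M.a_closed UnI1 multilinear_relsI)+
  qed
qed

lemma list_rep:
  assumes "module K M" "E \<subseteq> carrier (free_module K (tuples M n))" "n > 0"
    "q \<in> carrier (list_rels K M n E)"
  shows "\<exists>L. set L \<subseteq> tuples M n \<and> q = lsum (list_rels K M n E) L (gen K (list_rels K M n E))"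
proof -
  interpret M: module K M by fact
  have R: "multilinear_rels K M n \<union> E \<subseteq> carrier (free_module K (tuples M n))"
    using multilinear_rels_closed[OF assms(1)] assms(2) by auto
  note m = list_gen_mlin[OF assms(1,2)]
  obtain n' where n: "n = Suc n'" using assms(3) by (cases n) auto
  show ?thesis
  proof (rule presented_rep[OF M.R.is_cring R _ assms(4)])
    fix c p assume c: "c \<in> carrier K" and p: "p \<in> tuples M n"
    then obtain x xs where p: "p = x # xs" "x \<in> carrier M" "xs \<in> tuples M n'" by (auto simp: n tuples_Suc)
    have "(\<lambda>x. gen K (list_rels K M n E) (x # xs)) \<in> lin_hom K M (list_rels K M n E)"
      using mlin_slot[OF m, of "[]" x xs] p by (simp add: n)
    from lin_hom_smult[OF this c p(2)]
    show "\<exists>p'\<in>tuples M n. c \<odot>\<^bsub>list_rels K M n E\<^esub> gen K (list_rels K M n E) p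
        = gen K (list_rels K M n E) p'"
      using p c by (intro bexI[of _ "(c \<odot>\<^bsub>M\<^esub> x) # xs"]) (auto simp: n)
  qed
qed

lemma list_lift:
  assumes "module K M" "E \<subseteq> carrier (free_module K (tuples M n))"
    "module K W" "mlin K M W n F" "\<And>r. r \<in> E \<Longrightarrow> lin_ext K W F r = \<zero>\<^bsub>W\<^esub>"
  shows "gen_lift K W F \<in> lin_hom K (list_rels K M n E) W"
    and "xs \<in> tuples M n \<Longrightarrow> gen_lift K W F (gen K (list_rels K M n E) xs) = F xs"
proof -
  interpret M: module K M by fact
  interpret W: module K W by fact
  have R: "multilinear_rels K M n \<union> E \<subseteq> carrier (free_module K (tuples M n))"
    using multilinear_rels_closed[OF assms(1)] assms(2) by auto
  have f: "F p \<in> carrier W" if "p \<in> tuples M n" for p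
    using mlin_closed[OF assms(4) that] .
  note a = lin_ext_add[OF assms(3) f] and s = lin_ext_smult[OF assms(3) f]
  note z = module_diff_zero[OF assms(3)]
  note ms = mlin_slot[OF assms(4)]
  have "lin_ext K W F r = \<zero>\<^bsub>W\<^esub>" if "r \<in> multilinear_rels K M n" for r
    using that
  proof (cases rule: multilinear_relsE)
    case (add xs x x' ys)
    have t: "xs @ [z] @ ys \<in> tuples M n" if "z \<in> carrier M" for z
      using tuples_slot[OF add(2) that] .
    have x: "x \<in> carrier M" using tuples_slotD[OF add(2)] .
    have fs: "F (xs @ [z] @ ys) \<in> carrier W" if "z \<in> carrier M" for z
      using f[OF t[OF that]] .
    have "lin_ext K W F r = F (xs @ [x \<oplus>\<^bsub>M\<^esub> x'] @ ys) \<ominus>\<^bsub>W\<^esub> (F (xs @ [x] @ ys) \<oplus>\<^bsub>W\<^esub> F (xs @ [x'] @ ys))"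
      unfolding add(1) by (rule a) (intro t M.a_closed x add(3) | assumption)+
    then show ?thesis
      unfolding lin_hom_add[OF ms[OF add(2)] x add(3)]
      using fs[OF x] fs[OF add(3)] by (simp add: z)
  next
    case (smult xs c x ys)
    have t: "xs @ [z] @ ys \<in> tuples M n" if "z \<in> carrier M" for z
      using tuples_slot[OF smult(3) that] .
    have x: "x \<in> carrier M" using tuples_slotD[OF smult(3)] .
    have fs: "F (xs @ [z] @ ys) \<in> carrier W" if "z \<in> carrier M" for z
      using f[OF t[OF that]] .
    have "lin_ext K W F r = F (xs @ [c \<odot>\<^bsub>M\<^esub> x] @ ys) \<ominus>\<^bsub>W\<^esub> (c \<odot>\<^bsub>W\<^esub> F (xs @ [x] @ ys))"
      unfolding smult(1) by (rule s) (intro t M.smult_closed x smult(2) | assumption)+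
    then show ?thesis
      unfolding lin_hom_smult[OF ms[OF smult(3)] smult(2) x]
      using fs[OF x] smult(2) by (simp add: z)
  qed
  then have k: "lin_ext K W F r = \<zero>\<^bsub>W\<^esub>" if "r \<in> multilinear_rels K M n \<union> E" for r
    using that assms(5) by auto
  show "gen_lift K W F \<in> lin_hom K (list_rels K M n E) W"
    by (rule presented_lift_lin[OF assms(3) R]) (erule f k)+
  show "gen_lift K W F (gen K (list_rels K M n E) xs) = F xs" if "xs \<in> tuples M n"
    by (rule presented_lift_gen[OF assms(3) R]) (erule f k | rule that)+
qed

lemma list_rels_module:
  assumes "module K M" "E \<subseteq> carrier (free_module K (tuples M n))"
  shows "module K (list_rels K M n E)"
  using assms(2) multilinear_rels_closed[OF assms(1)] module.axioms(1)[OF assms(1)]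
  by (intro presented_module) auto

lemma pair_rels_module:
  assumes "module K M" "module K N" "E \<subseteq> carrier (free_module K (carrier M \<times> carrier N))"
  shows "module K (pair_rels K M N E)"
  using assms(3) bilinear_rels_closed[OF assms(1,2)] module.axioms(1)[OF assms(1)]
  by (intro presented_module) auto

text \<open>\<open>tensor\<close> and \<open>tensor_power\<close> differ from these only in their multiplicative fields.\<close>

lemma tensor_fields [simp]:
  "carrier (tensor K M N) = carrier (pair_rels K M N {})"
  "add (tensor K M N) = add (pair_rels K M N {})"
  "zero (tensor K M N) = zero (pair_rels K M N {})"
  "smult (tensor K M N) = smult (pair_rels K M N {})"
  "gen K (tensor K M N) = gen K (pair_rels K M N {})"
  by (auto simp: tensor_def Let_def gen_def)

lemma tensor_power_fields [simp]:
  "carrier (tensor_power K M n) = carrier (list_rels K M n {})"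
  "add (tensor_power K M n) = add (list_rels K M n {})"
  "zero (tensor_power K M n) = zero (list_rels K M n {})"
  "smult (tensor_power K M n) = smult (list_rels K M n {})"
  "gen K (tensor_power K M n) = gen K (list_rels K M n {})"
  by (auto simp: tensor_power_def Let_def gen_def)

lemma bilin_record_cong:
  assumes "carrier W' = carrier W" "add W' = add W" "smult W' = smult W"
  shows "bilin K M N W' F = bilin K M N W F"
  using assms by (simp add: bilin_def lin_hom_def)

lemma mlin_record_cong:
  assumes "carrier W' = carrier W" "add W' = add W" "smult W' = smult W"
  shows "mlin K M W' n f = mlin K M W n f"
  using assms by (induction n arbitrary: f) (simp_all add: lin_hom_def)

lemma gen_lift_record_cong:
  fixes W W' :: "('k,'w,'u) module_scheme"
  assumes "carrier W' = carrier W" "add W' = add W" "zero W' = zero W" "smult W' = smult W"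
  shows "gen_lift K W' f = gen_lift K W f"
  using assms by (simp add: gen_lift_def lin_ext_def[abs_def] finsum_def)

lemma tensor_facts:
  assumes "module K M" "module K N"
  shows tensor_module: "module K (tensor K M N)"
    and tensor_gen_bilin: "bilin K M N (tensor K M N) (\<lambda>x y. gen K (tensor K M N) (x, y))"
    and tensor_rep: "q \<in> carrier (tensor K M N) \<Longrightarrow> \<exists>L. set L \<subseteq> carrier M \<times> carrier N \<and>
          q = lsum (tensor K M N) L (\<lambda>p. gen K (tensor K M N) (fst p, snd p))"
    and tensor_lift_lin: "module K W \<Longrightarrow> bilin K M N W F \<Longrightarrow>
          gen_lift K W (\<lambda>(x, y). F x y) \<in> lin_hom K (tensor K M N) W"
    and tensor_lift_gen: "module K W \<Longrightarrow> bilin K M N W F \<Longrightarrow> x \<in> carrier M \<Longrightarrow> y \<in> carrier N \<Longrightarrow>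
          gen_lift K W (\<lambda>(x, y). F x y) (gen K (tensor K M N) (x, y)) = F x y"
proof -
  let ?T = "tensor K M N"
  show "module K ?T"
    by (rule module_record_cong[OF pair_rels_module[OF assms, of "{}"]]) simp_all
  show "bilin K M N ?T (\<lambda>x y. gen K ?T (x, y))"
    using pair_gen_bilin[OF assms, of "{}"]
    by (simp add: bilin_record_cong[of "tensor K M N" "pair_rels K M N {}"])
  show "\<exists>L. set L \<subseteq> carrier M \<times> carrier N \<and>
      q = lsum ?T L (\<lambda>p. gen K ?T (fst p, snd p))"
    if "q \<in> carrier ?T"
    using pair_rep[OF assms, of "{}" q] that
    by (simp add: lsum_record_cong[of "tensor K M N" "pair_rels K M N {}"])
  have l: "lin_hom K ?T W = lin_hom K (pair_rels K M N {}) W"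
    by (rule lin_hom_record_cong) simp_all
  show "gen_lift K W (\<lambda>(x, y). F x y) \<in> lin_hom K ?T W"
    if "module K W" "bilin K M N W F"
    unfolding l by (rule pair_lift(1)[OF assms]) (use that in auto)
  show "gen_lift K W (\<lambda>(x, y). F x y) (gen K ?T (x, y)) = F x y"
    if "module K W" "bilin K M N W F" "x \<in> carrier M" "y \<in> carrier N"
    unfolding tensor_fields by (rule pair_lift(2)[OF assms]) (use that in auto)
qed

lemma tensor_power_facts:
  assumes "module K M"
  shows tensor_power_module: "module K (tensor_power K M n)"
    and tensor_power_gen_mlin: "mlin K M (tensor_power K M n) n (gen K (tensor_power K M n))"
    and tensor_power_rep: "0 < n \<Longrightarrow> q \<in> carrier (tensor_power K M n) \<Longrightarrow>
          \<exists>L. set L \<subseteq> tuples M n \<and> q = lsum (tensor_power K M n) L (gen K (tensor_power K M n))"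
    and tensor_power_lift_lin: "module K W \<Longrightarrow> mlin K M W n F \<Longrightarrow>
          gen_lift K W F \<in> lin_hom K (tensor_power K M n) W"
    and tensor_power_lift_gen: "module K W \<Longrightarrow> mlin K M W n F \<Longrightarrow> xs \<in> tuples M n \<Longrightarrow>
          gen_lift K W F (gen K (tensor_power K M n) xs) = F xs"
proof -
  let ?T = "tensor_power K M n"
  show "module K ?T"
    by (rule module_record_cong[OF list_rels_module[OF assms, of "{}" n]]) simp_all
  show "mlin K M ?T n (gen K ?T)"
    using list_gen_mlin[OF assms, of "{}"]
    by (simp add: mlin_record_cong[of "tensor_power K M n" "list_rels K M n {}"])
  show "\<exists>L. set L \<subseteq> tuples M n \<and> q = lsum ?T L (gen K ?T)"
    if "0 < n" "q \<in> carrier ?T"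
    using list_rep[OF assms, of "{}" n q] that
    by (simp add: lsum_record_cong[of "tensor_power K M n" "list_rels K M n {}"])
  have l: "lin_hom K ?T W = lin_hom K (list_rels K M n {}) W"
    by (rule lin_hom_record_cong) simp_all
  show "gen_lift K W F \<in> lin_hom K ?T W"
    if "module K W" "mlin K M W n F"
    unfolding l by (rule list_lift(1)[OF assms]) (use that in auto)
  show "gen_lift K W F (gen K ?T xs) = F xs"
    if "module K W" "mlin K M W n F" "xs \<in> tuples M n"
    unfolding tensor_power_fields by (rule list_lift(2)[OF assms]) (use that in auto)
qed

lemma tensor_lift_sum:
  assumes "module K M" "module K N" "module K W" "bilin K M N W F" "set L \<subseteq> carrier M \<times> carrier N"
  shows "gen_lift K W (\<lambda>(x, y). F x y) (lsum (tensor K M N) L (\<lambda>p. gen K (tensor K M N) (fst p, snd p)))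
    = lsum W L (\<lambda>p. F (fst p) (snd p))"
proof -
  have "gen_lift K W (\<lambda>(x, y). F x y) (lsum (tensor K M N) L (\<lambda>p. gen K (tensor K M N) (fst p, snd p)))
    = lsum W L (\<lambda>p. gen_lift K W (\<lambda>(x, y). F x y) (gen K (tensor K M N) (fst p, snd p)))"
    by (rule lin_hom_lsum[OF tensor_module[OF assms(1,2)] assms(3) tensor_lift_lin[OF assms(1-4)]])
      (use assms(5) bilinD(3)[OF tensor_gen_bilin[OF assms(1,2)]] in auto)
  also have "\<dots> = lsum W L (\<lambda>p. F (fst p) (snd p))"
    by (rule lsum_cong, rule tensor_lift_gen[OF assms(1-4)]) (use assms(5) in auto)
  finally show ?thesis .
qed

lemma tensor_power_lift_sum:
  assumes "module K M" "module K W" "mlin K M W n F" "set L \<subseteq> tuples M n"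
  shows "gen_lift K W F (lsum (tensor_power K M n) L (gen K (tensor_power K M n))) = lsum W L F"
proof -
  have "gen_lift K W F (lsum (tensor_power K M n) L (gen K (tensor_power K M n)))
    = lsum W L (\<lambda>p. gen_lift K W F (gen K (tensor_power K M n) p))"
    by (rule lin_hom_lsum[OF tensor_power_module[OF assms(1)] assms(2) tensor_power_lift_lin[OF assms(1-3)]])
      (use assms(4) mlin_closed[OF tensor_power_gen_mlin[OF assms(1)]] in blast)
  also have "\<dots> = lsum W L F"
    by (rule lsum_cong, rule tensor_power_lift_gen[OF assms(1-3)]) (use assms(4) in auto)
  finally show ?thesis .
qed

context k_algebra begin

abbreviation times_A (infixl "\<cdot>" 70) where "x \<cdot> y \<equiv> x \<otimes>\<^bsub>A\<^esub> y"
abbreviation one_A ("1\<^sub>A") where "1\<^sub>A \<equiv> \<one>\<^bsub>A\<^esub>"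

lemma mult_lin:
  shows mult_lin_left: "y \<in> carrier A \<Longrightarrow> (\<lambda>x. x \<cdot> y) \<in> lin_hom K A A"
    and mult_lin_right: "x \<in> carrier A \<Longrightarrow> (\<lambda>y. x \<cdot> y) \<in> lin_hom K A A"
proof -
  interpret A: ring A by (rule ring)
  show "y \<in> carrier A \<Longrightarrow> (\<lambda>x. x \<cdot> y) \<in> lin_hom K A A"
    by (rule lin_homI) (simp_all add: A.l_distr smult_mult_left)
  show "x \<in> carrier A \<Longrightarrow> (\<lambda>y. x \<cdot> y) \<in> lin_hom K A A"
    by (rule lin_homI) (simp_all add: A.r_distr smult_mult_right)
qed

lemma tuples_map2: "xs \<in> tuples A n \<Longrightarrow> ys \<in> tuples A n \<Longrightarrow> map2 (mult A) xs ys \<in> tuples A n"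
proof (induction n arbitrary: xs ys)
  case (Suc n)
  interpret A: ring A by (rule ring)
  show ?case using Suc by (auto simp: tuples_Suc)
qed simp

lemma mlin_map2:
  assumes "mlin K A W n F"
  shows mlin_map2_left: "ys \<in> tuples A n \<Longrightarrow> mlin K A W n (\<lambda>xs. F (map2 (mult A) xs ys))"
    and mlin_map2_right: "xs \<in> tuples A n \<Longrightarrow> mlin K A W n (\<lambda>ys. F (map2 (mult A) xs ys))"
proof -
  interpret A: ring A by (rule ring)
  show "mlin K A W n (\<lambda>xs. F (map2 (mult A) xs ys))" if "ys \<in> tuples A n"
    using assms that
  proof (induction n arbitrary: F ys)
    case (Suc n)
    then obtain z zs where y: "ys = z # zs" "z \<in> carrier A" "zs \<in> tuples A n" by (auto simp: tuples_Suc)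
    have "mlin K A W n (\<lambda>xs. F (x \<cdot> z # map2 (mult A) xs zs))" if "x \<in> carrier A" for x
      by (rule Suc.IH) (use Suc.prems that y in auto)
    moreover have "(\<lambda>x. F (x \<cdot> z # map2 (mult A) xs zs)) \<in> lin_hom K A W" if "xs \<in> tuples A n" for xs
      by (rule lin_hom_comp[OF mult_lin_left[OF y(2)]]) (use Suc.prems that y tuples_map2 in auto)
    ultimately show ?case by (simp add: y)
  qed simp
  show "mlin K A W n (\<lambda>ys. F (map2 (mult A) xs ys))" if "xs \<in> tuples A n"
    using assms that
  proof (induction n arbitrary: F xs)
    case (Suc n)
    then obtain z zs where y: "xs = z # zs" "z \<in> carrier A" "zs \<in> tuples A n" by (auto simp: tuples_Suc)
    have "mlin K A W n (\<lambda>xs. F (z \<cdot> x # map2 (mult A) zs xs))" if "x \<in> carrier A" for x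
      by (rule Suc.IH) (use Suc.prems that y in auto)
    moreover have "(\<lambda>x. F (z \<cdot> x # map2 (mult A) zs xs)) \<in> lin_hom K A W" if "xs \<in> tuples A n" for xs
      by (rule lin_hom_comp[OF mult_lin_right[OF y(2)]]) (use Suc.prems that y tuples_map2 in auto)
    ultimately show ?case by (simp add: y)
  qed simp
qed

end

text \<open>Sums over lists multiply termwise, by the very definition of the two products.\<close>

lemma tensor_mult_sum:
  assumes "k_algebra K M" "k_algebra K N" "set L \<subseteq> carrier M \<times> carrier N" "set L' \<subseteq> carrier M \<times> carrier N"
  defines "T \<equiv> tensor K M N"
  shows "lsum T L (\<lambda>p. gen K T (fst p, snd p)) \<otimes>\<^bsub>T\<^esub> lsum T L' (\<lambda>q. gen K T (fst q, snd q))
    = lsum T L (\<lambda>p. lsum T L' (\<lambda>q. gen K T (fst p \<otimes>\<^bsub>M\<^esub> fst q, snd p \<otimes>\<^bsub>N\<^esub> snd q)))"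
proof -
  interpret M: k_algebra K M by fact
  interpret N: k_algebra K N by fact
  interpret MR: ring M by (rule M.ring)
  interpret NR: ring N by (rule N.ring)
  note mod = M.module N.module
  note g = tensor_gen_bilin[OF mod, folded T_def]
  note T = tensor_module[OF mod, folded T_def]
  interpret T: module K T by (rule T)
  let ?P = "pair_rels K M N {}"
  have lE: "gen_lift K ?P = gen_lift K T"
    by (intro ext gen_lift_record_cong) (simp_all add: T_def)
  have gE: "gen K ?P = gen K T" by (simp add: T_def)
  have "x \<otimes>\<^bsub>T\<^esub> y = gen_lift K T (\<lambda>(x, y'). gen_lift K T
      (\<lambda>(x', y''). gen K T (x \<otimes>\<^bsub>M\<^esub> x', y' \<otimes>\<^bsub>N\<^esub> y'')) y) x" for x y
    unfolding lE[symmetric] gE[symmetric] by (simp add: T_def tensor_def Let_def)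
  moreover have b: "bilin K M N T (\<lambda>x' y'. gen K T (x \<otimes>\<^bsub>M\<^esub> x', y \<otimes>\<^bsub>N\<^esub> y'))"
    if "x \<in> carrier M" "y \<in> carrier N" for x y
    using that by (intro bilinI lin_hom_comp[OF M.mult_lin_right bilinD(2)[OF g]]
        lin_hom_comp[OF N.mult_lin_right bilinD(1)[OF g]]) auto
  moreover have b': "bilin K M N T (\<lambda>x y. gen K T (x \<otimes>\<^bsub>M\<^esub> x', y \<otimes>\<^bsub>N\<^esub> y'))"
    if "x' \<in> carrier M" "y' \<in> carrier N" for x' y'
    using that by (intro bilinI lin_hom_comp[OF M.mult_lin_left bilinD(2)[OF g]]
        lin_hom_comp[OF N.mult_lin_left bilinD(1)[OF g]]) auto
  let ?Y = "lsum T L' (\<lambda>q. gen K T (fst q, snd q))"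
  have 1: "gen_lift K T (\<lambda>(x', y'). gen K T (x \<otimes>\<^bsub>M\<^esub> x', y \<otimes>\<^bsub>N\<^esub> y')) ?Y
     = lsum T L' (\<lambda>q. gen K T (x \<otimes>\<^bsub>M\<^esub> fst q, y \<otimes>\<^bsub>N\<^esub> snd q))"
    if "x \<in> carrier M" "y \<in> carrier N" for x y
    using tensor_lift_sum[OF mod T b[OF that] assms(4), folded T_def] .
  have 2: "bilin K M N T (\<lambda>x y. gen_lift K T (\<lambda>(x', y'). gen K T (x \<otimes>\<^bsub>M\<^esub> x', y \<otimes>\<^bsub>N\<^esub> y')) ?Y)"
  proof (rule bilinI)
    fix x assume x: "x \<in> carrier M"
    have "(\<lambda>y. lsum T L' (\<lambda>q. gen K T (x \<otimes>\<^bsub>M\<^esub> fst q, y \<otimes>\<^bsub>N\<^esub> snd q))) \<in> lin_hom K N T"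
      by (rule T.lin_lsum, rule bilinD(1)[OF b']) (use assms(4) x in auto)
    then show "(\<lambda>y. gen_lift K T (\<lambda>(x', y'). gen K T (x \<otimes>\<^bsub>M\<^esub> x', y \<otimes>\<^bsub>N\<^esub> y')) ?Y) \<in> lin_hom K N T"
      by (rule lin_hom_cong[OF mod(2)]) (simp only: 1[OF x])
  next
    fix y assume y: "y \<in> carrier N"
    have "(\<lambda>x. lsum T L' (\<lambda>q. gen K T (x \<otimes>\<^bsub>M\<^esub> fst q, y \<otimes>\<^bsub>N\<^esub> snd q))) \<in> lin_hom K M T"
      by (rule T.lin_lsum, rule bilinD(2)[OF b']) (use assms(4) y in auto)
    then show "(\<lambda>x. gen_lift K T (\<lambda>(x', y'). gen K T (x \<otimes>\<^bsub>M\<^esub> x', y \<otimes>\<^bsub>N\<^esub> y')) ?Y) \<in> lin_hom K M T"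
      by (rule lin_hom_cong[OF mod(1)]) (simp only: 1[OF _ y])
  qed
  have "lsum T L (\<lambda>p. gen_lift K T (\<lambda>(x', y'). gen K T (fst p \<otimes>\<^bsub>M\<^esub> x', snd p \<otimes>\<^bsub>N\<^esub> y')) ?Y)
     = lsum T L (\<lambda>p. lsum T L' (\<lambda>q. gen K T (fst p \<otimes>\<^bsub>M\<^esub> fst q, snd p \<otimes>\<^bsub>N\<^esub> snd q)))"
    by (rule lsum_cong, rule 1) (use assms(3) in auto)
  with calculation(1) tensor_lift_sum[OF mod T 2 assms(3), folded T_def] show ?thesis by simp
qed

lemma tensor_power_mult_sum:
  assumes "k_algebra K M" "set L \<subseteq> tuples M n" "set L' \<subseteq> tuples M n"
  defines "T \<equiv> tensor_power K M n"
  shows "lsum T L (gen K T) \<otimes>\<^bsub>T\<^esub> lsum T L' (gen K T)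
    = lsum T L (\<lambda>xs. lsum T L' (\<lambda>ys. gen K T (map2 (mult M) xs ys)))"
proof -
  interpret M: k_algebra K M by fact
  note mod = M.module
  note g = tensor_power_gen_mlin[OF mod, of n, folded T_def]
  note T = tensor_power_module[OF mod, of n, folded T_def]
  let ?P = "list_rels K M n {}"
  have lE: "gen_lift K ?P = gen_lift K T"
    by (intro ext gen_lift_record_cong) (simp_all add: T_def)
  have gE: "gen K ?P = gen K T" by (simp add: T_def)
  have "x \<otimes>\<^bsub>T\<^esub> y = gen_lift K T (\<lambda>xs. gen_lift K T (\<lambda>ys. gen K T (map2 (mult M) xs ys)) y) x" for x y
    unfolding lE[symmetric] gE[symmetric] by (simp add: T_def tensor_power_def Let_def)
  moreover
  let ?Y = "lsum T L' (gen K T)"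
  have 1: "gen_lift K T (\<lambda>ys. gen K T (map2 (mult M) xs ys)) ?Y = lsum T L' (\<lambda>ys. gen K T (map2 (mult M) xs ys))"
    if "xs \<in> tuples M n" for xs
    using tensor_power_lift_sum[OF mod T M.mlin_map2_right[OF g that] assms(3), folded T_def] .
  have 2: "mlin K M T n (\<lambda>xs. gen_lift K T (\<lambda>ys. gen K T (map2 (mult M) xs ys)) ?Y)"
  proof (rule mlin_cong[OF mod])
    show "mlin K M T n (\<lambda>xs. lsum T L' (\<lambda>ys. gen K T (map2 (mult M) xs ys)))"
      by (rule mlin_lsum[OF T], rule M.mlin_map2_left[OF g]) (use assms(3) in auto)
  qed (simp add: 1)
  have "lsum T L (\<lambda>xs. gen_lift K T (\<lambda>ys. gen K T (map2 (mult M) xs ys)) ?Y)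
     = lsum T L (\<lambda>xs. lsum T L' (\<lambda>ys. gen K T (map2 (mult M) xs ys)))"
    by (rule lsum_cong, rule 1) (use assms(2) in auto)
  with calculation tensor_power_lift_sum[OF mod T 2 assms(2), folded T_def] show ?thesis by simp
qed

lemma bimod_quot_facts:
  assumes "module K X" "\<And>x b. x \<in> carrier X \<Longrightarrow> b \<in> B \<Longrightarrow> ra x b \<in> carrier X"
    "\<And>x b. x \<in> carrier X \<Longrightarrow> b \<in> B \<Longrightarrow> la b x \<in> carrier X"
  defines "Q \<equiv> bimod_quot K X B la ra"
  shows bimod_quot_module: "module K Q"
    and bimod_quot_map_lin: "(\<lambda>x. \<zero>\<^bsub>Q\<^esub> +>\<^bsub>X\<^esub> x) \<in> lin_hom K X Q"
    and bimod_quot_map_surj: "carrier Q = (\<lambda>x. \<zero>\<^bsub>Q\<^esub> +>\<^bsub>X\<^esub> x) ` carrier X"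
    and bimod_quot_map_eq: "x \<in> carrier X \<Longrightarrow> b \<in> B \<Longrightarrow> \<zero>\<^bsub>Q\<^esub> +>\<^bsub>X\<^esub> ra x b = \<zero>\<^bsub>Q\<^esub> +>\<^bsub>X\<^esub> la b x"
    and bimod_quot_lift_lin: "module K W \<Longrightarrow> f \<in> lin_hom K X W \<Longrightarrow>
          (\<And>x b. x \<in> carrier X \<Longrightarrow> b \<in> B \<Longrightarrow> f (ra x b) = f (la b x)) \<Longrightarrow> quot_lift f \<in> lin_hom K Q W"
    and bimod_quot_lift_eq: "module K W \<Longrightarrow> f \<in> lin_hom K X W \<Longrightarrow>
          (\<And>x b. x \<in> carrier X \<Longrightarrow> b \<in> B \<Longrightarrow> f (ra x b) = f (la b x)) \<Longrightarrow> x \<in> carrier X \<Longrightarrow>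
          quot_lift f (\<zero>\<^bsub>Q\<^esub> +>\<^bsub>X\<^esub> x) = f x"
proof -
  interpret X: module K X by fact
  let ?S = "{ra x b \<ominus>\<^bsub>X\<^esub> la b x | x b. x \<in> carrier X \<and> b \<in> B}"
  have S: "?S \<subseteq> carrier X" using assms(2,3) by auto
  let ?N = "lin_span K X ?S"
  note N = submodule_lin_span[OF assms(1) S]
  have Q: "Q = quot_module X ?N" by (simp add: Q_def bimod_quot_def)
  have z: "\<zero>\<^bsub>Q\<^esub> = ?N" by (simp add: Q quot_module_def)
  show mQ: "module K Q" unfolding Q by (rule quot_module_module[OF assms(1) N])
  show l: "(\<lambda>x. \<zero>\<^bsub>Q\<^esub> +>\<^bsub>X\<^esub> x) \<in> lin_hom K X Q" unfolding z unfolding Q by (rule quot_map_lin[OF assms(1) N])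
  show "carrier Q = (\<lambda>x. \<zero>\<^bsub>Q\<^esub> +>\<^bsub>X\<^esub> x) ` carrier X"
    unfolding z unfolding Q by (rule quot_map_surj[OF assms(1) N])
  show "\<zero>\<^bsub>Q\<^esub> +>\<^bsub>X\<^esub> ra x b = \<zero>\<^bsub>Q\<^esub> +>\<^bsub>X\<^esub> la b x" if "x \<in> carrier X" "b \<in> B"
  proof -
    have "ra x b \<ominus>\<^bsub>X\<^esub> la b x \<in> ?N" using lin_span_superset that by fast
    from quot_map_zero[OF assms(1) N this]
    have "\<zero>\<^bsub>Q\<^esub> +>\<^bsub>X\<^esub> (ra x b \<ominus>\<^bsub>X\<^esub> la b x) = \<zero>\<^bsub>Q\<^esub>" using z by (simp add: Q)
    then show ?thesis
      using lin_hom_minus[OF assms(1) mQ l assms(2,3)[OF that]]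
        module_diff_zero[OF mQ lin_hom_closed[OF l assms(2)[OF that]] lin_hom_closed[OF l assms(3)[OF that]]]
      by simp
  qed
  have k: "f n = \<zero>\<^bsub>W\<^esub>" if "module K W" "f \<in> lin_hom K X W"
    "\<And>x b. x \<in> carrier X \<Longrightarrow> b \<in> B \<Longrightarrow> f (ra x b) = f (la b x)" "n \<in> ?N" for f n
  proof (rule lin_span_kernel[OF assms(1) that(1,2) S _ that(4)])
    fix s assume "s \<in> ?S"
    then obtain x b where s: "s = ra x b \<ominus>\<^bsub>X\<^esub> la b x" "x \<in> carrier X" "b \<in> B" by blast
    then show "f s = \<zero>\<^bsub>W\<^esub>"
      using lin_hom_minus[OF assms(1) that(1,2) assms(2,3)[OF s(2,3)]] that(3)[OF s(2,3)]
        module_diff_zero[OF that(1)] lin_hom_closed[OF that(2) assms(3)[OF s(2,3)]] by simp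
  qed
  show "quot_lift f \<in> lin_hom K Q W" if "module K W" "f \<in> lin_hom K X W"
    "\<And>x b. x \<in> carrier X \<Longrightarrow> b \<in> B \<Longrightarrow> f (ra x b) = f (la b x)"
    unfolding Q by (rule quot_lift_lin[OF assms(1) N that(1,2)]) (rule k[OF that])
  show "quot_lift f (\<zero>\<^bsub>Q\<^esub> +>\<^bsub>X\<^esub> x) = f x" if "module K W" "f \<in> lin_hom K X W"
    "\<And>x b. x \<in> carrier X \<Longrightarrow> b \<in> B \<Longrightarrow> f (ra x b) = f (la b x)" "x \<in> carrier X"
    unfolding z by (rule quot_lift_eq[OF assms(1) N that(1,2) _ that(4)]) (rule k[OF that(1-3)])
qed

declare tensor_fields [simp del] tensor_power_fields [simp del]

section \<open>Sweedler sums in a Hopf algebra\<close>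

definition trilin ::
  "('k,'r) ring_scheme \<Rightarrow> ('k,'m,'s) module_scheme \<Rightarrow> ('k,'n,'t) module_scheme \<Rightarrow>
   ('k,'p,'v) module_scheme \<Rightarrow> ('k,'w,'u) module_scheme \<Rightarrow> ('m \<Rightarrow> 'n \<Rightarrow> 'p \<Rightarrow> 'w) \<Rightarrow> bool"
  where "trilin K M N P W F \<longleftrightarrow> (\<forall>x\<in>carrier M. bilin K N P W (F x)) \<and>
    (\<forall>y\<in>carrier N. \<forall>z\<in>carrier P. (\<lambda>x. F x y z) \<in> lin_hom K M W)"

lemma trilinI:
  "(\<And>y z. y \<in> carrier N \<Longrightarrow> z \<in> carrier P \<Longrightarrow> (\<lambda>x. F x y z) \<in> lin_hom K M W) \<Longrightarrow>
   (\<And>x z. x \<in> carrier M \<Longrightarrow> z \<in> carrier P \<Longrightarrow> (\<lambda>y. F x y z) \<in> lin_hom K N W) \<Longrightarrow>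
   (\<And>x y. x \<in> carrier M \<Longrightarrow> y \<in> carrier N \<Longrightarrow> (\<lambda>z. F x y z) \<in> lin_hom K P W) \<Longrightarrow>
   trilin K M N P W F"
  by (auto simp: trilin_def bilin_def)

lemma trilinD:
  assumes "trilin K M N P W F"
  shows "y \<in> carrier N \<Longrightarrow> z \<in> carrier P \<Longrightarrow> (\<lambda>x. F x y z) \<in> lin_hom K M W"
    and "x \<in> carrier M \<Longrightarrow> z \<in> carrier P \<Longrightarrow> (\<lambda>y. F x y z) \<in> lin_hom K N W"
    and "x \<in> carrier M \<Longrightarrow> y \<in> carrier N \<Longrightarrow> (\<lambda>z. F x y z) \<in> lin_hom K P W"
    and "x \<in> carrier M \<Longrightarrow> y \<in> carrier N \<Longrightarrow> z \<in> carrier P \<Longrightarrow> F x y z \<in> carrier W"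
  using assms bilinD[of K N P W "F x"] unfolding trilin_def by blast+

lemma mlin_snoc: "mlin K M W (Suc n) F \<Longrightarrow> z \<in> carrier M \<Longrightarrow> mlin K M W n (\<lambda>xs. F (xs @ [z]))"
proof (induction n arbitrary: F)
  case 0
  then show ?case using mlin_closed[OF 0(1), of "[z]"] by simp
next
  case (Suc n)
  have "mlin K M W n (\<lambda>xs. F (x # xs @ [z]))" if "x \<in> carrier M" for x
    by (rule Suc.IH[of "\<lambda>xs. F (x # xs)"]) (use Suc.prems that in auto)
  moreover have "(\<lambda>x. F (x # xs @ [z])) \<in> lin_hom K M W" if "xs \<in> tuples M n" for xs
    using mlin_slot[OF Suc.prems(1), of "[]" z "xs @ [z]"] that Suc.prems(2) by (simp add: tuples_def)
  ultimately show ?case by simp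
qed

lemma mlin_snoc_lin: "mlin K M W (Suc n) F \<Longrightarrow> xs \<in> tuples M n \<Longrightarrow> (\<lambda>z. F (xs @ [z])) \<in> lin_hom K M W"
proof (induction n arbitrary: F xs)
  case (Suc n)
  then obtain y ys where xs: "xs = y # ys" "y \<in> carrier M" "ys \<in> tuples M n" by (auto simp: tuples_Suc)
  show ?case using Suc.IH[of "\<lambda>xs. F (y # xs)" ys] Suc.prems xs by simp
qed simp

lemma mlin_1: "mlin K M W (Suc 0) F \<longleftrightarrow> (\<lambda>x. F [x]) \<in> lin_hom K M W"
  by (auto simp: lin_hom_def)

lemma smult_lin:
  assumes "module K W"
  shows "w \<in> carrier W \<Longrightarrow> f \<in> carrier M \<rightarrow> carrier K \<Longrightarrow>
      (\<And>x y. x \<in> carrier M \<Longrightarrow> y \<in> carrier M \<Longrightarrow> f (x \<oplus>\<^bsub>M\<^esub> y) = f x \<oplus>\<^bsub>K\<^esub> f y) \<Longrightarrow>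
      (\<And>c x. c \<in> carrier K \<Longrightarrow> x \<in> carrier M \<Longrightarrow> f (c \<odot>\<^bsub>M\<^esub> x) = c \<otimes>\<^bsub>K\<^esub> f x) \<Longrightarrow>
      (\<lambda>x. f x \<odot>\<^bsub>W\<^esub> w) \<in> lin_hom K M W"
    and smult_const_lin: "c \<in> carrier K \<Longrightarrow> g \<in> lin_hom K M W \<Longrightarrow> (\<lambda>x. c \<odot>\<^bsub>W\<^esub> g x) \<in> lin_hom K M W"
proof -
  interpret W: module K W by fact
  show "(\<lambda>x. f x \<odot>\<^bsub>W\<^esub> w) \<in> lin_hom K M W"
    if "w \<in> carrier W" "f \<in> carrier M \<rightarrow> carrier K"
      "\<And>x y. x \<in> carrier M \<Longrightarrow> y \<in> carrier M \<Longrightarrow> f (x \<oplus>\<^bsub>M\<^esub> y) = f x \<oplus>\<^bsub>K\<^esub> f y"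
      "\<And>c x. c \<in> carrier K \<Longrightarrow> x \<in> carrier M \<Longrightarrow> f (c \<odot>\<^bsub>M\<^esub> x) = c \<otimes>\<^bsub>K\<^esub> f x"
    using that by (intro lin_homI) (auto simp: W.smult_l_distr W.smult_assoc1 Pi_def)
  show "(\<lambda>x. c \<odot>\<^bsub>W\<^esub> g x) \<in> lin_hom K M W" if "c \<in> carrier K" "g \<in> lin_hom K M W"
    using that lin_hom_closed[OF that(2)]
    by (intro lin_homI) (auto simp: lin_hom_add lin_hom_smult W.smult_r_distr W.R.m_comm simp flip: W.smult_assoc1)
qed

context hopf_algebra begin

abbreviation times_H (infixl "\<star>" 70) where "x \<star> y \<equiv> x \<otimes>\<^bsub>H\<^esub> y"
abbreviation times_Hs (infixl "\<bullet>" 70) where "hs \<bullet> ks \<equiv> map2 (\<lambda>x y. x \<star> y) hs ks"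
abbreviation one_H ("1\<^sub>H") where "1\<^sub>H \<equiv> \<one>\<^bsub>H\<^esub>"

abbreviation "Tn n \<equiv> tensor_power K H n"

text \<open>Chosen summands of \<open>\<Delta>(h)\<close>, and of the iterated coproduct with \<open>n + 1\<close> factors. Splitting the last
  factor, not the first, lets \<open>dn\<close> be a recursion that puts entries in front of a list.\<close>

definition dl :: "'h \<Rightarrow> ('h \<times> 'h) list"
  where "dl h = (if h \<in> carrier H then SOME L. set L \<subseteq> carrier H \<times> carrier H \<and>
    comult H h = lsum (Tn 2) L (\<lambda>p. gen K (Tn 2) [fst p, snd p]) else [])"

primrec dn :: "nat \<Rightarrow> 'h \<Rightarrow> 'h list list" where
  "dn 0 h = [[h]]"
| "dn (Suc n) h = concat (map (\<lambda>p. map (Cons (fst p)) (dn n (snd p))) (dl h))"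

lemma dl_spec:
  assumes "h \<in> carrier H"
  shows "set (dl h) \<subseteq> carrier H \<times> carrier H"
    and "comult H h = lsum (Tn 2) (dl h) (\<lambda>p. gen K (Tn 2) [fst p, snd p])"
proof -
  have "comult H h \<in> carrier (Tn 2)" using lin_hom_closed[OF comult_linear assms] .
  then obtain L where L: "set L \<subseteq> tuples H 2" "comult H h = lsum (Tn 2) L (gen K (Tn 2))"
    using tensor_power_rep[OF module, of 2 "comult H h"] by auto
  let ?L = "map (\<lambda>xs. (xs ! 0, xs ! 1)) L"
  have l: "xs = [xs ! 0, xs ! 1]" "xs ! 0 \<in> carrier H" "xs ! 1 \<in> carrier H" if "xs \<in> set L" for xs
    using that L(1) by (auto simp: tuples_Suc numeral_2_eq_2 subset_iff)
  have "comult H h = lsum (Tn 2) ?L (\<lambda>p. gen K (Tn 2) [fst p, snd p])"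
    unfolding L(2) lsum_map fst_conv snd_conv by (rule lsum_cong) (simp only: l(1)[symmetric])
  moreover have "set ?L \<subseteq> carrier H \<times> carrier H" using l(2,3) by auto
  ultimately have "\<exists>L. set L \<subseteq> carrier H \<times> carrier H \<and>
      comult H h = lsum (Tn 2) L (\<lambda>p. gen K (Tn 2) [fst p, snd p])" by blast
  from someI_ex[OF this] show "set (dl h) \<subseteq> carrier H \<times> carrier H"
    "comult H h = lsum (Tn 2) (dl h) (\<lambda>p. gen K (Tn 2) [fst p, snd p])"
    using assms by (simp_all add: dl_def)
qed

lemma dl_set [simp]: "p \<in> set (dl h) \<Longrightarrow> fst p \<in> carrier H" "p \<in> set (dl h) \<Longrightarrow> snd p \<in> carrier H"
  using dl_spec(1)[of h] by (cases "h \<in> carrier H"; auto simp: dl_def)+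

lemma dl_set_pair: "(x, y) \<in> set (dl h) \<Longrightarrow> x \<in> carrier H \<and> y \<in> carrier H"
  using dl_set[of "(x, y)"] by simp

lemma mlin_2: "bilin K H H W F \<Longrightarrow> mlin K H W 2 (\<lambda>hs. F (hs ! 0) (hs ! 1))"
  by (auto simp: numeral_2_eq_2 tuples_Suc bilinD)

lemma gen_lift_sum2:
  assumes "module K W" "mlin K H W 2 G" "set L \<subseteq> carrier H \<times> carrier H"
  shows "gen_lift K W G (lsum (Tn 2) L (\<lambda>p. gen K (Tn 2) [fst p, snd p])) = lsum W L (\<lambda>p. G [fst p, snd p])"
proof -
  have "[fst p, snd p] \<in> tuples H 2" if "p \<in> set L" for p
    using assms(3) that by (auto simp: numeral_2_eq_2)
  then show ?thesis
    using tensor_power_lift_sum[OF module assms(1,2), of "map (\<lambda>p. [fst p, snd p]) L"]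
    by (simp add: image_subset_iff)
qed

lemma gen_lift_comult:
  assumes "module K W" "mlin K H W 2 G" "h \<in> carrier H"
  shows "gen_lift K W G (comult H h) = lsum W (dl h) (\<lambda>p. G [fst p, snd p])"
  unfolding dl_spec(2)[OF assms(3)] by (rule gen_lift_sum2[OF assms(1,2) dl_spec(1)[OF assms(3)]])

lemma dl_lin:
  assumes "module K W" "bilin K H H W F"
  shows "(\<lambda>h. lsum W (dl h) (\<lambda>p. F (fst p) (snd p))) \<in> lin_hom K H W"
proof -
  note m = mlin_2[OF assms(2)]
  have "(\<lambda>h. gen_lift K W (\<lambda>hs. F (hs ! 0) (hs ! 1)) (comult H h)) \<in> lin_hom K H W"
    by (rule lin_hom_comp[OF comult_linear tensor_power_lift_lin[OF module assms(1) m]])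
  then show ?thesis
    by (rule lin_hom_cong[OF module]) (simp add: gen_lift_comult[OF assms(1) m] del: One_nat_def)
qed

lemma H_closed [simp]:
  "1\<^sub>H \<in> carrier H" "x \<in> carrier H \<Longrightarrow> y \<in> carrier H \<Longrightarrow> x \<star> y \<in> carrier H"
  "x \<in> carrier H \<Longrightarrow> counit H x \<in> carrier K" "x \<in> carrier H \<Longrightarrow> antipode H x \<in> carrier H"
proof -
  interpret ring H by (rule ring)
  show "1\<^sub>H \<in> carrier H" "x \<in> carrier H \<Longrightarrow> y \<in> carrier H \<Longrightarrow> x \<star> y \<in> carrier H" by auto
  show "x \<in> carrier H \<Longrightarrow> counit H x \<in> carrier K" using counit_ring_hom by (auto simp: ring_hom_def)
  show "x \<in> carrier H \<Longrightarrow> antipode H x \<in> carrier H" using lin_hom_closed[OF antipode_linear] .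
qed

lemma H_monoid:
  "x \<in> carrier H \<Longrightarrow> 1\<^sub>H \<star> x = x" "x \<in> carrier H \<Longrightarrow> x \<star> 1\<^sub>H = x"
  "x \<in> carrier H \<Longrightarrow> y \<in> carrier H \<Longrightarrow> z \<in> carrier H \<Longrightarrow>
    x \<star> y \<star> z = x \<star> (y \<star> z)"
proof -
  interpret ring H by (rule ring)
  show "x \<in> carrier H \<Longrightarrow> 1\<^sub>H \<star> x = x" "x \<in> carrier H \<Longrightarrow> x \<star> 1\<^sub>H = x"
  "x \<in> carrier H \<Longrightarrow> y \<in> carrier H \<Longrightarrow> z \<in> carrier H \<Longrightarrow>
    x \<star> y \<star> z = x \<star> (y \<star> z)" by (auto simp: m_assoc)
qed

lemma counit_lin: "module K W \<Longrightarrow> w \<in> carrier W \<Longrightarrow> (\<lambda>h. counit H h \<odot>\<^bsub>W\<^esub> w) \<in> lin_hom K H W"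
  using counit_ring_hom by (intro smult_lin) (auto simp: ring_hom_def counit_smult)

lemma mlin_split:
  assumes "module K W" "mlin K H W (Suc n) G" "i < n"
  shows "mlin K H W n (\<lambda>hs. lsum W (dl (hs ! i)) (\<lambda>p. G (take i hs @ [fst p, snd p] @ drop (Suc i) hs)))"
  using assms(2,3)
proof (induction i arbitrary: n G)
  case 0
  then obtain n' where n: "n = Suc n'" by (cases n) auto
  have "mlin K H W n' (\<lambda>hs. lsum W (dl x) (\<lambda>p. G (fst p # snd p # hs)))" if "x \<in> carrier H" for x
    by (rule mlin_lsum[OF assms(1)]) (use 0 n in simp)
  moreover have "(\<lambda>x. lsum W (dl x) (\<lambda>p. G (fst p # snd p # hs))) \<in> lin_hom K H W" if "hs \<in> tuples H n'" for hs
    by (rule dl_lin[OF assms(1)], rule bilinI) (use 0 n that in auto)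
  ultimately show ?case by (simp add: n)
next
  case (Suc i)
  then obtain n' where n: "n = Suc n'" by (cases n) auto
  have "mlin K H W n' (\<lambda>hs. lsum W (dl (hs ! i)) (\<lambda>p. G (x # take i hs @ [fst p, snd p] @ drop (Suc i) hs)))"
    if "x \<in> carrier H" for x
    using Suc.IH[of n' "\<lambda>hs. G (x # hs)"] Suc.prems that by (simp add: n)
  moreover have "(\<lambda>x. lsum W (dl (hs ! i)) (\<lambda>p. G (x # take i hs @ [fst p, snd p] @ drop (Suc i) hs))) \<in> lin_hom K H W"
    if "hs \<in> tuples H n'" for hs
  proof (rule module.lin_lsum[OF assms(1)])
    fix p assume "p \<in> set (dl (hs ! i))"
    then have "take i hs @ [fst p, snd p] @ drop (Suc i) hs \<in> tuples H (Suc n')"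
      using that Suc.prems n by (auto simp: tuples_def dest: in_set_takeD in_set_dropD)
    then show "(\<lambda>x. G (x # take i hs @ [fst p, snd p] @ drop (Suc i) hs)) \<in> lin_hom K H W"
      using Suc.prems n by simp
  qed
  ultimately show ?case by (simp add: n)
qed

lemma mlin_omit:
  assumes "module K W" "mlin K H W n G" "i \<le> n"
  shows "mlin K H W (Suc n) (\<lambda>hs. counit H (hs ! i) \<odot>\<^bsub>W\<^esub> G (take i hs @ drop (Suc i) hs))"
  using assms(2,3)
proof (induction i arbitrary: n G)
  case 0
  have "mlin K H W n (\<lambda>hs. counit H x \<odot>\<^bsub>W\<^esub> G hs)" if "x \<in> carrier H" for x
    by (rule mlin_lin[OF 0(1) smult_const_lin[OF assms(1) _ lin_hom_id]]) (use that in simp)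
  moreover have "(\<lambda>x. counit H x \<odot>\<^bsub>W\<^esub> G hs) \<in> lin_hom K H W" if "hs \<in> tuples H n" for hs
    by (rule counit_lin[OF assms(1) mlin_closed[OF 0(1) that]])
  ultimately show ?case by simp
next
  case (Suc i)
  then obtain n' where n: "n = Suc n'" by (cases n) auto
  have "mlin K H W n (\<lambda>hs. counit H (hs ! i) \<odot>\<^bsub>W\<^esub> G (x # take i hs @ drop (Suc i) hs))" if "x \<in> carrier H" for x
    using Suc.IH[of n' "\<lambda>hs. G (x # hs)"] Suc.prems that by (simp add: n)
  moreover have "(\<lambda>x. counit H (hs ! i) \<odot>\<^bsub>W\<^esub> G (x # take i hs @ drop (Suc i) hs)) \<in> lin_hom K H W"
    if hs: "hs \<in> tuples H n" for hs
  proof (rule smult_const_lin[OF assms(1)])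
    show "counit H (hs ! i) \<in> carrier K"
      using that Suc.prems n by (auto simp: tuples_def subset_iff intro!: H_closed)
    have "take i hs @ drop (Suc i) hs \<in> tuples H n'"
      using that Suc.prems n by (auto simp: tuples_def dest: in_set_takeD in_set_dropD)
    then show "(\<lambda>x. G (x # take i hs @ drop (Suc i) hs)) \<in> lin_hom K H W" using Suc.prems n by simp
  qed
  ultimately show ?case by simp
qed

lemma comult_at_facts:
  assumes "i < n"
  shows comult_at_lin: "comult_at K H n i \<in> lin_hom K (Tn n) (Tn (Suc n))"
    and comult_at_gen: "hs \<in> tuples H n \<Longrightarrow> comult_at K H n i (gen K (Tn n) hs)
      = lsum (Tn (Suc n)) (dl (hs ! i)) (\<lambda>p. gen K (Tn (Suc n)) (take i hs @ [fst p, snd p] @ drop (Suc i) hs))"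
proof -
  let ?T = "Tn (Suc n)"
  note T = tensor_power_module[OF module, of "Suc n"]
  note g = tensor_power_gen_mlin[OF module, of "Suc n"]
  let ?f = "\<lambda>hs. gen_lift K ?T (\<lambda>gs. gen K ?T (take i hs @ gs @ drop (Suc i) hs)) (comult H (hs ! i))"
  let ?g = "\<lambda>hs. lsum ?T (dl (hs ! i)) (\<lambda>p. gen K ?T (take i hs @ [fst p, snd p] @ drop (Suc i) hs))"
  have fg: "?g hs = ?f hs" if hs: "hs \<in> tuples H n" for hs
  proof -
    have i: "hs ! i \<in> carrier H" using hs assms by (auto simp: tuples_def)
    have "mlin K H ?T 2 (\<lambda>gs. gen K ?T (take i hs @ gs @ drop (Suc i) hs))"
    proof (rule mlinI_slot)
      show "gen K ?T (take i hs @ xs @ drop (Suc i) hs) \<in> carrier ?T" if "xs \<in> tuples H 2" for xs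
        by (rule mlin_closed[OF g]) (use hs that assms in \<open>auto simp: tuples_def dest: in_set_takeD in_set_dropD\<close>)
      fix xs ys assume "set xs \<subseteq> carrier H" "set ys \<subseteq> carrier H" "length xs + length ys + 1 = 2"
      then have "(take i hs @ xs) @ [1\<^sub>H] @ (ys @ drop (Suc i) hs) \<in> tuples H (Suc n)"
        using hs assms by (auto simp: tuples_def dest: in_set_takeD in_set_dropD)
      from mlin_slot[OF g this]
      show "(\<lambda>x. gen K ?T (take i hs @ (xs @ [x] @ ys) @ drop (Suc i) hs)) \<in> lin_hom K H ?T"
        by simp
    qed
    from gen_lift_comult[OF T this i] show ?thesis by simp
  qed
  have m: "mlin K H ?T n ?f"
    by (rule mlin_cong[OF module mlin_split[OF T g assms]]) (rule fg)
  have eq: "comult_at K H n i = gen_lift K ?T ?f" by (simp add: comult_at_def Let_def)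
  show "comult_at K H n i \<in> lin_hom K (Tn n) ?T"
    unfolding eq by (rule tensor_power_lift_lin[OF module T m])
  show "comult_at K H n i (gen K (Tn n) hs) = ?g hs" if "hs \<in> tuples H n"
    unfolding eq fg[OF that] by (rule tensor_power_lift_gen[OF module T m that])
qed

lemma counit_at_facts:
  assumes "i \<le> n"
  shows counit_at_lin: "counit_at K H (Suc n) i \<in> lin_hom K (Tn (Suc n)) (Tn n)"
    and counit_at_gen: "hs \<in> tuples H (Suc n) \<Longrightarrow> counit_at K H (Suc n) i (gen K (Tn (Suc n)) hs)
      = counit H (hs ! i) \<odot>\<^bsub>Tn n\<^esub> gen K (Tn n) (take i hs @ drop (Suc i) hs)"
proof -
  note T = tensor_power_module[OF module, of n]
  note m = mlin_omit[OF T tensor_power_gen_mlin[OF module] assms]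
  have eq: "counit_at K H (Suc n) i = gen_lift K (Tn n)
      (\<lambda>hs. counit H (hs ! i) \<odot>\<^bsub>Tn n\<^esub> gen K (Tn n) (take i hs @ drop (Suc i) hs))"
    by (simp add: counit_at_def Let_def)
  show "counit_at K H (Suc n) i \<in> lin_hom K (Tn (Suc n)) (Tn n)"
    unfolding eq by (rule tensor_power_lift_lin[OF module T m])
  show "counit_at K H (Suc n) i (gen K (Tn (Suc n)) hs)
      = counit H (hs ! i) \<odot>\<^bsub>Tn n\<^esub> gen K (Tn n) (take i hs @ drop (Suc i) hs)" if "hs \<in> tuples H (Suc n)"
    unfolding eq by (rule tensor_power_lift_gen[OF module T m that])
qed

lemma mlin_3: "trilin K H H H W F \<Longrightarrow> mlin K H W 3 (\<lambda>hs. F (hs ! 0) (hs ! 1) (hs ! 2))"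
  by (auto simp: trilin_def bilin_def numeral_3_eq_3 numeral_2_eq_2 tuples_Suc intro: lin_hom_closed)

lemma dl_coassoc:
  assumes "module K W" "trilin K H H H W F" "h \<in> carrier H"
  shows "lsum W (dl h) (\<lambda>p. lsum W (dl (fst p)) (\<lambda>q. F (fst q) (snd q) (snd p)))
    = lsum W (dl h) (\<lambda>p. lsum W (dl (snd p)) (\<lambda>q. F (fst p) (fst q) (snd q)))"
proof -
  note T2 = tensor_power_module[OF module, of 2] and T3 = tensor_power_module[OF module, of 3]
  note m = mlin_3[OF assms(2)]
  let ?F = "gen_lift K W (\<lambda>hs. F (hs ! 0) (hs ! 1) (hs ! 2))"
  note l = tensor_power_lift_lin[OF module assms(1) m]
  note lg = tensor_power_lift_gen[OF module assms(1) m]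
  note c2 = mlin_closed[OF tensor_power_gen_mlin[OF module, of 2]]
  note c3 = mlin_closed[OF tensor_power_gen_mlin[OF module, of 3]]
  have *: "?F (comult_at K H 2 i (comult H h)) = lsum W (dl h) (\<lambda>p. lsum W (dl ([fst p, snd p] ! i))
      (\<lambda>q. (\<lambda>hs. F (hs ! 0) (hs ! 1) (hs ! 2)) (take i [fst p, snd p] @ [fst q, snd q] @ drop (Suc i) [fst p, snd p])))"
    if i: "i < 2" for i
  proof -
    have t: "[fst p, snd p] \<in> tuples H 2" if "p \<in> set (dl h)" for p
      using that by (simp add: numeral_2_eq_2)
    have t3: "take i [fst p, snd p] @ [fst q, snd q] @ drop (Suc i) [fst p, snd p] \<in> tuples H 3"
      if "p \<in> set (dl h)" "q \<in> set (dl ([fst p, snd p] ! i))" for p q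
      using that i by (auto simp: less_Suc_eq numeral_2_eq_2 numeral_3_eq_3)
    have cl: "comult_at K H 2 i \<in> lin_hom K (Tn 2) (Tn 3)"
      using comult_at_lin[OF i] by simp
    have "comult_at K H 2 i (comult H h) = lsum (Tn 3) (dl h) (\<lambda>p. comult_at K H 2 i (gen K (Tn 2) [fst p, snd p]))"
      unfolding dl_spec(2)[OF assms(3)]
      by (rule lin_hom_lsum[OF T2 T3 cl], intro c2 t)
    also have "\<dots> = lsum (Tn 3) (dl h) (\<lambda>p. lsum (Tn 3) (dl ([fst p, snd p] ! i))
        (\<lambda>q. gen K (Tn 3) (take i [fst p, snd p] @ [fst q, snd q] @ drop (Suc i) [fst p, snd p])))"
      using comult_at_gen[OF i t] by (intro lsum_cong) simp
    finally have "?F (comult_at K H 2 i (comult H h)) = lsum W (dl h) (\<lambda>p. ?F (lsum (Tn 3) (dl ([fst p, snd p] ! i))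
        (\<lambda>q. gen K (Tn 3) (take i [fst p, snd p] @ [fst q, snd q] @ drop (Suc i) [fst p, snd p]))))"
      by (simp only:) (rule lin_hom_lsum[OF T3 assms(1) l], intro module.lsum_closed[OF T3] c3 t3)
    also have "\<dots> = lsum W (dl h) (\<lambda>p. lsum W (dl ([fst p, snd p] ! i))
        (\<lambda>q. ?F (gen K (Tn 3) (take i [fst p, snd p] @ [fst q, snd q] @ drop (Suc i) [fst p, snd p]))))"
      by (rule lsum_cong, rule lin_hom_lsum[OF T3 assms(1) l], intro c3 t3)
    also have "\<dots> = lsum W (dl h) (\<lambda>p. lsum W (dl ([fst p, snd p] ! i))
      (\<lambda>q. (\<lambda>hs. F (hs ! 0) (hs ! 1) (hs ! 2)) (take i [fst p, snd p] @ [fst q, snd q] @ drop (Suc i) [fst p, snd p])))"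
      by (rule lsum_cong, rule lsum_cong, rule lg, rule t3)
    finally show ?thesis .
  qed
  from *[of 0] *[of 1] coassoc[OF assms(3)] show ?thesis by (simp add: numeral_2_eq_2)
qed

lemma dn_tuples: "h \<in> carrier H \<Longrightarrow> ds \<in> set (dn n h) \<Longrightarrow> ds \<in> tuples H (Suc n)"
  by (induction n arbitrary: h ds) (auto simp del: One_nat_def dest!: dl_set_pair)

lemma lsum_dn_Suc:
  assumes "module K W" "\<And>ds. ds \<in> tuples H (Suc (Suc n)) \<Longrightarrow> F ds \<in> carrier W" "h \<in> carrier H"
  shows "lsum W (dn (Suc n) h) F = lsum W (dl h) (\<lambda>p. lsum W (dn n (snd p)) (\<lambda>ds. F (fst p # ds)))"
proof -
  have "lsum W (dn (Suc n) h) F = lsum W (dl h) (\<lambda>p. lsum W (map (Cons (fst p)) (dn n (snd p))) F)"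
    unfolding dn.simps
  proof (rule module.lsum_concat[OF assms(1)])
    fix p ds assume p: "p \<in> set (dl h)" and "ds \<in> set (map ((#) (fst p)) (dn n (snd p)))"
    then obtain es where "ds = fst p # es" "es \<in> set (dn n (snd p))" by auto
    then show "F ds \<in> carrier W" using p dn_tuples[of "snd p" es n] by (intro assms(2)) simp
  qed
  then show ?thesis by simp
qed

lemma dn_lin:
  assumes "module K W" "mlin K H W (Suc n) F"
  shows "(\<lambda>h. lsum W (dn n h) F) \<in> lin_hom K H W"
  using assms(2)
proof (induction n arbitrary: F)
  case 0
  have "(\<lambda>x. F [x]) \<in> lin_hom K H W" using 0 by (simp add: mlin_1)
  then show ?case
    by (rule lin_hom_cong[OF module])
      (use mlin_closed[OF 0] in \<open>auto simp: module.lsum_single[OF assms(1)] abelian_monoid.r_zero[OF abelian_group.axioms(1)[OF module.axioms(2)[OF assms(1)]]]\<close>)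
next
  case (Suc n)
  have "bilin K H H W (\<lambda>x y. lsum W (dn n y) (\<lambda>ds. F (x # ds)))"
  proof (rule bilinI)
    show "(\<lambda>y. lsum W (dn n y) (\<lambda>ds. F (x # ds))) \<in> lin_hom K H W" if "x \<in> carrier H" for x
      by (rule Suc.IH) (use Suc.prems that in simp)
    show "(\<lambda>x. lsum W (dn n y) (\<lambda>ds. F (x # ds))) \<in> lin_hom K H W" if "y \<in> carrier H" for y
      by (rule module.lin_lsum[OF assms(1)]) (use Suc.prems dn_tuples[OF that] in auto)
  qed
  from dl_lin[OF assms(1) this] show ?case
    by (rule lin_hom_cong[OF module]) (simp only: lsum_dn_Suc[OF assms(1) mlin_closed[OF Suc.prems]])
qed

lemma dn_closed:
  assumes "module K W" "mlin K H W (Suc n) F" "h \<in> carrier H"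
  shows "lsum W (dn n h) F \<in> carrier W"
  using lin_hom_closed[OF dn_lin[OF assms(1,2)] assms(3)] .

lemma lsum_dn_0: "module K W \<Longrightarrow> F [h] \<in> carrier W \<Longrightarrow> lsum W (dn 0 h) F = F [h]"
  using module.lsum_single[of K W F "[h]"] by simp

text \<open>\<open>iter_comult\<close> splits the first factor again and again, and \<open>dn\<close> the last one. Coassociativity
  makes the results agree.\<close>

lemma dn_split_head:
  assumes "module K W" "mlin K H W (Suc (Suc n)) G" "h \<in> carrier H"
  shows "lsum W (dn n h) (\<lambda>ds. lsum W (dl (ds ! 0)) (\<lambda>p. G (take 0 ds @ [fst p, snd p] @ drop (Suc 0) ds)))
    = lsum W (dn (Suc n) h) G"
proof -
  note M = assms(1)
  have c: "G ds \<in> carrier W" if "ds \<in> tuples H (Suc (Suc n))" for ds using mlin_closed[OF assms(2) that] .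
  show ?thesis
  proof (cases n)
    case 0
    have "lsum W (dn (Suc 0) h) G = lsum W (dl h) (\<lambda>p. lsum W (dn 0 (snd p)) (\<lambda>ds. G (fst p # ds)))"
      by (rule lsum_dn_Suc[OF M]) (use c 0 assms(3) in auto)
    also have "\<dots> = lsum W (dl h) (\<lambda>p. G [fst p, snd p])"
      by (rule lsum_cong, rule lsum_dn_0[OF M]) (use c 0 in auto)
    also have "\<dots> = lsum W (dn 0 h) (\<lambda>ds. lsum W (dl (ds ! 0)) (\<lambda>p. G (take 0 ds @ [fst p, snd p] @ drop (Suc 0) ds)))"
      by (subst lsum_dn_0[OF M]) (use c 0 in \<open>auto intro!: module.lsum_closed[OF M] dest: dl_set_pair\<close>)
    finally show ?thesis unfolding 0 by simp
  next
    case (Suc n')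
    note m = assms(2)[unfolded Suc]
    have t: "trilin K H H H W (\<lambda>x y z. lsum W (dn n' z) (\<lambda>ds. G (x # y # ds)))"
    proof (rule trilinI)
      show "(\<lambda>x. lsum W (dn n' z) (\<lambda>ds. G (x # y # ds))) \<in> lin_hom K H W" if "y \<in> carrier H" "z \<in> carrier H" for y z
        by (rule module.lin_lsum[OF M]) (use m dn_tuples[OF that(2)] that in auto)
      show "(\<lambda>y. lsum W (dn n' z) (\<lambda>ds. G (x # y # ds))) \<in> lin_hom K H W" if "x \<in> carrier H" "z \<in> carrier H" for x z
        by (rule module.lin_lsum[OF M]) (use m dn_tuples[OF that(2)] that in auto)
      show "(\<lambda>z. lsum W (dn n' z) (\<lambda>ds. G (x # y # ds))) \<in> lin_hom K H W" if "x \<in> carrier H" "y \<in> carrier H" for x y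
        by (rule dn_lin[OF M]) (use m that in auto)
    qed
    have c': "G (x # y # ds) \<in> carrier W" if "x \<in> carrier H" "y \<in> carrier H" "ds \<in> tuples H (Suc n')" for x y ds
      using c[of "x # y # ds"] that by (simp add: Suc)
    have "lsum W (dn n h) (\<lambda>ds. lsum W (dl (ds ! 0)) (\<lambda>p. G (take 0 ds @ [fst p, snd p] @ drop (Suc 0) ds)))
      = lsum W (dl h) (\<lambda>p. lsum W (dn n' (snd p)) (\<lambda>ds. lsum W (dl (fst p)) (\<lambda>q. G (fst q # snd q # ds))))"
      unfolding Suc
      by (subst lsum_dn_Suc[OF M _ assms(3)])
        (auto intro!: module.lsum_closed[OF M] c' simp: tuples_Suc dest: dl_set_pair)
    also have "\<dots> = lsum W (dl h) (\<lambda>p. lsum W (dl (fst p)) (\<lambda>q. lsum W (dn n' (snd p)) (\<lambda>ds. G (fst q # snd q # ds))))"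
      by (rule lsum_cong, rule module.lsum_swap[OF M], rule c') (auto intro!: dn_tuples[rotated] dest!: dl_set_pair)
    also have "\<dots> = lsum W (dl h) (\<lambda>p. lsum W (dl (snd p)) (\<lambda>q. lsum W (dn n' (snd q)) (\<lambda>ds. G (fst p # fst q # ds))))"
      by (rule dl_coassoc[OF M t assms(3)])
    also have "\<dots> = lsum W (dl h) (\<lambda>p. lsum W (dn n (snd p)) (\<lambda>ds. G (fst p # ds)))"
      unfolding Suc
      by (rule lsum_cong, rule lsum_dn_Suc[OF M, symmetric]) (use c in \<open>auto simp: Suc\<close>)
    also have "\<dots> = lsum W (dn (Suc n) h) G"
      by (rule lsum_dn_Suc[OF M c assms(3), symmetric])
    finally show ?thesis .
  qed
qed

text \<open>Coassociativity once more: the last factor is split off first.\<close>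

lemma dn_snoc:
  assumes "module K W" "mlin K H W (Suc (Suc n)) F" "h \<in> carrier H"
  shows "lsum W (dl h) (\<lambda>p. lsum W (dn n (fst p)) (\<lambda>ds. F (ds @ [snd p]))) = lsum W (dn (Suc n) h) F"
  using assms(2,3)
proof (induction n arbitrary: F h)
  case 0
  have c: "F [x, y] \<in> carrier W" if "x \<in> carrier H" "y \<in> carrier H" for x y
    using mlin_closed[OF 0(1), of "[x, y]"] that by simp
  have "lsum W (dl h) (\<lambda>p. lsum W (dn 0 (fst p)) (\<lambda>ds. F (ds @ [snd p]))) = lsum W (dl h) (\<lambda>p. F [fst p, snd p])"
    by (rule lsum_cong, subst lsum_dn_0[OF assms(1)]) (auto intro!: c dest!: dl_set_pair)
  also have "\<dots> = lsum W (dl h) (\<lambda>p. lsum W (dn 0 (snd p)) (\<lambda>ds. F (fst p # ds)))"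
    by (rule lsum_cong, subst lsum_dn_0[OF assms(1)]) (auto intro!: c dest!: dl_set_pair)
  also have "\<dots> = lsum W (dn (Suc 0) h) F"
    by (rule lsum_dn_Suc[OF assms(1) mlin_closed[OF 0(1)] 0(2), symmetric])
  finally show ?case .
next
  case (Suc n)
  note M = assms(1)
  note m = Suc.prems(1) and h = Suc.prems(2)
  have c: "F (x # ds @ [y]) \<in> carrier W" if "x \<in> carrier H" "y \<in> carrier H" "ds \<in> tuples H (Suc n)" for x y ds
    using mlin_closed[OF m, of "x # ds @ [y]"] that by (simp add: tuples_def)
  have mc: "mlin K H W (Suc (Suc n)) (\<lambda>ds. F (x # ds))" if "x \<in> carrier H" for x using m that by simp
  have t: "trilin K H H H W (\<lambda>x y z. lsum W (dn n y) (\<lambda>ds. F (x # ds @ [z])))"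
  proof (rule trilinI)
    show "(\<lambda>x. lsum W (dn n y) (\<lambda>ds. F (x # ds @ [z]))) \<in> lin_hom K H W" if "y \<in> carrier H" "z \<in> carrier H" for y z
    proof (rule module.lin_lsum[OF M])
      fix ds assume "ds \<in> set (dn n y)"
      then have "ds @ [z] \<in> tuples H (Suc (Suc n))" using dn_tuples[OF that(1)] that by (auto simp: tuples_def)
      then show "(\<lambda>x. F (x # ds @ [z])) \<in> lin_hom K H W" using m by simp
    qed
    show "(\<lambda>y. lsum W (dn n y) (\<lambda>ds. F (x # ds @ [z]))) \<in> lin_hom K H W" if "x \<in> carrier H" "z \<in> carrier H" for x z
      by (rule dn_lin[OF M mlin_snoc[OF mc]]) (use that in auto)
    show "(\<lambda>z. lsum W (dn n y) (\<lambda>ds. F (x # ds @ [z]))) \<in> lin_hom K H W" if "x \<in> carrier H" "y \<in> carrier H" for x y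
      by (rule module.lin_lsum[OF M], rule mlin_snoc_lin[OF mc]) (use that dn_tuples in auto)
  qed
  have "lsum W (dl h) (\<lambda>p. lsum W (dn (Suc n) (fst p)) (\<lambda>ds. F (ds @ [snd p])))
      = lsum W (dl h) (\<lambda>p. lsum W (dl (fst p)) (\<lambda>q. lsum W (dn n (snd q)) (\<lambda>ds. F (fst q # ds @ [snd p]))))"
    by (rule lsum_cong, subst lsum_dn_Suc[OF M mlin_closed[OF mlin_snoc[OF m]]]) auto
  also have "\<dots> = lsum W (dl h) (\<lambda>p. lsum W (dl (snd p)) (\<lambda>q. lsum W (dn n (fst q)) (\<lambda>ds. F (fst p # ds @ [snd q]))))"
    by (rule dl_coassoc[OF M t h])
  also have "\<dots> = lsum W (dl h) (\<lambda>p. lsum W (dn (Suc n) (snd p)) (\<lambda>ds. F (fst p # ds)))"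
    by (rule lsum_cong, rule Suc.IH) (auto intro!: mc simp del: mlin.simps dest!: dl_set_pair)
  also have "\<dots> = lsum W (dn (Suc (Suc n)) h) F"
    by (rule lsum_dn_Suc[OF M mlin_closed[OF m] h, symmetric])
  finally show ?case .
qed

lemma iter_comult_dn:
  assumes "h \<in> carrier H"
  shows "iter_comult K H n h = lsum (Tn (Suc n)) (dn n h) (gen K (Tn (Suc n)))"
  using assms
proof (induction n)
  case 0
  note T = tensor_power_module[OF module, of "Suc 0"]
  show ?case
    using lsum_dn_0[OF T, of "gen K (Tn (Suc 0))" h] mlin_closed[OF tensor_power_gen_mlin[OF module, of "Suc 0"], of "[h]"] 0
    by simp
next
  case (Suc n)
  note T = tensor_power_module[OF module, of "Suc n"] and T' = tensor_power_module[OF module, of "Suc (Suc n)"]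
  note g = tensor_power_gen_mlin[OF module, of "Suc n"] and g' = tensor_power_gen_mlin[OF module, of "Suc (Suc n)"]
  have "iter_comult K H (Suc n) h = comult_at K H (Suc n) 0 (lsum (Tn (Suc n)) (dn n h) (gen K (Tn (Suc n))))"
    using Suc by simp
  also have "\<dots> = lsum (Tn (Suc (Suc n))) (dn n h) (\<lambda>ds. comult_at K H (Suc n) 0 (gen K (Tn (Suc n)) ds))"
    by (rule lin_hom_lsum[OF T T' comult_at_lin], simp, rule mlin_closed[OF g], rule dn_tuples[OF Suc.prems])
  also have "\<dots> = lsum (Tn (Suc (Suc n))) (dn n h) (\<lambda>ds. lsum (Tn (Suc (Suc n))) (dl (ds ! 0))
      (\<lambda>p. gen K (Tn (Suc (Suc n))) (take 0 ds @ [fst p, snd p] @ drop (Suc 0) ds)))"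
    by (rule lsum_cong, rule comult_at_gen, simp, rule dn_tuples[OF Suc.prems])
  also have "\<dots> = lsum (Tn (Suc (Suc n))) (dn (Suc n) h) (gen K (Tn (Suc (Suc n))))"
    by (rule dn_split_head[OF T' g' Suc.prems])
  finally show ?case .
qed

lemma diag_act_gen:
  assumes "hs \<in> tuples H (Suc n)" "h \<in> carrier H"
  shows "diag_act K H n (gen K (Tn (Suc n)) hs) h
    = lsum (Tn (Suc n)) (dn n h) (\<lambda>ds. gen K (Tn (Suc n)) (hs \<bullet> ds))"
proof -
  let ?T = "Tn (Suc n)"
  note T = tensor_power_module[OF module, of "Suc n"]
  note g = tensor_power_gen_mlin[OF module, of "Suc n"]
  have "gen K ?T hs = lsum ?T [hs] (gen K ?T)"
    using module.lsum_single[OF T, of "gen K ?T" hs] mlin_closed[OF g assms(1)] by simp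
  then have "diag_act K H n (gen K ?T hs) h
      = lsum ?T [hs] (gen K ?T) \<otimes>\<^bsub>?T\<^esub> lsum ?T (dn n h) (gen K ?T)"
    by (simp only: diag_act_def iter_comult_dn[OF assms(2)] Suc_eq_plus1[symmetric])
  also have "\<dots> = lsum ?T [hs] (\<lambda>xs. lsum ?T (dn n h) (\<lambda>ys. gen K ?T (xs \<bullet> ys)))"
    by (rule tensor_power_mult_sum[OF k_algebra_axioms]) (use assms dn_tuples in auto)
  also have "\<dots> = lsum ?T (dn n h) (\<lambda>ds. gen K ?T (hs \<bullet> ds))"
    by (rule module.lsum_single[OF T], rule dn_closed[OF T mlin_map2_right[OF g assms(1)] assms(2)])
  finally show ?thesis .
qed

lemma diag_act_lin:
  assumes "h \<in> carrier H"
  shows "(\<lambda>X. diag_act K H n X h) \<in> lin_hom K (Tn (Suc n)) (Tn (Suc n))"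
proof -
  note T = tensor_power_module[OF module, of "Suc n"]
  note g = tensor_power_gen_mlin[OF module, of "Suc n"]
  let ?T = "Tn (Suc n)"
  let ?f = "\<lambda>xs. lsum ?T (dn n h) (\<lambda>ys. gen K ?T (xs \<bullet> ys))"
  have m: "mlin K H ?T (Suc n) ?f"
    by (rule mlin_lsum[OF T], rule mlin_map2_left[OF g], rule dn_tuples[OF assms])
  have "gen_lift K ?T ?f X = diag_act K H n X h" if X: "X \<in> carrier ?T" for X
  proof -
    obtain L where L: "set L \<subseteq> tuples H (Suc n)" "X = lsum ?T L (gen K ?T)"
      using tensor_power_rep[OF module _ X] by blast
    have "diag_act K H n X h = lsum ?T L ?f"
      unfolding L(2) diag_act_def iter_comult_dn[OF assms] Suc_eq_plus1[symmetric]
      by (rule tensor_power_mult_sum[OF k_algebra_axioms L(1)]) (use assms dn_tuples in auto)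
    then show ?thesis using tensor_power_lift_sum[OF module T m L(1)] L(2) by simp
  qed
  then show ?thesis by (rule lin_hom_cong[OF T tensor_power_lift_lin[OF module T m]])
qed

end

section \<open>Sweedler sums in a Hopf-Galois extension\<close>

lemma lin_hom_inv_into:
  assumes "module K M" "f \<in> lin_hom K M N" "bij_betw f (carrier M) (carrier N)"
  shows "inv_into (carrier M) f \<in> lin_hom K N M"
proof -
  interpret M: module K M by fact
  let ?g = "inv_into (carrier M) f"
  have g: "?g y \<in> carrier M" "f (?g y) = y" if "y \<in> carrier N" for y
    using assms(3) that by (auto simp: bij_betw_def inv_into_into f_inv_into_f)
  have u: "?g (f x) = x" if "x \<in> carrier M" for x
    using assms(3) that by (auto simp: bij_betw_def)
  show ?thesis
  proof (rule lin_homI)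
    fix y assume y: "y \<in> carrier N"
    show "?g y \<in> carrier M" using g(1)[OF y] .
    show "?g (c \<odot>\<^bsub>N\<^esub> y) = c \<odot>\<^bsub>M\<^esub> ?g y" if "c \<in> carrier K" for c
      using lin_hom_smult[OF assms(2) that g(1)[OF y]] u[OF M.smult_closed[OF that g(1)[OF y]]] g(2)[OF y] by simp
    fix z assume z: "z \<in> carrier N"
    show "?g (y \<oplus>\<^bsub>N\<^esub> z) = ?g y \<oplus>\<^bsub>M\<^esub> ?g z"
      using lin_hom_add[OF assms(2) g(1)[OF y] g(1)[OF z]] u[OF M.M.a_closed[OF g(1)[OF y] g(1)[OF z]]] g(2)[OF y] g(2)[OF z] by simp
  qed
qed

definition balanced :: "('k,'m,'s) module_scheme \<Rightarrow> 'm set \<Rightarrow> nat \<Rightarrow> ('m list \<Rightarrow> 'w) \<Rightarrow> bool"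
  where "balanced A B n F \<longleftrightarrow> (\<forall>xs x b y ys. b \<in> B \<longrightarrow> xs @ [x, y] @ ys \<in> tuples A n \<longrightarrow>
    F (xs @ [x \<otimes>\<^bsub>A\<^esub> b, y] @ ys) = F (xs @ [x, b \<otimes>\<^bsub>A\<^esub> y] @ ys))"

lemma balancedD: "balanced A B n F \<Longrightarrow> b \<in> B \<Longrightarrow> xs @ [x, y] @ ys \<in> tuples A n \<Longrightarrow>
    F (xs @ [x \<otimes>\<^bsub>A\<^esub> b, y] @ ys) = F (xs @ [x, b \<otimes>\<^bsub>A\<^esub> y] @ ys)"
  unfolding balanced_def by blast

text \<open>The first neighbouring pair is the only one not covered by the tail of the list.\<close>

lemma balanced_ConsI:
  assumes "\<And>x y b ys. x \<in> carrier A \<Longrightarrow> y \<in> carrier A \<Longrightarrow> ys \<in> tuples A n \<Longrightarrow> b \<in> B \<Longrightarrow>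
      F ((x \<otimes>\<^bsub>A\<^esub> b) # y # ys) = F (x # (b \<otimes>\<^bsub>A\<^esub> y) # ys)"
    and "\<And>x. x \<in> carrier A \<Longrightarrow> balanced A B (Suc n) (\<lambda>xs. F (x # xs))"
  shows "balanced A B (Suc (Suc n)) F"
  unfolding balanced_def
proof (intro allI impI)
  fix xs x b y ys assume b: "b \<in> B" and t: "xs @ [x, y] @ ys \<in> tuples A (Suc (Suc n))"
  show "F (xs @ [x \<otimes>\<^bsub>A\<^esub> b, y] @ ys) = F (xs @ [x, b \<otimes>\<^bsub>A\<^esub> y] @ ys)"
  proof (cases xs)
    case Nil then show ?thesis using assms(1)[of x y ys b] b t by simp
  next
    case (Cons z zs)
    then have "z \<in> carrier A" "zs @ [x, y] @ ys \<in> tuples A (Suc n)" using t by auto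
    from balancedD[OF assms(2)[OF this(1)] b this(2)] Cons show ?thesis by simp
  qed
qed

lemma balanced_Cons:
  assumes "balanced A B (Suc n) F" "x \<in> carrier A"
  shows "balanced A B n (\<lambda>xs. F (x # xs))"
  unfolding balanced_def
proof (intro allI impI)
  fix xs z b y ys assume b: "b \<in> B" and t: "xs @ [z, y] @ ys \<in> tuples A n"
  then have "(x # xs) @ [z, y] @ ys \<in> tuples A (Suc n)" using assms(2) by simp
  from balancedD[OF assms(1) b this] show "F (x # xs @ [z \<otimes>\<^bsub>A\<^esub> b, y] @ ys) = F (x # xs @ [z, b \<otimes>\<^bsub>A\<^esub> y] @ ys)"
    by simp
qed

lemma balanced_head:
  assumes "balanced A B (Suc (Suc n)) F" "x \<in> carrier A" "y \<in> carrier A" "ys \<in> tuples A n" "b \<in> B"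
  shows "F ((x \<otimes>\<^bsub>A\<^esub> b) # y # ys) = F (x # (b \<otimes>\<^bsub>A\<^esub> y) # ys)"
  using balancedD[OF assms(1,5), of "[]" x y ys] assms by simp

lemma balanced_1: "balanced A B (Suc 0) F"
  by (auto simp: balanced_def tuples_def)

lemma balanced_2:
  "(\<And>x y b. x \<in> carrier A \<Longrightarrow> y \<in> carrier A \<Longrightarrow> b \<in> B \<Longrightarrow> F (x \<otimes>\<^bsub>A\<^esub> b) y = F x (b \<otimes>\<^bsub>A\<^esub> y)) \<Longrightarrow>
   balanced A B 2 (\<lambda>xs. F (xs ! 0) (xs ! 1))"
  unfolding numeral_2_eq_2 by (rule balanced_ConsI) (auto simp: balanced_1)

context k_algebra begin

lemma A_closed [simp]:
  "1\<^sub>A \<in> carrier A" "x \<in> carrier A \<Longrightarrow> y \<in> carrier A \<Longrightarrow> x \<cdot> y \<in> carrier A"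
  "x \<in> carrier A \<Longrightarrow> 1\<^sub>A \<cdot> x = x" "x \<in> carrier A \<Longrightarrow> x \<cdot> 1\<^sub>A = x"
proof -
  interpret ring A by (rule ring)
  show "1\<^sub>A \<in> carrier A" "x \<in> carrier A \<Longrightarrow> y \<in> carrier A \<Longrightarrow> x \<cdot> y \<in> carrier A"
  "x \<in> carrier A \<Longrightarrow> 1\<^sub>A \<cdot> x = x" "x \<in> carrier A \<Longrightarrow> x \<cdot> 1\<^sub>A = x" by auto
qed

lemma A_assoc:
  "x \<in> carrier A \<Longrightarrow> y \<in> carrier A \<Longrightarrow> z \<in> carrier A \<Longrightarrow> x \<cdot> y \<cdot> z = x \<cdot> (y \<cdot> z)"
proof -
  interpret ring A by (rule ring)
  show "x \<in> carrier A \<Longrightarrow> y \<in> carrier A \<Longrightarrow> z \<in> carrier A \<Longrightarrow> x \<cdot> y \<cdot> z = x \<cdot> (y \<cdot> z)"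
    by (rule m_assoc)
qed

lemma mlin_rot:
  assumes "mlin K A W (Suc n) F"
  shows "mlin K A W (Suc n) (\<lambda>xs. F (last xs # butlast xs))"
proof (rule mlinI_slot)
  show "F (last xs # butlast xs) \<in> carrier W" if "xs \<in> tuples A (Suc n)" for xs
    by (rule mlin_closed[OF assms]) (use that in \<open>cases xs rule: rev_cases; auto simp: tuples_def\<close>)
  fix xs ys assume x: "set xs \<subseteq> carrier A" "set ys \<subseteq> carrier A" "length xs + length ys + 1 = Suc n"
  show "(\<lambda>x. F (last (xs @ [x] @ ys) # butlast (xs @ [x] @ ys))) \<in> lin_hom K A W"
  proof (cases ys rule: rev_cases)
    case Nil
    then show ?thesis using mlin_slot[OF assms, of "[]" "1\<^sub>A" xs] x by (simp add: tuples_def)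
  next
    case (snoc zs z)
    then show ?thesis using mlin_slot[OF assms, of "z # xs" "1\<^sub>A" zs] x by (simp add: tuples_def butlast_append)
  qed
qed

lemma mlin_2: "bilin K A A W F \<Longrightarrow> mlin K A W 2 (\<lambda>xs. F (xs ! 0) (xs ! 1))"
  by (auto simp: numeral_2_eq_2 tuples_Suc bilinD)

text \<open>The universal property of the tensor power over a subset \<open>B\<close>.\<close>

lemma rel_tensor_facts:
  assumes "B \<subseteq> carrier A"
  shows rel_tensor_module: "module K (rel_tensor_power K A B n)"
    and rel_tensor_gen_mlin: "mlin K A (rel_tensor_power K A B n) n (gen K (rel_tensor_power K A B n))"
    and rel_tensor_gen_bal: "balanced A B n (gen K (rel_tensor_power K A B n))"
    and rel_tensor_rep: "0 < n \<Longrightarrow> q \<in> carrier (rel_tensor_power K A B n) \<Longrightarrow>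
          \<exists>L. set L \<subseteq> tuples A n \<and> q = lsum (rel_tensor_power K A B n) L (gen K (rel_tensor_power K A B n))"
    and rel_tensor_lift_lin: "module K W \<Longrightarrow> mlin K A W n F \<Longrightarrow> balanced A B n F \<Longrightarrow>
          gen_lift K W F \<in> lin_hom K (rel_tensor_power K A B n) W"
    and rel_tensor_lift_gen: "module K W \<Longrightarrow> mlin K A W n F \<Longrightarrow> balanced A B n F \<Longrightarrow> xs \<in> tuples A n \<Longrightarrow>
          gen_lift K W F (gen K (rel_tensor_power K A B n) xs) = F xs"
proof -
  let ?R = "rel_tensor_power K A B n"
  let ?F = "free_module K (tuples A n)" and ?e = "basis_vec K"
  let ?E = "{?e (xs @ [x \<cdot> b, y] @ ys) \<ominus>\<^bsub>?F\<^esub> ?e (xs @ [x, b \<cdot> y] @ ys) | xs x b y ys.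
           b \<in> B \<and> xs @ [x, y] @ ys \<in> tuples A n}"
  have eq: "rel_tensor_power K A B n = list_rels K A n ?E"
    by (simp add: rel_tensor_power_def Let_def)
  have cr: "cring K" using module by (simp add: module_def)
  have t: "xs @ [x \<cdot> b, y] @ ys \<in> tuples A n" "xs @ [x, b \<cdot> y] @ ys \<in> tuples A n"
    if "b \<in> B" "xs @ [x, y] @ ys \<in> tuples A n" for xs x b y ys
    using that assms by (auto simp: tuples_def)
  have E: "?E \<subseteq> carrier ?F"
  proof
    fix r assume "r \<in> ?E"
    then obtain xs x b y ys where r: "r = ?e (xs @ [x \<cdot> b, y] @ ys) \<ominus>\<^bsub>?F\<^esub> ?e (xs @ [x, b \<cdot> y] @ ys)"
      "b \<in> B" "xs @ [x, y] @ ys \<in> tuples A n" by blast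
    show "r \<in> carrier ?F" unfolding r(1) by (rule free_rels_closed(1)[OF cr t(1)[OF r(2,3)] t(2)[OF r(2,3)]])
  qed
  show "module K ?R" unfolding eq by (rule list_rels_module[OF module E])
  show "mlin K A ?R n (gen K ?R)"
    unfolding eq by (rule list_gen_mlin[OF module E])
  have R: "multilinear_rels K A n \<union> ?E \<subseteq> carrier ?F"
    using multilinear_rels_closed[OF module] E by (rule Un_least)
  show "balanced A B n (gen K ?R)"
    unfolding balanced_def eq
  proof (intro allI impI)
    fix xs x b y ys assume b: "b \<in> B" and xy: "xs @ [x, y] @ ys \<in> tuples A n"
    have "?e (xs @ [x \<cdot> b, y] @ ys) \<ominus>\<^bsub>?F\<^esub> ?e (xs @ [x, b \<cdot> y] @ ys) \<in> multilinear_rels K A n \<union> ?E"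
      using b xy by blast
    then show "gen K (list_rels K A n ?E) (xs @ [x \<cdot> b, y] @ ys) = gen K (list_rels K A n ?E) (xs @ [x, b \<cdot> y] @ ys)"
      by (rule presented_gen_eq[OF cr R t(1)[OF b xy] t(2)[OF b xy]])
  qed
  show "\<exists>L. set L \<subseteq> tuples A n \<and> q = lsum ?R L (gen K ?R)"
    if "0 < n" "q \<in> carrier ?R"
    using list_rep[OF module E that(1)] that(2) unfolding eq by blast
  have kill: "lin_ext K W F r = \<zero>\<^bsub>W\<^esub>" if W: "module K W" and m: "mlin K A W n F" and b: "balanced A B n F" and r: "r \<in> ?E" for r
  proof -
    obtain xs x b' y ys where r: "r = ?e (xs @ [x \<cdot> b', y] @ ys) \<ominus>\<^bsub>?F\<^esub> ?e (xs @ [x, b' \<cdot> y] @ ys)"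
      "b' \<in> B" "xs @ [x, y] @ ys \<in> tuples A n" using r by blast
    have "lin_ext K W F r = F (xs @ [x \<cdot> b', y] @ ys) \<ominus>\<^bsub>W\<^esub> F (xs @ [x, b' \<cdot> y] @ ys)"
      unfolding r(1) by (rule lin_ext_diff[OF W mlin_closed[OF m] t(1)[OF r(2,3)] t(2)[OF r(2,3)]])
    then show ?thesis
      using module_diff_zero[OF W mlin_closed[OF m t(1)[OF r(2,3)]] mlin_closed[OF m t(2)[OF r(2,3)]]]
        balancedD[OF b r(2,3)] by simp
  qed
  show "gen_lift K W F \<in> lin_hom K ?R W"
    if "module K W" "mlin K A W n F" "balanced A B n F"
    unfolding eq by (rule list_lift(1)[OF module E that(1,2) kill[OF that]])
  show "gen_lift K W F (gen K ?R xs) = F xs"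
    if "module K W" "mlin K A W n F" "balanced A B n F" "xs \<in> tuples A n"
    unfolding eq by (rule list_lift(2)[OF module E that(1,2) kill[OF that(1-3)] that(4)])
qed

lemma rel_tensor_lift_sum:
  assumes "B \<subseteq> carrier A" "module K W" "mlin K A W n F" "balanced A B n F" "set L \<subseteq> tuples A n"
  shows "gen_lift K W F (lsum (rel_tensor_power K A B n) L (gen K (rel_tensor_power K A B n))) = lsum W L F"
proof -
  have "gen_lift K W F (lsum (rel_tensor_power K A B n) L (gen K (rel_tensor_power K A B n)))
    = lsum W L (\<lambda>p. gen_lift K W F (gen K (rel_tensor_power K A B n) p))"
    by (rule lin_hom_lsum[OF rel_tensor_module[OF assms(1)] assms(2) rel_tensor_lift_lin[OF assms(1-4)]])
      (use assms(5) mlin_closed[OF rel_tensor_gen_mlin[OF assms(1)]] in blast)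
  also have "\<dots> = lsum W L F"
    by (rule lsum_cong, rule rel_tensor_lift_gen[OF assms(1-4)]) (use assms(5) in auto)
  finally show ?thesis .
qed

end

context galois_extension begin
abbreviation "TT \<equiv> tensor K A H"
abbreviation "AQ \<equiv> alg_quot K A B"
abbreviation "cls \<equiv> alg_class K A B"
abbreviation "R2 \<equiv> rel_tensor_power K A B 2"

text \<open>Chosen summands of \<open>\<rho>(a)\<close>.\<close>

definition rl :: "'a \<Rightarrow> ('a \<times> 'h) list"
  where "rl a = (if a \<in> carrier A then SOME L. set L \<subseteq> carrier A \<times> carrier H \<and>
    \<rho> a = lsum TT L (\<lambda>p. gen K TT (fst p, snd p)) else [])"

lemma B_sub: "B \<subseteq> carrier A" by (auto simp: coinvariants)

lemma B_closed [simp]: "b \<in> B \<Longrightarrow> b \<in> carrier A" using B_sub by auto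

lemma TT_module: "module K TT" by (rule tensor_module[OF A.module H.module])

lemma TT_bilin: "bilin K A H TT (\<lambda>x y. gen K TT (x, y))" by (rule tensor_gen_bilin[OF A.module H.module])

lemma rl_spec:
  assumes "a \<in> carrier A"
  shows "set (rl a) \<subseteq> carrier A \<times> carrier H"
    and "\<rho> a = lsum TT (rl a) (\<lambda>p. gen K TT (fst p, snd p))"
proof -
  have "\<rho> a \<in> carrier TT" using lin_hom_closed[OF coaction_linear assms] .
  from someI_ex[OF tensor_rep[OF A.module H.module this]]
  show "set (rl a) \<subseteq> carrier A \<times> carrier H" "\<rho> a = lsum TT (rl a) (\<lambda>p. gen K TT (fst p, snd p))"
    using assms by (simp_all add: rl_def)
qed

lemma rl_set [simp]: "p \<in> set (rl a) \<Longrightarrow> fst p \<in> carrier A" "p \<in> set (rl a) \<Longrightarrow> snd p \<in> carrier H"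
  using rl_spec(1)[of a] by (cases "a \<in> carrier A"; auto simp: rl_def)+

lemma rl_set_pair: "(x, y) \<in> set (rl a) \<Longrightarrow> x \<in> carrier A \<and> y \<in> carrier H"
  using rl_set[of "(x, y)"] by simp

lemma gen_lift_rho:
  assumes "module K W" "bilin K A H W F" "a \<in> carrier A"
  shows "gen_lift K W (\<lambda>(x, y). F x y) (\<rho> a) = lsum W (rl a) (\<lambda>p. F (fst p) (snd p))"
  unfolding rl_spec(2)[OF assms(3)]
  by (rule tensor_lift_sum[OF A.module H.module assms(1,2) rl_spec(1)[OF assms(3)]])

lemma rl_lin:
  assumes "module K W" "bilin K A H W F"
  shows "(\<lambda>a. lsum W (rl a) (\<lambda>p. F (fst p) (snd p))) \<in> lin_hom K A W"
proof -
  have "(\<lambda>a. gen_lift K W (\<lambda>(x, y). F x y) (\<rho> a)) \<in> lin_hom K A W"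
    by (rule lin_hom_comp[OF coaction_linear tensor_lift_lin[OF A.module H.module assms]])
  then show ?thesis by (rule lin_hom_cong[OF A.module]) (simp add: gen_lift_rho[OF assms])
qed

lemma rl_mult:
  assumes "module K W" "bilin K A H W F" "a \<in> carrier A" "c \<in> carrier A"
  shows "lsum W (rl (a \<cdot> c)) (\<lambda>p. F (fst p) (snd p))
    = lsum W (rl a) (\<lambda>p. lsum W (rl c) (\<lambda>q. F (fst p \<cdot> fst q) (snd p \<star> snd q)))"
proof -
  let ?L = "concat (map (\<lambda>p. map (\<lambda>q. (fst p \<cdot> fst q, snd p \<star> snd q)) (rl c)) (rl a))"
  have s: "set ?L \<subseteq> carrier A \<times> carrier H" by (auto dest!: rl_set_pair)
  have "\<rho> (a \<cdot> c) = \<rho> a \<otimes>\<^bsub>TT\<^esub> \<rho> c"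
    using coaction_ring_hom assms(3,4) by (auto simp: ring_hom_def)
  also have "\<dots> = lsum TT (rl a) (\<lambda>p. lsum TT (rl c) (\<lambda>q. gen K TT (fst p \<cdot> fst q, snd p \<star> snd q)))"
    unfolding rl_spec(2)[OF assms(3)] rl_spec(2)[OF assms(4)]
    by (rule tensor_mult_sum[OF A.k_algebra_axioms H.k_algebra_axioms rl_spec(1)[OF assms(3)] rl_spec(1)[OF assms(4)]])
  also have "\<dots> = lsum TT ?L (\<lambda>p. gen K TT (fst p, snd p))"
    using bilinD(3)[OF TT_bilin] by (subst module.lsum_concat[OF TT_module]) (auto dest!: rl_set_pair)
  finally have *: "\<rho> (a \<cdot> c) = \<dots>" .
  have "lsum W (rl (a \<cdot> c)) (\<lambda>p. F (fst p) (snd p)) = gen_lift K W (\<lambda>(x, y). F x y) (\<rho> (a \<cdot> c))"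
    using assms(3,4) by (simp add: gen_lift_rho[OF assms(1,2)])
  also have "\<dots> = lsum W ?L (\<lambda>p. F (fst p) (snd p))"
    unfolding * by (rule tensor_lift_sum[OF A.module H.module assms(1,2) s])
  also have "\<dots> = lsum W (rl a) (\<lambda>p. lsum W (rl c) (\<lambda>q. F (fst p \<cdot> fst q) (snd p \<star> snd q)))"
    using bilinD(3)[OF assms(2)] by (subst module.lsum_concat[OF assms(1)]) (auto dest!: rl_set_pair)
  finally show ?thesis .
qed

lemma rl_coinv:
  assumes "module K W" "bilin K A H W F" "b \<in> B"
  shows "lsum W (rl b) (\<lambda>p. F (fst p) (snd p)) = F b 1\<^sub>H"
proof -
  have "\<rho> b = gen K TT (b, 1\<^sub>H)" using assms(3) coinvariants by blast
  then show ?thesis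
    using gen_lift_rho[OF assms(1,2) B_closed[OF assms(3)]]
      tensor_lift_gen[OF A.module H.module assms(1,2) B_closed[OF assms(3)], of "1\<^sub>H"] by simp
qed

lemma one_B: "1\<^sub>A \<in> B"
proof -
  have "\<rho> 1\<^sub>A = \<one>\<^bsub>TT\<^esub>" using coaction_ring_hom by (auto simp: ring_hom_def)
  also have "\<dots> = gen K TT (1\<^sub>A, 1\<^sub>H)"
    unfolding tensor_fields by (simp add: tensor_def Let_def)
  finally have "1\<^sub>A \<in> {a \<in> carrier A. \<rho> a = gen K TT (a, 1\<^sub>H)}" by simp
  then show ?thesis by (simp only: coinvariants[symmetric])
qed

lemma rl_counit:
  assumes "module K W" "F \<in> lin_hom K A W" "a \<in> carrier A"
  shows "lsum W (rl a) (\<lambda>p. counit H (snd p) \<odot>\<^bsub>W\<^esub> F (fst p)) = F a"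
proof -
  interpret mod: module K A by (rule A.module)
  have b: "bilin K A H A (\<lambda>x y. counit H y \<odot>\<^bsub>A\<^esub> x)"
    by (auto intro!: bilinI smult_const_lin[OF A.module _ lin_hom_id] H.counit_lin A.module)
  have "F a = F (lsum A (rl a) (\<lambda>p. counit H (snd p) \<odot>\<^bsub>A\<^esub> fst p))"
    using coaction_counit[OF assms(3)] gen_lift_rho[OF A.module b assms(3)] by simp
  also have "\<dots> = lsum W (rl a) (\<lambda>p. F (counit H (snd p) \<odot>\<^bsub>A\<^esub> fst p))"
    by (rule lin_hom_lsum[OF A.module assms(1,2)]) simp
  also have "\<dots> = lsum W (rl a) (\<lambda>p. counit H (snd p) \<odot>\<^bsub>W\<^esub> F (fst p))"
    by (rule lsum_cong, rule lin_hom_smult[OF assms(2)]) auto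
  finally show ?thesis by simp
qed

lemma rl_coassoc:
  assumes "module K W" "trilin K A H H W F" "a \<in> carrier A"
  shows "lsum W (rl a) (\<lambda>p. lsum W (rl (fst p)) (\<lambda>q. F (fst q) (snd q) (snd p)))
    = lsum W (rl a) (\<lambda>p. lsum W (H.dl (snd p)) (\<lambda>q. F (fst p) (fst q) (snd q)))"
proof -
  let ?T2 = "tensor_power K H 2"
  note T2 = tensor_power_module[OF H.module, of 2]
  note F = trilinD[OF assms(2)]
  have t2: "gen K ?T2 [g, h] \<in> carrier ?T2" if "g \<in> carrier H" "h \<in> carrier H" for g h
    by (rule mlin_closed[OF tensor_power_gen_mlin[OF H.module]]) (use that in \<open>simp add: numeral_2_eq_2\<close>)
  have gb: "bilin K H H ?T2 (\<lambda>g h. gen K ?T2 [g, h])"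
    using tensor_power_gen_mlin[OF H.module, of 2]
    by (auto intro!: bilinI simp: numeral_2_eq_2)
  let ?T' = "tensor K A ?T2"
  note T' = tensor_module[OF A.module T2]
  note g' = tensor_gen_bilin[OF A.module T2]
  have b1: "bilin K A H ?T' (\<lambda>x' g. gen K ?T' (x', gen K ?T2 [g, h]))" if "h \<in> carrier H" for h
  proof (rule bilinI)
    show "(\<lambda>g. gen K ?T' (x, gen K ?T2 [g, h])) \<in> lin_hom K H ?T'" if "x \<in> carrier A" for x
      using lin_hom_comp[OF bilinD(2)[OF gb \<open>h \<in> carrier H\<close>] bilinD(1)[OF g' that]] .
    show "(\<lambda>x. gen K ?T' (x, gen K ?T2 [g, h])) \<in> lin_hom K A ?T'" if "g \<in> carrier H" for g
      by (rule bilinD(2)[OF g' t2[OF that \<open>h \<in> carrier H\<close>]])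
  qed
  have b2: "bilin K A H ?T' (\<lambda>x h. lsum ?T' (rl x) (\<lambda>p. gen K ?T' (fst p, gen K ?T2 [snd p, h])))"
  proof (rule bilinI)
    show "(\<lambda>h. lsum ?T' (rl x) (\<lambda>p. gen K ?T' (fst p, gen K ?T2 [snd p, h]))) \<in> lin_hom K H ?T'" for x
      by (rule module.lin_lsum[OF T'], rule lin_hom_comp[OF bilinD(1)[OF gb] bilinD(1)[OF g']]) simp_all
    show "(\<lambda>x. lsum ?T' (rl x) (\<lambda>p. gen K ?T' (fst p, gen K ?T2 [snd p, h]))) \<in> lin_hom K A ?T'" if "h \<in> carrier H" for h
      by (rule rl_lin[OF T' b1[OF that]])
  qed
  have b3: "bilin K A H ?T' (\<lambda>x h. gen K ?T' (x, comult H h))"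
    by (intro bilinI lin_hom_comp[OF H.comult_linear bilinD(1)[OF g']] bilinD(2)[OF g'] lin_hom_closed[OF H.comult_linear])
  have "gen_lift K ?T' (\<lambda>(x, h). gen_lift K ?T' (\<lambda>(x', g). gen K ?T' (x', gen K ?T2 [g, h])) (\<rho> x)) (\<rho> a)
      = lsum ?T' (rl a) (\<lambda>p. lsum ?T' (rl (fst p)) (\<lambda>q. gen K ?T' (fst q, gen K ?T2 [snd q, snd p])))"
  proof -
    have e: "lsum ?T' (rl x) (\<lambda>p. gen K ?T' (fst p, gen K ?T2 [snd p, h]))
        = gen_lift K ?T' (\<lambda>(x', g). gen K ?T' (x', gen K ?T2 [g, h])) (\<rho> x)"
      if "x \<in> carrier A" "h \<in> carrier H" for x h
      by (rule gen_lift_rho[OF T' b1[OF that(2)] that(1), symmetric])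
    have "bilin K A H ?T' (\<lambda>x h. gen_lift K ?T' (\<lambda>(x', g). gen K ?T' (x', gen K ?T2 [g, h])) (\<rho> x))"
      by (rule bilinI; rule lin_hom_cong[OF _ bilinD(1)[OF b2]] lin_hom_cong[OF _ bilinD(2)[OF b2]])
        (auto simp: e H.module A.module)
    from gen_lift_rho[OF T' this assms(3)] show ?thesis by (simp add: e cong: lsum_cong)
  qed
  moreover have "gen_lift K ?T' (\<lambda>(x, h). gen K ?T' (x, comult H h)) (\<rho> a)
      = lsum ?T' (rl a) (\<lambda>p. gen K ?T' (fst p, comult H (snd p)))"
    by (rule gen_lift_rho[OF T' b3 assms(3)])
  ultimately have eq: "lsum ?T' (rl a) (\<lambda>p. lsum ?T' (rl (fst p)) (\<lambda>q. gen K ?T' (fst q, gen K ?T2 [snd q, snd p])))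
      = lsum ?T' (rl a) (\<lambda>p. gen K ?T' (fst p, comult H (snd p)))"
    using coaction_coassoc[OF assms(3)] by (simp add: Let_def)
  have m2: "mlin K H W 2 (\<lambda>hs. F x (hs ! 0) (hs ! 1))" if "x \<in> carrier A" for x
    by (rule H.mlin_2) (use assms(2) that in \<open>simp add: trilin_def\<close>)
  let ?G = "\<lambda>x X. gen_lift K W (\<lambda>hs. F x (hs ! 0) (hs ! 1)) X"
  have G: "bilin K A ?T2 W ?G"
  proof (rule bilinI)
    show "(\<lambda>X. ?G x X) \<in> lin_hom K ?T2 W" if "x \<in> carrier A" for x
      by (rule tensor_power_lift_lin[OF H.module assms(1) m2[OF that]])
    fix X assume "X \<in> carrier ?T2"
    then obtain L where L: "set L \<subseteq> tuples H 2" "X = lsum ?T2 L (gen K ?T2)"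
      using tensor_power_rep[OF H.module, of 2 X] by auto
    have "(\<lambda>x. lsum W L (\<lambda>hs. F x (hs ! 0) (hs ! 1))) \<in> lin_hom K A W"
      by (rule module.lin_lsum[OF assms(1)], rule F(1))
        (use L(1) in \<open>auto simp: numeral_2_eq_2 subset_iff tuples_def\<close>)
    then show "(\<lambda>x. ?G x X) \<in> lin_hom K A W"
      by (rule lin_hom_cong[OF A.module]) (simp only: L(2) tensor_power_lift_sum[OF H.module assms(1) m2 L(1)])
  qed
  let ?\<Phi> = "gen_lift K W (\<lambda>(x, X). ?G x X)"
  note Pl = tensor_lift_lin[OF A.module T2 assms(1) G]
  note Pg = tensor_lift_gen[OF A.module T2 assms(1) G]
  note gc = bilinD(3)[OF g']
  have "?\<Phi> (lsum ?T' (rl a) (\<lambda>p. lsum ?T' (rl (fst p)) (\<lambda>q. gen K ?T' (fst q, gen K ?T2 [snd q, snd p]))))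
      = lsum W (rl a) (\<lambda>p. ?\<Phi> (lsum ?T' (rl (fst p)) (\<lambda>q. gen K ?T' (fst q, gen K ?T2 [snd q, snd p]))))"
    by (rule lin_hom_lsum[OF T' assms(1) Pl], rule module.lsum_closed[OF T'], rule gc, simp, rule t2, simp, simp)
  also have "\<dots> = lsum W (rl a) (\<lambda>p. lsum W (rl (fst p)) (\<lambda>q. ?\<Phi> (gen K ?T' (fst q, gen K ?T2 [snd q, snd p]))))"
    by (rule lsum_cong, rule lin_hom_lsum[OF T' assms(1) Pl], rule gc, simp, rule t2, simp, simp)
  also have "\<dots> = lsum W (rl a) (\<lambda>p. lsum W (rl (fst p)) (\<lambda>q. F (fst q) (snd q) (snd p)))"
  proof (rule lsum_cong, rule lsum_cong)
    fix p q assume pq: "p \<in> set (rl a)" "q \<in> set (rl (fst p))"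
    have "?G (fst q) (gen K ?T2 [snd q, snd p]) = F (fst q) (snd q) (snd p)"
      by (subst tensor_power_lift_gen[OF H.module assms(1) m2]) (use pq in \<open>auto simp: numeral_2_eq_2\<close>)
    then show "?\<Phi> (gen K ?T' (fst q, gen K ?T2 [snd q, snd p])) = F (fst q) (snd q) (snd p)"
      by (subst Pg) (use pq t2 in auto)
  qed
  finally have l: "?\<Phi> (lsum ?T' (rl a) (\<lambda>p. lsum ?T' (rl (fst p)) (\<lambda>q. gen K ?T' (fst q, gen K ?T2 [snd q, snd p])))) = \<dots>" .
  have "?\<Phi> (lsum ?T' (rl a) (\<lambda>p. gen K ?T' (fst p, comult H (snd p))))
      = lsum W (rl a) (\<lambda>p. ?\<Phi> (gen K ?T' (fst p, comult H (snd p))))"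
    by (rule lin_hom_lsum[OF T' assms(1) Pl], rule gc) (auto intro!: lin_hom_closed[OF H.comult_linear] dest!: rl_set_pair)
  also have "\<dots> = lsum W (rl a) (\<lambda>p. lsum W (H.dl (snd p)) (\<lambda>q. F (fst p) (fst q) (snd q)))"
  proof (rule lsum_cong)
    fix p assume p: "p \<in> set (rl a)"
    have "?\<Phi> (gen K ?T' (fst p, comult H (snd p))) = ?G (fst p) (comult H (snd p))"
      by (rule Pg) (use p lin_hom_closed[OF H.comult_linear] in auto)
    also have "\<dots> = lsum W (H.dl (snd p)) (\<lambda>q. F (fst p) ([fst q, snd q] ! 0) ([fst q, snd q] ! 1))"
      by (rule H.gen_lift_comult[OF assms(1) m2]) (use p in auto)
    finally show "?\<Phi> (gen K ?T' (fst p, comult H (snd p))) = lsum W (H.dl (snd p)) (\<lambda>q. F (fst p) (fst q) (snd q))"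
      by simp
  qed
  finally show ?thesis using eq l by simp
qed

definition beta_sum :: "'a \<Rightarrow> 'a \<Rightarrow> ('a \<times> 'h \<Rightarrow> 'k) set"
  where "beta_sum x y = lsum TT (rl y) (\<lambda>p. gen K TT (x \<cdot> fst p, snd p))"

lemma left_mult_bilin:
  assumes "bilin K A H W F" "x \<in> carrier A"
  shows "bilin K A H W (\<lambda>y h. F (x \<cdot> y) h)"
proof (rule bilinI)
  show "(\<lambda>y. F (x \<cdot> y) h) \<in> lin_hom K A W" if "h \<in> carrier H" for h
    by (rule lin_hom_comp[OF A.mult_lin_right[OF assms(2)] bilinD(2)[OF assms(1) that]])
qed (use bilinD(1)[OF assms(1)] assms(2) in simp)

lemma beta_sum_bilin: "bilin K A A TT beta_sum"
proof (rule bilinI)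
  show "beta_sum x \<in> lin_hom K A TT" if "x \<in> carrier A" for x
    unfolding beta_sum_def[abs_def] by (rule rl_lin[OF TT_module left_mult_bilin[OF TT_bilin that]])
  show "(\<lambda>x. beta_sum x y) \<in> lin_hom K A TT" for y
    unfolding beta_sum_def
    by (rule module.lin_lsum[OF TT_module], rule lin_hom_comp[OF A.mult_lin_left bilinD(2)[OF TT_bilin]]) simp_all
qed

lemma rl_mult_bilin:
  assumes "module K W" "bilin K A H W F"
  shows "bilin K A H W (\<lambda>a h. lsum W (rl y) (\<lambda>q. F (a \<cdot> fst q) (h \<star> snd q)))"
    and "bilin K A H W (\<lambda>a h. lsum W (rl y) (\<lambda>q. F (fst q \<cdot> a) (snd q \<star> h)))"
proof -
  note F = bilinD[OF assms(2)]
  show "bilin K A H W (\<lambda>a h. lsum W (rl y) (\<lambda>q. F (a \<cdot> fst q) (h \<star> snd q)))"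
    by (rule bilinI; rule module.lin_lsum[OF assms(1)];
        rule lin_hom_comp[OF H.mult_lin_left F(1)] lin_hom_comp[OF A.mult_lin_left F(2)]) auto
  show "bilin K A H W (\<lambda>a h. lsum W (rl y) (\<lambda>q. F (fst q \<cdot> a) (snd q \<star> h)))"
    by (rule bilinI; rule module.lin_lsum[OF assms(1)];
        rule lin_hom_comp[OF H.mult_lin_right F(1)] lin_hom_comp[OF A.mult_lin_right F(2)]) auto
qed

lemma rl_coinv_mult:
  assumes "module K W" "bilin K A H W F" "b \<in> B" "a \<in> carrier A"
  shows rl_coinv_left: "lsum W (rl (b \<cdot> a)) (\<lambda>p. F (fst p) (snd p)) = lsum W (rl a) (\<lambda>p. F (b \<cdot> fst p) (snd p))"
    and rl_coinv_right: "lsum W (rl (a \<cdot> b)) (\<lambda>p. F (fst p) (snd p)) = lsum W (rl a) (\<lambda>p. F (fst p \<cdot> b) (snd p))"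
proof -
  have "lsum W (rl (b \<cdot> a)) (\<lambda>p. F (fst p) (snd p))
      = lsum W (rl b) (\<lambda>p. lsum W (rl a) (\<lambda>q. F (fst p \<cdot> fst q) (snd p \<star> snd q)))"
    by (rule rl_mult[OF assms(1,2)]) (use assms in auto)
  also have "\<dots> = lsum W (rl a) (\<lambda>q. F (b \<cdot> fst q) (1\<^sub>H \<star> snd q))"
    by (rule rl_coinv[OF assms(1) rl_mult_bilin(1)[OF assms(1,2)] assms(3)])
  also have "\<dots> = lsum W (rl a) (\<lambda>p. F (b \<cdot> fst p) (snd p))"
    by (rule lsum_cong) (simp add: H.H_monoid)
  finally show "lsum W (rl (b \<cdot> a)) (\<lambda>p. F (fst p) (snd p)) = \<dots>" .
  have c: "F (fst q \<cdot> fst p) (snd q \<star> snd p) \<in> carrier W" if "q \<in> set (rl a)" "p \<in> set (rl b)" for p q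
    by (rule bilinD(3)[OF assms(2)]) (use that in auto)
  have "lsum W (rl (a \<cdot> b)) (\<lambda>p. F (fst p) (snd p))
      = lsum W (rl a) (\<lambda>q. lsum W (rl b) (\<lambda>p. F (fst q \<cdot> fst p) (snd q \<star> snd p)))"
    by (rule rl_mult[OF assms(1,2)]) (use assms in auto)
  also have "\<dots> = lsum W (rl b) (\<lambda>p. lsum W (rl a) (\<lambda>q. F (fst q \<cdot> fst p) (snd q \<star> snd p)))"
    by (rule module.lsum_swap[OF assms(1) c])
  also have "\<dots> = lsum W (rl a) (\<lambda>q. F (fst q \<cdot> b) (snd q \<star> 1\<^sub>H))"
    by (rule rl_coinv[OF assms(1) rl_mult_bilin(2)[OF assms(1,2)] assms(3)])
  also have "\<dots> = lsum W (rl a) (\<lambda>p. F (fst p \<cdot> b) (snd p))"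
    by (rule lsum_cong) (simp add: H.H_monoid)
  finally show "lsum W (rl (a \<cdot> b)) (\<lambda>p. F (fst p) (snd p)) = \<dots>" .
qed

lemma beta_sum_bal:
  assumes "x \<in> carrier A" "y \<in> carrier A" "b \<in> B"
  shows "beta_sum (x \<cdot> b) y = beta_sum x (b \<cdot> y)"
  unfolding beta_sum_def rl_coinv_left[OF TT_module left_mult_bilin[OF TT_bilin assms(1)] assms(3,2)]
  by (rule lsum_cong) (use assms in \<open>simp add: A.A_assoc\<close>)

lemma R2_gen_bilin: "bilin K A A R2 (\<lambda>x y. gen K R2 [x, y])"
  using A.rel_tensor_gen_mlin[OF B_sub, of 2] by (auto intro!: bilinI simp: numeral_2_eq_2)

lemma R2_lift_sum:
  assumes "module K W" "bilin K A A W F"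
    "\<And>x y b. x \<in> carrier A \<Longrightarrow> y \<in> carrier A \<Longrightarrow> b \<in> B \<Longrightarrow> F (x \<cdot> b) y = F x (b \<cdot> y)"
    "set L \<subseteq> carrier A \<times> carrier A"
  shows "gen_lift K W (\<lambda>xs. F (xs ! 0) (xs ! 1)) (lsum R2 L (\<lambda>p. gen K R2 [fst p, snd p]))
    = lsum W L (\<lambda>p. F (fst p) (snd p))"
proof -
  have "[fst p, snd p] \<in> tuples A 2" if "p \<in> set L" for p
    using assms(4) that by (auto simp: numeral_2_eq_2)
  then show ?thesis
    using A.rel_tensor_lift_sum[OF B_sub assms(1) A.mlin_2[OF assms(2)] balanced_2[of A B F, OF assms(3)],
        of "map (\<lambda>p. [fst p, snd p]) L"]
    by (simp add: image_subset_iff)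
qed

lemma R2_lift_lin:
  assumes "module K W" "bilin K A A W F"
    "\<And>x y b. x \<in> carrier A \<Longrightarrow> y \<in> carrier A \<Longrightarrow> b \<in> B \<Longrightarrow> F (x \<cdot> b) y = F x (b \<cdot> y)"
  shows "gen_lift K W (\<lambda>xs. F (xs ! 0) (xs ! 1)) \<in> lin_hom K R2 W"
  by (rule A.rel_tensor_lift_lin[OF B_sub assms(1) A.mlin_2[OF assms(2)] balanced_2]) (rule assms(3))

lemma galois_map_eq:
  shows galois_map_lin: "galois_map K H A \<rho> \<in> lin_hom K R2 TT"
    and galois_map_sum: "set L \<subseteq> carrier A \<times> carrier A \<Longrightarrow>
      galois_map K H A \<rho> (lsum R2 L (\<lambda>p. gen K R2 [fst p, snd p])) = lsum TT L (\<lambda>p. beta_sum (fst p) (snd p))"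
proof -
  let ?f = "\<lambda>xs. gen_lift K TT (\<lambda>(y\<^sub>0, y\<^sub>1). gen K TT (xs ! 0 \<cdot> y\<^sub>0, y\<^sub>1)) (\<rho> (xs ! 1))"
  have eq: "galois_map K H A \<rho> = gen_lift K TT ?f" by (simp add: galois_map_def Let_def)
  have f: "beta_sum (xs ! 0) (xs ! 1) = ?f xs" if "xs \<in> tuples A 2" for xs
  proof -
    have x: "xs ! 0 \<in> carrier A" "xs ! 1 \<in> carrier A" using that by (auto simp: tuples_Suc numeral_2_eq_2)
    show ?thesis unfolding beta_sum_def
      by (rule gen_lift_rho[OF TT_module left_mult_bilin[OF TT_bilin x(1)] x(2), symmetric])
  qed
  have m: "mlin K A TT 2 ?f" by (rule mlin_cong[OF A.module A.mlin_2[OF beta_sum_bilin] f])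
  have b: "balanced A B 2 ?f"
    unfolding balanced_def
  proof (intro allI impI)
    fix xs x b y ys assume b: "b \<in> B" and t: "xs @ [x, y] @ ys \<in> tuples A 2"
    then have xy: "xs = []" "ys = []" "x \<in> carrier A" "y \<in> carrier A" by (auto simp: tuples_def)
    then have "[x \<cdot> b, y] \<in> tuples A 2" "[x, b \<cdot> y] \<in> tuples A 2" using b by (auto simp: numeral_2_eq_2)
    from f[OF this(1)] f[OF this(2)] beta_sum_bal[OF xy(3,4) b] show "?f (xs @ [x \<cdot> b, y] @ ys) = ?f (xs @ [x, b \<cdot> y] @ ys)"
      using xy by simp
  qed
  show "galois_map K H A \<rho> \<in> lin_hom K R2 TT"
    unfolding eq by (rule A.rel_tensor_lift_lin[OF B_sub TT_module m b])
  show "galois_map K H A \<rho> (lsum R2 L (\<lambda>p. gen K R2 [fst p, snd p])) = lsum TT L (\<lambda>p. beta_sum (fst p) (snd p))"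
    if L: "set L \<subseteq> carrier A \<times> carrier A"
  proof -
    have t: "[fst p, snd p] \<in> tuples A 2" if "p \<in> set L" for p
      using L that by (auto simp: numeral_2_eq_2)
    have "galois_map K H A \<rho> (lsum R2 L (\<lambda>p. gen K R2 [fst p, snd p])) = lsum TT L (\<lambda>p. ?f [fst p, snd p])"
      using A.rel_tensor_lift_sum[OF B_sub TT_module m b, of "map (\<lambda>p. [fst p, snd p]) L"] t
      by (simp add: image_subset_iff eq)
    also have "\<dots> = lsum TT L (\<lambda>p. beta_sum (fst p) (snd p))"
      by (rule lsum_cong) (use f[OF t] in simp)
    finally show ?thesis .
  qed
qed

text \<open>As the Galois map is injective, balanced maps cannot tell apart two sums with the same image
  under it.\<close>

lemma galois_cancel:
  assumes "module K W" "bilin K A A W F"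
    "\<And>x y b. x \<in> carrier A \<Longrightarrow> y \<in> carrier A \<Longrightarrow> b \<in> B \<Longrightarrow> F (x \<cdot> b) y = F x (b \<cdot> y)"
    "set L \<subseteq> carrier A \<times> carrier A" "set L' \<subseteq> carrier A \<times> carrier A"
    "lsum TT L (\<lambda>p. beta_sum (fst p) (snd p)) = lsum TT L' (\<lambda>p. beta_sum (fst p) (snd p))"
  shows "lsum W L (\<lambda>p. F (fst p) (snd p)) = lsum W L' (\<lambda>p. F (fst p) (snd p))"
proof -
  let ?s = "\<lambda>L. lsum R2 L (\<lambda>p. gen K R2 [fst p, snd p])"
  have c: "?s L \<in> carrier R2" if "set L \<subseteq> carrier A \<times> carrier A" for L
    by (rule module.lsum_closed[OF A.rel_tensor_module[OF B_sub]])
      (use that bilinD(3)[OF R2_gen_bilin] in auto)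
  have "galois_map K H A \<rho> (?s L) = galois_map K H A \<rho> (?s L')"
    using assms(4-6) by (simp add: galois_map_sum)
  then have "?s L = ?s L'"
    using galois c assms(4,5) by (auto simp: bij_betw_def inj_on_def)
  then show ?thesis using R2_lift_sum[OF assms(1-3), of L] R2_lift_sum[OF assms(1-3), of L'] assms(4,5) by simp
qed

text \<open>Chosen summands of \<open>\<kappa>(h)\<close>.\<close>

definition kl :: "'h \<Rightarrow> ('a \<times> 'a) list"
  where "kl h = (if h \<in> carrier H then SOME L. set L \<subseteq> carrier A \<times> carrier A \<and>
    translation K H A B \<rho> h = lsum R2 L (\<lambda>p. gen K R2 [fst p, snd p]) else [])"

lemma translation_facts:
  assumes "h \<in> carrier H"
  shows translation_closed: "translation K H A B \<rho> h \<in> carrier R2"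
    and galois_translation: "galois_map K H A \<rho> (translation K H A B \<rho> h) = gen K TT (1\<^sub>A, h)"
proof -
  have "gen K TT (1\<^sub>A, h) \<in> carrier TT" by (rule bilinD(3)[OF TT_bilin]) (use assms in auto)
  then show "translation K H A B \<rho> h \<in> carrier R2"
    "galois_map K H A \<rho> (translation K H A B \<rho> h) = gen K TT (1\<^sub>A, h)"
    using galois by (auto simp: translation_def bij_betw_def inv_into_into f_inv_into_f)
qed

lemma kl_spec:
  assumes "h \<in> carrier H"
  shows "set (kl h) \<subseteq> carrier A \<times> carrier A"
    and "translation K H A B \<rho> h = lsum R2 (kl h) (\<lambda>p. gen K R2 [fst p, snd p])"
proof -
  obtain L where L: "set L \<subseteq> tuples A 2" "translation K H A B \<rho> h = lsum R2 L (gen K R2)"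
    using A.rel_tensor_rep[OF B_sub _ translation_closed[OF assms]] by auto
  let ?L = "map (\<lambda>xs. (xs ! 0, xs ! 1)) L"
  have l: "xs = [xs ! 0, xs ! 1]" "xs ! 0 \<in> carrier A" "xs ! 1 \<in> carrier A" if "xs \<in> set L" for xs
    using that L(1) by (auto simp: tuples_Suc numeral_2_eq_2 subset_iff)
  have "translation K H A B \<rho> h = lsum R2 ?L (\<lambda>p. gen K R2 [fst p, snd p])"
    unfolding L(2) lsum_map fst_conv snd_conv by (rule lsum_cong) (simp only: l(1)[symmetric])
  moreover have "set ?L \<subseteq> carrier A \<times> carrier A" using l(2,3) by auto
  ultimately have "\<exists>L. set L \<subseteq> carrier A \<times> carrier A \<and>
      translation K H A B \<rho> h = lsum R2 L (\<lambda>p. gen K R2 [fst p, snd p])" by blast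
  from someI_ex[OF this] show "set (kl h) \<subseteq> carrier A \<times> carrier A"
    "translation K H A B \<rho> h = lsum R2 (kl h) (\<lambda>p. gen K R2 [fst p, snd p])"
    using assms by (simp_all add: kl_def)
qed

lemma kl_set [simp]: "p \<in> set (kl h) \<Longrightarrow> fst p \<in> carrier A" "p \<in> set (kl h) \<Longrightarrow> snd p \<in> carrier A"
  using kl_spec(1)[of h] by (cases "h \<in> carrier H"; auto simp: kl_def)+

lemma kl_set_pair: "(x, y) \<in> set (kl a) \<Longrightarrow> x \<in> carrier A \<and> y \<in> carrier A"
  using kl_set[of "(x, y)"] by simp

lemma gen_lift_translation:
  assumes "module K W" "bilin K A A W F"
    "\<And>x y b. x \<in> carrier A \<Longrightarrow> y \<in> carrier A \<Longrightarrow> b \<in> B \<Longrightarrow> F (x \<cdot> b) y = F x (b \<cdot> y)"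
    "h \<in> carrier H"
  shows "gen_lift K W (\<lambda>xs. F (xs ! 0) (xs ! 1)) (translation K H A B \<rho> h) = lsum W (kl h) (\<lambda>p. F (fst p) (snd p))"
  unfolding kl_spec(2)[OF assms(4)] by (rule R2_lift_sum[OF assms(1-3) kl_spec(1)[OF assms(4)]])

lemma kl_lin:
  assumes "module K W" "bilin K A A W F"
    "\<And>x y b. x \<in> carrier A \<Longrightarrow> y \<in> carrier A \<Longrightarrow> b \<in> B \<Longrightarrow> F (x \<cdot> b) y = F x (b \<cdot> y)"
  shows "(\<lambda>h. lsum W (kl h) (\<lambda>p. F (fst p) (snd p))) \<in> lin_hom K H W"
proof -
  have "(\<lambda>h. translation K H A B \<rho> h) \<in> lin_hom K H R2"
    unfolding translation_def
    by (rule lin_hom_comp[OF bilinD(1)[OF TT_bilin] lin_hom_inv_into[OF A.rel_tensor_module[OF B_sub] galois_map_lin galois]]) simp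
  moreover have "gen_lift K W (\<lambda>xs. F (xs ! 0) (xs ! 1)) \<in> lin_hom K R2 W"
    by (rule R2_lift_lin[OF assms])
  ultimately have "(\<lambda>h. gen_lift K W (\<lambda>xs. F (xs ! 0) (xs ! 1)) (translation K H A B \<rho> h)) \<in> lin_hom K H W"
    by (rule lin_hom_comp)
  moreover have "gen_lift K W (\<lambda>xs. F (xs ! 0) (xs ! 1)) (translation K H A B \<rho> h) = lsum W (kl h) (\<lambda>p. F (fst p) (snd p))"
    if "h \<in> carrier H" for h
    by (rule gen_lift_translation[OF assms(1,2) _ that]) (rule assms(3))
  ultimately show ?thesis by (rule lin_hom_cong[OF H.module])
qed

text \<open>\<open>\<Sum> \<kappa>\<^sup>1(h) \<kappa>\<^sup>2(h)\<^sub>0 \<otimes> \<kappa>\<^sup>2(h)\<^sub>1 = 1 \<otimes> h\<close>, which says that \<open>\<kappa>\<close> is a section of the Galois map.\<close>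

lemma kl_rl:
  assumes "module K W" "bilin K A H W F" "h \<in> carrier H"
  shows "lsum W (kl h) (\<lambda>p. lsum W (rl (snd p)) (\<lambda>q. F (fst p \<cdot> fst q) (snd q))) = F 1\<^sub>A h"
proof -
  let ?G = "gen_lift K W (\<lambda>(x, y). F x y)"
  note G = tensor_lift_lin[OF A.module H.module assms(1,2)]
  note g = tensor_lift_gen[OF A.module H.module assms(1,2)]
  have e: "lsum TT (kl h) (\<lambda>p. beta_sum (fst p) (snd p)) = gen K TT (1\<^sub>A, h)"
    using galois_map_sum[OF kl_spec(1)[OF assms(3)]] galois_translation[OF assms(3)] kl_spec(2)[OF assms(3)] by simp
  have "?G (lsum TT (kl h) (\<lambda>p. beta_sum (fst p) (snd p))) = lsum W (kl h) (\<lambda>p. ?G (beta_sum (fst p) (snd p)))"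
    by (rule lin_hom_lsum[OF TT_module assms(1) G], rule bilinD(3)[OF beta_sum_bilin]) auto
  also have "\<dots> = lsum W (kl h) (\<lambda>p. lsum W (rl (snd p)) (\<lambda>q. ?G (gen K TT (fst p \<cdot> fst q, snd q))))"
    unfolding beta_sum_def
    by (rule lsum_cong, rule lin_hom_lsum[OF TT_module assms(1) G], rule bilinD(3)[OF TT_bilin]) auto
  also have "\<dots> = lsum W (kl h) (\<lambda>p. lsum W (rl (snd p)) (\<lambda>q. F (fst p \<cdot> fst q) (snd q)))"
    by (rule lsum_cong, rule lsum_cong, rule g) auto
  finally show ?thesis unfolding e using g[of "1\<^sub>A" h] assms(3) by simp
qed

text \<open>\<open>\<Sum> a\<^sub>0 \<kappa>(a\<^sub>1) = 1 \<otimes> a\<close>, since the Galois map sends both sides to \<open>\<Sum> a\<^sub>0 \<otimes> a\<^sub>1\<close>.\<close>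

lemma rl_kl:
  assumes "module K W" "bilin K A A W F"
    "\<And>x y b. x \<in> carrier A \<Longrightarrow> y \<in> carrier A \<Longrightarrow> b \<in> B \<Longrightarrow> F (x \<cdot> b) y = F x (b \<cdot> y)"
    "a \<in> carrier A"
  shows "lsum W (rl a) (\<lambda>p. lsum W (kl (snd p)) (\<lambda>q. F (fst p \<cdot> fst q) (snd q))) = F 1\<^sub>A a"
proof -
  let ?L = "concat (map (\<lambda>p. map (\<lambda>q. (fst p \<cdot> fst q, snd q)) (kl (snd p))) (rl a))"
  have L: "set ?L \<subseteq> carrier A \<times> carrier A" by (auto dest!: rl_set_pair kl_set_pair)
  have conc: "lsum W' ?L (\<lambda>p. F (fst p) (snd p)) = lsum W' (rl a) (\<lambda>p. lsum W' (kl (snd p)) (\<lambda>q. F (fst p \<cdot> fst q) (snd q)))"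
    if "module K W'" "bilin K A A W' F" for W' :: "('k, 'z, 'u) module_scheme" and F
    using bilinD(3)[OF that(2)] by (subst module.lsum_concat[OF that(1)]) (auto dest!: rl_set_pair kl_set_pair)
  have "lsum TT ?L (\<lambda>p. beta_sum (fst p) (snd p))
      = lsum TT (rl a) (\<lambda>p. lsum TT (kl (snd p)) (\<lambda>q. beta_sum (fst p \<cdot> fst q) (snd q)))"
    by (rule conc[OF TT_module beta_sum_bilin])
  also have "\<dots> = lsum TT (rl a) (\<lambda>p. gen K TT (fst p \<cdot> 1\<^sub>A, snd p))"
  proof (rule lsum_cong)
    fix p assume p: "p \<in> set (rl a)"
    have "lsum TT (kl (snd p)) (\<lambda>q. beta_sum (fst p \<cdot> fst q) (snd q))
        = lsum TT (kl (snd p)) (\<lambda>q. lsum TT (rl (snd q)) (\<lambda>s. gen K TT (fst p \<cdot> (fst q \<cdot> fst s), snd s)))"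
      unfolding beta_sum_def by (rule lsum_cong, rule lsum_cong) (use p in \<open>simp add: A.A_assoc\<close>)
    also have "\<dots> = gen K TT (fst p \<cdot> 1\<^sub>A, snd p)"
      by (rule kl_rl[OF TT_module left_mult_bilin[OF TT_bilin]]) (use p in auto)
    finally show "lsum TT (kl (snd p)) (\<lambda>q. beta_sum (fst p \<cdot> fst q) (snd q)) = gen K TT (fst p \<cdot> 1\<^sub>A, snd p)" .
  qed
  also have "\<dots> = beta_sum 1\<^sub>A a" unfolding beta_sum_def by (rule lsum_cong) simp
  also have "\<dots> = lsum TT [(1\<^sub>A, a)] (\<lambda>p. beta_sum (fst p) (snd p))"
    by (subst module.lsum_single[OF TT_module]) (use bilinD(3)[OF beta_sum_bilin] assms(4) in auto)
  finally have eq: "lsum TT ?L (\<lambda>p. beta_sum (fst p) (snd p)) = \<dots>" .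
  have "lsum W ?L (\<lambda>p. F (fst p) (snd p)) = lsum W [(1\<^sub>A, a)] (\<lambda>p. F (fst p) (snd p))"
    by (rule galois_cancel[OF assms(1-3) L _ eq]) (use assms(4) in auto)
  also have "\<dots> = F 1\<^sub>A a"
    by (subst module.lsum_single[OF assms(1)]) (use bilinD(3)[OF assms(2)] assms(4) in auto)
  finally show ?thesis by (simp only: conc[OF assms(1,2)])
qed

lemma right_mult_bilin:
  assumes "bilin K A H W F" "x \<in> carrier A"
  shows "bilin K A H W (\<lambda>y h. F (y \<cdot> x) h)"
proof (rule bilinI)
  show "(\<lambda>y. F (y \<cdot> x) h) \<in> lin_hom K A W" if "h \<in> carrier H" for h
    by (rule lin_hom_comp[OF A.mult_lin_left[OF assms(2)] bilinD(2)[OF assms(1) that]])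
qed (use bilinD(1)[OF assms(1)] assms(2) in simp)

text \<open>\<open>b \<kappa>(h) = \<kappa>(h) b\<close>, since the Galois map sends both sides to \<open>b \<otimes> h\<close>.\<close>

lemma kl_commute:
  assumes "module K W" "bilin K A A W F"
    "\<And>x y b. x \<in> carrier A \<Longrightarrow> y \<in> carrier A \<Longrightarrow> b \<in> B \<Longrightarrow> F (x \<cdot> b) y = F x (b \<cdot> y)"
    "b \<in> B" "h \<in> carrier H"
  shows "lsum W (kl h) (\<lambda>q. F (b \<cdot> fst q) (snd q)) = lsum W (kl h) (\<lambda>q. F (fst q) (snd q \<cdot> b))"
proof -
  let ?L = "map (\<lambda>q. (b \<cdot> fst q, snd q)) (kl h)" and ?L' = "map (\<lambda>q. (fst q, snd q \<cdot> b)) (kl h)"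
  have b: "b \<in> carrier A" using assms(4) by simp
  have L: "set ?L \<subseteq> carrier A \<times> carrier A" "set ?L' \<subseteq> carrier A \<times> carrier A" using b by (auto dest!: kl_set_pair)
  have "lsum TT (kl h) (\<lambda>q. beta_sum (b \<cdot> fst q) (snd q))
      = lsum TT (kl h) (\<lambda>q. lsum TT (rl (snd q)) (\<lambda>s. gen K TT (b \<cdot> (fst q \<cdot> fst s), snd s)))"
    unfolding beta_sum_def by (rule lsum_cong, rule lsum_cong) (simp add: A.A_assoc b)
  also have "\<dots> = gen K TT (b \<cdot> 1\<^sub>A, h)" by (rule kl_rl[OF TT_module left_mult_bilin[OF TT_bilin b] assms(5)])
  also have "\<dots> = gen K TT (1\<^sub>A \<cdot> b, h)" using b by simp
  also have "\<dots> = lsum TT (kl h) (\<lambda>q. lsum TT (rl (snd q)) (\<lambda>s. gen K TT (fst q \<cdot> fst s \<cdot> b, snd s)))"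
    by (rule kl_rl[OF TT_module right_mult_bilin[OF TT_bilin b] assms(5), symmetric])
  also have "\<dots> = lsum TT (kl h) (\<lambda>q. lsum TT (rl (snd q)) (\<lambda>s. gen K TT (fst q \<cdot> (fst s \<cdot> b), snd s)))"
    by (rule lsum_cong, rule lsum_cong) (simp add: A.A_assoc b)
  also have "\<dots> = lsum TT (kl h) (\<lambda>q. beta_sum (fst q) (snd q \<cdot> b))"
    unfolding beta_sum_def
    by (rule lsum_cong, rule rl_coinv_right[OF TT_module left_mult_bilin[OF TT_bilin] assms(4), symmetric]) simp_all
  finally show ?thesis using galois_cancel[OF assms(1-3) L] by simp
qed

section \<open>The Ulbrich-Miyashita action and the tensor product over \<open>H\<close>\<close>

lemma AQ_facts:
  shows AQ_module: "module K AQ"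
    and cls_lin: "cls \<in> lin_hom K A AQ"
    and cls_surj: "carrier AQ = cls ` carrier A"
    and cls_comm: "a \<in> carrier A \<Longrightarrow> b \<in> B \<Longrightarrow> cls (a \<cdot> b) = cls (b \<cdot> a)"
    and AQ_lift_lin: "module K W \<Longrightarrow> f \<in> lin_hom K A W \<Longrightarrow>
          (\<And>x b. x \<in> carrier A \<Longrightarrow> b \<in> B \<Longrightarrow> f (x \<cdot> b) = f (b \<cdot> x)) \<Longrightarrow> quot_lift f \<in> lin_hom K AQ W"
    and AQ_lift_eq: "module K W \<Longrightarrow> f \<in> lin_hom K A W \<Longrightarrow>
          (\<And>x b. x \<in> carrier A \<Longrightarrow> b \<in> B \<Longrightarrow> f (x \<cdot> b) = f (b \<cdot> x)) \<Longrightarrow> x \<in> carrier A \<Longrightarrow>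
          quot_lift f (cls x) = f x"
proof -
  note f = bimod_quot_facts[where K = K and X = A and B = B and ra = "mult A" and la = "mult A",
      OF A.module, folded alg_quot_def]
  have e: "cls = (\<lambda>x. \<zero>\<^bsub>AQ\<^esub> +>\<^bsub>A\<^esub> x)" by (rule ext) (simp add: alg_class_def)
  show "module K AQ" by (rule f(1)) auto
  show "cls \<in> lin_hom K A AQ" unfolding e by (rule f(2)) auto
  show "carrier AQ = cls ` carrier A" unfolding e by (rule f(3)) auto
  show "cls (a \<cdot> b) = cls (b \<cdot> a)" if "a \<in> carrier A" "b \<in> B" unfolding e by (rule f(4)) (use that in auto)
  show "quot_lift f \<in> lin_hom K AQ W" if "module K W" "f \<in> lin_hom K A W"
    "\<And>x b. x \<in> carrier A \<Longrightarrow> b \<in> B \<Longrightarrow> f (x \<cdot> b) = f (b \<cdot> x)"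
    by (rule f(5)) (use that in auto)
  show "quot_lift f (cls x) = f x" if "module K W" "f \<in> lin_hom K A W"
    "\<And>x b. x \<in> carrier A \<Longrightarrow> b \<in> B \<Longrightarrow> f (x \<cdot> b) = f (b \<cdot> x)" "x \<in> carrier A"
    unfolding e by (rule f(6)) (use that in auto)
qed

lemma cls_closed [simp]: "a \<in> carrier A \<Longrightarrow> cls a \<in> carrier AQ"
  by (rule lin_hom_closed[OF cls_lin])

text \<open>\<open>y a x\<close> for \<open>x \<otimes> y\<close> in \<open>A \<otimes>\<^sub>B A\<close>, modulo commutators.\<close>

lemma sandwich_facts:
  assumes "a \<in> carrier A"
  shows sandwich_bilin: "bilin K A A AQ (\<lambda>x y. cls (y \<cdot> a \<cdot> x))"
    and sandwich_bal: "x \<in> carrier A \<Longrightarrow> y \<in> carrier A \<Longrightarrow> b \<in> B \<Longrightarrow>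
      cls (y \<cdot> a \<cdot> (x \<cdot> b)) = cls (b \<cdot> y \<cdot> a \<cdot> x)"
proof -
  show "bilin K A A AQ (\<lambda>x y. cls (y \<cdot> a \<cdot> x))"
  proof (rule bilinI)
    show "(\<lambda>y. cls (y \<cdot> a \<cdot> x)) \<in> lin_hom K A AQ" if "x \<in> carrier A" for x
      by (rule lin_hom_comp[OF lin_hom_comp[OF A.mult_lin_left[OF assms] A.mult_lin_left[OF that]] cls_lin])
    show "(\<lambda>x. cls (y \<cdot> a \<cdot> x)) \<in> lin_hom K A AQ" if "y \<in> carrier A" for y
      by (rule lin_hom_comp[OF A.mult_lin_right cls_lin]) (use that assms in simp)
  qed
  show "cls (y \<cdot> a \<cdot> (x \<cdot> b)) = cls (b \<cdot> y \<cdot> a \<cdot> x)"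
    if "x \<in> carrier A" "y \<in> carrier A" "b \<in> B"
    using cls_comm[of "y \<cdot> a \<cdot> x" b] that assms by (simp add: A.A_assoc)
qed

text \<open>By \<open>kl_commute\<close>, \<open>a b\<close> and \<open>b a\<close> have the same image, so that the action is well defined on \<open>A\<^sub>B\<close>.\<close>

lemma um_act_facts:
  assumes h: "h \<in> carrier H"
  shows um_act_lin: "um_act K H A B \<rho> h \<in> lin_hom K AQ AQ"
    and um_act_cls: "a \<in> carrier A \<Longrightarrow>
      um_act K H A B \<rho> h (cls a) = lsum AQ (kl h) (\<lambda>p. cls (snd p \<cdot> a \<cdot> fst p))"
proof -
  let ?g = "\<lambda>a. lsum AQ (kl h) (\<lambda>p. cls (snd p \<cdot> a \<cdot> fst p))"
  let ?f = "\<lambda>a. gen_lift K AQ (\<lambda>xs. cls (xs ! 1 \<cdot> a \<cdot> xs ! 0)) (translation K H A B \<rho> h)"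
  have fg: "?g a = ?f a" if "a \<in> carrier A" for a
    by (rule gen_lift_translation[OF AQ_module sandwich_bilin[OF that] _ h, symmetric])
      (rule sandwich_bal[OF that])
  have eq: "um_act K H A B \<rho> h = quot_lift ?f" by (simp add: um_act_def)
  have "?g \<in> lin_hom K A AQ"
    by (rule module.lin_lsum[OF AQ_module], rule lin_hom_comp[OF lin_hom_comp[OF A.mult_lin_right A.mult_lin_left] cls_lin]) auto
  then have l: "?f \<in> lin_hom K A AQ" by (rule lin_hom_cong[OF A.module]) (rule fg)
  have b: "?f (a \<cdot> b) = ?f (b \<cdot> a)" if a: "a \<in> carrier A" and "b \<in> B" for a b
  proof -
    have "lsum AQ (kl h) (\<lambda>q. cls (snd q \<cdot> a \<cdot> (b \<cdot> fst q)))
        = lsum AQ (kl h) (\<lambda>q. cls (snd q \<cdot> b \<cdot> a \<cdot> fst q))"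
      by (rule kl_commute[OF AQ_module sandwich_bilin[OF a] sandwich_bal[OF a] \<open>b \<in> B\<close> h])
    moreover have "lsum AQ (kl h) (\<lambda>q. cls (snd q \<cdot> a \<cdot> (b \<cdot> fst q))) = ?g (a \<cdot> b)"
      by (rule lsum_cong) (use that in \<open>simp add: A.A_assoc\<close>)
    moreover have "lsum AQ (kl h) (\<lambda>q. cls (snd q \<cdot> b \<cdot> a \<cdot> fst q)) = ?g (b \<cdot> a)"
      by (rule lsum_cong) (use that in \<open>simp add: A.A_assoc\<close>)
    ultimately show ?thesis using that by (simp add: fg[symmetric] del: One_nat_def)
  qed
  show "um_act K H A B \<rho> h \<in> lin_hom K AQ AQ" unfolding eq by (rule AQ_lift_lin[OF AQ_module l b])
  show "um_act K H A B \<rho> h (cls a) = ?g a" if "a \<in> carrier A"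
    unfolding eq fg[OF that] by (rule AQ_lift_eq[OF AQ_module l b that])
qed

text \<open>\<open>\<Sum> y\<^sub>1 \<cdot> [x y\<^sub>0] = [y x]\<close>, by applying \<open>u \<otimes> v \<mapsto> [v x u]\<close> to \<open>\<Sum> y\<^sub>0 \<kappa>(y\<^sub>1) = 1 \<otimes> y\<close>. Stability of the
  module-comodule \<open>A\<^sub>B\<close> is the case \<open>x = 1\<close>. The general case turns the relations of the tensor
  product over \<open>H\<close> into commutators.\<close>

lemma um_act_coaction:
  assumes "x \<in> carrier A" "y \<in> carrier A"
  shows "lsum AQ (rl y) (\<lambda>p. um_act K H A B \<rho> (snd p) (cls (x \<cdot> fst p))) = cls (y \<cdot> x)"
proof -
  have "lsum AQ (rl y) (\<lambda>p. um_act K H A B \<rho> (snd p) (cls (x \<cdot> fst p)))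
      = lsum AQ (rl y) (\<lambda>p. lsum AQ (kl (snd p)) (\<lambda>q. cls (snd q \<cdot> x \<cdot> (fst p \<cdot> fst q))))"
  proof (rule lsum_cong)
    fix p assume p: "p \<in> set (rl y)"
    have "um_act K H A B \<rho> (snd p) (cls (x \<cdot> fst p))
        = lsum AQ (kl (snd p)) (\<lambda>q. cls (snd q \<cdot> (x \<cdot> fst p) \<cdot> fst q))"
      by (rule um_act_cls) (use p assms in auto)
    also have "\<dots> = lsum AQ (kl (snd p)) (\<lambda>q. cls (snd q \<cdot> x \<cdot> (fst p \<cdot> fst q)))"
      by (rule lsum_cong) (use p assms in \<open>simp add: A.A_assoc\<close>)
    finally show "um_act K H A B \<rho> (snd p) (cls (x \<cdot> fst p)) = \<dots>" .
  qed
  also have "\<dots> = cls (y \<cdot> x \<cdot> 1\<^sub>A)"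
    by (rule rl_kl[OF AQ_module sandwich_bilin[OF assms(1)] sandwich_bal[OF assms(1)] assms(2)])
  finally show ?thesis using assms by simp
qed

abbreviation "SH n \<equiv> hopf_space K H A B \<rho> n"
abbreviation "Tp n \<equiv> tensor_power K H (Suc n)"

definition SH_rels :: "nat \<Rightarrow> (('h list \<Rightarrow> 'k) set \<times> 'a set \<Rightarrow> 'k) set"
  where "SH_rels n = {basis_vec K (diag_act K H n X h, m)
      \<ominus>\<^bsub>free_module K (carrier (Tp n) \<times> carrier AQ)\<^esub> basis_vec K (X, um_act K H A B \<rho> h m) | X h m.
      X \<in> carrier (Tp n) \<and> h \<in> carrier H \<and> m \<in> carrier AQ}"

lemma SH_eq: "SH n = pair_rels K (Tp n) AQ (SH_rels n)"
  by (simp add: hopf_space_def tensor_over_def SH_rels_def Let_def)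

lemma Tp_module: "module K (Tp n)" by (rule tensor_power_module[OF H.module])

lemma SH_rels_closed: "SH_rels n \<subseteq> carrier (free_module K (carrier (Tp n) \<times> carrier AQ))"
proof
  have cr: "cring K" using A.module by (simp add: module_def)
  fix r assume "r \<in> SH_rels n"
  then obtain X h m where r: "r = basis_vec K (diag_act K H n X h, m)
      \<ominus>\<^bsub>free_module K (carrier (Tp n) \<times> carrier AQ)\<^esub> basis_vec K (X, um_act K H A B \<rho> h m)"
    "X \<in> carrier (Tp n)" "h \<in> carrier H" "m \<in> carrier AQ" unfolding SH_rels_def by blast
  show "r \<in> carrier (free_module K (carrier (Tp n) \<times> carrier AQ))"
    unfolding r(1)
    by (rule free_rels_closed(1)[OF cr])
      (use r lin_hom_closed[OF H.diag_act_lin] lin_hom_closed[OF um_act_lin] in auto)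
qed

lemma SH_module: "module K (SH n)"
  unfolding SH_eq by (rule pair_rels_module[OF Tp_module AQ_module SH_rels_closed])

lemma SH_gen_bilin: "bilin K (Tp n) AQ (SH n) (\<lambda>X m. gen K (SH n) (X, m))"
  unfolding SH_eq by (rule pair_gen_bilin[OF Tp_module AQ_module SH_rels_closed])

lemma SH_gen_act:
  assumes "X \<in> carrier (Tp n)" "h \<in> carrier H" "m \<in> carrier AQ"
  shows "gen K (SH n) (diag_act K H n X h, m) = gen K (SH n) (X, um_act K H A B \<rho> h m)"
  unfolding SH_eq
proof (rule presented_gen_eq)
  show "cring K" using A.module by (simp add: module_def)
  show "bilinear_rels K (Tp n) AQ \<union> SH_rels n \<subseteq> carrier (free_module K (carrier (Tp n) \<times> carrier AQ))"
    using bilinear_rels_closed[OF Tp_module AQ_module] SH_rels_closed by (rule Un_least)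
  show "basis_vec K (diag_act K H n X h, m) \<ominus>\<^bsub>free_module K (carrier (Tp n) \<times> carrier AQ)\<^esub>
      basis_vec K (X, um_act K H A B \<rho> h m) \<in> bilinear_rels K (Tp n) AQ \<union> SH_rels n"
    unfolding SH_rels_def using assms by blast
qed (use assms lin_hom_closed[OF H.diag_act_lin] lin_hom_closed[OF um_act_lin] in auto)

text \<open>The generator \<open>(h\<^sup>0, \<dots>, h\<^sup>n) \<otimes>\<^sub>H [a]\<close>.\<close>

definition sg :: "nat \<Rightarrow> 'h list \<Rightarrow> 'a \<Rightarrow> (('h list \<Rightarrow> 'k) set \<times> 'a set \<Rightarrow> 'k) set"
  where "sg n hs a = gen K (SH n) (gen K (Tp n) hs, cls a)"

lemma Tp_gen_closed [simp]: "hs \<in> tuples H (Suc n) \<Longrightarrow> gen K (Tp n) hs \<in> carrier (Tp n)"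
  by (rule mlin_closed[OF tensor_power_gen_mlin[OF H.module]])

lemma sg_mlin: "a \<in> carrier A \<Longrightarrow> mlin K H (SH n) (Suc n) (\<lambda>hs. sg n hs a)"
  unfolding sg_def by (rule mlin_lin[OF tensor_power_gen_mlin[OF H.module] bilinD(2)[OF SH_gen_bilin]]) simp

lemma sg_lin: "hs \<in> tuples H (Suc n) \<Longrightarrow> (\<lambda>a. sg n hs a) \<in> lin_hom K A (SH n)"
  unfolding sg_def by (rule lin_hom_comp[OF cls_lin bilinD(1)[OF SH_gen_bilin]]) simp

lemma sg_closed: "hs \<in> tuples H (Suc n) \<Longrightarrow> a \<in> carrier A \<Longrightarrow> sg n hs a \<in> carrier (SH n)"
  by (rule lin_hom_closed[OF sg_lin])

lemma SH_act:
  assumes "hs \<in> tuples H (Suc n)" "h \<in> carrier H" "m \<in> carrier AQ"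
  shows "lsum (SH n) (H.dn n h) (\<lambda>ds. gen K (SH n) (gen K (Tp n) (hs \<bullet> ds), m))
    = gen K (SH n) (gen K (Tp n) hs, um_act K H A B \<rho> h m)"
proof -
  have "gen K (SH n) (gen K (Tp n) hs, um_act K H A B \<rho> h m)
      = gen K (SH n) (lsum (Tp n) (H.dn n h) (\<lambda>ds. gen K (Tp n) (hs \<bullet> ds)), m)"
    using SH_gen_act[of "gen K (Tp n) hs" n h m] assms by (simp add: H.diag_act_gen)
  also have "\<dots> = lsum (SH n) (H.dn n h) (\<lambda>ds. gen K (SH n) (gen K (Tp n) (hs \<bullet> ds), m))"
    by (rule lin_hom_lsum[OF Tp_module SH_module bilinD(2)[OF SH_gen_bilin]])
      (use assms H.tuples_map2 H.dn_tuples in auto)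
  finally show ?thesis by simp
qed

text \<open>The relations of the tensor product over \<open>H\<close>, in a form that mentions neither \<open>\<kappa>\<close> nor the action
  on \<open>A\<^sub>B\<close>.\<close>

lemma sg_key:
  assumes "hs \<in> tuples H (Suc n)" "x \<in> carrier A" "y \<in> carrier A"
  shows "lsum (SH n) (rl y) (\<lambda>p. lsum (SH n) (H.dn n (snd p)) (\<lambda>ds. sg n (hs \<bullet> ds) (x \<cdot> fst p)))
    = sg n hs (y \<cdot> x)"
proof -
  have "lsum (SH n) (rl y) (\<lambda>p. lsum (SH n) (H.dn n (snd p)) (\<lambda>ds. sg n (hs \<bullet> ds) (x \<cdot> fst p)))
      = lsum (SH n) (rl y) (\<lambda>p. gen K (SH n) (gen K (Tp n) hs, um_act K H A B \<rho> (snd p) (cls (x \<cdot> fst p))))"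
    unfolding sg_def by (rule lsum_cong, rule SH_act[OF assms(1)]) (use assms in auto)
  also have "\<dots> = gen K (SH n) (gen K (Tp n) hs, lsum AQ (rl y) (\<lambda>p. um_act K H A B \<rho> (snd p) (cls (x \<cdot> fst p))))"
    by (rule lin_hom_lsum[OF AQ_module SH_module bilinD(1)[OF SH_gen_bilin], symmetric])
      (use assms in \<open>auto intro!: lin_hom_closed[OF um_act_lin] dest!: rl_set_pair\<close>)
  finally show ?thesis using assms by (simp add: um_act_coaction sg_def)
qed

lemma SH_rep:
  assumes "q \<in> carrier (SH n)"
  shows "\<exists>L. set L \<subseteq> tuples H (Suc n) \<times> carrier A \<and> q = lsum (SH n) L (\<lambda>p. sg n (fst p) (snd p))"
proof -
  note b = SH_gen_bilin[of n]
  interpret S: module K "SH n" by (rule SH_module)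
  let ?P = "\<lambda>q. \<exists>L. set L \<subseteq> tuples H (Suc n) \<times> carrier A \<and> q = lsum (SH n) L (\<lambda>p. sg n (fst p) (snd p))"
  have c: "sg n (fst p) (snd p) \<in> carrier (SH n)" if "p \<in> tuples H (Suc n) \<times> carrier A" for p
    using that sg_closed by auto
  obtain L where L: "set L \<subseteq> carrier (Tp n) \<times> carrier AQ" "q = lsum (SH n) L (\<lambda>p. gen K (SH n) (fst p, snd p))"
    using pair_rep[OF Tp_module AQ_module SH_rels_closed assms[unfolded SH_eq]] unfolding SH_eq by blast
  have one: "?P (gen K (SH n) (X, m))" if X: "X \<in> carrier (Tp n)" and m: "m \<in> carrier AQ" for X m
  proof -
    obtain a where a: "a \<in> carrier A" "m = cls a" using m cls_surj by auto
    obtain M where M: "set M \<subseteq> tuples H (Suc n)" "X = lsum (Tp n) M (gen K (Tp n))"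
      using tensor_power_rep[OF H.module _ X] by auto
    have "gen K (SH n) (X, m) = lsum (SH n) M (\<lambda>hs. gen K (SH n) (gen K (Tp n) hs, m))"
      unfolding M(2) by (rule lin_hom_lsum[OF Tp_module SH_module bilinD(2)[OF b m]]) (use M(1) in auto)
    then show ?thesis using M a by (intro exI[of _ "map (\<lambda>hs. (hs, a)) M"]) (auto simp: sg_def)
  qed
  show ?thesis unfolding L(2) using L(1)
  proof (induction L)
    case Nil then show ?case by (intro exI[of _ "[]"]) simp
  next
    case (Cons p L)
    obtain L1 where L1: "set L1 \<subseteq> tuples H (Suc n) \<times> carrier A"
      "gen K (SH n) (fst p, snd p) = lsum (SH n) L1 (\<lambda>p. sg n (fst p) (snd p))"
      using one[of "fst p" "snd p"] Cons.prems by auto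
    obtain L2 where L2: "set L2 \<subseteq> tuples H (Suc n) \<times> carrier A"
      "lsum (SH n) L (\<lambda>p. gen K (SH n) (fst p, snd p)) = lsum (SH n) L2 (\<lambda>p. sg n (fst p) (snd p))"
      using Cons by auto
    have "lsum (SH n) (L1 @ L2) (\<lambda>p. sg n (fst p) (snd p))
        = lsum (SH n) L1 (\<lambda>p. sg n (fst p) (snd p)) \<oplus>\<^bsub>SH n\<^esub> lsum (SH n) L2 (\<lambda>p. sg n (fst p) (snd p))"
      by (rule S.lsum_append; rule c) (use L1 L2 in auto)
    then show ?case using L1 L2 by (intro exI[of _ "L1 @ L2"]) simp
  qed
qed

lemma SH_lift_act:
  assumes "module K W" "bilin K (Tp n) AQ W f"
    and act: "\<And>hs h m. hs \<in> tuples H (Suc n) \<Longrightarrow> h \<in> carrier H \<Longrightarrow> m \<in> carrier AQ \<Longrightarrow>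
      lsum W (H.dn n h) (\<lambda>ds. f (gen K (Tp n) (hs \<bullet> ds)) m) = f (gen K (Tp n) hs) (um_act K H A B \<rho> h m)"
  shows SH_lift_act_lin: "gen_lift K W (\<lambda>(X, m). f X m) \<in> lin_hom K (SH n) W"
    and SH_lift_act_gen: "X \<in> carrier (Tp n) \<Longrightarrow> m \<in> carrier AQ \<Longrightarrow>
      gen_lift K W (\<lambda>(X, m). f X m) (gen K (SH n) (X, m)) = f X m"
proof -
  note W = assms(1) and f = bilinD[OF assms(2)]
  have bal_gen: "f (diag_act K H n (gen K (Tp n) hs) h) m = f (gen K (Tp n) hs) (um_act K H A B \<rho> h m)"
    if hs: "hs \<in> tuples H (Suc n)" and h: "h \<in> carrier H" and m: "m \<in> carrier AQ" for hs h m
    unfolding H.diag_act_gen[OF hs h] act[OF hs h m, symmetric]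
    by (rule lin_hom_lsum[OF Tp_module W f(2)[OF m]]) (use H.tuples_map2[OF hs] H.dn_tuples[OF h] in auto)
  have bal: "f (diag_act K H n X h) m = f X (um_act K H A B \<rho> h m)"
    if X: "X \<in> carrier (Tp n)" and h: "h \<in> carrier H" and m: "m \<in> carrier AQ" for X h m
  proof -
    obtain M where M: "set M \<subseteq> tuples H (Suc n)" "X = lsum (Tp n) M (gen K (Tp n))"
      using tensor_power_rep[OF H.module _ X] by auto
    have um: "um_act K H A B \<rho> h m \<in> carrier AQ" by (rule lin_hom_closed[OF um_act_lin[OF h] m])
    have "f (diag_act K H n X h) m = lsum W M (\<lambda>hs. f (diag_act K H n (gen K (Tp n) hs) h) m)"
      unfolding M(2) by (rule lin_hom_lsum[OF Tp_module W lin_hom_comp[OF H.diag_act_lin[OF h] f(2)[OF m]]]) (use M(1) in auto)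
    also have "\<dots> = lsum W M (\<lambda>hs. f (gen K (Tp n) hs) (um_act K H A B \<rho> h m))"
      by (rule lsum_cong, rule bal_gen[OF _ h m]) (use M(1) in auto)
    also have "\<dots> = f X (um_act K H A B \<rho> h m)"
      unfolding M(2) by (rule lin_hom_lsum[OF Tp_module W f(2)[OF um], symmetric]) (use M(1) in auto)
    finally show ?thesis .
  qed
  have k: "lin_ext K W (\<lambda>(X, m). f X m) r = \<zero>\<^bsub>W\<^esub>" if rel: "r \<in> SH_rels n" for r
  proof -
    obtain X h m where r: "r = basis_vec K (diag_act K H n X h, m)
        \<ominus>\<^bsub>free_module K (carrier (Tp n) \<times> carrier AQ)\<^esub> basis_vec K (X, um_act K H A B \<rho> h m)"
      "X \<in> carrier (Tp n)" "h \<in> carrier H" "m \<in> carrier AQ"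
      using rel unfolding SH_rels_def by blast
    have d: "diag_act K H n X h \<in> carrier (Tp n)" by (rule lin_hom_closed[OF H.diag_act_lin[OF r(3)] r(2)])
    have u: "um_act K H A B \<rho> h m \<in> carrier AQ" by (rule lin_hom_closed[OF um_act_lin[OF r(3)] r(4)])
    have "lin_ext K W (\<lambda>(X, m). f X m) r = (\<lambda>(X, m). f X m) (diag_act K H n X h, m)
        \<ominus>\<^bsub>W\<^esub> (\<lambda>(X, m). f X m) (X, um_act K H A B \<rho> h m)"
      unfolding r(1) by (rule lin_ext_diff[OF W]) (use f(3) d u r in auto)
    then show ?thesis using module_diff_zero[OF W f(3)[OF d r(4)] f(3)[OF r(2) u]] bal[OF r(2-4)] by simp
  qed
  show "gen_lift K W (\<lambda>(X, m). f X m) \<in> lin_hom K (SH n) W"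
    unfolding SH_eq by (rule pair_lift(1)[OF Tp_module AQ_module SH_rels_closed W assms(2) k])
  show "gen_lift K W (\<lambda>(X, m). f X m) (gen K (SH n) (X, m)) = f X m" if "X \<in> carrier (Tp n)" "m \<in> carrier AQ"
    unfolding SH_eq by (rule pair_lift(2)[OF Tp_module AQ_module SH_rels_closed W assms(2) k that])
qed

text \<open>Conversely, the identities of \<open>sg_key\<close> imply all relations: by the Galois property every \<open>a \<otimes> h\<close> is a sum of
  elements \<open>x y\<^sub>0 \<otimes> y\<^sub>1\<close>.\<close>

lemma SH_lift:
  assumes "module K W" "bilin K (Tp n) AQ W f"
    and key: "\<And>hs x y. hs \<in> tuples H (Suc n) \<Longrightarrow> x \<in> carrier A \<Longrightarrow> y \<in> carrier A \<Longrightarrow>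
      lsum W (rl y) (\<lambda>p. lsum W (H.dn n (snd p)) (\<lambda>ds. f (gen K (Tp n) (hs \<bullet> ds)) (cls (x \<cdot> fst p))))
      = f (gen K (Tp n) hs) (cls (y \<cdot> x))"
  shows SH_lift_lin: "gen_lift K W (\<lambda>(X, m). f X m) \<in> lin_hom K (SH n) W"
    and SH_lift_gen: "X \<in> carrier (Tp n) \<Longrightarrow> m \<in> carrier AQ \<Longrightarrow>
      gen_lift K W (\<lambda>(X, m). f X m) (gen K (SH n) (X, m)) = f X m"
proof -
  note W = assms(1) and f = bilinD[OF assms(2)]
  note gm = tensor_power_gen_mlin[OF H.module, of "Suc n"]
  have act: "lsum W (H.dn n h) (\<lambda>ds. f (gen K (Tp n) (hs \<bullet> ds)) m) = f (gen K (Tp n) hs) (um_act K H A B \<rho> h m)"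
    if hs: "hs \<in> tuples H (Suc n)" and h: "h \<in> carrier H" and m: "m \<in> carrier AQ" for hs h m
  proof -
    obtain a where a: "a \<in> carrier A" "m = cls a" using m cls_surj by auto
    let ?F = "\<lambda>a h. lsum W (H.dn n h) (\<lambda>ds. f (gen K (Tp n) (hs \<bullet> ds)) (cls a))"
    have Fb: "bilin K A H W ?F"
    proof (rule bilinI)
      show "(\<lambda>h. ?F a h) \<in> lin_hom K H W" if "a \<in> carrier A" for a
        by (rule H.dn_lin[OF W], rule H.mlin_map2_right[OF mlin_lin[OF gm f(2)] hs]) (use that in simp)
      show "(\<lambda>a. ?F a h) \<in> lin_hom K A W" if "h \<in> carrier H" for h
        by (rule module.lin_lsum[OF W], rule lin_hom_comp[OF cls_lin f(1)])
          (use H.tuples_map2[OF hs] H.dn_tuples[OF that] in auto)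
    qed
    have "lsum W (H.dn n h) (\<lambda>ds. f (gen K (Tp n) (hs \<bullet> ds)) m) = ?F (a \<cdot> 1\<^sub>A) h"
      using a by simp
    \<comment> \<open>\<open>a \<otimes> h\<close> is the sum of the \<open>x y\<^sub>0 \<otimes> y\<^sub>1\<close> with \<open>x = a \<kappa>\<^sup>1(h)\<close> and \<open>y = \<kappa>\<^sup>2(h)\<close>.\<close>
    also have "\<dots> = lsum W (kl h) (\<lambda>p. lsum W (rl (snd p)) (\<lambda>q. ?F (a \<cdot> (fst p \<cdot> fst q)) (snd q)))"
      by (rule kl_rl[OF W left_mult_bilin[OF Fb a(1)] h, symmetric])
    also have "\<dots> = lsum W (kl h) (\<lambda>p. lsum W (rl (snd p)) (\<lambda>q. ?F (a \<cdot> fst p \<cdot> fst q) (snd q)))"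
      by (rule lsum_cong, rule lsum_cong) (simp add: A.A_assoc a(1))
    also have "\<dots> = lsum W (kl h) (\<lambda>p. f (gen K (Tp n) hs) (cls (snd p \<cdot> (a \<cdot> fst p))))"
      by (rule lsum_cong, rule key[OF hs]) (use a(1) in auto)
    also have "\<dots> = f (gen K (Tp n) hs) (lsum AQ (kl h) (\<lambda>p. cls (snd p \<cdot> (a \<cdot> fst p))))"
      by (rule lin_hom_lsum[OF AQ_module W f(1), symmetric]) (use hs a(1) in auto)
    also have "lsum AQ (kl h) (\<lambda>p. cls (snd p \<cdot> (a \<cdot> fst p))) = um_act K H A B \<rho> h m"
      unfolding a(2) um_act_cls[OF h a(1)] by (rule lsum_cong) (use a(1) in \<open>simp add: A.A_assoc\<close>)
    finally show ?thesis .
  qed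
  show "gen_lift K W (\<lambda>(X, m). f X m) \<in> lin_hom K (SH n) W"
    by (rule SH_lift_act_lin[OF W assms(2) act])
  show "gen_lift K W (\<lambda>(X, m). f X m) (gen K (SH n) (X, m)) = f X m" if "X \<in> carrier (Tp n)" "m \<in> carrier AQ"
    by (rule SH_lift_act_gen[OF W assms(2) act that])
qed

text \<open>The same for a map given on generators; the third assumption lets it pass to \<open>A\<^sub>B\<close>.\<close>

lemma SH_lift_list:
  assumes "module K W"
    and m: "\<And>a. a \<in> carrier A \<Longrightarrow> mlin K H W (Suc n) (\<lambda>hs. F hs a)"
    and l: "\<And>hs. hs \<in> tuples H (Suc n) \<Longrightarrow> (\<lambda>a. F hs a) \<in> lin_hom K A W"
    and c: "\<And>hs a b. hs \<in> tuples H (Suc n) \<Longrightarrow> a \<in> carrier A \<Longrightarrow> b \<in> B \<Longrightarrow> F hs (a \<cdot> b) = F hs (b \<cdot> a)"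
    and key: "\<And>hs x y. hs \<in> tuples H (Suc n) \<Longrightarrow> x \<in> carrier A \<Longrightarrow> y \<in> carrier A \<Longrightarrow>
      lsum W (rl y) (\<lambda>p. lsum W (H.dn n (snd p)) (\<lambda>ds. F (hs \<bullet> ds) (x \<cdot> fst p)))
      = F hs (y \<cdot> x)"
  shows "\<exists>\<Psi>\<in>lin_hom K (SH n) W. \<forall>hs\<in>tuples H (Suc n). \<forall>a\<in>carrier A. \<Psi> (sg n hs a) = F hs a"
proof -
  note W = assms(1)
  let ?q = "\<lambda>m hs. quot_lift (F hs) m"
  have q: "?q (cls a) hs = F hs a" if "hs \<in> tuples H (Suc n)" "a \<in> carrier A" for hs a
    by (rule AQ_lift_eq[OF W l[OF that(1)] c[OF that(1)] that(2)])
  have ql: "(\<lambda>m. ?q m hs) \<in> lin_hom K AQ W" if "hs \<in> tuples H (Suc n)" for hs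
    by (rule AQ_lift_lin[OF W l[OF that] c[OF that]])
  have qm: "mlin K H W (Suc n) (?q m')" if m': "m' \<in> carrier AQ" for m'
  proof -
    obtain a where a: "a \<in> carrier A" "m' = cls a" using m' cls_surj by auto
    show ?thesis unfolding a(2) by (rule mlin_cong[OF H.module m[OF a(1)]]) (simp add: q a(1))
  qed
  let ?f = "\<lambda>X m. gen_lift K W (?q m) X"
  have fb: "bilin K (Tp n) AQ W ?f"
  proof (rule bilinI)
    show "(\<lambda>X. ?f X m) \<in> lin_hom K (Tp n) W" if "m \<in> carrier AQ" for m
      by (rule tensor_power_lift_lin[OF H.module W qm[OF that]])
    fix X assume "X \<in> carrier (Tp n)"
    then obtain M where M: "set M \<subseteq> tuples H (Suc n)" "X = lsum (Tp n) M (gen K (Tp n))"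
      using tensor_power_rep[OF H.module, of "Suc n" X] by auto
    have "(\<lambda>m. lsum W M (?q m)) \<in> lin_hom K AQ W"
      by (rule module.lin_lsum[OF W], rule ql) (use M(1) in auto)
    then show "(\<lambda>m. ?f X m) \<in> lin_hom K AQ W"
      by (rule lin_hom_cong[OF AQ_module]) (simp only: M(2) tensor_power_lift_sum[OF H.module W qm M(1)])
  qed
  have fg: "?f (gen K (Tp n) hs) (cls a) = F hs a" if "hs \<in> tuples H (Suc n)" "a \<in> carrier A" for hs a
    using tensor_power_lift_gen[OF H.module W qm that(1)] q[OF that] that by simp
  have fk: "lsum W (rl y) (\<lambda>p. lsum W (H.dn n (snd p)) (\<lambda>ds. ?f (gen K (Tp n) (hs \<bullet> ds)) (cls (x \<cdot> fst p))))
      = ?f (gen K (Tp n) hs) (cls (y \<cdot> x))"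
    if hs: "hs \<in> tuples H (Suc n)" and x: "x \<in> carrier A" and y: "y \<in> carrier A" for hs x y
  proof -
    have "lsum W (rl y) (\<lambda>p. lsum W (H.dn n (snd p)) (\<lambda>ds. ?f (gen K (Tp n) (hs \<bullet> ds)) (cls (x \<cdot> fst p))))
      = lsum W (rl y) (\<lambda>p. lsum W (H.dn n (snd p)) (\<lambda>ds. F (hs \<bullet> ds) (x \<cdot> fst p)))"
      by (rule lsum_cong, rule lsum_cong, rule fg, rule H.tuples_map2[OF hs], rule H.dn_tuples) (use x in auto)
    then show ?thesis using key[OF that] fg[OF hs, of "y \<cdot> x"] x y by simp
  qed
  show ?thesis
  proof (intro bexI[of _ "gen_lift K W (\<lambda>(X, m). ?f X m)"] ballI)
    show "gen_lift K W (\<lambda>(X, m). ?f X m) \<in> lin_hom K (SH n) W" by (rule SH_lift_lin[OF W fb fk])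
    show "gen_lift K W (\<lambda>(X, m). ?f X m) (sg n hs a) = F hs a" if "hs \<in> tuples H (Suc n)" "a \<in> carrier A" for hs a
      unfolding sg_def using SH_lift_gen[OF W fb fk, of "gen K (Tp n) hs" "cls a"] fg[OF that] that by simp
  qed
qed

end

section \<open>The cyclic object of a subalgebra\<close>

locale algebra_pair = A: k_algebra K A
  for K :: "('k,'r) ring_scheme" and A :: "('k,'a) module" +
  fixes B :: "'a set"
  assumes B_sub: "B \<subseteq> carrier A"
begin

abbreviation "RT n \<equiv> rel_tensor_power K A B (Suc n)"
abbreviation "Z n \<equiv> rel_space K A B n"
abbreviation "zc n \<equiv> rel_class K A B n"

lemma B_cl [simp]: "b \<in> B \<Longrightarrow> b \<in> carrier A" using B_sub by auto

definition lft :: "'a \<Rightarrow> 'a list \<Rightarrow> 'a list" where "lft b as = (b \<cdot> hd as) # tl as"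
definition rgt :: "'a \<Rightarrow> 'a list \<Rightarrow> 'a list" where "rgt b as = butlast as @ [last as \<cdot> b]"
definition rot :: "'a list \<Rightarrow> 'a list" where "rot as = last as # butlast as"

fun mrg :: "nat \<Rightarrow> 'a list \<Rightarrow> 'a list" where
  "mrg 0 (a # c # as) = (a \<cdot> c) # as"
| "mrg (Suc i) (a # as) = a # mrg i as"
| "mrg _ as = as"

fun ins :: "nat \<Rightarrow> 'a list \<Rightarrow> 'a list" where
  "ins 0 (a # as) = a # 1\<^sub>A # as"
| "ins (Suc i) (a # as) = a # ins i as"
| "ins _ [] = []"

lemma lft_Cons [simp]: "lft b (a # as) = (b \<cdot> a) # as" by (simp add: lft_def)
lemma rgt_single [simp]: "rgt b [a] = [a \<cdot> b]" by (simp add: rgt_def)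
lemma rgt_Cons [simp]: "rgt b (a # c # as) = a # rgt b (c # as)" by (simp add: rgt_def)
lemma rgt_snoc [simp]: "rgt b (as @ [a]) = as @ [a \<cdot> b]" by (simp add: rgt_def)
lemma rot_snoc [simp]: "rot (as @ [a]) = a # as" by (simp add: rot_def)
lemma rot_single [simp]: "rot [a] = [a]" by (simp add: rot_def)

lemma mrg_take_drop:
  "Suc i < length as \<Longrightarrow> mrg i as = take i as @ [as ! i \<cdot> as ! Suc i] @ drop (Suc (Suc i)) as"
proof (induction i as rule: mrg.induct)
  case (2 i a as) then show ?case by (cases as) auto
qed auto

lemma ins_take_drop:
  "i < length as \<Longrightarrow> ins i as = take (Suc i) as @ [1\<^sub>A] @ drop (Suc i) as"
  by (induction i as rule: ins.induct) auto

lemma length_mrg: "Suc i < length as \<Longrightarrow> length (mrg i as) = length as - 1"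
  by (induction i as rule: mrg.induct) auto

lemma mrg_tuples: "as \<in> tuples A (Suc n) \<Longrightarrow> i < n \<Longrightarrow> mrg i as \<in> tuples A n"
proof (induction i as arbitrary: n rule: mrg.induct)
  case (2 i a as) then show ?case by (cases n) auto
qed (auto simp: tuples_def)

lemma ins_tuples: "as \<in> tuples A n \<Longrightarrow> i < n \<Longrightarrow> ins i as \<in> tuples A (Suc n)"
proof (induction i as arbitrary: n rule: ins.induct)
  case (2 i a as) then show ?case by (cases n) auto
qed (auto simp: tuples_def)

lemma tuples_snocE:
  assumes "as \<in> tuples A (Suc n)"
  obtains xs z where "as = xs @ [z]" "xs \<in> tuples A n" "z \<in> carrier A"
  using assms by (cases as rule: rev_cases) (auto simp: tuples_def)

lemma tuples_snoc [simp]: "xs @ [z] \<in> tuples A (Suc n) \<longleftrightarrow> xs \<in> tuples A n \<and> z \<in> carrier A"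
  by (auto simp: tuples_def)

lemma rot_tuples: "as \<in> tuples A (Suc n) \<Longrightarrow> rot as \<in> tuples A (Suc n)"
  by (erule tuples_snocE) simp

lemma lft_tuples: "as \<in> tuples A (Suc n) \<Longrightarrow> b \<in> carrier A \<Longrightarrow> lft b as \<in> tuples A (Suc n)"
  by (auto simp: tuples_Suc)

lemma rgt_tuples: "as \<in> tuples A (Suc n) \<Longrightarrow> b \<in> carrier A \<Longrightarrow> rgt b as \<in> tuples A (Suc n)"
  by (erule tuples_snocE) simp

text \<open>The maps on generators that factor through \<open>A \<otimes>\<^sub>B \<dots> \<otimes>\<^sub>B A \<otimes>\<^sub>B\<close>, closed up to a circle.\<close>

definition zlin :: "nat \<Rightarrow> ('k,'w,'u) module_scheme \<Rightarrow> ('a list \<Rightarrow> 'w) \<Rightarrow> bool"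
  where "zlin n W F \<longleftrightarrow> mlin K A W (Suc n) F \<and> balanced A B (Suc n) F \<and>
    (\<forall>as\<in>tuples A (Suc n). \<forall>b\<in>B. F (rgt b as) = F (lft b as))"

lemma zlin_cong:
  assumes "zlin n W F" "\<And>as. as \<in> tuples A (Suc n) \<Longrightarrow> F as = G as"
  shows "zlin n W G"
proof -
  have "F (rgt b as) = G (rgt b as)" "F (lft b as) = G (lft b as)" if "as \<in> tuples A (Suc n)" "b \<in> B" for as b
    using that by (auto intro!: assms(2) lft_tuples rgt_tuples simp del: tuples_Cons)
  moreover have "balanced A B (Suc n) G"
    unfolding balanced_def
  proof (intro allI impI)
    fix xs x b y ys assume b: "b \<in> B" and t: "xs @ [x, y] @ ys \<in> tuples A (Suc n)"
    then have "xs @ [x \<cdot> b, y] @ ys \<in> tuples A (Suc n)" "xs @ [x, b \<cdot> y] @ ys \<in> tuples A (Suc n)"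
      by (auto simp: tuples_def)
    from assms(2)[OF this(1)] assms(2)[OF this(2)] balancedD[of A B "Suc n" F, OF _ b t] assms(1)
    show "G (xs @ [x \<cdot> b, y] @ ys) = G (xs @ [x, b \<cdot> y] @ ys)" by (simp add: zlin_def)
  qed
  moreover have "mlin K A W (Suc n) F" using assms(1) by (simp only: zlin_def)
  then have "mlin K A W (Suc n) G" by (rule mlin_cong[OF A.module _ assms(2)])
  ultimately show ?thesis using assms(1) by (simp add: zlin_def del: mlin.simps)
qed

lemma mlin_lft: "mlin K A W (Suc n) F \<Longrightarrow> b \<in> carrier A \<Longrightarrow> mlin K A W (Suc n) (\<lambda>as. F (lft b as))"
  by (auto intro: lin_hom_comp[OF A.mult_lin_right])

lemma mlin_rgt:
  assumes "mlin K A W (Suc n) F" "b \<in> carrier A"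
  shows "mlin K A W (Suc n) (\<lambda>as. F (rgt b as))"
proof (rule mlinI_slot)
  show "F (rgt b as) \<in> carrier W" if "as \<in> tuples A (Suc n)" for as
    using that by (elim tuples_snocE) (use assms mlin_closed[OF assms(1)] in simp)
  fix xs ys assume x: "set xs \<subseteq> carrier A" "set ys \<subseteq> carrier A" "length xs + length ys + 1 = Suc n"
  show "(\<lambda>x. F (rgt b (xs @ [x] @ ys))) \<in> lin_hom K A W"
  proof (cases ys rule: rev_cases)
    case Nil
    have "(\<lambda>x. F (xs @ [x])) \<in> lin_hom K A W"
      by (rule mlin_snoc_lin[OF assms(1)]) (use x Nil in \<open>auto simp: tuples_def\<close>)
    from lin_hom_comp[OF A.mult_lin_left[OF assms(2)] this] show ?thesis by (simp add: Nil)
  next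
    case (snoc zs z)
    have "xs @ [1\<^sub>A] @ (zs @ [z \<cdot> b]) \<in> tuples A (Suc n)"
      using x snoc assms(2) by (auto simp: tuples_def)
    from mlin_slot[OF assms(1) this] show ?thesis
      using rgt_snoc[of b "xs @ _ # zs" z] by (simp add: snoc)
  qed
qed

lemma bal_lft:
  assumes "balanced A B (Suc n) F" "b \<in> carrier A"
  shows "balanced A B (Suc n) (\<lambda>as. F (lft b as))"
proof (cases n)
  case (Suc m)
  show ?thesis unfolding Suc
  proof (rule balanced_ConsI)
    fix x y c ys assume "x \<in> carrier A" "y \<in> carrier A" "ys \<in> tuples A m" "c \<in> B"
    then show "F (lft b (x \<cdot> c # y # ys)) = F (lft b (x # c \<cdot> y # ys))"
      using balanced_head[of A B m F "b \<cdot> x" y ys c] assms Suc by (simp add: A.A_assoc)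
  next
    fix x assume "x \<in> carrier A"
    then show "balanced A B (Suc m) (\<lambda>xs. F (lft b (x # xs)))"
      using balanced_Cons[of A B "Suc m" F "b \<cdot> x"] assms Suc by simp
  qed
qed (simp add: balanced_1)

lemma bal_rgt:
  assumes "balanced A B (Suc n) F" "b \<in> carrier A"
  shows "balanced A B (Suc n) (\<lambda>as. F (rgt b as))"
  unfolding balanced_def
proof (intro allI impI)
  fix xs x c y ys assume c: "c \<in> B" and t: "xs @ [x, y] @ ys \<in> tuples A (Suc n)"
  show "F (rgt b (xs @ [x \<cdot> c, y] @ ys)) = F (rgt b (xs @ [x, c \<cdot> y] @ ys))"
  proof (cases ys rule: rev_cases)
    case Nil
    have xy: "x \<in> carrier A" "y \<in> carrier A" using t by (auto simp: tuples_def)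
    have "xs @ [x, y \<cdot> b] @ [] \<in> tuples A (Suc n)" using t Nil assms(2) by (auto simp: tuples_def)
    from balancedD[OF assms(1) c this] show ?thesis
      using rgt_snoc[of b "xs @ [_]" _] xy assms(2) c by (simp add: Nil A.A_assoc)
  next
    case (snoc zs z)
    have "xs @ [x, y] @ (zs @ [z \<cdot> b]) \<in> tuples A (Suc n)" using t snoc assms(2) by (auto simp: tuples_def)
    from balancedD[OF assms(1) c this] show ?thesis
      using rgt_snoc[of b "xs @ _ # _ # zs" z] by (simp add: snoc)
  qed
qed

lemma act_facts:
  assumes "b \<in> B"
  shows left_act_lin: "rel_left_act K A B (Suc n) b \<in> lin_hom K (RT n) (RT n)"
    and left_act_gen: "as \<in> tuples A (Suc n) \<Longrightarrow>
      rel_left_act K A B (Suc n) b (gen K (RT n) as) = gen K (RT n) (lft b as)"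
    and right_act_lin: "(\<lambda>X. rel_right_act K A B (Suc n) X b) \<in> lin_hom K (RT n) (RT n)"
    and right_act_gen: "as \<in> tuples A (Suc n) \<Longrightarrow>
      rel_right_act K A B (Suc n) (gen K (RT n) as) b = gen K (RT n) (rgt b as)"
proof -
  note R = A.rel_tensor_module[OF B_sub, of "Suc n"]
  note m = A.rel_tensor_gen_mlin[OF B_sub, of "Suc n"] and ba = A.rel_tensor_gen_bal[OF B_sub, of "Suc n"]
  have l: "rel_left_act K A B (Suc n) b = gen_lift K (RT n) (\<lambda>as. gen K (RT n) (lft b as))"
    and r: "(\<lambda>X. rel_right_act K A B (Suc n) X b) = gen_lift K (RT n) (\<lambda>as. gen K (RT n) (rgt b as))"
    by (simp_all add: rel_left_act_def rel_right_act_def Let_def lft_def[abs_def] rgt_def[abs_def])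
  have b: "b \<in> carrier A" using assms by simp
  show "rel_left_act K A B (Suc n) b \<in> lin_hom K (RT n) (RT n)"
    unfolding l by (rule A.rel_tensor_lift_lin[OF B_sub R mlin_lft[OF m b] bal_lft[OF ba b]])
  show "(\<lambda>X. rel_right_act K A B (Suc n) X b) \<in> lin_hom K (RT n) (RT n)"
    unfolding r by (rule A.rel_tensor_lift_lin[OF B_sub R mlin_rgt[OF m b] bal_rgt[OF ba b]])
  show "rel_left_act K A B (Suc n) b (gen K (RT n) as) = gen K (RT n) (lft b as)" if "as \<in> tuples A (Suc n)"
    unfolding l by (rule A.rel_tensor_lift_gen[OF B_sub R mlin_lft[OF m b] bal_lft[OF ba b] that])
  show "rel_right_act K A B (Suc n) (gen K (RT n) as) b = gen K (RT n) (rgt b as)" if "as \<in> tuples A (Suc n)"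
    using fun_cong[OF r] A.rel_tensor_lift_gen[OF B_sub R mlin_rgt[OF m b] bal_rgt[OF ba b] that] by simp
qed

lemma Z_facts:
  shows Z_module: "module K (Z n)"
    and zc_zlin: "zlin n (Z n) (zc n)"
    and Z_rep: "q \<in> carrier (Z n) \<Longrightarrow> \<exists>L. set L \<subseteq> tuples A (Suc n) \<and> q = lsum (Z n) L (zc n)"
proof -
  note R = A.rel_tensor_module[OF B_sub, of "Suc n"]
  note m = A.rel_tensor_gen_mlin[OF B_sub, of "Suc n"] and ba = A.rel_tensor_gen_bal[OF B_sub, of "Suc n"]
  have eq: "Z n = bimod_quot K (RT n) B (rel_left_act K A B (Suc n)) (rel_right_act K A B (Suc n))"
    by (simp add: rel_space_def)
  note f = bimod_quot_facts[where K = K and X = "RT n" and B = B and la = "rel_left_act K A B (Suc n)"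
      and ra = "rel_right_act K A B (Suc n)", OF R lin_hom_closed[OF right_act_lin] lin_hom_closed[OF left_act_lin],
      folded eq]
  have e: "zc n = (\<lambda>as. \<zero>\<^bsub>Z n\<^esub> +>\<^bsub>RT n\<^esub> gen K (RT n) as)"
    by (rule ext) (simp add: rel_class_def Let_def)
  show Zm: "module K (Z n)" by (rule f(1))
  have l: "(\<lambda>x. \<zero>\<^bsub>Z n\<^esub> +>\<^bsub>RT n\<^esub> x) \<in> lin_hom K (RT n) (Z n)" by (rule f(2))
  show "zlin n (Z n) (zc n)"
    unfolding zlin_def
  proof (intro conjI ballI)
    show "mlin K A (Z n) (Suc n) (zc n)" unfolding e by (rule mlin_lin[OF m l])
    show "balanced A B (Suc n) (zc n)" using ba unfolding e balanced_def by metis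
    fix as b assume as: "as \<in> tuples A (Suc n)" and b: "b \<in> B"
    show "zc n (rgt b as) = zc n (lft b as)"
      using f(4)[OF _ _ _ _ mlin_closed[OF m as] b] by (simp add: e left_act_gen[OF b as] right_act_gen[OF b as])
  qed
  show "\<exists>L. set L \<subseteq> tuples A (Suc n) \<and> q = lsum (Z n) L (zc n)" if q: "q \<in> carrier (Z n)"
  proof -
    have s: "carrier (Z n) = (\<lambda>x. \<zero>\<^bsub>Z n\<^esub> +>\<^bsub>RT n\<^esub> x) ` carrier (RT n)" by (rule f(3))
    then obtain X where X: "X \<in> carrier (RT n)" "q = \<zero>\<^bsub>Z n\<^esub> +>\<^bsub>RT n\<^esub> X" using q by auto
    obtain L where L: "set L \<subseteq> tuples A (Suc n)" "X = lsum (RT n) L (gen K (RT n))"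
      using A.rel_tensor_rep[OF B_sub _ X(1)] by auto
    have "q = lsum (Z n) L (zc n)"
      unfolding X(2) L(2) e by (rule lin_hom_lsum[OF R Zm l], rule mlin_closed[OF m]) (use L(1) in auto)
    then show ?thesis using L(1) by blast
  qed
qed

lemma Z_lift:
  assumes "module K W" "zlin n W F"
  shows Z_lift_lin: "rel_lift K W F \<in> lin_hom K (Z n) W"
    and Z_lift_gen: "as \<in> tuples A (Suc n) \<Longrightarrow> rel_lift K W F (zc n as) = F as"
proof -
  note R = A.rel_tensor_module[OF B_sub, of "Suc n"]
  note m = A.rel_tensor_gen_mlin[OF B_sub, of "Suc n"]
  have eq: "Z n = bimod_quot K (RT n) B (rel_left_act K A B (Suc n)) (rel_right_act K A B (Suc n))"
    by (simp add: rel_space_def)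
  note f = bimod_quot_facts[where K = K and X = "RT n" and B = B and la = "rel_left_act K A B (Suc n)"
      and ra = "rel_right_act K A B (Suc n)", OF R lin_hom_closed[OF right_act_lin] lin_hom_closed[OF left_act_lin],
      folded eq]
  have F: "mlin K A W (Suc n) F" "balanced A B (Suc n) F" using assms(2) by (auto simp: zlin_def simp del: mlin.simps)
  note gl = A.rel_tensor_lift_lin[OF B_sub assms(1) F] and gg = A.rel_tensor_lift_gen[OF B_sub assms(1) F]
  have b: "gen_lift K W F (rel_right_act K A B (Suc n) X b) = gen_lift K W F (rel_left_act K A B (Suc n) b X)"
    if X: "X \<in> carrier (RT n)" and b: "b \<in> B" for X b
  proof -
    obtain L where L: "set L \<subseteq> tuples A (Suc n)" "X = lsum (RT n) L (gen K (RT n))"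
      using A.rel_tensor_rep[OF B_sub _ X] by auto
    have g: "gen K (RT n) as \<in> carrier (RT n)" if "as \<in> set L" for as
      using mlin_closed[OF m] that L(1) by auto
    have t: "rgt b as \<in> tuples A (Suc n)" "lft b as \<in> tuples A (Suc n)" if "as \<in> set L" for as
      using that L(1) b by (auto intro!: rgt_tuples lft_tuples)
    have "gen_lift K W F (rel_right_act K A B (Suc n) X b) = lsum W L (\<lambda>as. gen_lift K W F (rel_right_act K A B (Suc n) (gen K (RT n) as) b))"
      unfolding L(2) by (rule lin_hom_lsum[OF R assms(1) lin_hom_comp[OF right_act_lin[OF b] gl] g])
    also have "\<dots> = lsum W L (\<lambda>as. gen_lift K W F (rel_left_act K A B (Suc n) b (gen K (RT n) as)))"
      by (rule lsum_cong) (use L(1) assms(2) b in \<open>auto simp: left_act_gen[OF b] right_act_gen[OF b] gg t zlin_def subset_iff simp del: mlin.simps\<close>)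
    also have "\<dots> = gen_lift K W F (rel_left_act K A B (Suc n) b X)"
      unfolding L(2) by (rule lin_hom_lsum[OF R assms(1) lin_hom_comp[OF left_act_lin[OF b] gl] g, symmetric])
    finally show ?thesis .
  qed
  show "rel_lift K W F \<in> lin_hom K (Z n) W" unfolding rel_lift_def by (rule f(5)[OF _ _ _ _ assms(1) gl b])
  show "rel_lift K W F (zc n as) = F as" if "as \<in> tuples A (Suc n)"
    using f(6)[OF _ _ _ _ assms(1) gl b mlin_closed[OF m that]] gg[OF that]
    by (simp add: rel_lift_def rel_class_def Let_def)
qed

lemma zc_closed: "as \<in> tuples A (Suc n) \<Longrightarrow> zc n as \<in> carrier (Z n)"
  using zc_zlin[of n] by (intro mlin_closed[of K A "Z n" "Suc n" "zc n"]) (auto simp: zlin_def simp del: mlin.simps)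

lemma Z_ext:
  assumes "module K W" "f \<in> lin_hom K (Z n) W" "g \<in> lin_hom K (Z n) W"
    "\<And>as. as \<in> tuples A (Suc n) \<Longrightarrow> f (zc n as) = g (zc n as)" "q \<in> carrier (Z n)"
  shows "f q = g q"
proof -
  obtain L where L: "set L \<subseteq> tuples A (Suc n)" "q = lsum (Z n) L (zc n)" using Z_rep[OF assms(5)] by blast
  have c: "zc n as \<in> carrier (Z n)" if "as \<in> set L" for as using that L(1) zc_closed by auto
  have "f q = lsum W L (\<lambda>as. f (zc n as))" unfolding L(2) by (rule lin_hom_lsum[OF Z_module assms(1,2) c])
  also have "\<dots> = lsum W L (\<lambda>as. g (zc n as))" by (rule lsum_cong, rule assms(4)) (use L(1) in auto)
  also have "\<dots> = g q" unfolding L(2) by (rule lin_hom_lsum[OF Z_module assms(1,3) c, symmetric])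
  finally show ?thesis .
qed

lemma zlinD:
  assumes "zlin n W F"
  shows "mlin K A W (Suc n) F" "balanced A B (Suc n) F"
    "as \<in> tuples A (Suc n) \<Longrightarrow> b \<in> B \<Longrightarrow> F (rgt b as) = F (lft b as)"
  using assms unfolding zlin_def by blast+

lemma mlin_mrg:
  assumes "mlin K A W (Suc n) F" "i \<le> n"
  shows "mlin K A W (Suc (Suc n)) (\<lambda>as. F (mrg i as))"
  using assms
proof (induction i arbitrary: n F)
  case 0
  have c: "mlin K A W n (\<lambda>xs. F (x # xs))" if "x \<in> carrier A" for x
    using 0 that by auto
  have l: "(\<lambda>x. F (x # xs)) \<in> lin_hom K A W" if "xs \<in> tuples A n" for xs using 0 that by auto
  have "(\<lambda>x. F (x \<cdot> y # ys)) \<in> lin_hom K A W" "(\<lambda>x. F (y \<cdot> x # ys)) \<in> lin_hom K A W"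
    if "y \<in> carrier A" "ys \<in> tuples A n" for y ys
    using lin_hom_comp[OF A.mult_lin_left[OF that(1)] l[OF that(2)]]
      lin_hom_comp[OF A.mult_lin_right[OF that(1)] l[OF that(2)]] .
  then show ?case using c by (auto simp: tuples_Suc)
next
  case (Suc i)
  then obtain m where n: "n = Suc m" by (cases n) auto
  have "mlin K A W (Suc (Suc m)) (\<lambda>as. F (x # mrg i as))" if "x \<in> carrier A" for x
    by (rule Suc.IH[of m "\<lambda>as. F (x # as)"]) (use Suc.prems n that in auto)
  moreover have "(\<lambda>x. F (x # mrg i xs)) \<in> lin_hom K A W" if "xs \<in> tuples A (Suc (Suc m))" for xs
  proof -
    have "mrg i xs \<in> tuples A (Suc m)" by (rule mrg_tuples[OF that]) (use Suc.prems n in simp)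
    then show ?thesis using Suc.prems(1) n by simp
  qed
  ultimately show ?case unfolding n by (subst mlin.simps(2)) simp
qed

lemma mrg_lft: "Suc i < length as \<Longrightarrow> set as \<subseteq> carrier A \<Longrightarrow> b \<in> carrier A \<Longrightarrow> mrg i (lft b as) = lft b (mrg i as)"
  by (cases "(i, as)" rule: mrg.cases) (auto simp: A.A_assoc)

lemma mrg_rgt: "Suc i < length as \<Longrightarrow> set as \<subseteq> carrier A \<Longrightarrow> b \<in> carrier A \<Longrightarrow> mrg i (rgt b as) = rgt b (mrg i as)"
proof (induction i as rule: mrg.induct)
  case (1 a c as) then show ?case by (cases as) (auto simp: A.A_assoc)
next
  case (2 i a as)
  then obtain x xs where as: "as = x # xs" by (cases as) auto
  obtain y ys where m: "mrg i as = y # ys" using 2(2) length_mrg[of i as] by (cases "mrg i as") auto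
  then show ?case using 2 as by auto
qed auto

lemma bal_mrg:
  assumes "balanced A B (Suc n) F" "i \<le> n"
  shows "balanced A B (Suc (Suc n)) (\<lambda>as. F (mrg i as))"
  using assms
proof (induction i arbitrary: n F)
  case 0
  show ?case
  proof (rule balanced_ConsI)
    fix x assume x: "x \<in> carrier A"
    show "balanced A B (Suc n) (\<lambda>xs. F (mrg 0 (x # xs)))"
    proof (cases n)
      case (Suc m)
      show ?thesis unfolding Suc
      proof (rule balanced_ConsI)
        fix y z b ys assume "y \<in> carrier A" "z \<in> carrier A" "ys \<in> tuples A m" "b \<in> B"
        then show "F (mrg 0 (x # y \<cdot> b # z # ys)) = F (mrg 0 (x # y # b \<cdot> z # ys))"
          using balanced_head[of A B m F "x \<cdot> y" z ys b] 0 Suc x by (simp add: A.A_assoc)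
      next
        fix y assume "y \<in> carrier A"
        then show "balanced A B (Suc m) (\<lambda>xs. F (mrg 0 (x # y # xs)))"
          using balanced_Cons[of A B "Suc m" F "x \<cdot> y"] 0 Suc x by simp
      qed
    qed (simp add: balanced_1)
  qed (simp add: A.A_assoc)
next
  case (Suc i)
  then obtain m where n: "n = Suc m" by (cases n) auto
  show ?case
  proof (rule balanced_ConsI)
    fix x assume x: "x \<in> carrier A"
    show "balanced A B (Suc n) (\<lambda>xs. F (mrg (Suc i) (x # xs)))"
      using Suc.IH[of m "\<lambda>xs. F (x # xs)"] balanced_Cons[of A B "Suc m" F x] Suc.prems x n by simp
  next
    fix x y b ys assume t: "x \<in> carrier A" "y \<in> carrier A" "ys \<in> tuples A n" "b \<in> B"
    then obtain z zs where z: "ys = z # zs" "z \<in> carrier A" "zs \<in> tuples A m" by (auto simp: n tuples_Suc)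
    show "F (mrg (Suc i) (x \<cdot> b # y # ys)) = F (mrg (Suc i) (x # b \<cdot> y # ys))"
    proof (cases i)
      case 0
      then show ?thesis using balanced_head[of A B m F x "y \<cdot> z" zs b] Suc.prems t z n by (simp add: A.A_assoc)
    next
      case (Suc j)
      have "mrg j ys \<in> tuples A m" by (rule mrg_tuples) (use t n Suc Suc.prems in auto)
      then show ?thesis using balanced_head[of A B m F x y "mrg j ys" b] Suc.prems t n Suc by simp
    qed
  qed
qed

lemma zlin_mrg:
  assumes "zlin n W F" "i \<le> n"
  shows "zlin (Suc n) W (\<lambda>as. F (mrg i as))"
  unfolding zlin_def
proof (intro conjI ballI)
  show "mlin K A W (Suc (Suc n)) (\<lambda>as. F (mrg i as))" by (rule mlin_mrg[OF zlinD(1)[OF assms(1)] assms(2)])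
  show "balanced A B (Suc (Suc n)) (\<lambda>as. F (mrg i as))" by (rule bal_mrg[OF zlinD(2)[OF assms(1)] assms(2)])
  fix as b assume as: "as \<in> tuples A (Suc (Suc n))" and b: "b \<in> B"
  have l: "Suc i < length as" "set as \<subseteq> carrier A" using as assms(2) by (auto simp: tuples_def)
  show "F (mrg i (rgt b as)) = F (mrg i (lft b as))"
    unfolding mrg_rgt[OF l B_cl[OF b]] mrg_lft[OF l B_cl[OF b]]
    by (rule zlinD(3)[OF assms(1) mrg_tuples[OF as] b]) (use assms(2) in simp)
qed

lemma mlin_ins:
  assumes "mlin K A W (Suc (Suc n)) F" "i \<le> n"
  shows "mlin K A W (Suc n) (\<lambda>as. F (ins i as))"
  using assms
proof (induction i arbitrary: n F)
  case (Suc i)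
  then obtain m where n: "n = Suc m" by (cases n) auto
  have "mlin K A W (Suc m) (\<lambda>as. F (x # ins i as))" if "x \<in> carrier A" for x
    by (rule Suc.IH[of m "\<lambda>as. F (x # as)"]) (use Suc.prems n that in auto)
  moreover have "(\<lambda>x. F (x # ins i xs)) \<in> lin_hom K A W" if "xs \<in> tuples A (Suc m)" for xs
  proof -
    have "ins i xs \<in> tuples A (Suc (Suc m))" by (rule ins_tuples[OF that]) (use Suc.prems n in simp)
    then show ?thesis using Suc.prems(1) n by simp
  qed
  ultimately show ?case unfolding n by (subst mlin.simps(2)) simp
qed simp

lemma bal_ins:
  assumes "balanced A B (Suc (Suc n)) F" "i \<le> n"
  shows "balanced A B (Suc n) (\<lambda>as. F (ins i as))"
  using assms
proof (induction i arbitrary: n F)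
  case 0
  show ?case
  proof (cases n)
    case (Suc m)
    show ?thesis unfolding Suc
    proof (rule balanced_ConsI)
      fix x y b ys assume t: "x \<in> carrier A" "y \<in> carrier A" "ys \<in> tuples A m" "b \<in> B"
      have "F (x \<cdot> b # 1\<^sub>A # y # ys) = F (x # b # y # ys)"
        using balanced_head[of A B "Suc m" F x "1\<^sub>A" "y # ys" b] 0 t Suc by simp
      also have "\<dots> = F (x # 1\<^sub>A # b \<cdot> y # ys)"
        using balancedD[of A B "Suc (Suc (Suc m))" F b "[x]" "1\<^sub>A" y ys] 0 t Suc by simp
      finally show "F (ins 0 (x \<cdot> b # y # ys)) = F (ins 0 (x # b \<cdot> y # ys))" by simp
    next
      fix x assume x: "x \<in> carrier A"
      show "balanced A B (Suc m) (\<lambda>xs. F (ins 0 (x # xs)))"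
        using balanced_Cons[OF balanced_Cons, of A B "Suc m" F x "1\<^sub>A"] 0 x Suc by simp
    qed
  qed (simp add: balanced_1)
next
  case (Suc i)
  then obtain m where n: "n = Suc m" by (cases n) auto
  show ?case unfolding n
  proof (rule balanced_ConsI)
    fix x assume x: "x \<in> carrier A"
    show "balanced A B (Suc m) (\<lambda>xs. F (ins (Suc i) (x # xs)))"
      using Suc.IH[of m "\<lambda>xs. F (x # xs)"] balanced_Cons[of A B "Suc (Suc m)" F x] Suc.prems x n by simp
  next
    fix x y b ys assume t: "x \<in> carrier A" "y \<in> carrier A" "ys \<in> tuples A m" "b \<in> B"
    show "F (ins (Suc i) (x \<cdot> b # y # ys)) = F (ins (Suc i) (x # b \<cdot> y # ys))"
    proof (cases i)
      case 0
      then show ?thesis using balanced_head[of A B "Suc m" F x y "1\<^sub>A # ys" b] Suc.prems t n by simp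
    next
      case (Suc j)
      have "ins j ys \<in> tuples A (Suc m)" by (rule ins_tuples) (use t n Suc Suc.prems in auto)
      then show ?thesis using balanced_head[of A B "Suc m" F x y "ins j ys" b] Suc.prems t n Suc by simp
    qed
  qed
qed

lemma ins_lft: "i < length as \<Longrightarrow> ins i (lft b as) = lft b (ins i as)"
  by (cases "(i, as)" rule: ins.cases) auto

lemma ins_append: "i < length xs \<Longrightarrow> ins i (xs @ ys) = ins i xs @ ys"
  by (induction i xs rule: ins.induct) auto

lemma ins_last: "ins (length xs) (xs @ [z]) = xs @ [z, 1\<^sub>A]"
  by (induction xs) auto

lemma mrg_append: "Suc i < length xs \<Longrightarrow> mrg i (xs @ ys) = mrg i xs @ ys"
  by (induction i xs rule: mrg.induct) auto

lemma mrg_last: "mrg (length xs) (xs @ [y, z]) = xs @ [y \<cdot> z]"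
  by (induction xs) auto

lemma zlin_ins:
  assumes "zlin (Suc n) W F" "i \<le> n"
  shows "zlin n W (\<lambda>as. F (ins i as))"
  unfolding zlin_def
proof (intro conjI ballI)
  show "mlin K A W (Suc n) (\<lambda>as. F (ins i as))" by (rule mlin_ins[OF zlinD(1)[OF assms(1)] assms(2)])
  show "balanced A B (Suc n) (\<lambda>as. F (ins i as))" by (rule bal_ins[OF zlinD(2)[OF assms(1)] assms(2)])
  fix as b assume as: "as \<in> tuples A (Suc n)" and b: "b \<in> B"
  obtain xs z where z: "as = xs @ [z]" "xs \<in> tuples A n" "z \<in> carrier A" using tuples_snocE[OF as] .
  have l: "length xs = n" using z by (simp add: tuples_def)
  have "F (ins i (rgt b as)) = F (rgt b (ins i as))"
  proof (cases "i = n")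
    case True
    have "xs @ [z, 1\<^sub>A] @ [] \<in> tuples A (Suc (Suc n))" using z by (auto simp: tuples_def)
    from balancedD[OF zlinD(2)[OF assms(1)] b this]
    show ?thesis using True l ins_last[of xs] b rgt_snoc[of b "xs @ [z]" "1\<^sub>A"] by (simp add: z)
  next
    case False
    then show ?thesis using assms(2) l by (simp add: z ins_append)
  qed
  also have "\<dots> = F (lft b (ins i as))"
    by (rule zlinD(3)[OF assms(1) ins_tuples[OF as] b]) (use assms(2) in simp)
  also have "\<dots> = F (ins i (lft b as))" using ins_lft[of i as b] assms(2) l z by simp
  finally show "F (ins i (rgt b as)) = F (ins i (lft b as))" .
qed

lemma zlin_rot:
  assumes "zlin n W F"
  shows "zlin n W (\<lambda>as. F (rot as))"
proof -
  note m = zlinD(1)[OF assms] and ba = zlinD(2)[OF assms] and cy = zlinD(3)[OF assms]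
  have rs: "rot (xs @ x # zs @ [z]) = z # xs @ x # zs" for xs x zs z
    using rot_snoc[of "xs @ x # zs" z] by simp
  show ?thesis
    unfolding zlin_def
  proof (intro conjI ballI)
    show "mlin K A W (Suc n) (\<lambda>as. F (rot as))" using A.mlin_rot[OF m] by (simp add: rot_def)
    show "balanced A B (Suc n) (\<lambda>as. F (rot as))"
      unfolding balanced_def
    proof (intro allI impI)
      fix xs x b y ys assume b: "b \<in> B" and t: "xs @ [x, y] @ ys \<in> tuples A (Suc n)"
      show "F (rot (xs @ [x \<cdot> b, y] @ ys)) = F (rot (xs @ [x, b \<cdot> y] @ ys))"
      proof (cases ys rule: rev_cases)
        case Nil
        have "y # xs @ [x] \<in> tuples A (Suc n)" using t Nil by (auto simp: tuples_def)
        from cy[OF this b] show ?thesis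
          using rs[of xs _ "[]" _] rgt_snoc[of b "y # xs" x] by (simp add: Nil)
      next
        case (snoc zs z)
        have "(z # xs) @ [x, y] @ zs \<in> tuples A (Suc n)" using t snoc by (auto simp: tuples_def)
        from balancedD[OF ba b this] show ?thesis using rs[of xs _ "_ # zs" z] by (simp add: snoc)
      qed
    qed
    fix as b assume as: "as \<in> tuples A (Suc n)" and b: "b \<in> B"
    show "F (rot (rgt b as)) = F (rot (lft b as))"
    proof (cases n)
      case 0
      then show ?thesis using cy[OF as b] as by (auto simp: tuples_Suc)
    next
      case (Suc m)
      obtain xs z where z: "as = xs @ [z]" "xs \<in> tuples A n" "z \<in> carrier A" using tuples_snocE[OF as] .
      then obtain a w where w: "xs = a # w" "a \<in> carrier A" "w \<in> tuples A m" by (auto simp: Suc tuples_Suc)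
      have "F ((z \<cdot> b) # a # w) = F (z # (b \<cdot> a) # w)"
        by (rule balanced_head[of A B m]) (use ba z w b Suc in auto)
      then show ?thesis using rgt_snoc[of b "a # w" z] rot_snoc[of "a # w"] rot_snoc[of "b \<cdot> a # w" z]
        by (simp add: z w del: rgt_Cons)
    qed
  qed
qed

lemma op_facts:
  assumes "zlin n (Z m) (\<lambda>as. zc m (g as))" "\<And>as. as \<in> tuples A (Suc n) \<Longrightarrow> g as = g' as"
  shows op_lin: "rel_lift K (Z m) (\<lambda>as. zc m (g' as)) \<in> lin_hom K (Z n) (Z m)"
    and op_zc: "as \<in> tuples A (Suc n) \<Longrightarrow> rel_lift K (Z m) (\<lambda>as. zc m (g' as)) (zc n as) = zc m (g as)"
proof -
  have z: "zlin n (Z m) (\<lambda>as. zc m (g' as))" by (rule zlin_cong[OF assms(1)]) (simp add: assms(2))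
  show "rel_lift K (Z m) (\<lambda>as. zc m (g' as)) \<in> lin_hom K (Z n) (Z m)" by (rule Z_lift_lin[OF Z_module z])
  show "rel_lift K (Z m) (\<lambda>as. zc m (g' as)) (zc n as) = zc m (g as)" if "as \<in> tuples A (Suc n)"
    using Z_lift_gen[OF Z_module z that] assms(2)[OF that] by simp
qed

abbreviation "ZZ \<equiv> rel_cyclic K A B"

lemma space_ZZ [simp]: "space ZZ n = Z n" by (simp add: rel_cyclic_def)

lemma tuples_length: "as \<in> tuples A n \<Longrightarrow> length as = n" by (simp add: tuples_def)

definition fc :: "nat \<Rightarrow> nat \<Rightarrow> 'a list \<Rightarrow> 'a list"
  where "fc n i as = (if i < n then mrg i as else mrg 0 (rot as))"

lemma tuples_endsE:
  assumes "as \<in> tuples A (Suc (Suc n))"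
  obtains a w z where "as = a # w @ [z]" "a \<in> carrier A" "w \<in> tuples A n" "z \<in> carrier A"
proof -
  obtain xs z where z: "as = xs @ [z]" "xs \<in> tuples A (Suc n)" "z \<in> carrier A" using tuples_snocE[OF assms] .
  then obtain a w where "xs = a # w" "a \<in> carrier A" "w \<in> tuples A n" by (auto simp: tuples_Suc)
  then show ?thesis using that z by simp
qed

lemma fc_tuples: "as \<in> tuples A (Suc (Suc n)) \<Longrightarrow> fc (Suc n) i as \<in> tuples A (Suc n)"
  using mrg_tuples[of as "Suc n" i] mrg_tuples[OF rot_tuples[of as "Suc n"], of 0] by (simp add: fc_def)

lemma face_ZZ:
  assumes "i \<le> Suc n"
  shows face_ZZ_lin: "face ZZ (Suc n) i \<in> lin_hom K (Z (Suc n)) (Z n)"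
    and face_ZZ_zc: "as \<in> tuples A (Suc (Suc n)) \<Longrightarrow> face ZZ (Suc n) i (zc (Suc n) as) = zc n (fc (Suc n) i as)"
proof -
  let ?g = "\<lambda>as. if i < Suc n then take i as @ [as ! i \<cdot> as ! (i + 1)] @ drop (i + 2) as
      else (last as \<cdot> hd as) # tl (butlast as)"
  have eq: "face ZZ (Suc n) i = rel_lift K (Z n) (\<lambda>as. zc n (?g as))" by (simp add: rel_cyclic_def)
  have z: "zlin (Suc n) (Z n) (\<lambda>as. zc n (fc (Suc n) i as))"
    unfolding fc_def using zlin_mrg[OF zc_zlin, of i n] zlin_rot[OF zlin_mrg[OF zc_zlin, of 0 n]]
    by (cases "i < Suc n") auto
  have g: "fc (Suc n) i as = ?g as" if t: "as \<in> tuples A (Suc (Suc n))" for as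
  proof (cases "i < Suc n")
    case True
    then show ?thesis using mrg_take_drop[of i as] tuples_length[OF t] by (simp add: fc_def)
  next
    case False
    obtain a w z where "as = a # w @ [z]" using t by (rule tuples_endsE)
    then show ?thesis using False by (simp add: fc_def rot_def)
  qed
  show "face ZZ (Suc n) i \<in> lin_hom K (Z (Suc n)) (Z n)" unfolding eq by (rule op_lin[OF z g])
  show "face ZZ (Suc n) i (zc (Suc n) as) = zc n (fc (Suc n) i as)" if "as \<in> tuples A (Suc (Suc n))"
    unfolding eq by (rule op_zc[OF z g that])
qed

lemma degen_ZZ:
  assumes "i \<le> n"
  shows degen_ZZ_lin: "degen ZZ n i \<in> lin_hom K (Z n) (Z (Suc n))"
    and degen_ZZ_zc: "as \<in> tuples A (Suc n) \<Longrightarrow> degen ZZ n i (zc n as) = zc (Suc n) (ins i as)"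
proof -
  have eq: "degen ZZ n i = rel_lift K (Z (Suc n)) (\<lambda>as. zc (Suc n) (take (i + 1) as @ [1\<^sub>A] @ drop (i + 1) as))"
    by (simp add: rel_cyclic_def)
  have z: "zlin n (Z (Suc n)) (\<lambda>as. zc (Suc n) (ins i as))" by (rule zlin_ins[OF zc_zlin assms])
  have g: "ins i as = take (i + 1) as @ [1\<^sub>A] @ drop (i + 1) as" if "as \<in> tuples A (Suc n)" for as
    using ins_take_drop[of i as] tuples_length[OF that] assms by simp
  show "degen ZZ n i \<in> lin_hom K (Z n) (Z (Suc n))" unfolding eq by (rule op_lin[OF z g])
  show "degen ZZ n i (zc n as) = zc (Suc n) (ins i as)" if "as \<in> tuples A (Suc n)"
    unfolding eq by (rule op_zc[OF z g that])
qed

lemma cyc_ZZ: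
  shows cyc_ZZ_lin: "cyc ZZ n \<in> lin_hom K (Z n) (Z n)"
    and cyc_ZZ_zc: "as \<in> tuples A (Suc n) \<Longrightarrow> cyc ZZ n (zc n as) = zc n (rot as)"
proof -
  have eq: "cyc ZZ n = rel_lift K (Z n) (\<lambda>as. zc n (last as # butlast as))" by (simp add: rel_cyclic_def)
  note z = zlin_rot[OF zc_zlin, of n]
  show "cyc ZZ n \<in> lin_hom K (Z n) (Z n)" unfolding eq by (rule op_lin[OF z]) (simp add: rot_def)
  show "cyc ZZ n (zc n as) = zc n (rot as)" if "as \<in> tuples A (Suc n)"
    unfolding eq by (rule op_zc[OF z _ that]) (simp add: rot_def)
qed

text \<open>The identities between the operations on lists. A list with at least two entries is taken apart
  into its first entry, its last entry and the rest.\<close>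

lemma mrg_mrg: "i < j \<Longrightarrow> Suc j < length as \<Longrightarrow> set as \<subseteq> carrier A \<Longrightarrow> mrg i (mrg j as) = mrg (j - 1) (mrg i as)"
proof (induction i as arbitrary: j rule: mrg.induct)
  case (1 a c as)
  then obtain k where k: "j = Suc k" by (cases j) auto
  show ?case
  proof (cases k)
    case 0 then show ?thesis using 1 k by (cases as) (auto simp: A.A_assoc)
  next
    case (Suc l) then show ?thesis using 1 k by simp
  qed
next
  case (2 i a as)
  then obtain k where k: "j = Suc k" by (cases j) auto
  then obtain l where l: "k = Suc l" using 2 by (cases k) auto
  then show ?case using 2 k by auto
qed auto

lemma ins_ins: "i \<le> j \<Longrightarrow> j < length as \<Longrightarrow> ins i (ins j as) = ins (Suc j) (ins i as)"
proof (induction i as arbitrary: j rule: ins.induct)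
  case (1 a as) then show ?case by (cases j) auto
next
  case (2 i a as) then show ?case by (cases j) auto
qed auto

lemma mrg_ins_less: "i < j \<Longrightarrow> j < length as \<Longrightarrow> mrg i (ins j as) = ins (j - 1) (mrg i as)"
proof (induction i as arbitrary: j rule: mrg.induct)
  case (1 a c as)
  then obtain k where "j = Suc k" by (cases j) auto
  then show ?case by (cases k) auto
next
  case (2 i a as)
  then obtain k where k: "j = Suc k" by (cases j) auto
  then obtain l where l: "k = Suc l" using 2 by (cases k) auto
  then show ?case using 2 k by auto
qed auto

lemma mrg_ins_eq: "j < length as \<Longrightarrow> set as \<subseteq> carrier A \<Longrightarrow> mrg j (ins j as) = as"
  by (induction j as rule: ins.induct) auto

lemma mrg_ins_Suc: "Suc j < length as \<Longrightarrow> set as \<subseteq> carrier A \<Longrightarrow> mrg (Suc j) (ins j as) = as"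
proof (induction j as rule: ins.induct)
  case (1 a as) then show ?case by (cases as) auto
qed auto

lemma mrg_ins_greater: "Suc j < i \<Longrightarrow> i < length as \<Longrightarrow> mrg i (ins j as) = ins j (mrg (i - 1) as)"
proof (induction j as arbitrary: i rule: ins.induct)
  case (1 a as)
  then obtain k where k: "i = Suc k" by (cases i) auto
  then obtain l where l: "k = Suc l" using 1 by (cases k) auto
  then show ?case using 1 k by auto
next
  case (2 j a as)
  then obtain k where k: "i = Suc k" by (cases i) auto
  then obtain l where l: "k = Suc l" using 2 by (cases k) auto
  then show ?case using 2 k by auto
qed auto

lemma rot_ends: "rot (a # w @ [z]) = z # a # w" using rot_snoc[of "a # w" z] by simp

lemma fc_fc:
  assumes "i < j" "j \<le> n + 2" "as \<in> tuples A (n + 3)"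
  shows "fc (n + 1) i (fc (n + 2) j as) = fc (n + 1) (j - 1) (fc (n + 2) i as)"
proof (cases "j < n + 2")
  case True
  then show ?thesis using assms mrg_mrg[of i j as] by (auto simp: fc_def tuples_def)
next
  case False
  then have j: "j = n + 2" using assms by simp
  obtain a w z where z: "as = a # w @ [z]" "a \<in> carrier A" "w \<in> tuples A (Suc n)" "z \<in> carrier A"
    using assms(3) by (auto simp: numeral_3_eq_3 elim: tuples_endsE)
  have lw: "length w = Suc n" using tuples_length[OF z(3)] .
  have lst: "fc (n + 2) j as = (z \<cdot> a) # w" by (simp add: j fc_def z rot_ends)
  show ?thesis
  proof (cases i)
    case 0
    obtain y v where y: "w = y # v" "y \<in> carrier A" using z(3) by (auto simp: tuples_Suc)
    show ?thesis unfolding lst using 0 j z y by (simp add: fc_def rot_ends A.A_assoc)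
  next
    case (Suc k)
    show ?thesis
    proof (cases "i < n + 1")
      case True
      have "mrg k (w @ [z]) = mrg k w @ [z]" by (rule mrg_append) (use True Suc lw in simp)
      then show ?thesis unfolding lst using True Suc j z by (simp add: fc_def rot_ends)
    next
      case False
      then have k: "k = n" using assms(1) j Suc by simp
      obtain v y where y: "w = v @ [y]" "v \<in> tuples A n" "y \<in> carrier A" using tuples_snocE[OF z(3)] .
      have "mrg k (v @ [y, z]) = v @ [y \<cdot> z]" using mrg_last[of v y z] tuples_length[OF y(2)] k by simp
      then show ?thesis unfolding lst using False Suc k j z y by (simp add: fc_def rot_ends A.A_assoc)
    qed
  qed
qed

lemma fc_ins_greater:
  assumes "j + 1 < i" "i \<le> n + 2" "as \<in> tuples A (n + 2)"
  shows "fc (n + 2) i (ins j as) = ins j (fc (n + 1) (i - 1) as)"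
proof (cases "i < n + 2")
  case True
  then show ?thesis using assms mrg_ins_greater[of j i as] by (auto simp: fc_def tuples_def)
next
  case False
  then have i: "i = n + 2" using assms by simp
  obtain a w z where z: "as = a # w @ [z]" "a \<in> carrier A" "w \<in> tuples A n" "z \<in> carrier A"
    using assms(3) by (auto simp: numeral_2_eq_2 elim: tuples_endsE)
  have "j < length (a # w)" using assms i tuples_length[OF z(3)] by simp
  then have "ins j as = ins j (a # w) @ [z]" using ins_append[of j "a # w" "[z]"] z by simp
  then show ?thesis using i z rot_snoc[of "a # 1\<^sub>A # w" z] by (cases j) (simp_all add: fc_def rot_ends)
qed

lemma fc_rot:
  assumes "1 \<le> i" "i \<le> n + 1" "as \<in> tuples A (n + 2)"
  shows "fc (n + 1) i (rot as) = rot (fc (n + 1) (i - 1) as)"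
proof -
  obtain a w z where z: "as = a # w @ [z]" "a \<in> carrier A" "w \<in> tuples A n" "z \<in> carrier A"
    using assms(3) by (auto simp: numeral_2_eq_2 elim: tuples_endsE)
  obtain k where k: "i = Suc k" using assms(1) by (cases i) auto
  have l: "length w = n" using tuples_length[OF z(3)] .
  show ?thesis
  proof (cases "i < n + 1")
    case True
    have "mrg k (a # w @ [z]) = mrg k (a # w) @ [z]" using mrg_append[of k "a # w" "[z]"] True k l by simp
    then show ?thesis using True k z by (simp add: fc_def rot_ends)
  next
    case False
    have "a # w \<in> tuples A (Suc n)" using z by simp
    then obtain v y where y: "a # w = v @ [y]" "v \<in> tuples A n" "y \<in> carrier A" by (rule tuples_snocE)
    have as: "as = v @ [y, z]" using z(1) y(1) by simp
    have "mrg k as = v @ [y \<cdot> z]"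
      using mrg_last[of v y z] tuples_length[OF y(2)] False assms(2) k as by simp
    moreover have "rot as = z # v @ [y]" using as rot_snoc[of "v @ [y]" z] by simp
    ultimately show ?thesis using False assms(2) k by (simp add: fc_def rot_ends)
  qed
qed

lemma rot_ins:
  assumes "1 \<le> i" "i \<le> n" "as \<in> tuples A (n + 1)"
  shows "ins i (rot as) = rot (ins (i - 1) as)"
proof -
  obtain w z where z: "as = w @ [z]" "w \<in> tuples A n" using assms(3) by (auto elim: tuples_snocE)
  obtain k where "i = Suc k" using assms(1) by (cases i) auto
  then show ?thesis using ins_append[of k w "[z]"] assms(2) tuples_length[OF z(2)] by (simp add: z)
qed

lemma rot_rot_ins:
  assumes "as \<in> tuples A (n + 1)"
  shows "ins 0 (rot as) = rot (rot (ins n as))"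
proof -
  obtain w z where z: "as = w @ [z]" "w \<in> tuples A n" using assms by (auto elim: tuples_snocE)
  have "ins n as = (w @ [z]) @ [1\<^sub>A]" using ins_last[of w z] tuples_length[OF z(2)] z by simp
  then show ?thesis using rot_snoc[of "w @ [z]" "1\<^sub>A"] rot_snoc[of "1\<^sub>A # w" z] by (simp add: z)
qed

lemma rot_power: "as \<in> tuples A (Suc n) \<Longrightarrow> (rot ^^ Suc n) as = as"
proof -
  assume as: "as \<in> tuples A (Suc n)"
  have t: "(rot ^^ k) as \<in> tuples A (Suc n)" for k by (induction k) (auto simp: as rot_tuples)
  have inv: "rotate1 (rot xs) = xs" if "xs \<in> tuples A (Suc n)" for xs
    using that by (elim tuples_snocE) simp
  have "(rotate1 ^^ k) ((rot ^^ k) as) = as" for k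
  proof (induction k)
    case (Suc k)
    have "(rotate1 ^^ Suc k) ((rot ^^ Suc k) as) = (rotate1 ^^ k) (rotate1 (rot ((rot ^^ k) as)))"
      by (subst funpow_Suc_right[of k rotate1]) simp
    then show ?case using Suc inv[OF t] by simp
  qed simp
  from this[of "Suc n"] have "rotate (Suc n) ((rot ^^ Suc n) as) = as" by (simp add: rotate_def)
  moreover have "rotate (Suc n) xs = xs" if "xs \<in> tuples A (Suc n)" for xs
    using tuples_length[OF that] by (intro rotate_id) simp
  ultimately show ?thesis using t[of "Suc n"] by simp
qed

lemma rel_cyclic_object: "cyclic_object K ZZ"
proof (rule cyclic_object.intro)
  show "module K (space ZZ n)" for n by (simp add: Z_module)
  show "face ZZ (n + 1) i \<in> lin_hom K (space ZZ (n + 1)) (space ZZ n)" if "i \<le> n + 1" for i n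
    using face_ZZ_lin[of i n] that by simp
  show "degen ZZ n i \<in> lin_hom K (space ZZ n) (space ZZ (n + 1))" if "i \<le> n" for i n
    using degen_ZZ_lin[OF that] by simp
  show "cyc ZZ n \<in> lin_hom K (space ZZ n) (space ZZ n)" for n using cyc_ZZ_lin by simp
  show "face ZZ (n + 1) i (face ZZ (n + 2) j x) = face ZZ (n + 1) (j - 1) (face ZZ (n + 2) i x)"
    if "i < j" "j \<le> n + 2" "x \<in> carrier (space ZZ (n + 2))" for i j n x
  proof -
    have l: "(\<lambda>x. face ZZ (Suc n) k (face ZZ (Suc (Suc n)) l x)) \<in> lin_hom K (Z (Suc (Suc n))) (Z n)"
      if "k \<le> Suc n" "l \<le> Suc (Suc n)" for k l
      by (rule lin_hom_comp[OF face_ZZ_lin face_ZZ_lin]) (use that in auto)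
    show ?thesis
      using Z_ext[OF Z_module l[of i j] l[of "j - 1" i], of x] fc_fc[of i j n] that
      by (simp add: face_ZZ_zc fc_tuples numeral_3_eq_3)
  qed
  show "degen ZZ (n + 1) i (degen ZZ n j x) = degen ZZ (n + 1) (j + 1) (degen ZZ n i x)"
    if "i \<le> j" "j \<le> n" "x \<in> carrier (space ZZ n)" for i j n x
  proof -
    have l: "(\<lambda>x. degen ZZ (Suc n) k (degen ZZ n l x)) \<in> lin_hom K (Z n) (Z (Suc (Suc n)))"
      if "k \<le> Suc n" "l \<le> n" for k l
      by (rule lin_hom_comp[OF degen_ZZ_lin degen_ZZ_lin]) (use that in auto)
    show ?thesis
      using Z_ext[OF Z_module l[of i j] l[of "Suc j" i], of x] ins_ins[of i j] that
      by (simp add: degen_ZZ_zc ins_tuples tuples_length)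
  qed
  show "face ZZ (n + 2) i (degen ZZ (n + 1) j x) = degen ZZ n (j - 1) (face ZZ (n + 1) i x)"
    if "i < j" "j \<le> n + 1" "x \<in> carrier (space ZZ (n + 1))" for i j n x
  proof -
    have l: "(\<lambda>x. face ZZ (Suc (Suc n)) i (degen ZZ (Suc n) j x)) \<in> lin_hom K (Z (Suc n)) (Z (Suc n))"
      by (rule lin_hom_comp[OF degen_ZZ_lin face_ZZ_lin]) (use that in auto)
    have r: "(\<lambda>x. degen ZZ n (j - 1) (face ZZ (Suc n) i x)) \<in> lin_hom K (Z (Suc n)) (Z (Suc n))"
      by (rule lin_hom_comp[OF face_ZZ_lin degen_ZZ_lin]) (use that in auto)
    have e: "fc (Suc (Suc n)) i (ins j as) = ins (j - 1) (fc (Suc n) i as)" if "as \<in> tuples A (Suc (Suc n))" for as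
      using mrg_ins_less[of i j as] tuples_length[OF that] \<open>i < j\<close> \<open>j \<le> n + 1\<close> by (simp add: fc_def)
    show ?thesis
      using Z_ext[OF Z_module l r, of x] that by (simp add: face_ZZ_zc degen_ZZ_zc fc_tuples ins_tuples e)
  qed
  show "face ZZ (n + 1) i (degen ZZ n j x) = x"
    if "i = j \<or> i = j + 1" "j \<le> n" "x \<in> carrier (space ZZ n)" for i j n x
  proof -
    have l: "(\<lambda>x. face ZZ (Suc n) i (degen ZZ n j x)) \<in> lin_hom K (Z n) (Z n)"
      by (rule lin_hom_comp[OF degen_ZZ_lin face_ZZ_lin]) (use that in auto)
    have e: "fc (Suc n) i (ins j as) = as" if as: "as \<in> tuples A (Suc n)" for as
    proof (cases "i < Suc n")
      case True
      then show ?thesis using mrg_ins_eq[of j as] mrg_ins_Suc[of j as] as \<open>i = j \<or> i = j + 1\<close> \<open>j \<le> n\<close>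
        by (auto simp: fc_def tuples_def)
    next
      case False
      then have j: "j = n" "i = Suc n" using \<open>i = j \<or> i = j + 1\<close> \<open>j \<le> n\<close> by auto
      obtain a w where a: "as = a # w" "a \<in> carrier A" using as by (auto simp: tuples_Suc)
      obtain v z where v: "as = v @ [z]" "v \<in> tuples A n" using tuples_snocE[OF as] .
      have "ins j as = (v @ [z]) @ [1\<^sub>A]" using ins_last[of v z] tuples_length[OF v(2)] v j by simp
      then have "ins j as = a # w @ [1\<^sub>A]" using v(1)[symmetric] a(1) by simp
      then show ?thesis using a j by (simp add: fc_def rot_ends)
    qed
    have "face ZZ (Suc n) i (degen ZZ n j (zc n as)) = zc n as" if "as \<in> tuples A (Suc n)" for as
    proof -
      have "ins j as \<in> tuples A (Suc (Suc n))" by (rule ins_tuples[OF that]) (use \<open>j \<le> n\<close> in simp)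
      from face_ZZ_zc[OF _ this, of i] degen_ZZ_zc[OF \<open>j \<le> n\<close> that] e[OF that] show ?thesis
        using \<open>i = j \<or> i = j + 1\<close> \<open>j \<le> n\<close> by auto
    qed
    from Z_ext[OF Z_module l lin_hom_id this, of x] that(3) show ?thesis by simp
  qed
  show "face ZZ (n + 2) i (degen ZZ (n + 1) j x) = degen ZZ n j (face ZZ (n + 1) (i - 1) x)"
    if "j + 1 < i" "i \<le> n + 2" "x \<in> carrier (space ZZ (n + 1))" for i j n x
  proof -
    have l: "(\<lambda>x. face ZZ (Suc (Suc n)) i (degen ZZ (Suc n) j x)) \<in> lin_hom K (Z (Suc n)) (Z (Suc n))"
      by (rule lin_hom_comp[OF degen_ZZ_lin face_ZZ_lin]) (use that in auto)
    have r: "(\<lambda>x. degen ZZ n j (face ZZ (Suc n) (i - 1) x)) \<in> lin_hom K (Z (Suc n)) (Z (Suc n))"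
      by (rule lin_hom_comp[OF face_ZZ_lin degen_ZZ_lin]) (use that in auto)
    show ?thesis
      using Z_ext[OF Z_module l r, of x] fc_ins_greater[of j i n] that
      by (simp add: face_ZZ_zc degen_ZZ_zc fc_tuples ins_tuples)
  qed
  show "face ZZ (n + 1) i (cyc ZZ (n + 1) x) = cyc ZZ n (face ZZ (n + 1) (i - 1) x)"
    if "1 \<le> i" "i \<le> n + 1" "x \<in> carrier (space ZZ (n + 1))" for i n x
  proof -
    have l: "(\<lambda>x. face ZZ (Suc n) i (cyc ZZ (Suc n) x)) \<in> lin_hom K (Z (Suc n)) (Z n)"
      by (rule lin_hom_comp[OF cyc_ZZ_lin face_ZZ_lin]) (use that in auto)
    have r: "(\<lambda>x. cyc ZZ n (face ZZ (Suc n) (i - 1) x)) \<in> lin_hom K (Z (Suc n)) (Z n)"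
      by (rule lin_hom_comp[OF face_ZZ_lin cyc_ZZ_lin]) (use that in auto)
    show ?thesis
      using Z_ext[OF Z_module l r, of x] fc_rot[of i n] that
      by (simp add: face_ZZ_zc cyc_ZZ_zc fc_tuples rot_tuples)
  qed
  show "face ZZ (n + 1) 0 (cyc ZZ (n + 1) x) = face ZZ (n + 1) (n + 1) x"
    if "x \<in> carrier (space ZZ (n + 1))" for n x
  proof -
    have l: "(\<lambda>x. face ZZ (Suc n) 0 (cyc ZZ (Suc n) x)) \<in> lin_hom K (Z (Suc n)) (Z n)"
      by (rule lin_hom_comp[OF cyc_ZZ_lin face_ZZ_lin]) auto
    show ?thesis
      using Z_ext[OF Z_module l face_ZZ_lin[of "Suc n" n], of x] that
      by (simp add: face_ZZ_zc cyc_ZZ_zc rot_tuples) (simp add: fc_def)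
  qed
  show "degen ZZ n i (cyc ZZ n x) = cyc ZZ (n + 1) (degen ZZ n (i - 1) x)"
    if "1 \<le> i" "i \<le> n" "x \<in> carrier (space ZZ n)" for i n x
  proof -
    have l: "(\<lambda>x. degen ZZ n i (cyc ZZ n x)) \<in> lin_hom K (Z n) (Z (Suc n))"
      by (rule lin_hom_comp[OF cyc_ZZ_lin degen_ZZ_lin]) (use that in auto)
    have r: "(\<lambda>x. cyc ZZ (Suc n) (degen ZZ n (i - 1) x)) \<in> lin_hom K (Z n) (Z (Suc n))"
      by (rule lin_hom_comp[OF degen_ZZ_lin cyc_ZZ_lin]) (use that in auto)
    show ?thesis
      using Z_ext[OF Z_module l r, of x] rot_ins[of i n] that
      by (simp add: degen_ZZ_zc cyc_ZZ_zc ins_tuples rot_tuples)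
  qed
  show "degen ZZ n 0 (cyc ZZ n x) = cyc ZZ (n + 1) (cyc ZZ (n + 1) (degen ZZ n n x))"
    if "x \<in> carrier (space ZZ n)" for n x
  proof -
    have l: "(\<lambda>x. degen ZZ n 0 (cyc ZZ n x)) \<in> lin_hom K (Z n) (Z (Suc n))"
      by (rule lin_hom_comp[OF cyc_ZZ_lin degen_ZZ_lin]) auto
    have r: "(\<lambda>x. cyc ZZ (Suc n) (cyc ZZ (Suc n) (degen ZZ n n x))) \<in> lin_hom K (Z n) (Z (Suc n))"
      by (rule lin_hom_comp[OF lin_hom_comp[OF degen_ZZ_lin cyc_ZZ_lin] cyc_ZZ_lin]) auto
    show ?thesis
      using Z_ext[OF Z_module l r, of x] rot_rot_ins[of _ n] that
      by (simp add: degen_ZZ_zc cyc_ZZ_zc ins_tuples rot_tuples)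
  qed
  show "(cyc ZZ n ^^ (n + 1)) x = x" if "x \<in> carrier (space ZZ n)" for n x
  proof -
    have l: "(cyc ZZ n ^^ k) \<in> lin_hom K (Z n) (Z n)" for k
    proof (induction k)
      case (Suc k)
      have "(\<lambda>x. cyc ZZ n ((cyc ZZ n ^^ k) x)) \<in> lin_hom K (Z n) (Z n)" by (rule lin_hom_comp[OF Suc cyc_ZZ_lin])
      then show ?case by (simp add: comp_def)
    qed (simp add: lin_hom_id id_def)
    have e: "(cyc ZZ n ^^ k) (zc n as) = zc n ((rot ^^ k) as) \<and> (rot ^^ k) as \<in> tuples A (Suc n)"
      if "as \<in> tuples A (Suc n)" for k as
      by (induction k) (auto simp: that cyc_ZZ_zc rot_tuples)
    show ?thesis
      using Z_ext[OF Z_module l[of "Suc n"] lin_hom_id, of x] e[of _ "Suc n"] rot_power that by (simp del: funpow.simps)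
  qed
qed

end

lemma balanced_cong:
  assumes "k_algebra K A" "B \<subseteq> carrier A" "balanced A B n F" "\<And>as. as \<in> tuples A n \<Longrightarrow> F as = G as"
  shows "balanced A B n G"
  unfolding balanced_def
proof (intro allI impI)
  interpret k_algebra K A by fact
  fix xs x b y ys assume b: "b \<in> B" and t: "xs @ [x, y] @ ys \<in> tuples A n"
  have "b \<in> carrier A" using b assms(2) by blast
  moreover have "x \<in> carrier A" "y \<in> carrier A" "set xs \<subseteq> carrier A" "set ys \<subseteq> carrier A" "length xs + (2 + length ys) = n"
    using t by (auto simp: tuples_def)
  ultimately have "xs @ [x \<otimes>\<^bsub>A\<^esub> b, y] @ ys \<in> tuples A n" "xs @ [x, b \<otimes>\<^bsub>A\<^esub> y] @ ys \<in> tuples A n"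
    by (simp_all add: tuples_def)
  from assms(4)[OF this(1)] assms(4)[OF this(2)] balancedD[OF assms(3) b t]
  show "G (xs @ [x \<otimes>\<^bsub>A\<^esub> b, y] @ ys) = G (xs @ [x, b \<otimes>\<^bsub>A\<^esub> y] @ ys)" by simp
qed

section \<open>Iterating the Galois map\<close>

sublocale galois_extension \<subseteq> P: algebra_pair K A B
  by unfold_locales (rule B_sub)

context galois_extension begin

text \<open>The Galois map applied \<open>n\<close> times from the right gives \<open>A \<otimes>\<^sub>B \<dots> \<otimes>\<^sub>B A \<rightarrow> H\<^sup>\<otimes>\<^sup>n \<otimes> A\<close>, and \<open>psi\<close> its inverse.
  Both are given on generators, as lists of summands.\<close>

fun phi :: "'a list \<Rightarrow> ('h list \<times> 'a) list" where
  "phi [] = []"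
| "phi [a] = [([], a)]"
| "phi (a # c # as) = concat (map (\<lambda>p. map (\<lambda>q. (snd q # fst p, a \<cdot> fst q)) (rl (snd p))) (phi (c # as)))"

primrec psi :: "'h list \<Rightarrow> 'a \<Rightarrow> 'a list list" where
  "psi [] c = [[c]]"
| "psi (h # hs) c = concat (map (\<lambda>p. map (Cons (c \<cdot> fst p)) (psi hs (snd p))) (kl h))"

definition mbil :: "nat \<Rightarrow> ('k,'w,'u) module_scheme \<Rightarrow> ('h list \<Rightarrow> 'a \<Rightarrow> 'w) \<Rightarrow> bool"
  where "mbil n W F \<longleftrightarrow> (\<forall>c\<in>carrier A. mlin K H W n (\<lambda>X. F X c)) \<and>
    (\<forall>X\<in>tuples H n. (\<lambda>c. F X c) \<in> lin_hom K A W)"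

lemma mbilI:
  "(\<And>c. c \<in> carrier A \<Longrightarrow> mlin K H W n (\<lambda>X. F X c)) \<Longrightarrow>
   (\<And>X. X \<in> tuples H n \<Longrightarrow> (\<lambda>c. F X c) \<in> lin_hom K A W) \<Longrightarrow> mbil n W F"
  by (simp add: mbil_def)

lemma mbilD:
  assumes "mbil n W F"
  shows "c \<in> carrier A \<Longrightarrow> mlin K H W n (\<lambda>X. F X c)"
    and "X \<in> tuples H n \<Longrightarrow> (\<lambda>c. F X c) \<in> lin_hom K A W"
    and "X \<in> tuples H n \<Longrightarrow> c \<in> carrier A \<Longrightarrow> F X c \<in> carrier W"
  using assms unfolding mbil_def by (blast, blast, blast intro: lin_hom_closed)

lemma mbil_bilin:
  assumes "mbil (Suc n) W F" "X \<in> tuples H n"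
  shows "bilin K A H W (\<lambda>a h. F (h # X) a)"
  by (rule bilinI) (use assms mbilD(1)[OF assms(1)] mbilD(2)[OF assms(1)] in auto)

abbreviation "phi_step W F a \<equiv> (\<lambda>X c. lsum W (rl c) (\<lambda>q. F (snd q # X) (a \<cdot> fst q)))"

lemma mbil_step:
  assumes "module K W" "mbil (Suc n) W F" "a \<in> carrier A"
  shows "mbil n W (phi_step W F a)"
proof (rule mbilI)
  show "mlin K H W n (\<lambda>X. phi_step W F a X c)" for c
    by (rule mlin_lsum[OF assms(1)]) (use mbilD(1)[OF assms(2)] assms(3) in simp)
  show "phi_step W F a X \<in> lin_hom K A W" if "X \<in> tuples H n" for X
    by (rule rl_lin[OF assms(1) left_mult_bilin[OF mbil_bilin[OF assms(2) that] assms(3)]])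
qed

lemma phi_set:
  assumes "as \<in> tuples A (Suc n)" "p \<in> set (phi as)"
  shows "fst p \<in> tuples H n \<and> snd p \<in> carrier A"
  using assms
proof (induction as arbitrary: n p rule: phi.induct)
  case (3 a c as)
  then obtain m where n: "n = Suc m" by (cases n) auto
  from 3(3) obtain q r where q: "q \<in> set (phi (c # as))" "r \<in> set (rl (snd q))"
    "p = (snd r # fst q, a \<cdot> fst r)" by auto
  have "fst q \<in> tuples H m" using 3(1)[of m q] 3(2) q(1) n by simp
  then show ?case using q n 3(2) by simp
qed (auto simp: tuples_def)

abbreviation "psum W as F \<equiv> lsum W (phi as) (\<lambda>p. F (fst p) (snd p))"

lemma psum_Cons:
  assumes "module K W" "mbil (Suc n) W F" "a \<in> carrier A" "as \<in> tuples A (Suc n)"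
  shows "psum W (a # as) F = psum W as (phi_step W F a)"
proof -
  obtain c cs where as: "as = c # cs" using assms(4) by (auto simp: tuples_Suc)
  have "psum W (a # as) F = lsum W (phi as) (\<lambda>p. lsum W (map (\<lambda>q. (snd q # fst p, a \<cdot> fst q)) (rl (snd p))) (\<lambda>p. F (fst p) (snd p)))"
    unfolding as phi.simps(3)
  proof (rule module.lsum_concat[OF assms(1)])
    fix p r assume p: "p \<in> set (phi (c # cs))" and "r \<in> set (map (\<lambda>q. (snd q # fst p, a \<cdot> fst q)) (rl (snd p)))"
    then obtain q where "q \<in> set (rl (snd p))" "r = (snd q # fst p, a \<cdot> fst q)" by auto
    then show "F (fst r) (snd r) \<in> carrier W"
      using phi_set[OF assms(4), of p] p as assms(3) by (auto intro!: mbilD(3)[OF assms(2)])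
  qed
  then show ?thesis by simp
qed

lemma psum_closed:
  assumes "module K W" "mbil n W F" "as \<in> tuples A (Suc n)"
  shows "psum W as F \<in> carrier W"
  by (rule module.lsum_closed[OF assms(1)]) (use phi_set[OF assms(3)] mbilD(3)[OF assms(2)] in blast)

lemma psum_single: "module K W \<Longrightarrow> mbil 0 W F \<Longrightarrow> a \<in> carrier A \<Longrightarrow> psum W [a] F = F [] a"
  using module.lsum_single[of K W "\<lambda>p. F (fst p) (snd p)" "([], a)"] mbilD(3)[of 0 W F "[]" a] by simp

lemma psum_mlin:
  assumes "module K W" "mbil n W F"
  shows "mlin K A W (Suc n) (\<lambda>as. psum W as F)"
  using assms(2)
proof (induction n arbitrary: F)
  case 0
  have "(\<lambda>a. F [] a) \<in> lin_hom K A W" using mbilD(2)[OF 0, of "[]"] by simp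
  then show ?case unfolding mlin_1
    by (rule lin_hom_cong[OF A.module]) (simp only: psum_single[OF assms(1) 0])
next
  case (Suc n)
  note M = assms(1)
  have "mlin K A W (Suc n) (\<lambda>as. psum W (a # as) F)" if a: "a \<in> carrier A" for a
    by (rule mlin_cong[OF A.module Suc.IH[OF mbil_step[OF M Suc.prems a]]])
      (simp only: psum_Cons[OF M Suc.prems a])
  moreover have "(\<lambda>a. psum W (a # as) F) \<in> lin_hom K A W" if as: "as \<in> tuples A (Suc n)" for as
  proof -
    have "(\<lambda>a. psum W as (phi_step W F a)) \<in> lin_hom K A W"
    proof (rule module.lin_lsum[OF M], rule module.lin_lsum[OF M])
      fix p q assume p: "p \<in> set (phi as)" and q: "q \<in> set (rl (snd p))"
      have "snd q # fst p \<in> tuples H (Suc n)" using phi_set[OF as p] q by simp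
      then show "(\<lambda>a. F (snd q # fst p) (a \<cdot> fst q)) \<in> lin_hom K A W"
        using q by (intro lin_hom_comp[OF A.mult_lin_left mbilD(2)[OF Suc.prems]]) auto
    qed
    then show ?thesis by (rule lin_hom_cong[OF A.module]) (simp only: psum_Cons[OF M Suc.prems _ as])
  qed
  ultimately show ?case by (subst mlin.simps(2)) blast
qed

lemma psum_lft:
  assumes "as \<in> tuples A (Suc n)" "b \<in> carrier A"
  shows "psum W (P.lft b as) F = psum W as (\<lambda>X c. F X (b \<cdot> c))"
proof -
  have "phi (P.lft b as) = map (\<lambda>p. (fst p, b \<cdot> snd p)) (phi as)"
    using assms(1)
  proof (cases as rule: phi.cases)
    case (3 a c cs)
    have a: "a \<in> carrier A" using assms(1) 3 by simp
    show ?thesis unfolding 3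
      by (auto simp: map_concat comp_def A.A_assoc a assms(2) intro!: arg_cong[of _ _ concat] map_cong dest!: rl_set_pair)
  qed (auto simp: tuples_def)
  then show ?thesis by simp
qed

lemma psum_rgt:
  assumes "module K W" "mbil n W F" "as \<in> tuples A (Suc n)" "b \<in> B"
  shows "psum W (P.rgt b as) F = psum W as (\<lambda>X c. F X (c \<cdot> b))"
  using assms(2,3)
proof (induction n arbitrary: F as)
  case 0
  then obtain a where a: "as = [a]" "a \<in> carrier A" by (auto simp: tuples_Suc)
  then show ?case using assms(4) by simp
next
  case (Suc n)
  note M = assms(1)
  then obtain a cs where a: "as = a # cs" "a \<in> carrier A" "cs \<in> tuples A (Suc n)" using Suc.prems by (auto simp: tuples_Suc)
  have b: "b \<in> carrier A" using assms(4) by simp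
  have m': "mbil (Suc n) W (\<lambda>X c. F X (c \<cdot> b))"
    by (rule mbilI) (use mbilD(1)[OF Suc.prems(1)] b lin_hom_comp[OF A.mult_lin_left[OF b] mbilD(2)[OF Suc.prems(1)]] in auto)
  have "P.rgt b as = a # P.rgt b cs" using a by (auto simp: tuples_Suc)
  then have "psum W (P.rgt b as) F = psum W (P.rgt b cs) (phi_step W F a)"
    using psum_Cons[OF M Suc.prems(1) a(2) P.rgt_tuples[OF a(3) b]] by simp
  also have "\<dots> = psum W cs (\<lambda>X c. phi_step W F a X (c \<cdot> b))"
    by (rule Suc.IH[OF mbil_step[OF M Suc.prems(1) a(2)] a(3)])
  also have "\<dots> = psum W cs (phi_step W (\<lambda>X c. F X (c \<cdot> b)) a)"
  proof (rule lsum_cong)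
    fix p assume "p \<in> set (phi cs)"
    then have p: "fst p \<in> tuples H n" "snd p \<in> carrier A" using phi_set[OF a(3)] by auto
    have "phi_step W F a (fst p) (snd p \<cdot> b) = lsum W (rl (snd p)) (\<lambda>q. F (snd q # fst p) (a \<cdot> (fst q \<cdot> b)))"
      by (rule rl_coinv_right[OF M left_mult_bilin[OF mbil_bilin[OF Suc.prems(1) p(1)] a(2)] assms(4) p(2)])
    also have "\<dots> = lsum W (rl (snd p)) (\<lambda>q. F (snd q # fst p) (a \<cdot> fst q \<cdot> b))"
      by (rule lsum_cong) (simp add: A.A_assoc a b)
    finally show "phi_step W F a (fst p) (snd p \<cdot> b) = \<dots>" .
  qed
  also have "\<dots> = psum W as (\<lambda>X c. F X (c \<cdot> b))"
    unfolding a(1) by (rule psum_Cons[OF M m' a(2,3), symmetric])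
  finally show ?case .
qed

lemma psum_bal:
  assumes "module K W" "mbil n W F"
  shows "balanced A B (Suc n) (\<lambda>as. psum W as F)"
  using assms(2)
proof (induction n arbitrary: F)
  case 0 show ?case by (rule balanced_1)
next
  case (Suc n)
  note M = assms(1)
  show ?case
  proof (rule balanced_ConsI)
    fix a assume a: "a \<in> carrier A"
    show "balanced A B (Suc n) (\<lambda>as. psum W (a # as) F)"
      by (rule balanced_cong[OF A.k_algebra_axioms B_sub Suc.IH[OF mbil_step[OF M Suc.prems a]]])
        (simp only: psum_Cons[OF M Suc.prems a])
  next
    fix x y b ys assume t: "x \<in> carrier A" "y \<in> carrier A" "ys \<in> tuples A n" "b \<in> B"
    have b: "b \<in> carrier A" using t by simp
    have yt: "y # ys \<in> tuples A (Suc n)" using t by simp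
    have "psum W (x # b \<cdot> y # ys) F = psum W (b \<cdot> y # ys) (phi_step W F x)"
      by (rule psum_Cons[OF M Suc.prems t(1)]) (use t b in simp)
    also have "\<dots> = psum W (y # ys) (\<lambda>X c. phi_step W F x X (b \<cdot> c))"
      using psum_lft[OF yt b, of W "phi_step W F x"] by simp
    also have "\<dots> = psum W (y # ys) (phi_step W F (x \<cdot> b))"
    proof (rule lsum_cong)
      fix p assume "p \<in> set (phi (y # ys))"
      then have p: "fst p \<in> tuples H n" "snd p \<in> carrier A" using phi_set[OF yt] by auto
      have "phi_step W F x (fst p) (b \<cdot> snd p) = lsum W (rl (snd p)) (\<lambda>q. F (snd q # fst p) (x \<cdot> (b \<cdot> fst q)))"
        by (rule rl_coinv_left[OF M left_mult_bilin[OF mbil_bilin[OF Suc.prems(1) p(1)] t(1)] t(4) p(2)])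
      also have "\<dots> = phi_step W F (x \<cdot> b) (fst p) (snd p)"
        by (rule lsum_cong) (simp add: A.A_assoc t b)
      finally show "phi_step W F x (fst p) (b \<cdot> snd p) = \<dots>" .
    qed
    also have "\<dots> = psum W (x \<cdot> b # y # ys) F"
      by (rule psum_Cons[OF M Suc.prems _ yt, symmetric]) (use t b in simp)
    finally show "psum W (x \<cdot> b # y # ys) F = psum W (x # b \<cdot> y # ys) F" by simp
  qed
qed

lemma psi_tuples: "length hs = n \<Longrightarrow> c \<in> carrier A \<Longrightarrow> zs \<in> set (psi hs c) \<Longrightarrow> zs \<in> tuples A (Suc n)"
proof (induction hs arbitrary: n c zs)
  case (Cons h hs)
  then obtain p ws where p: "p \<in> set (kl h)" "ws \<in> set (psi hs (snd p))" "zs = c \<cdot> fst p # ws" by auto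
  then have "ws \<in> tuples A (Suc (length hs))" by (intro Cons.IH[of _ "snd p"]) auto
  then show ?case using p Cons.prems by auto
qed simp

abbreviation "qsum W hs c F \<equiv> lsum W (psi hs c) F"

lemma qsum_Nil: "module K W \<Longrightarrow> F [c] \<in> carrier W \<Longrightarrow> qsum W [] c F = F [c]"
  using module.lsum_single[of K W F "[c]"] by simp

lemma qsum_Cons:
  assumes "module K W" "\<And>zs. zs \<in> tuples A (Suc (Suc (length hs))) \<Longrightarrow> F zs \<in> carrier W" "c \<in> carrier A"
  shows "qsum W (h # hs) c F = lsum W (kl h) (\<lambda>p. qsum W hs (snd p) (\<lambda>zs. F (c \<cdot> fst p # zs)))"
proof -
  have "qsum W (h # hs) c F = lsum W (kl h) (\<lambda>p. lsum W (map (Cons (c \<cdot> fst p)) (psi hs (snd p))) F)"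
    unfolding psi.simps
  proof (rule module.lsum_concat[OF assms(1)])
    fix p zs assume "p \<in> set (kl h)" "zs \<in> set (map ((#) (c \<cdot> fst p)) (psi hs (snd p)))"
    then show "F zs \<in> carrier W" using psi_tuples[of hs "length hs" "snd p"] assms(3) by (auto intro!: assms(2))
  qed
  then show ?thesis by simp
qed

lemma psi_lft:
  assumes "b \<in> carrier A" "c \<in> carrier A"
  shows "psi hs (b \<cdot> c) = map (P.lft b) (psi hs c)"
  using assms by (cases hs) (auto simp: map_concat comp_def A.A_assoc intro!: arg_cong[of _ _ concat] map_cong dest!: kl_set_pair)

lemma qsum_lft:
  assumes "b \<in> carrier A" "c \<in> carrier A"
  shows "qsum W hs (b \<cdot> c) F = qsum W hs c (\<lambda>zs. F (P.lft b zs))"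
  by (simp add: psi_lft[OF assms])

lemma qsum_lin:
  assumes "module K W" "mlin K A W (Suc n) F" "length hs = n"
  shows "(\<lambda>c. qsum W hs c F) \<in> lin_hom K A W"
proof (cases hs)
  case Nil
  have "(\<lambda>c. F [c]) \<in> lin_hom K A W" using assms(2,3) Nil mlin_1[of K A W F] by simp
  then show ?thesis unfolding Nil
    by (rule lin_hom_cong[OF A.module]) (rule qsum_Nil[OF assms(1), symmetric], rule mlin_closed[OF assms(2)], use assms(3) Nil in simp)
next
  case (Cons h hs')
  then obtain m where n: "n = Suc m" "length hs' = m" using assms(3) by auto
  note F = assms(2)[unfolded n]
  have "(\<lambda>c. lsum W (kl h) (\<lambda>p. qsum W hs' (snd p) (\<lambda>zs. F (c \<cdot> fst p # zs)))) \<in> lin_hom K A W"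
  proof (rule module.lin_lsum[OF assms(1)], rule module.lin_lsum[OF assms(1)])
    fix p zs assume p: "p \<in> set (kl h)" and "zs \<in> set (psi hs' (snd p))"
    then have "zs \<in> tuples A (Suc m)" using psi_tuples[OF n(2), of "snd p" zs] by simp
    then have "(\<lambda>c. F (c # zs)) \<in> lin_hom K A W" using F by simp
    then show "(\<lambda>c. F (c \<cdot> fst p # zs)) \<in> lin_hom K A W"
      using p by (intro lin_hom_comp[OF A.mult_lin_left]) auto
  qed
  then show ?thesis unfolding Cons
    by (rule lin_hom_cong[OF A.module]) (rule qsum_Cons[OF assms(1) mlin_closed[OF F], symmetric], use n in auto)
qed

lemma qsum_closed:
  assumes "module K W" "mlin K A W (Suc n) F" "length hs = n" "c \<in> carrier A"
  shows "qsum W hs c F \<in> carrier W"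
  by (rule lin_hom_closed[OF qsum_lin[OF assms(1-3)] assms(4)])

text \<open>The map out of \<open>A \<otimes>\<^sub>B A\<close> summed over in one step of \<open>psi\<close>.\<close>

lemma psi_step:
  assumes "module K W" "mlin K A W (Suc (Suc n)) F" "balanced A B (Suc (Suc n)) F" "length hs = n" "c \<in> carrier A"
  shows psi_step_bilin: "bilin K A A W (\<lambda>x y. qsum W hs y (\<lambda>zs. F (c \<cdot> x # zs)))"
    and psi_step_bal: "x \<in> carrier A \<Longrightarrow> y \<in> carrier A \<Longrightarrow> b \<in> B \<Longrightarrow>
      qsum W hs y (\<lambda>zs. F (c \<cdot> (x \<cdot> b) # zs)) = qsum W hs (b \<cdot> y) (\<lambda>zs. F (c \<cdot> x # zs))"
proof -
  show "bilin K A A W (\<lambda>x y. qsum W hs y (\<lambda>zs. F (c \<cdot> x # zs)))"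
  proof (rule bilinI)
    show "(\<lambda>y. qsum W hs y (\<lambda>zs. F (c \<cdot> x # zs))) \<in> lin_hom K A W" if "x \<in> carrier A" for x
      by (rule qsum_lin[OF assms(1) _ assms(4)]) (use assms(2,5) that in simp)
    show "(\<lambda>x. qsum W hs y (\<lambda>zs. F (c \<cdot> x # zs))) \<in> lin_hom K A W" if "y \<in> carrier A" for y
    proof (rule module.lin_lsum[OF assms(1)])
      fix zs assume "zs \<in> set (psi hs y)"
      then have "zs \<in> tuples A (Suc n)" using psi_tuples[OF assms(4) that] by simp
      then have "(\<lambda>x. F (x # zs)) \<in> lin_hom K A W" using assms(2) by simp
      then show "(\<lambda>x. F (c \<cdot> x # zs)) \<in> lin_hom K A W" by (rule lin_hom_comp[OF A.mult_lin_right[OF assms(5)]])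
    qed
  qed
  fix x y b assume t: "x \<in> carrier A" "y \<in> carrier A" "b \<in> B"
  then have b: "b \<in> carrier A" by simp
  show "qsum W hs y (\<lambda>zs. F (c \<cdot> (x \<cdot> b) # zs)) = qsum W hs (b \<cdot> y) (\<lambda>zs. F (c \<cdot> x # zs))"
    unfolding qsum_lft[OF b t(2)]
  proof (rule lsum_cong)
    fix zs assume "zs \<in> set (psi hs y)"
    then have "zs \<in> tuples A (Suc n)" using psi_tuples[OF assms(4) t(2)] by simp
    then obtain z ws where z: "zs = z # ws" "z \<in> carrier A" "ws \<in> tuples A n" by (auto simp: tuples_Suc)
    show "F (c \<cdot> (x \<cdot> b) # zs) = F (c \<cdot> x # P.lft b zs)"
      using balanced_head[OF assms(3), of "c \<cdot> x" z ws b] z t b assms(5) by (simp add: A.A_assoc)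
  qed
qed

lemma qsum_mlin:
  assumes "module K W" "mlin K A W (Suc n) F" "balanced A B (Suc n) F" "c \<in> carrier A"
  shows "mlin K H W n (\<lambda>hs. qsum W hs c F)"
  using assms(2-4)
proof (induction n arbitrary: F c)
  case 0
  then show ?case using qsum_closed[OF assms(1) 0(1), of "[]" c] by simp
next
  case (Suc n)
  note M = assms(1)
  have e: "qsum W (h # hs) c F = lsum W (kl h) (\<lambda>p. qsum W hs (snd p) (\<lambda>zs. F (c \<cdot> fst p # zs)))"
    if "hs \<in> tuples H n" for h hs
    by (rule qsum_Cons[OF M mlin_closed[OF Suc.prems(1)] Suc.prems(3)]) (use that in \<open>auto simp: tuples_def\<close>)
  have "mlin K H W n (\<lambda>hs. qsum W (h # hs) c F)" for h
  proof (rule mlin_cong[OF H.module])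
    show "mlin K H W n (\<lambda>hs. lsum W (kl h) (\<lambda>p. qsum W hs (snd p) (\<lambda>zs. F (c \<cdot> fst p # zs))))"
      by (rule mlin_lsum[OF M], rule Suc.IH) (use Suc.prems balanced_Cons[OF Suc.prems(2)] in auto)
  qed (simp only: e)
  moreover have "(\<lambda>h. qsum W (h # hs) c F) \<in> lin_hom K H W" if hs: "hs \<in> tuples H n" for hs
  proof -
    have l: "length hs = n" using hs by (simp add: tuples_def)
    have "(\<lambda>h. lsum W (kl h) (\<lambda>p. qsum W hs (snd p) (\<lambda>zs. F (c \<cdot> fst p # zs)))) \<in> lin_hom K H W"
      by (rule kl_lin[OF M psi_step_bilin[OF M Suc.prems(1,2) l Suc.prems(3)] psi_step_bal[OF M Suc.prems(1,2) l Suc.prems(3)]])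
    then show ?thesis by (rule lin_hom_cong[OF H.module]) (simp only: e[OF hs])
  qed
  ultimately show ?case by (subst mlin.simps(2)) blast
qed

text \<open>In the induction step, \<open>\<kappa>\<close> being a section of the Galois map makes the two outermost sums cancel.\<close>

lemma psi_phi:
  assumes "module K W" "mbil n W F" "X \<in> tuples H n" "c \<in> carrier A"
  shows "qsum W X c (\<lambda>zs. psum W zs F) = F X c"
  using assms(2-4)
proof (induction n arbitrary: F X c)
  case 0
  then show ?case using qsum_Nil[OF assms(1), of "\<lambda>zs. psum W zs F" c] psum_single[OF assms(1) 0(1,3)] mbilD(3)[OF 0(1), of "[]" c]
    by simp
next
  case (Suc n)
  note M = assms(1)
  obtain h X' where X: "X = h # X'" "h \<in> carrier H" "X' \<in> tuples H n" using Suc.prems by (auto simp: tuples_Suc)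
  have l: "length X' = n" using X by (simp add: tuples_def)
  note c = Suc.prems(3)
  have "qsum W X c (\<lambda>zs. psum W zs F) = lsum W (kl h) (\<lambda>p. qsum W X' (snd p) (\<lambda>zs. psum W (c \<cdot> fst p # zs) F))"
    unfolding X(1) by (rule qsum_Cons[OF M _ c]) (rule psum_closed[OF M Suc.prems(1)], simp add: l)
  also have "\<dots> = lsum W (kl h) (\<lambda>p. qsum W X' (snd p) (\<lambda>zs. psum W zs (phi_step W F (c \<cdot> fst p))))"
    by (rule lsum_cong, rule lsum_cong, rule psum_Cons[OF M Suc.prems(1)]) (use c in \<open>auto intro: psi_tuples[OF l, rotated] dest!: kl_set_pair\<close>)
  also have "\<dots> = lsum W (kl h) (\<lambda>p. phi_step W F (c \<cdot> fst p) X' (snd p))"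
    by (rule lsum_cong, rule Suc.IH[OF mbil_step[OF M Suc.prems(1)] X(3)]) (use c in auto)
  also have "\<dots> = lsum W (kl h) (\<lambda>p. lsum W (rl (snd p)) (\<lambda>q. F (snd q # X') (c \<cdot> (fst p \<cdot> fst q))))"
    by (rule lsum_cong, rule lsum_cong) (simp add: A.A_assoc c)
  also have "\<dots> = F (h # X') (c \<cdot> 1\<^sub>A)"
    by (rule kl_rl[OF M left_mult_bilin[OF mbil_bilin[OF Suc.prems(1) X(3)] c] X(2)])
  finally show ?case using X c by simp
qed

text \<open>Here the outermost sums cancel by \<open>\<Sum> a\<^sub>0 \<kappa>(a\<^sub>1) = 1 \<otimes> a\<close>, which applies because \<open>F\<close> is balanced over \<open>B\<close>.\<close>

lemma phi_psi:
  assumes "module K W" "mlin K A W (Suc n) F" "balanced A B (Suc n) F" "as \<in> tuples A (Suc n)"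
  shows "psum W as (\<lambda>X c. qsum W X c F) = F as"
  using assms(2-4)
proof (induction n arbitrary: F as)
  case 0
  then obtain a where a: "as = [a]" "a \<in> carrier A" by (auto simp: tuples_Suc)
  have m: "mbil 0 W (\<lambda>X c. qsum W X c F)"
    by (rule mbilI) (use qsum_mlin[OF assms(1) 0(1,2)] qsum_lin[OF assms(1) 0(1)] in auto)
  show ?case using psum_single[OF assms(1) m a(2)] qsum_Nil[OF assms(1), of F a] mlin_closed[OF 0(1,3)] a by simp
next
  case (Suc n)
  note M = assms(1)
  obtain a as' where a: "as = a # as'" "a \<in> carrier A" "as' \<in> tuples A (Suc n)" using Suc.prems by (auto simp: tuples_Suc)
  have m: "mbil (Suc n) W (\<lambda>X c. qsum W X c F)"
    by (rule mbilI) (rule qsum_mlin[OF M Suc.prems(1,2)], assumption, rule qsum_lin[OF M Suc.prems(1)], simp add: tuples_def)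
  have "psum W as (\<lambda>X c. qsum W X c F) = psum W as' (phi_step W (\<lambda>X c. qsum W X c F) a)"
    unfolding a(1) by (rule psum_Cons[OF M m a(2,3)])
  also have "\<dots> = psum W as' (\<lambda>X c. qsum W X c (\<lambda>zs. F (a # zs)))"
  proof (rule lsum_cong)
    fix p assume "p \<in> set (phi as')"
    then have p: "fst p \<in> tuples H n" "snd p \<in> carrier A" using phi_set[OF a(3)] by auto
    have l: "length (fst p) = n" using p by (simp add: tuples_def)
    have "phi_step W (\<lambda>X c. qsum W X c F) a (fst p) (snd p) = lsum W (rl (snd p)) (\<lambda>q. lsum W (kl (snd q))
        (\<lambda>r. qsum W (fst p) (snd r) (\<lambda>zs. F (a \<cdot> fst q \<cdot> fst r # zs))))"
      by (rule lsum_cong, rule qsum_Cons[OF M mlin_closed[OF Suc.prems(1)]]) (use a l in auto)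
    also have "\<dots> = lsum W (rl (snd p)) (\<lambda>q. lsum W (kl (snd q))
        (\<lambda>r. qsum W (fst p) (snd r) (\<lambda>zs. F (a \<cdot> (fst q \<cdot> fst r) # zs))))"
      by (rule lsum_cong, rule lsum_cong, rule lsum_cong) (simp add: A.A_assoc a)
    also have "\<dots> = qsum W (fst p) (snd p) (\<lambda>zs. F (a \<cdot> 1\<^sub>A # zs))"
      by (rule rl_kl[OF M psi_step_bilin[OF M Suc.prems(1,2) l a(2)] psi_step_bal[OF M Suc.prems(1,2) l a(2)] p(2)])
    finally show "phi_step W (\<lambda>X c. qsum W X c F) a (fst p) (snd p) = qsum W (fst p) (snd p) (\<lambda>zs. F (a # zs))"
      using a by simp
  qed
  also have "\<dots> = F as"
    unfolding a(1) by (rule Suc.IH) (use Suc.prems a balanced_Cons[OF Suc.prems(2)] in auto)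
  finally show ?case .
qed

end

context hopf_algebra begin
lemma tuples_snoc_iff [simp]: "xs @ [z] \<in> tuples H (Suc n) \<longleftrightarrow> xs \<in> tuples H n \<and> z \<in> carrier H"
  by (auto simp: tuples_def)

end

abbreviation (input) "rmv i xs \<equiv> take i xs @ drop (Suc i) xs"
abbreviation (input) "spl i xs p \<equiv> take i xs @ [fst p, snd p] @ drop (Suc i) xs"

lemma rmv_tuples: "xs \<in> tuples M (Suc n) \<Longrightarrow> i \<le> n \<Longrightarrow> rmv i xs \<in> tuples M n"
  by (auto simp: tuples_def dest: in_set_takeD in_set_dropD)

lemma spl_tuples: "xs \<in> tuples M n \<Longrightarrow> i < n \<Longrightarrow> fst p \<in> carrier M \<Longrightarrow> snd p \<in> carrier M \<Longrightarrow> spl i xs p \<in> tuples M (Suc n)"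
  by (auto simp: tuples_def dest: in_set_takeD in_set_dropD)

lemma nth_tuples: "xs \<in> tuples M n \<Longrightarrow> i < n \<Longrightarrow> xs ! i \<in> carrier M"
  by (auto simp: tuples_def)

context galois_extension begin

lemma mbil_omit:
  assumes "module K W" "mbil n W F" "i \<le> n"
  shows "mbil (Suc n) W (\<lambda>X c. counit H (X ! i) \<odot>\<^bsub>W\<^esub> F (rmv i X) c)"
  by (rule mbilI[OF H.mlin_omit[OF assms(1) mbilD(1)[OF assms(2)] assms(3)] smult_const_lin[OF assms(1) _ mbilD(2)[OF assms(2)]]])
    (use assms(3) nth_tuples[of _ H "Suc n" i] rmv_tuples[of _ H n i] in auto)

lemma mbil_split:
  assumes "module K W" "mbil (Suc n) W F" "i < n"
  shows "mbil n W (\<lambda>X c. lsum W (H.dl (X ! i)) (\<lambda>p. F (spl i X p) c))"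
  by (rule mbilI[OF H.mlin_split[OF assms(1) mbilD(1)[OF assms(2)] assms(3)] module.lin_lsum[OF assms(1) mbilD(2)[OF assms(2)]]])
    (use assms(3) spl_tuples[of _ H n i] in auto)

text \<open>Multiplying neighbours omits one Galois step, since \<open>\<Sum> \<epsilon>(c\<^sub>1) a c\<^sub>0 = a c\<close>.\<close>

lemma psum_mrg:
  assumes "module K W" "mbil n W F" "as \<in> tuples A (Suc (Suc n))" "i \<le> n"
  shows "psum W (P.mrg i as) F = psum W as (\<lambda>X c. counit H (X ! i) \<odot>\<^bsub>W\<^esub> F (rmv i X) c)"
  using assms(2-4)
proof (induction i arbitrary: n F as)
  case 0
  note M = assms(1)
  obtain a b cs where as: "as = a # b # cs" "a \<in> carrier A" "b # cs \<in> tuples A (Suc n)"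
    using 0(2) by (auto simp: tuples_Suc)
  have "psum W (P.mrg 0 as) F = psum W (b # cs) (\<lambda>X c. F X (a \<cdot> c))"
    using psum_lft[OF as(3,2)] by (simp add: as(1))
  also have "\<dots> = psum W (b # cs) (phi_step W (\<lambda>X c. counit H (X ! 0) \<odot>\<^bsub>W\<^esub> F (rmv 0 X) c) a)"
  proof (rule lsum_cong)
    fix p assume "p \<in> set (phi (b # cs))"
    then have p: "fst p \<in> tuples H n" "snd p \<in> carrier A" using phi_set[OF as(3)] by auto
    show "F (fst p) (a \<cdot> snd p) = phi_step W (\<lambda>X c. counit H (X ! 0) \<odot>\<^bsub>W\<^esub> F (rmv 0 X) c) a (fst p) (snd p)"
      using rl_counit[OF M lin_hom_comp[OF A.mult_lin_right[OF as(2)] mbilD(2)[OF 0(1) p(1)]] p(2)] by simp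
  qed
  also have "\<dots> = psum W as (\<lambda>X c. counit H (X ! 0) \<odot>\<^bsub>W\<^esub> F (rmv 0 X) c)"
    unfolding as(1) by (rule psum_Cons[OF M mbil_omit[OF M 0(1)] as(2,3), symmetric]) simp
  finally show ?case .
next
  case (Suc i)
  note M = assms(1)
  obtain m where n: "n = Suc m" using Suc.prems(3) by (cases n) auto
  obtain a bs where as: "as = a # bs" "a \<in> carrier A" "bs \<in> tuples A (Suc (Suc m))"
    using Suc.prems(2) n by (auto simp: tuples_Suc)
  note F = Suc.prems(1)[unfolded n]
  note i = Suc.prems(3)[unfolded n]
  have "psum W (P.mrg (Suc i) as) F = psum W (P.mrg i bs) (phi_step W F a)"
    unfolding as(1) P.mrg.simps
    by (rule psum_Cons[OF M F as(2) P.mrg_tuples[OF as(3)]]) (use i in simp)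
  also have "\<dots> = psum W bs (\<lambda>X c. counit H (X ! i) \<odot>\<^bsub>W\<^esub> phi_step W F a (rmv i X) c)"
    by (rule Suc.IH[OF mbil_step[OF M F as(2)] as(3)]) (use i in simp)
  also have "\<dots> = psum W bs (phi_step W (\<lambda>X c. counit H (X ! Suc i) \<odot>\<^bsub>W\<^esub> F (rmv (Suc i) X) c) a)"
  proof (rule lsum_cong)
    fix p assume "p \<in> set (phi bs)"
    then have p: "fst p \<in> tuples H (Suc m)" "snd p \<in> carrier A" using phi_set[OF as(3)] by auto
    have "F (snd q # rmv i (fst p)) (a \<cdot> fst q) \<in> carrier W" if "q \<in> set (rl (snd p))" for q
      using that rmv_tuples[OF p(1), of i] i as(2) by (intro mbilD(3)[OF F]) auto
    then show "counit H (fst p ! i) \<odot>\<^bsub>W\<^esub> phi_step W F a (rmv i (fst p)) (snd p)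
        = phi_step W (\<lambda>X c. counit H (X ! Suc i) \<odot>\<^bsub>W\<^esub> F (rmv (Suc i) X) c) a (fst p) (snd p)"
      using module.lsum_smult[OF M, of "counit H (fst p ! i)" "rl (snd p)" "\<lambda>q. F (snd q # rmv i (fst p)) (a \<cdot> fst q)"]
        nth_tuples[OF p(1), of i] i by simp
  qed
  also have "\<dots> = psum W as (\<lambda>X c. counit H (X ! Suc i) \<odot>\<^bsub>W\<^esub> F (rmv (Suc i) X) c)"
    unfolding as(1) by (rule psum_Cons[OF M mbil_omit[OF M F] as(2,3), symmetric]) (use i in simp)
  finally show ?case .
qed

text \<open>An inserted \<open>1\<close> applies \<open>\<rho>\<close> twice in a row; by coassociativity, this is \<open>\<Delta>\<close> on the factor obtained from
  one application.\<close>

lemma psum_ins: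
  assumes "module K W" "mbil (Suc n) W F" "as \<in> tuples A (Suc n)" "i < n"
  shows "psum W (P.ins i as) F = psum W as (\<lambda>X c. lsum W (H.dl (X ! i)) (\<lambda>p. F (spl i X p) c))"
  using assms(2-4)
proof (induction i arbitrary: n F as)
  case 0
  note M = assms(1)
  obtain m where n: "n = Suc m" using 0(3) by (cases n) auto
  obtain a bs where as: "as = a # bs" "a \<in> carrier A" "bs \<in> tuples A (Suc m)"
    using 0(2) n by (auto simp: tuples_Suc)
  note F = 0(1)[unfolded n]
  have o: "1\<^sub>A \<in> carrier A" by simp
  have "psum W (P.ins 0 as) F = psum W (1\<^sub>A # bs) (phi_step W F a)"
    unfolding as(1) P.ins.simps by (rule psum_Cons[OF M F as(2)]) (use as in simp)
  also have "\<dots> = psum W bs (phi_step W (phi_step W F a) 1\<^sub>A)"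
    by (rule psum_Cons[OF M mbil_step[OF M F as(2)] o as(3)])
  also have "\<dots> = psum W bs (phi_step W (\<lambda>X c. lsum W (H.dl (X ! 0)) (\<lambda>p. F (spl 0 X p) c)) a)"
  proof (rule lsum_cong)
    fix p assume "p \<in> set (phi bs)"
    then have p: "fst p \<in> tuples H m" "snd p \<in> carrier A" using phi_set[OF as(3)] by auto
    have t: "trilin K A H H W (\<lambda>x g h. F (g # h # fst p) (a \<cdot> x))"
    proof (rule trilinI)
      show "(\<lambda>x. F (g # h # fst p) (a \<cdot> x)) \<in> lin_hom K A W" if "g \<in> carrier H" "h \<in> carrier H" for g h
        by (rule lin_hom_comp[OF A.mult_lin_right[OF as(2)] mbilD(2)[OF F]]) (use that p in simp)
      show "(\<lambda>g. F (g # h # fst p) (a \<cdot> x)) \<in> lin_hom K H W" if "x \<in> carrier A" "h \<in> carrier H" for x h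
        using mbilD(1)[OF F, of "a \<cdot> x"] that p as(2) by simp
      show "(\<lambda>h. F (g # h # fst p) (a \<cdot> x)) \<in> lin_hom K H W" if "x \<in> carrier A" "g \<in> carrier H" for x g
        using mbilD(1)[OF F, of "a \<cdot> x"] that p as(2) by simp
    qed
    have "phi_step W (phi_step W F a) 1\<^sub>A (fst p) (snd p)
        = lsum W (rl (snd p)) (\<lambda>q. lsum W (rl (fst q)) (\<lambda>r. F (snd r # snd q # fst p) (a \<cdot> fst r)))"
      by (rule lsum_cong) simp
    then show "phi_step W (phi_step W F a) 1\<^sub>A (fst p) (snd p)
        = phi_step W (\<lambda>X c. lsum W (H.dl (X ! 0)) (\<lambda>p. F (spl 0 X p) c)) a (fst p) (snd p)"
      using rl_coassoc[OF M t p(2)] by simp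
  qed
  also have "\<dots> = psum W as (\<lambda>X c. lsum W (H.dl (X ! 0)) (\<lambda>p. F (spl 0 X p) c))"
    unfolding as(1) by (rule psum_Cons[OF M mbil_split[OF M F] as(2,3), symmetric]) simp
  finally show ?case .
next
  case (Suc i)
  note M = assms(1)
  obtain m where n: "n = Suc m" using Suc.prems(3) by (cases n) auto
  obtain a bs where as: "as = a # bs" "a \<in> carrier A" "bs \<in> tuples A (Suc m)"
    using Suc.prems(2) n by (auto simp: tuples_Suc)
  note F = Suc.prems(1)[unfolded n]
  note i = Suc.prems(3)[unfolded n]
  have "psum W (P.ins (Suc i) as) F = psum W (P.ins i bs) (phi_step W F a)"
    unfolding as(1) P.ins.simps
    by (rule psum_Cons[OF M F as(2) P.ins_tuples[OF as(3)]]) (use i in simp)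
  also have "\<dots> = psum W bs (\<lambda>X c. lsum W (H.dl (X ! i)) (\<lambda>p. phi_step W F a (spl i X p) c))"
    by (rule Suc.IH[OF mbil_step[OF M F as(2)] as(3)]) (use i in simp)
  also have "\<dots> = psum W bs (phi_step W (\<lambda>X c. lsum W (H.dl (X ! Suc i)) (\<lambda>p. F (spl (Suc i) X p) c)) a)"
  proof (rule lsum_cong)
    fix p assume "p \<in> set (phi bs)"
    then have p: "fst p \<in> tuples H m" "snd p \<in> carrier A" using phi_set[OF as(3)] by auto
    have "F (snd q # spl i (fst p) r) (a \<cdot> fst q) \<in> carrier W" if "r \<in> set (H.dl (fst p ! i))" "q \<in> set (rl (snd p))" for q r
      using that spl_tuples[OF p(1), of i r] i as(2) by (intro mbilD(3)[OF F]) auto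
    from module.lsum_swap[OF M this]
    show "lsum W (H.dl (fst p ! i)) (\<lambda>r. phi_step W F a (spl i (fst p) r) (snd p))
        = phi_step W (\<lambda>X c. lsum W (H.dl (X ! Suc i)) (\<lambda>p. F (spl (Suc i) X p) c)) a (fst p) (snd p)"
      by simp
  qed
  also have "\<dots> = psum W as (\<lambda>X c. lsum W (H.dl (X ! Suc i)) (\<lambda>p. F (spl (Suc i) X p) c))"
    unfolding as(1) by (rule psum_Cons[OF M mbil_split[OF M F] as(2,3), symmetric]) (use i in simp)
  finally show ?case .
qed

text \<open>The innermost Galois step uses \<open>\<rho>(1) = 1 \<otimes> 1\<close>.\<close>

lemma psum_snoc_one:
  assumes "module K W" "mbil (Suc n) W F" "as \<in> tuples A (Suc n)"
  shows "psum W (as @ [1\<^sub>A]) F = psum W as (\<lambda>X c. F (X @ [1\<^sub>H]) c)"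
  using assms(2,3)
proof (induction n arbitrary: F as)
  case 0
  note M = assms(1)
  obtain a where a: "as = [a]" "a \<in> carrier A" using 0 by (auto simp: tuples_Suc)
  have o: "[1\<^sub>A] \<in> tuples A (Suc 0)" "[] \<in> tuples H 0" "1\<^sub>A \<in> carrier A" by simp_all
  have "psum W [a, 1\<^sub>A] F = phi_step W F a [] 1\<^sub>A"
    unfolding psum_Cons[OF M 0(1) a(2) o(1)] by (rule psum_single[OF M mbil_step[OF M 0(1) a(2)] o(3)])
  also have "\<dots> = F [1\<^sub>H] a"
    using rl_coinv[OF M left_mult_bilin[OF mbil_bilin[OF 0(1) o(2)] a(2)] one_B] a(2) by simp
  finally show ?case using module.lsum_single[OF M, of "\<lambda>p. F (fst p @ [1\<^sub>H]) (snd p)" "([], a)"] mbilD(3)[OF 0(1), of "[1\<^sub>H]" a] a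
    by simp
next
  case (Suc n)
  note M = assms(1)
  obtain a bs where as: "as = a # bs" "a \<in> carrier A" "bs \<in> tuples A (Suc n)"
    using Suc.prems(2) by (auto simp: tuples_Suc)
  have mb: "mbil (Suc n) W (\<lambda>X c. F (X @ [1\<^sub>H]) c)"
    by (rule mbilI[OF mlin_snoc[OF mbilD(1)[OF Suc.prems(1)]] mbilD(2)[OF Suc.prems(1)]]) auto
  have "psum W (as @ [1\<^sub>A]) F = psum W (bs @ [1\<^sub>A]) (phi_step W F a)"
    using psum_Cons[OF M Suc.prems(1) as(2), of "bs @ [1\<^sub>A]"] as by simp
  also have "\<dots> = psum W bs (phi_step W (\<lambda>X c. F (X @ [1\<^sub>H]) c) a)"
    using Suc.IH[OF mbil_step[OF M Suc.prems(1) as(2)] as(3)] by simp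
  also have "\<dots> = psum W as (\<lambda>X c. F (X @ [1\<^sub>H]) c)"
    unfolding as(1) by (rule psum_Cons[OF M mb as(2,3), symmetric])
  finally show ?case .
qed

text \<open>Coassociativity of \<open>\<rho>\<close> and of the iterated coproduct, for a further factor at either end.\<close>

lemma rl_dn_Cons:
  assumes "module K W" "mbil (Suc (Suc n)) W F" "y \<in> carrier A"
  shows "lsum W (rl y) (\<lambda>q. lsum W (rl (fst q)) (\<lambda>s. lsum W (H.dn n (snd q)) (\<lambda>ds. F (snd s # ds) (fst s))))
    = lsum W (rl y) (\<lambda>q. lsum W (H.dn (Suc n) (snd q)) (\<lambda>ds. F ds (fst q)))"
proof -
  note M = assms(1) and F = assms(2)
  have t: "trilin K A H H W (\<lambda>x g k. lsum W (H.dn n k) (\<lambda>ds. F (g # ds) x))"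
  proof (rule trilinI)
    show "(\<lambda>x. lsum W (H.dn n k) (\<lambda>ds. F (g # ds) x)) \<in> lin_hom K A W" if "g \<in> carrier H" "k \<in> carrier H" for g k
      by (rule module.lin_lsum[OF M], rule mbilD(2)[OF F]) (use that H.dn_tuples in simp)
    show "(\<lambda>g. lsum W (H.dn n k) (\<lambda>ds. F (g # ds) x)) \<in> lin_hom K H W" if "x \<in> carrier A" "k \<in> carrier H" for x k
      by (rule module.lin_lsum[OF M], rule bilinD(1)[OF mbil_bilin[OF F]]) (use that H.dn_tuples in auto)
    show "(\<lambda>k. lsum W (H.dn n k) (\<lambda>ds. F (g # ds) x)) \<in> lin_hom K H W" if "x \<in> carrier A" "g \<in> carrier H" for x g
      by (rule H.dn_lin[OF M]) (use mbilD(1)[OF F that(1)] that in simp)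
  qed
  have "lsum W (rl y) (\<lambda>q. lsum W (H.dl (snd q)) (\<lambda>s. lsum W (H.dn n (snd s)) (\<lambda>ds. F (fst s # ds) (fst q))))
      = lsum W (rl y) (\<lambda>q. lsum W (H.dn (Suc n) (snd q)) (\<lambda>ds. F ds (fst q)))"
    by (rule lsum_cong, rule H.lsum_dn_Suc[OF M mbilD(3)[OF F], symmetric]) auto
  then show ?thesis using rl_coassoc[OF M t assms(3)] by simp
qed

lemma rl_dn_snoc:
  assumes "module K W" "mbil (Suc (Suc n)) W F" "y \<in> carrier A"
  shows "lsum W (rl y) (\<lambda>q. lsum W (rl (fst q)) (\<lambda>s. lsum W (H.dn n (snd s)) (\<lambda>ds. F (ds @ [snd q]) (fst s))))
    = lsum W (rl y) (\<lambda>q. lsum W (H.dn (Suc n) (snd q)) (\<lambda>ds. F ds (fst q)))"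
proof -
  note M = assms(1) and F = assms(2)
  have t: "trilin K A H H W (\<lambda>x g k. lsum W (H.dn n g) (\<lambda>ds. F (ds @ [k]) x))"
  proof (rule trilinI)
    show "(\<lambda>x. lsum W (H.dn n g) (\<lambda>ds. F (ds @ [k]) x)) \<in> lin_hom K A W" if "g \<in> carrier H" "k \<in> carrier H" for g k
      by (rule module.lin_lsum[OF M], rule mbilD(2)[OF F]) (use that H.dn_tuples in simp)
    show "(\<lambda>g. lsum W (H.dn n g) (\<lambda>ds. F (ds @ [k]) x)) \<in> lin_hom K H W" if "x \<in> carrier A" "k \<in> carrier H" for x k
      by (rule H.dn_lin[OF M mlin_snoc[OF mbilD(1)[OF F that(1)] that(2)]])
    show "(\<lambda>k. lsum W (H.dn n g) (\<lambda>ds. F (ds @ [k]) x)) \<in> lin_hom K H W" if "x \<in> carrier A" "g \<in> carrier H" for x g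
      by (rule module.lin_lsum[OF M], rule mlin_snoc_lin[OF mbilD(1)[OF F that(1)]]) (use that H.dn_tuples in auto)
  qed
  have "lsum W (rl y) (\<lambda>q. lsum W (H.dl (snd q)) (\<lambda>s. lsum W (H.dn n (fst s)) (\<lambda>ds. F (ds @ [snd s]) (fst q))))
      = lsum W (rl y) (\<lambda>q. lsum W (H.dn (Suc n) (snd q)) (\<lambda>ds. F ds (fst q)))"
    by (rule lsum_cong, rule H.dn_snoc[OF M mbilD(1)[OF F]]) auto
  then show ?thesis using rl_coassoc[OF M t assms(3)] by simp
qed

text \<open>\<open>\<Sum> X\<cdot>z\<^sub>1 \<otimes> c z\<^sub>0\<close>, with the diagonal action.\<close>

abbreviation "asum W n z F X c \<equiv> lsum W (rl z) (\<lambda>q. lsum W (H.dn n (snd q)) (\<lambda>ds. F (X \<bullet> ds) (c \<cdot> fst q)))"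

lemma mbil_asum:
  assumes "module K W" "mbil (Suc n) W F" "z \<in> carrier A"
  shows "mbil (Suc n) W (asum W n z F)"
proof (rule mbilI)
  have t: "ds \<in> tuples H (Suc n)" if "q \<in> set (rl z)" "ds \<in> set (H.dn n (snd q))" for q ds
    using H.dn_tuples[OF _ that(2)] that(1) by simp
  show "mlin K H W (Suc n) (\<lambda>X. asum W n z F X c)" if "c \<in> carrier A" for c
    by (rule mlin_lsum[OF assms(1)], rule mlin_lsum[OF assms(1)], rule H.mlin_map2_left[OF mbilD(1)[OF assms(2)] t])
      (use that in simp_all)
  show "asum W n z F X \<in> lin_hom K A W" if "X \<in> tuples H (Suc n)" for X
    by (rule module.lin_lsum[OF assms(1)], rule module.lin_lsum[OF assms(1)],
        rule lin_hom_comp[OF A.mult_lin_left mbilD(2)[OF assms(2) H.tuples_map2[OF that t]]]) simp_all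
qed

lemma asum_step:
  assumes "module K W" "mbil (Suc (Suc n)) W F" "z \<in> carrier A" "a \<in> carrier A" "X \<in> tuples H (Suc n)" "c \<in> carrier A"
  shows "asum W n z (phi_step W F a) X c = phi_step W (asum W (Suc n) z F) a X c"
proof -
  note M = assms(1) and F = assms(2)
  let ?M = "\<lambda>ds. X \<bullet> ds"
  have Mt: "?M ds \<in> tuples H (Suc n)" if "ds \<in> tuples H (Suc n)" for ds using assms(5) that H.tuples_map2 by simp
  let ?G = "\<lambda>p r ds. F ((snd p \<star> snd r) # ?M ds) (a \<cdot> (fst p \<cdot> fst r))"
  have G: "?G p r ds \<in> carrier W" if "p \<in> set (rl c)" "r \<in> set (rl x)" "ds \<in> tuples H (Suc n)" for p r ds x
    by (rule mbilD(3)[OF F]) (use that Mt assms(4) in auto)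
  have "asum W n z (phi_step W F a) X c
      = lsum W (rl z) (\<lambda>q. lsum W (rl c) (\<lambda>p. lsum W (rl (fst q)) (\<lambda>r. lsum W (H.dn n (snd q)) (?G p r))))"
  proof (rule lsum_cong)
    fix q assume q: "q \<in> set (rl z)"
    have t: "ds \<in> tuples H (Suc n)" if "ds \<in> set (H.dn n (snd q))" for ds using H.dn_tuples[OF _ that] q by simp
    have "lsum W (H.dn n (snd q)) (\<lambda>ds. phi_step W F a (?M ds) (c \<cdot> fst q))
        = lsum W (H.dn n (snd q)) (\<lambda>ds. lsum W (rl c) (\<lambda>p. lsum W (rl (fst q)) (\<lambda>r. ?G p r ds)))"
    proof (rule lsum_cong)
      fix ds assume "ds \<in> set (H.dn n (snd q))"
      from rl_mult[OF M left_mult_bilin[OF mbil_bilin[OF F Mt[OF t[OF this]]] assms(4)] assms(6), of "fst q"]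
      show "phi_step W F a (?M ds) (c \<cdot> fst q) = lsum W (rl c) (\<lambda>p. lsum W (rl (fst q)) (\<lambda>r. ?G p r ds))"
        using q by simp
    qed
    also have "\<dots> = lsum W (rl c) (\<lambda>p. lsum W (H.dn n (snd q)) (\<lambda>ds. lsum W (rl (fst q)) (\<lambda>r. ?G p r ds)))"
      by (rule module.lsum_swap[OF M], rule module.lsum_closed[OF M], rule G) (use t in auto)
    also have "\<dots> = lsum W (rl c) (\<lambda>p. lsum W (rl (fst q)) (\<lambda>r. lsum W (H.dn n (snd q)) (?G p r)))"
      by (rule lsum_cong, rule module.lsum_swap[OF M], rule G) (use t in auto)
    finally show "lsum W (H.dn n (snd q)) (\<lambda>ds. phi_step W F a (?M ds) (c \<cdot> fst q)) = \<dots>" .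
  qed
  also have "\<dots> = lsum W (rl c) (\<lambda>p. lsum W (rl z) (\<lambda>q. lsum W (rl (fst q)) (\<lambda>r. lsum W (H.dn n (snd q)) (?G p r))))"
  proof (rule module.lsum_swap[OF M], rule module.lsum_closed[OF M], rule module.lsum_closed[OF M], rule G)
    fix q p r ds assume "q \<in> set (rl z)" "ds \<in> set (H.dn n (snd q))"
    then show "ds \<in> tuples H (Suc n)" using H.dn_tuples[of "snd q"] by simp
  qed
  also have "\<dots> = phi_step W (asum W (Suc n) z F) a X c"
  proof (rule lsum_cong)
    fix p assume p: "p \<in> set (rl c)"
    let ?F = "\<lambda>ks x. F ((snd p # X) \<bullet> ks) (a \<cdot> (fst p \<cdot> x))"
    have pX: "snd p # X \<in> tuples H (Suc (Suc n))" using p assms(5) by simp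
    have "mbil (Suc (Suc n)) W ?F"
      by (rule mbilI[OF H.mlin_map2_right[OF mbilD(1)[OF F] pX]
            lin_hom_comp[OF A.mult_lin_right lin_hom_comp[OF A.mult_lin_right mbilD(2)[OF F H.tuples_map2[OF pX]]]]])
        (use p assms(4) in auto)
    from rl_dn_Cons[OF M this assms(3)]
    have "lsum W (rl z) (\<lambda>q. lsum W (rl (fst q)) (\<lambda>r. lsum W (H.dn n (snd q)) (?G p r)))
        = lsum W (rl z) (\<lambda>q. lsum W (H.dn (Suc n) (snd q)) (\<lambda>ds. ?F ds (fst q)))" by simp
    also have "\<dots> = lsum W (rl z) (\<lambda>q. lsum W (H.dn (Suc n) (snd q)) (\<lambda>ds.
        F ((snd p # X) \<bullet> ds) (a \<cdot> fst p \<cdot> fst q)))"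
      by (rule lsum_cong, rule lsum_cong) (use p assms(4) in \<open>simp add: A.A_assoc\<close>)
    finally show "lsum W (rl z) (\<lambda>q. lsum W (rl (fst q)) (\<lambda>r. lsum W (H.dn n (snd q)) (?G p r)))
        = asum W (Suc n) z F (snd p # X) (a \<cdot> fst p)" by simp
  qed
  finally show ?thesis .
qed

text \<open>Multiplication by \<open>z\<close> from the right becomes the diagonal action by \<open>\<rho>(z)\<close>, because \<open>\<rho>\<close> is multiplicative and
  coassociative.\<close>

lemma psum_act:
  assumes "module K W" "mbil (Suc n) W F" "as \<in> tuples A (Suc (Suc n))" "z \<in> carrier A"
  shows "psum W (P.rgt z as) F = psum W as (asum W n z F)"
  using assms(2,3)
proof (induction n arbitrary: F as)
  case 0
  note M = assms(1) and F = 0(1) and z = assms(4)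
  obtain a c where a: "as = [a, c]" "a \<in> carrier A" "c \<in> carrier A" using 0(2) by (auto simp: tuples_Suc)
  have single: "psum W [a, x] G = phi_step W G a [] x" if "mbil (Suc 0) W G" "x \<in> carrier A" for G x
    using psum_Cons[OF M that(1) a(2), of "[x]"] psum_single[OF M mbil_step[OF M that(1) a(2)] that(2)] that(2) by simp
  have "psum W (P.rgt z as) F = phi_step W F a [] (c \<cdot> z)" using single[OF F, of "c \<cdot> z"] a z by simp
  also have "\<dots> = lsum W (rl c) (\<lambda>p. lsum W (rl z) (\<lambda>q. F [snd p \<star> snd q] (a \<cdot> (fst p \<cdot> fst q))))"
    by (rule rl_mult[OF M left_mult_bilin[OF mbil_bilin[OF F] a(2)] a(3) z]) simp
  also have "\<dots> = phi_step W (asum W 0 z F) a [] c"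
  proof (rule lsum_cong, rule lsum_cong)
    fix p q assume pq: "p \<in> set (rl c)" "q \<in> set (rl z)"
    have "lsum W (H.dn 0 (snd q)) (\<lambda>ds. F ([snd p] \<bullet> ds) (a \<cdot> fst p \<cdot> fst q)) = F ([snd p] \<bullet> [snd q]) (a \<cdot> fst p \<cdot> fst q)"
      by (rule H.lsum_dn_0[OF M], rule mbilD(3)[OF F]) (use pq a in auto)
    then show "F [snd p \<star> snd q] (a \<cdot> (fst p \<cdot> fst q)) = lsum W (H.dn 0 (snd q)) (\<lambda>ds. F ([snd p] \<bullet> ds) (a \<cdot> fst p \<cdot> fst q))"
      using pq a by (simp add: A.A_assoc)
  qed
  also have "\<dots> = psum W as (asum W 0 z F)" using single[OF mbil_asum[OF M F z] a(3)] a(1) by simp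
  finally show ?case .
next
  case (Suc n)
  note M = assms(1) and z = assms(4)
  obtain a bs where as: "as = a # bs" "a \<in> carrier A" "bs \<in> tuples A (Suc (Suc n))"
    using Suc.prems(2) by (auto simp: tuples_Suc)
  have "P.rgt z as = a # P.rgt z bs" using as by (auto simp: tuples_Suc)
  then have "psum W (P.rgt z as) F = psum W (P.rgt z bs) (phi_step W F a)"
    using psum_Cons[OF M Suc.prems(1) as(2) P.rgt_tuples[OF as(3) z]] by simp
  also have "\<dots> = psum W bs (asum W n z (phi_step W F a))"
    by (rule Suc.IH[OF mbil_step[OF M Suc.prems(1) as(2)] as(3)])
  also have "\<dots> = psum W bs (phi_step W (asum W (Suc n) z F) a)"
    by (rule lsum_cong, rule asum_step[OF M Suc.prems(1) z as(2)]) (use phi_set[OF as(3)] in auto)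
  also have "\<dots> = psum W as (asum W (Suc n) z F)"
    unfolding as(1) by (rule psum_Cons[OF M mbil_asum[OF M Suc.prems(1) z] as(2,3), symmetric])
  finally show ?case .
qed

text \<open>Since \<open>phi\<close> and \<open>psi\<close> are inverse to each other, an identity for sums over \<open>phi\<close> gives one for sums
  over \<open>psi\<close>.\<close>

lemma qsum_transfer:
  assumes "module K W" "mbil m W G" "X \<in> tuples H m" "c \<in> carrier A"
    "\<And>as. as \<in> tuples A (Suc m) \<Longrightarrow> psum W as G = E as"
  shows "G X c = qsum W X c E"
proof -
  have "G X c = qsum W X c (\<lambda>zs. psum W zs G)" by (rule psi_phi[OF assms(1-4), symmetric])
  also have "\<dots> = qsum W X c E"
    by (rule lsum_cong, rule assms(5), rule psi_tuples[of X, OF _ assms(4)]) (use assms(3) in \<open>simp add: tuples_def\<close>)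
  finally show ?thesis .
qed

context
  fixes W :: "('k,'w,'u) module_scheme" and n :: nat and F :: "'a list \<Rightarrow> 'w"
  assumes M: "module K W" and m: "mlin K A W (Suc n) F" and ba: "balanced A B (Suc n) F"
begin

lemma qsum_mbil: "mbil n W (\<lambda>X c. qsum W X c F)"
  by (rule mbilI) (rule qsum_mlin[OF M m ba], assumption, rule qsum_lin[OF M m], simp add: tuples_def)

lemma qsum_coinv:
  assumes "hs \<in> tuples H n" "c \<in> carrier A" "b \<in> B"
  shows "qsum W hs (c \<cdot> b) F = qsum W hs c (\<lambda>zs. F (P.rgt b zs))"
proof (rule qsum_transfer[OF M _ assms(1,2)])
  have b: "b \<in> carrier A" using assms(3) by simp
  show "mbil n W (\<lambda>X c. qsum W X (c \<cdot> b) F)"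
    by (rule mbilI) (use mbilD(1)[OF qsum_mbil] b lin_hom_comp[OF A.mult_lin_left[OF b] mbilD(2)[OF qsum_mbil]] in auto)
  fix as assume as: "as \<in> tuples A (Suc n)"
  have "psum W as (\<lambda>X c. qsum W X (c \<cdot> b) F) = psum W (P.rgt b as) (\<lambda>X c. qsum W X c F)"
    by (rule psum_rgt[OF M qsum_mbil as assms(3), symmetric])
  also have "\<dots> = F (P.rgt b as)" by (rule phi_psi[OF M m ba P.rgt_tuples[OF as b]])
  finally show "psum W as (\<lambda>X c. qsum W X (c \<cdot> b) F) = \<dots>" .
qed

lemma qsum_act:
  assumes "n = Suc k" "hs \<in> tuples H n" "c \<in> carrier A" "y \<in> carrier A"
  shows "asum W k y (\<lambda>X c. qsum W X c F) hs c = qsum W hs c (\<lambda>zs. F (P.rgt y zs))"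
proof (rule qsum_transfer[OF M _ assms(2,3)])
  note y = assms(4) and mb = qsum_mbil[unfolded assms(1)]
  show "mbil n W (asum W k y (\<lambda>X c. qsum W X c F))" unfolding assms(1) by (rule mbil_asum[OF M mb y])
  fix as assume as: "as \<in> tuples A (Suc n)"
  have "psum W as (asum W k y (\<lambda>X c. qsum W X c F)) = psum W (P.rgt y as) (\<lambda>X c. qsum W X c F)"
    by (rule psum_act[OF M mb as[unfolded assms(1)] y, symmetric])
  also have "\<dots> = F (P.rgt y as)" by (rule phi_psi[OF M m ba P.rgt_tuples[OF as y]])
  finally show "psum W as (asum W k y (\<lambda>X c. qsum W X c F)) = \<dots>" .
qed

end

lemma sg_mbil: "mbil (Suc n) (SH n) (sg n)"
  by (rule mbilI[OF sg_mlin sg_lin])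

text \<open>By \<open>psum_act\<close> the two sides are those of \<open>sg_key\<close>.\<close>

lemma psum_sg_comm:
  assumes "as \<in> tuples A (Suc (Suc n))" "z \<in> carrier A"
  shows "psum (SH n) (P.rgt z as) (sg n) = psum (SH n) (P.lft z as) (sg n)"
  unfolding psum_act[OF SH_module sg_mbil assms] psum_lft[OF assms]
  by (rule lsum_cong, rule sg_key) (use phi_set[OF assms(1)] assms(2) in auto)

section \<open>The isomorphism between the spaces of the two cyclic objects\<close>

text \<open>The isomorphism sends the class of \<open>a\<^sup>0 \<otimes> \<dots> \<otimes> a\<^sup>n\<close> to
  \<open>(\<Sum> a\<^sup>1\<^sub>1 \<dots> a\<^sup>n\<^sub>1, \<dots>, a\<^sup>n\<^sub>n, 1) \<otimes>\<^sub>H a\<^sup>0 a\<^sup>1\<^sub>0 \<dots> a\<^sup>n\<^sub>0\<close>, the last entry \<open>1\<close> being due to the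
  additional factor \<open>1\<close> of \<open>A\<close>.\<close>

definition PhiL :: "nat \<Rightarrow> 'a list \<Rightarrow> (('h list \<Rightarrow> 'k) set \<times> 'a set \<Rightarrow> 'k) set"
  where "PhiL n as = psum (SH n) (as @ [1\<^sub>A]) (sg n)"

definition Phi :: "nat \<Rightarrow> ('a list \<Rightarrow> 'k) set set \<Rightarrow> (('h list \<Rightarrow> 'k) set \<times> 'a set \<Rightarrow> 'k) set"
  where "Phi n = rel_lift K (SH n) (PhiL n)"

text \<open>A last factor other than \<open>1\<close> can be moved to the front, by \<open>psum_sg_comm\<close>.\<close>

lemma PhiL_snoc:
  assumes "as \<in> tuples A (Suc n)" "z \<in> carrier A"
  shows "psum (SH n) (as @ [z]) (sg n) = PhiL n (P.lft z as)"
proof -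
  have "P.lft z (as @ [1\<^sub>A]) = P.lft z as @ [1\<^sub>A]" using assms(1) by (auto simp: tuples_Suc)
  then show ?thesis using psum_sg_comm[of "as @ [1\<^sub>A]" n z] assms by (simp add: PhiL_def)
qed

lemma PhiL_zlin: "P.zlin n (SH n) (PhiL n)"
  unfolding P.zlin_def
proof (intro conjI ballI)
  let ?W = "\<lambda>as. psum (SH n) as (sg n)"
  note m = psum_mlin[OF SH_module sg_mbil, of n] and ba = psum_bal[OF SH_module sg_mbil, of n]
  show "mlin K A (SH n) (Suc n) (PhiL n)"
    unfolding PhiL_def[abs_def] by (rule mlin_snoc[OF m]) simp
  show "balanced A B (Suc n) (PhiL n)"
    unfolding balanced_def
  proof (intro allI impI)
    fix xs x b y ys assume "b \<in> B" "xs @ [x, y] @ ys \<in> tuples A (Suc n)"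
    then show "PhiL n (xs @ [x \<cdot> b, y] @ ys) = PhiL n (xs @ [x, b \<cdot> y] @ ys)"
      using balancedD[OF ba, of b xs x y "ys @ [1\<^sub>A]"] by (simp add: PhiL_def tuples_def)
  qed
  fix as b assume as: "as \<in> tuples A (Suc n)" and b: "b \<in> B"
  then obtain us z where z: "as = us @ [z]" "us \<in> tuples A n" "z \<in> carrier A" by (auto elim: P.tuples_snocE)
  have "PhiL n (P.rgt b as) = ?W (us @ [z, b])"
    using balancedD[OF ba b, of us z "1\<^sub>A" "[]"] z b by (simp add: PhiL_def tuples_def)
  then show "PhiL n (P.rgt b as) = PhiL n (P.lft b as)" using PhiL_snoc[OF as B_closed[OF b]] z(1) by simp
qed

lemma Phi_lin: "Phi n \<in> lin_hom K (P.Z n) (SH n)"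
  unfolding Phi_def by (rule P.Z_lift_lin[OF SH_module PhiL_zlin])

lemma Phi_zc: "as \<in> tuples A (Suc n) \<Longrightarrow> Phi n (P.zc n as) = PhiL n as"
  unfolding Phi_def by (rule P.Z_lift_gen[OF SH_module PhiL_zlin])

text \<open>Here \<open>Z\<^sub>n(A/B)\<close> appears as a quotient of the \<open>(n + 2)\<close>-fold tensor power. The quotient map is the last face,
  which multiplies the last factor into the first one.\<close>

lemma Phi_class:
  assumes "zs \<in> tuples A (Suc (Suc n))"
  shows "psum (SH n) zs (sg n) = Phi n (P.zc n (P.fc (Suc n) (Suc n) zs))"
proof -
  obtain a w z where z: "zs = a # w @ [z]" "a \<in> carrier A" "w \<in> tuples A n" "z \<in> carrier A"
    using assms by (rule P.tuples_endsE)
  have fc: "P.fc (Suc n) (Suc n) zs = (z \<cdot> a) # w" by (simp add: P.fc_def z(1) P.rot_ends)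
  have "(z \<cdot> a) # w \<in> tuples A (Suc n)" using z by simp
  from Phi_zc[OF this] show ?thesis unfolding fc using PhiL_snoc[of "a # w" n z] z by simp
qed

text \<open>The inverse multiplies the last factor of \<open>psi\<close> into the first one: it sends
  \<open>(h\<^sup>0, \<dots>, h\<^sup>n) \<otimes> a\<close> to \<open>\<Sum> \<kappa>\<^sup>2(h\<^sup>n) a \<kappa>\<^sup>1(h\<^sup>0) \<otimes> \<kappa>\<^sup>2(h\<^sup>0) \<kappa>\<^sup>1(h\<^sup>1) \<otimes> \<dots> \<otimes> \<kappa>\<^sup>2(h\<^sup>n\<^sup>-\<^sup>1) \<kappa>\<^sup>1(h\<^sup>n)\<close>. It respects the relations
  because moving \<open>y\<close> from the right end of a tensor to its left end does not change the image.\<close>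

lemma Phi_inj: "inj_on (Phi n) (carrier (P.Z n))"
proof -
  let ?Z = "P.Z n"
  note M = P.Z_module[of n]
  let ?G = "\<lambda>zs. P.zc n (P.mrg 0 (P.rot zs))"
  have G: "P.zlin (Suc n) ?Z ?G" by (rule P.zlin_rot[OF P.zlin_mrg[OF P.zc_zlin]]) simp
  note Gm = P.zlinD(1)[OF G] and Gb = P.zlinD(2)[OF G]
  have GG: "qsum ?Z hs c (\<lambda>zs. ?G (P.rgt y zs)) = qsum ?Z hs (y \<cdot> c) ?G"
    if hs: "hs \<in> tuples H (Suc n)" and c: "c \<in> carrier A" and y: "y \<in> carrier A" for hs c y
    unfolding qsum_lft[OF y c]
  proof (rule lsum_cong)
    fix zs assume "zs \<in> set (psi hs c)"
    then have "zs \<in> tuples A (Suc (Suc n))" using psi_tuples[OF _ c, of hs "Suc n" zs] hs by (simp add: tuples_def)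
    then obtain a w z where z: "zs = a # w @ [z]" "a \<in> carrier A" "w \<in> tuples A n" "z \<in> carrier A" by (rule P.tuples_endsE)
    show "?G (P.rgt y zs) = ?G (P.lft y zs)"
      using P.rgt_snoc[of y "a # w" z] z y by (simp add: P.rot_ends A.A_assoc del: P.rgt_Cons)
  qed
  have "\<exists>\<Psi>\<in>lin_hom K (SH n) ?Z. \<forall>hs\<in>tuples H (Suc n). \<forall>a\<in>carrier A. \<Psi> (sg n hs a) = qsum ?Z hs a ?G"
  proof (rule SH_lift_list[OF M])
    show "mlin K H ?Z (Suc n) (\<lambda>hs. qsum ?Z hs a ?G)" if "a \<in> carrier A" for a by (rule qsum_mlin[OF M Gm Gb that])
    fix hs assume hs: "hs \<in> tuples H (Suc n)"
    show "(\<lambda>a. qsum ?Z hs a ?G) \<in> lin_hom K A ?Z" by (rule qsum_lin[OF M Gm]) (use hs in \<open>simp add: tuples_def\<close>)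
    show "qsum ?Z hs (a \<cdot> b) ?G = qsum ?Z hs (b \<cdot> a) ?G" if "a \<in> carrier A" "b \<in> B" for a b
      unfolding GG[OF hs that(1) B_closed[OF that(2)], symmetric] by (rule qsum_coinv[OF M Gm Gb hs that])
    show "lsum ?Z (rl y) (\<lambda>p. lsum ?Z (H.dn n (snd p)) (\<lambda>ds. qsum ?Z (hs \<bullet> ds) (x \<cdot> fst p) ?G)) = qsum ?Z hs (y \<cdot> x) ?G"
      if "x \<in> carrier A" "y \<in> carrier A" for x y
      unfolding GG[OF hs that, symmetric] by (rule qsum_act[OF M Gm Gb refl hs that])
  qed
  then obtain \<Psi> where \<Psi>: "\<Psi> \<in> lin_hom K (SH n) ?Z"
    "\<And>hs a. hs \<in> tuples H (Suc n) \<Longrightarrow> a \<in> carrier A \<Longrightarrow> \<Psi> (sg n hs a) = qsum ?Z hs a ?G" by blast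
  have gen: "\<Psi> (PhiL n as) = P.zc n as" if as: "as \<in> tuples A (Suc n)" for as
  proof -
    have as1: "as @ [1\<^sub>A] \<in> tuples A (Suc (Suc n))" using as by simp
    have "\<Psi> (PhiL n as) = psum ?Z (as @ [1\<^sub>A]) (\<lambda>X c. \<Psi> (sg n X c))"
      unfolding PhiL_def by (rule lin_hom_lsum[OF SH_module M \<Psi>(1)], rule sg_closed) (use phi_set[OF as1] in auto)
    also have "\<dots> = psum ?Z (as @ [1\<^sub>A]) (\<lambda>X c. qsum ?Z X c ?G)"
      by (rule lsum_cong, rule \<Psi>(2)) (use phi_set[OF as1] in auto)
    also have "\<dots> = ?G (as @ [1\<^sub>A])" by (rule phi_psi[OF M Gm Gb as1])
    also have "\<dots> = P.zc n as" using as by (auto simp: tuples_Suc P.rot_ends)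
    finally show ?thesis .
  qed
  have "\<Psi> (Phi n q) = q" if "q \<in> carrier ?Z" for q
    by (rule P.Z_ext[OF M lin_hom_comp[OF Phi_lin \<Psi>(1)] lin_hom_id _ that]) (simp add: Phi_zc gen)
  then show ?thesis by (rule inj_on_inverseI)
qed

text \<open>By \<open>psi_phi\<close> every generator is a sum of terms \<open>psum (SH n) zs (sg n)\<close>, and these lie in the image by
  \<open>Phi_class\<close>.\<close>

lemma Phi_surj: "Phi n ` carrier (P.Z n) = carrier (SH n)"
proof
  note MS = SH_module[of n] and MZ = P.Z_module[of n]
  interpret Z: module K "P.Z n" by (rule MZ)
  let ?R = "Phi n ` carrier (P.Z n)"
  show "?R \<subseteq> carrier (SH n)" using lin_hom_closed[OF Phi_lin] by auto
  have zero: "\<zero>\<^bsub>SH n\<^esub> \<in> ?R" using lin_hom_zero[OF MZ MS Phi_lin] by (metis Z.M.zero_closed image_eqI)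
  have add: "x \<oplus>\<^bsub>SH n\<^esub> y \<in> ?R" if xy: "x \<in> ?R" "y \<in> ?R" for x y
  proof -
    obtain u v where "u \<in> carrier (P.Z n)" "v \<in> carrier (P.Z n)" "x = Phi n u" "y = Phi n v" using xy by auto
    then show ?thesis using lin_hom_add[OF Phi_lin, of u n v] by (intro image_eqI[of _ _ "u \<oplus>\<^bsub>P.Z n\<^esub> v"]) auto
  qed
  have sum: "lsum (SH n) L f \<in> ?R" if "\<And>x. x \<in> set L \<Longrightarrow> f x \<in> ?R" for L and f :: "'z \<Rightarrow> _"
    using that by (induction L) (auto simp: zero intro: add)
  have gen: "sg n hs a \<in> ?R" if hs: "hs \<in> tuples H (Suc n)" and a: "a \<in> carrier A" for hs a
  proof -
    have "sg n hs a = qsum (SH n) hs a (\<lambda>zs. psum (SH n) zs (sg n))"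
      by (rule psi_phi[OF MS sg_mbil hs a, symmetric])
    also have "\<dots> \<in> ?R"
    proof (rule sum)
      fix zs assume "zs \<in> set (psi hs a)"
      then have t: "zs \<in> tuples A (Suc (Suc n))" using psi_tuples[OF _ a, of hs "Suc n" zs] hs by (simp add: tuples_def)
      show "psum (SH n) zs (sg n) \<in> ?R" unfolding Phi_class[OF t] by (intro imageI P.zc_closed P.fc_tuples t)
    qed
    finally show ?thesis .
  qed
  show "carrier (SH n) \<subseteq> ?R"
  proof
    fix q assume "q \<in> carrier (SH n)"
    then obtain L where L: "set L \<subseteq> tuples H (Suc n) \<times> carrier A" "q = lsum (SH n) L (\<lambda>p. sg n (fst p) (snd p))"
      using SH_rep by blast
    show "q \<in> ?R" unfolding L(2) by (rule sum, rule gen) (use L(1) in auto)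
  qed
qed

lemma Phi_iso: "Phi n \<in> lin_iso K (P.Z n) (SH n)"
  using Phi_lin Phi_inj Phi_surj by (simp add: lin_iso_def bij_betw_def)

section \<open>The operators of the two cyclic objects correspond\<close>

abbreviation "HC \<equiv> hopf_cyclic K H A B \<rho>"

lemma space_HC [simp]: "space HC n = SH n" by (simp add: hopf_cyclic_def)

text \<open>The hypothesis \<open>eq\<close> says that \<open>f\<close> corresponds to \<open>g\<close> on the \<open>(n + 2)\<close>-fold tensor power. As \<open>psi\<close> writes every
  generator of \<open>H\<^sup>\<otimes>\<^sup>(\<^sup>n\<^sup>+\<^sup>1\<^sup>) \<otimes> A\<close> by such tensors, \<open>f\<close> agrees on generators with \<open>g\<close>, conjugated by \<open>Phi\<close>. The
  conjugate is defined on the tensor product over \<open>H\<close>, so \<open>f\<close> is balanced over \<open>H\<close>.\<close>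

lemma op_transfer:
  assumes b: "bilin K (Tp n) AQ (SH m) f" and g: "g \<in> lin_hom K (P.Z n) (P.Z m)"
    and eq: "\<And>zs. zs \<in> tuples A (Suc (Suc n)) \<Longrightarrow>
      psum (SH m) zs (\<lambda>X c. f (gen K (Tp n) X) (cls c)) = Phi m (g (P.zc n (P.fc (Suc n) (Suc n) zs)))"
  shows op_transfer_lin: "gen_lift K (SH m) (\<lambda>(X, x). f X x) \<in> lin_hom K (SH n) (SH m)"
    and op_transfer_comm: "q \<in> carrier (P.Z n) \<Longrightarrow> Phi m (g q) = gen_lift K (SH m) (\<lambda>(X, x). f X x) (Phi n q)"
proof -
  note M = SH_module[of m]
  let ?i = "inv_into (carrier (P.Z n)) (Phi n)"
  let ?L = "\<lambda>x. Phi m (g (?i x))"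
  let ?V = "\<lambda>X c. f (gen K (Tp n) X) (cls c)"
  have V: "mbil (Suc n) (SH m) ?V"
    by (rule mbilI[OF mlin_lin[OF tensor_power_gen_mlin[OF H.module] bilinD(2)[OF b]] lin_hom_comp[OF cls_lin bilinD(1)[OF b]]]) simp_all
  have "?i \<in> lin_hom K (SH n) (P.Z n)"
    by (rule lin_hom_inv_into[OF P.Z_module Phi_lin]) (use Phi_iso in \<open>simp add: lin_iso_def\<close>)
  then have L: "?L \<in> lin_hom K (SH n) (SH m)" by (intro lin_hom_comp[OF _ lin_hom_comp[OF g Phi_lin]])
  have Li: "?L (Phi n x) = Phi m (g x)" if "x \<in> carrier (P.Z n)" for x using Phi_inj that by simp
  have VL: "?V hs a = ?L (sg n hs a)" if hs: "hs \<in> tuples H (Suc n)" and a: "a \<in> carrier A" for hs a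
  proof -
    let ?c = "\<lambda>zs. P.zc n (P.fc (Suc n) (Suc n) zs)"
    have c: "?c zs \<in> carrier (P.Z n)" if "zs \<in> set (psi hs a)" for zs
      using psi_tuples[OF _ a that, of "Suc n"] hs by (intro P.zc_closed P.fc_tuples) (simp add: tuples_def)
    have "?L (sg n hs a) = ?L (qsum (SH n) hs a (\<lambda>zs. Phi n (?c zs)))"
      by (rule arg_cong[of _ _ ?L], rule qsum_transfer[OF SH_module sg_mbil hs a Phi_class])
    also have "\<dots> = qsum (SH m) hs a (\<lambda>zs. ?L (Phi n (?c zs)))"
      by (rule lin_hom_lsum[OF SH_module M L], rule lin_hom_closed[OF Phi_lin c])
    also have "\<dots> = qsum (SH m) hs a (\<lambda>zs. Phi m (g (?c zs)))" by (rule lsum_cong, rule Li[OF c])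
    also have "\<dots> = ?V hs a" by (rule qsum_transfer[OF M V hs a eq, symmetric])
    finally show ?thesis by simp
  qed
  have fL: "f (gen K (Tp n) hs) x = ?L (gen K (SH n) (gen K (Tp n) hs, x))" if "hs \<in> tuples H (Suc n)" "x \<in> carrier AQ" for hs x
    using VL[OF that(1)] that(2) unfolding cls_surj sg_def by auto
  have act: "lsum (SH m) (H.dn n h) (\<lambda>ds. f (gen K (Tp n) (hs \<bullet> ds)) x) = f (gen K (Tp n) hs) (um_act K H A B \<rho> h x)"
    if hs: "hs \<in> tuples H (Suc n)" and h: "h \<in> carrier H" and x: "x \<in> carrier AQ" for hs h x
  proof -
    have t: "hs \<bullet> ds \<in> tuples H (Suc n)" if "ds \<in> set (H.dn n h)" for ds
      by (rule H.tuples_map2[OF hs H.dn_tuples[OF h that]])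
    have "lsum (SH m) (H.dn n h) (\<lambda>ds. f (gen K (Tp n) (hs \<bullet> ds)) x)
        = lsum (SH m) (H.dn n h) (\<lambda>ds. ?L (gen K (SH n) (gen K (Tp n) (hs \<bullet> ds), x)))"
      by (rule lsum_cong, rule fL[OF t x])
    also have "\<dots> = ?L (gen K (SH n) (gen K (Tp n) hs, um_act K H A B \<rho> h x))"
      unfolding SH_act[OF hs h x, symmetric]
      by (rule lin_hom_lsum[OF SH_module M L, symmetric]) (use t x in \<open>auto intro: bilinD(3)[OF SH_gen_bilin]\<close>)
    finally show ?thesis using fL[OF hs lin_hom_closed[OF um_act_lin[OF h] x]] by simp
  qed
  let ?f = "gen_lift K (SH m) (\<lambda>(X, x). f X x)"
  show l: "?f \<in> lin_hom K (SH n) (SH m)" by (rule SH_lift_act_lin[OF M b act])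
  show "Phi m (g q) = ?f (Phi n q)" if q: "q \<in> carrier (P.Z n)"
  proof (rule P.Z_ext[OF M lin_hom_comp[OF g Phi_lin] lin_hom_comp[OF Phi_lin l] _ q])
    fix as assume as: "as \<in> tuples A (Suc n)"
    then have as1: "as @ [1\<^sub>A] \<in> tuples A (Suc (Suc n))" by simp
    have "?f (Phi n (P.zc n as)) = psum (SH m) (as @ [1\<^sub>A]) (\<lambda>X c. ?f (sg n X c))"
      unfolding Phi_zc[OF as] PhiL_def
      by (rule lin_hom_lsum[OF SH_module M l sg_closed]) (use phi_set[OF as1] in auto)
    also have "\<dots> = psum (SH m) (as @ [1\<^sub>A]) ?V"
      unfolding sg_def by (rule lsum_cong, rule SH_lift_act_gen[OF M b act]) (use phi_set[OF as1] in auto)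
    also have "\<dots> = Phi m (g (P.zc n (P.fc (Suc n) (Suc n) (as @ [1\<^sub>A]))))" by (rule eq[OF as1])
    also have "P.fc (Suc n) (Suc n) (as @ [1\<^sub>A]) = as" using as by (auto simp: tuples_Suc P.fc_def P.rot_ends)
    finally show "Phi m (g (P.zc n as)) = ?f (Phi n (P.zc n as))" by simp
  qed
qed

lemma face_HC:
  assumes "i \<le> Suc n"
  shows face_HC_lin: "face HC (Suc n) i \<in> lin_hom K (SH (Suc n)) (SH n)"
    and Phi_face: "q \<in> carrier (P.Z (Suc n)) \<Longrightarrow> Phi n (face P.ZZ (Suc n) i q) = face HC (Suc n) i (Phi (Suc n) q)"
proof -
  let ?f = "\<lambda>X m. gen K (SH n) (counit_at K H (Suc (Suc n)) i X, m)"
  have e: "face HC (Suc n) i = gen_lift K (SH n) (\<lambda>(X, m). ?f X m)" by (simp add: hopf_cyclic_def)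
  have cl: "counit_at K H (Suc (Suc n)) i \<in> lin_hom K (Tp (Suc n)) (Tp n)" by (rule H.counit_at_lin[OF assms])
  have b: "bilin K (Tp (Suc n)) AQ (SH n) ?f"
    by (rule bilinI[OF bilinD(1)[OF SH_gen_bilin lin_hom_closed[OF cl]] lin_hom_comp[OF cl bilinD(2)[OF SH_gen_bilin]]])
  have eq: "psum (SH n) zs (\<lambda>X c. ?f (gen K (Tp (Suc n)) X) (cls c))
      = Phi n (face P.ZZ (Suc n) i (P.zc (Suc n) (P.fc (Suc (Suc n)) (Suc (Suc n)) zs)))"
    if zs: "zs \<in> tuples A (Suc (Suc (Suc n)))" for zs
  proof -
    have m: "P.mrg i zs \<in> tuples A (Suc (Suc n))" by (rule P.mrg_tuples[OF zs]) (use assms in simp)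
    have "psum (SH n) zs (\<lambda>X c. ?f (gen K (Tp (Suc n)) X) (cls c))
        = psum (SH n) zs (\<lambda>X c. counit H (X ! i) \<odot>\<^bsub>SH n\<^esub> sg n (rmv i X) c)"
    proof (rule lsum_cong)
      fix p assume "p \<in> set (phi zs)"
      then have p: "fst p \<in> tuples H (Suc (Suc n))" "snd p \<in> carrier A" using phi_set[OF zs] by auto
      show "?f (gen K (Tp (Suc n)) (fst p)) (cls (snd p)) = counit H (fst p ! i) \<odot>\<^bsub>SH n\<^esub> sg n (rmv i (fst p)) (snd p)"
        unfolding H.counit_at_gen[OF assms p(1)] sg_def
        by (rule lin_hom_smult[OF bilinD(2)[OF SH_gen_bilin]])
          (use nth_tuples[OF p(1), of i] rmv_tuples[OF p(1) assms] p(2) assms in simp_all)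
    qed
    also have "\<dots> = psum (SH n) (P.mrg i zs) (sg n)" by (rule psum_mrg[OF SH_module sg_mbil zs assms, symmetric])
    also have "\<dots> = Phi n (P.zc n (P.fc (Suc n) (Suc n) (P.mrg i zs)))" by (rule Phi_class[OF m])
    also have "P.fc (Suc n) (Suc n) (P.mrg i zs) = P.fc (Suc n) i (P.fc (Suc (Suc n)) (Suc (Suc n)) zs)"
      \<comment> \<open>Multiplying neighbours before and after closing up gives the same, by the identity \<open>d\<^sub>i d\<^sub>j = d\<^sub>j\<^sub>-\<^sub>1 d\<^sub>i\<close>.\<close>
      using P.fc_fc[of i "Suc (Suc n)" n zs] zs assms by (simp add: P.fc_def numeral_3_eq_3)
    finally show ?thesis using P.face_ZZ_zc[OF assms P.fc_tuples[OF zs]] by simp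
  qed
  show "face HC (Suc n) i \<in> lin_hom K (SH (Suc n)) (SH n)"
    unfolding e by (rule op_transfer_lin[OF b P.face_ZZ_lin[OF assms] eq])
  show "Phi n (face P.ZZ (Suc n) i q) = face HC (Suc n) i (Phi (Suc n) q)" if "q \<in> carrier (P.Z (Suc n))"
    unfolding e by (rule op_transfer_comm[OF b P.face_ZZ_lin[OF assms] eq that])
qed

lemma degen_HC:
  assumes "i \<le> n"
  shows degen_HC_lin: "degen HC n i \<in> lin_hom K (SH n) (SH (Suc n))"
    and Phi_degen: "q \<in> carrier (P.Z n) \<Longrightarrow> Phi (Suc n) (degen P.ZZ n i q) = degen HC n i (Phi n q)"
proof -
  have i: "i < Suc n" using assms by simp
  let ?S = "SH (Suc n)"
  let ?f = "\<lambda>X m. gen K ?S (comult_at K H (Suc n) i X, m)"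
  have e: "degen HC n i = gen_lift K ?S (\<lambda>(X, m). ?f X m)" by (simp add: hopf_cyclic_def)
  have cl: "comult_at K H (Suc n) i \<in> lin_hom K (Tp n) (Tp (Suc n))" by (rule H.comult_at_lin[OF i])
  have b: "bilin K (Tp n) AQ ?S ?f"
    by (rule bilinI[OF bilinD(1)[OF SH_gen_bilin lin_hom_closed[OF cl]] lin_hom_comp[OF cl bilinD(2)[OF SH_gen_bilin]]])
  have eq: "psum ?S zs (\<lambda>X c. ?f (gen K (Tp n) X) (cls c)) = Phi (Suc n) (degen P.ZZ n i (P.zc n (P.fc (Suc n) (Suc n) zs)))"
    if zs: "zs \<in> tuples A (Suc (Suc n))" for zs
  proof -
    have m: "P.ins i zs \<in> tuples A (Suc (Suc (Suc n)))" by (rule P.ins_tuples[OF zs]) (use assms in simp)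
    have "psum ?S zs (\<lambda>X c. ?f (gen K (Tp n) X) (cls c))
        = psum ?S zs (\<lambda>X c. lsum ?S (H.dl (X ! i)) (\<lambda>p. sg (Suc n) (spl i X p) c))"
    proof (rule lsum_cong)
      fix p assume "p \<in> set (phi zs)"
      then have p: "fst p \<in> tuples H (Suc n)" "snd p \<in> carrier A" using phi_set[OF zs] by auto
      show "?f (gen K (Tp n) (fst p)) (cls (snd p)) = lsum ?S (H.dl (fst p ! i)) (\<lambda>r. sg (Suc n) (spl i (fst p) r) (snd p))"
        unfolding H.comult_at_gen[OF i p(1)] sg_def
        by (rule lin_hom_lsum[OF Tp_module SH_module bilinD(2)[OF SH_gen_bilin]]) (use spl_tuples[OF p(1) i] p(2) in simp_all)
    qed
    also have "\<dots> = psum ?S (P.ins i zs) (sg (Suc n))" by (rule psum_ins[OF SH_module sg_mbil zs i, symmetric])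
    also have "\<dots> = Phi (Suc n) (P.zc (Suc n) (P.fc (Suc (Suc n)) (Suc (Suc n)) (P.ins i zs)))" by (rule Phi_class[OF m])
    also have "P.fc (Suc (Suc n)) (Suc (Suc n)) (P.ins i zs) = P.ins i (P.fc (Suc n) (Suc n) zs)"
      using P.fc_ins_greater[of i "Suc (Suc n)" n zs] zs assms by simp
    finally show ?thesis using P.degen_ZZ_zc[OF assms P.fc_tuples[OF zs]] by simp
  qed
  show "degen HC n i \<in> lin_hom K (SH n) ?S"
    unfolding e by (rule op_transfer_lin[OF b P.degen_ZZ_lin[OF assms] eq])
  show "Phi (Suc n) (degen P.ZZ n i q) = degen HC n i (Phi n q)" if "q \<in> carrier (P.Z n)"
    unfolding e by (rule op_transfer_comm[OF b P.degen_ZZ_lin[OF assms] eq that])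
qed

text \<open>\<open>\<rho>\<close> is linear over \<open>B\<close> on both sides, because \<open>B\<close> is coinvariant; so it passes to \<open>A\<^sub>B\<close>.\<close>

lemma quot_coaction_facts:
  shows quot_coaction_lin: "quot_coaction K H A B \<rho> \<in> lin_hom K AQ (tensor K AQ H)"
    and quot_coaction_cls: "a \<in> carrier A \<Longrightarrow> quot_coaction K H A B \<rho> (cls a)
      = lsum (tensor K AQ H) (rl a) (\<lambda>p. gen K (tensor K AQ H) (cls (fst p), snd p))"
proof -
  let ?T = "tensor K AQ H"
  have T: "module K ?T" by (rule tensor_module[OF AQ_module H.module])
  note g = tensor_gen_bilin[OF AQ_module H.module]
  have b: "bilin K A H ?T (\<lambda>x h. gen K ?T (cls x, h))"
    by (rule bilinI[OF bilinD(1)[OF g] lin_hom_comp[OF cls_lin bilinD(2)[OF g]]]) auto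
  let ?q = "\<lambda>a. gen_lift K ?T (\<lambda>(x, h). gen K ?T (cls x, h)) (\<rho> a)"
  have eq: "quot_coaction K H A B \<rho> = quot_lift ?q" by (simp add: quot_coaction_def Let_def)
  have l: "?q \<in> lin_hom K A ?T" by (rule lin_hom_comp[OF coaction_linear tensor_lift_lin[OF A.module H.module T b]])
  have v: "?q a = lsum ?T (rl a) (\<lambda>p. gen K ?T (cls (fst p), snd p))" if "a \<in> carrier A" for a
    by (rule gen_lift_rho[OF T b that])
  have c: "?q (x \<cdot> y) = ?q (y \<cdot> x)" if "x \<in> carrier A" "y \<in> B" for x y
  proof -
    have "?q (x \<cdot> y) = lsum ?T (rl x) (\<lambda>p. gen K ?T (cls (fst p \<cdot> y), snd p))"
      using v[of "x \<cdot> y"] rl_coinv_right[OF T b that(2,1)] that by simp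
    also have "\<dots> = lsum ?T (rl x) (\<lambda>p. gen K ?T (cls (y \<cdot> fst p), snd p))"
      by (rule lsum_cong) (simp only: cls_comm[OF rl_set(1) that(2)])
    also have "\<dots> = ?q (y \<cdot> x)"
      using v[of "y \<cdot> x"] rl_coinv_left[OF T b that(2,1)] that by simp
    finally show ?thesis .
  qed
  show "quot_coaction K H A B \<rho> \<in> lin_hom K AQ ?T" unfolding eq by (rule AQ_lift_lin[OF T l c])
  show "quot_coaction K H A B \<rho> (cls a) = lsum ?T (rl a) (\<lambda>p. gen K ?T (cls (fst p), snd p))" if "a \<in> carrier A"
    unfolding eq v[OF that, symmetric] by (rule AQ_lift_eq[OF T l c that])
qed

lemma mbil_tau:
  assumes "us \<in> tuples H n" "g \<in> carrier H" "a \<in> carrier A"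
  shows "mbil (Suc (Suc n)) (SH n) (\<lambda>ks c.
    sg n (last ks \<star> (g \<star> hd ks) # us \<bullet> (butlast (tl ks))) (a \<cdot> c))"
proof (rule mbilI)
  note us = assms(1)
  fix c assume "c \<in> carrier A"
  then have ac: "a \<cdot> c \<in> carrier A" using assms by simp
  note m = sg_mlin[OF ac, of n]
  have hl: "(\<lambda>w. sg n (w # us \<bullet> es) (a \<cdot> c)) \<in> lin_hom K H (SH n)" if "es \<in> tuples H n" for es
    using m H.tuples_map2[OF us that] by simp
  show "mlin K H (SH n) (Suc (Suc n)) (\<lambda>ks.
      sg n (last ks \<star> (g \<star> hd ks) # us \<bullet> (butlast (tl ks))) (a \<cdot> c))"
    unfolding mlin.simps(2)[of _ _ _ "Suc n"]
  proof (intro conjI ballI)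
    fix k assume k: "k \<in> carrier H"
    let ?F = "\<lambda>zs. sg n (hd zs \<star> (g \<star> k) # us \<bullet> (tl zs)) (a \<cdot> c)"
    have "mlin K H (SH n) n (\<lambda>zs. sg n (w # us \<bullet> zs) (a \<cdot> c))" if "w \<in> carrier H" for w
      by (rule H.mlin_map2_right[OF _ us]) (use m that in simp)
    moreover have "(\<lambda>z. ?F (z # zs)) \<in> lin_hom K H (SH n)" if "zs \<in> tuples H n" for zs
      using lin_hom_comp[OF H.mult_lin_left hl[OF that], of "g \<star> k"] assms k by simp
    ultimately have "mlin K H (SH n) (Suc n) ?F" using assms k by simp
    from H.mlin_rot[OF this]
    show "mlin K H (SH n) (Suc n) (\<lambda>ks. sg n (last (k # ks) \<star> (g \<star> hd (k # ks)) # us \<bullet> (butlast (tl (k # ks)))) (a \<cdot> c))"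
      by (rule mlin_cong[OF H.module]) (auto simp: tuples_def)
  next
    fix ks assume "ks \<in> tuples H (Suc n)"
    then obtain es e where e: "ks = es @ [e]" "es \<in> tuples H n" "e \<in> carrier H"
      by (cases ks rule: rev_cases) (auto simp: tuples_def)
    from lin_hom_comp[OF H.mult_lin_right[OF assms(2)] lin_hom_comp[OF H.mult_lin_right[OF e(3)] hl[OF e(2)]]]
    show "(\<lambda>k. sg n (last (k # ks) \<star> (g \<star> hd (k # ks)) # us \<bullet> (butlast (tl (k # ks)))) (a \<cdot> c)) \<in> lin_hom K H (SH n)"
      by (simp add: e(1))
  qed
next
  fix ks assume "ks \<in> tuples H (Suc (Suc n))"
  then obtain k ls where k: "ks = k # ls" "k \<in> carrier H" "ls \<in> tuples H (Suc n)"
    by (cases ks) (auto simp: tuples_def)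
  then obtain es e where e: "ls = es @ [e]" "es \<in> tuples H n" "e \<in> carrier H"
    by (cases ls rule: rev_cases) (auto simp: tuples_def)
  show "(\<lambda>c. sg n (last ks \<star> (g \<star> hd ks) # us \<bullet> (butlast (tl ks))) (a \<cdot> c)) \<in> lin_hom K A (SH n)"
    by (rule lin_hom_comp[OF A.mult_lin_right[OF assms(3)] sg_lin]) (use k e assms H.tuples_map2[OF assms(1) e(2)] in simp)
qed

text \<open>By \<open>psum_act\<close> the last factor \<open>z\<close> acts diagonally. On a summand \<open>(X, 1) \<otimes> c\<close> the cyclic operator then gives
  \<open>\<Sum> (z\<^sub>n\<^sub>+\<^sub>2 c\<^sub>1 z\<^sub>1, X\<^sub>1 z\<^sub>2, \<dots>, X\<^sub>n z\<^sub>n\<^sub>+\<^sub>1) \<otimes> c\<^sub>0 z\<^sub>0\<close>. Here \<open>z\<^sub>1, \<dots>, z\<^sub>n\<^sub>+\<^sub>1\<close> act diagonally on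
  \<open>(z\<^sub>n\<^sub>+\<^sub>2 c\<^sub>1, X)\<close>, so that \<open>sg_key\<close> turns the sum into \<open>\<Sum> (z\<^sub>1 c\<^sub>1, X) \<otimes> z\<^sub>0 c\<^sub>0\<close>. This is \<open>\<rho>(z c)\<close> with \<open>X\<close>
  inserted, that is, the Galois map with one more factor \<open>1\<close> in front.\<close>

lemma psum_tau:
  assumes as: "as \<in> tuples A (Suc n)" and z: "z \<in> carrier A"
  shows "psum (SH n) (as @ [z]) (\<lambda>X c. lsum (SH n) (rl c) (\<lambda>p. sg n ((last X \<star> snd p) # butlast X) (fst p)))
    = PhiL n (P.rot (P.lft z as))"
proof -
  let ?S = "SH n"
  note M = SH_module[of n]
  let ?V = "\<lambda>X c. lsum ?S (rl c) (\<lambda>p. sg n ((last X \<star> snd p) # butlast X) (fst p))"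
  have ends: "last X \<in> carrier H \<and> butlast X \<in> tuples H n" if "X \<in> tuples H (Suc n)" for X
    using that by (cases X rule: rev_cases) (auto simp: tuples_def)
  have Rb: "bilin K A H ?S (\<lambda>c g. sg n ((last X \<star> g) # butlast X) c)" if X: "X \<in> tuples H (Suc n)" for X
  proof (rule bilinI)
    show "(\<lambda>c. sg n ((last X \<star> g) # butlast X) c) \<in> lin_hom K A ?S" if "g \<in> carrier H" for g
      by (rule sg_lin) (use ends[OF X] that in simp)
    show "(\<lambda>g. sg n ((last X \<star> g) # butlast X) c) \<in> lin_hom K H ?S" if "c \<in> carrier A" for c
      using ends[OF X] sg_mlin[OF that, of n] by (intro lin_hom_comp[OF H.mult_lin_right]) auto
  qed
  have Vm: "mbil (Suc n) ?S ?V"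
  proof (rule mbilI)
    fix c assume "c \<in> carrier A"
    show "mlin K H ?S (Suc n) (\<lambda>X. ?V X c)"
    proof (rule mlin_lsum[OF M])
      fix p assume p: "p \<in> set (rl c)"
      have "mlin K H ?S (Suc n) (\<lambda>X. sg n ((hd X \<star> snd p) # tl X) (fst p))"
        using sg_mlin[of "fst p" n] p by (auto intro: lin_hom_comp[OF H.mult_lin_left])
      from H.mlin_rot[OF this] show "mlin K H ?S (Suc n) (\<lambda>X. sg n ((last X \<star> snd p) # butlast X) (fst p))" by simp
    qed
  next
    show "?V X \<in> lin_hom K A ?S" if "X \<in> tuples H (Suc n)" for X by (rule rl_lin[OF M Rb[OF that]])
  qed
  have step: "asum ?S n z ?V (X @ [1\<^sub>H]) c = phi_step ?S (sg n) 1\<^sub>A X (z \<cdot> c)"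
    if X: "X \<in> tuples H n" and c: "c \<in> carrier A" for X c
  proof -
    let ?E = "\<lambda>p ks x. sg n (last ks \<star> (snd p \<star> hd ks) # X \<bullet> butlast (tl ks)) (fst p \<cdot> x)"
    have E: "mbil (Suc (Suc n)) ?S (?E p)" if "p \<in> set (rl c)" for p
      by (rule mbil_tau[OF X]) (use that in auto)
    have dt: "ds \<in> tuples H (Suc n)" if "h \<in> carrier H" "ds \<in> set (H.dn n h)" for h ds
      using H.dn_tuples[OF that] .
    \<comment> \<open>\<open>s\<close> splits \<open>z\<^sub>0\<close>, and its second component enters as the first entry of the list to which \<open>?E p\<close> is applied.\<close>
    have "asum ?S n z ?V (X @ [1\<^sub>H]) c = lsum ?S (rl z) (\<lambda>q. lsum ?S (rl c) (\<lambda>p. lsum ?S (rl (fst q)) (\<lambda>s.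
        lsum ?S (H.dn n (snd q)) (\<lambda>ds. ?E p (snd s # ds) (fst s)))))"
    proof (rule lsum_cong)
      fix q assume q: "q \<in> set (rl z)"
      have "lsum ?S (H.dn n (snd q)) (\<lambda>ds. ?V ((X @ [1\<^sub>H]) \<bullet> ds) (c \<cdot> fst q))
          = lsum ?S (H.dn n (snd q)) (\<lambda>ds. lsum ?S (rl c) (\<lambda>p. lsum ?S (rl (fst q)) (\<lambda>s. ?E p (snd s # ds) (fst s))))"
      proof (rule lsum_cong)
        fix ds assume "ds \<in> set (H.dn n (snd q))"
        then have ds: "ds \<in> tuples H (Suc n)" using dt[of "snd q"] q by simp
        then obtain es e where e: "ds = es @ [e]" "es \<in> tuples H n" "e \<in> carrier H"
          by (cases ds rule: rev_cases) (auto simp: tuples_def)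
        have l: "length X = length es" using X e(2) by (simp add: tuples_def)
        have m: "(X @ [1\<^sub>H]) \<bullet> ds \<in> tuples H (Suc n)" by (rule H.tuples_map2[OF _ ds]) (use X in simp)
        have "?V ((X @ [1\<^sub>H]) \<bullet> ds) (c \<cdot> fst q) = lsum ?S (rl c) (\<lambda>p. lsum ?S (rl (fst q)) (\<lambda>s.
            sg n ((last ((X @ [1\<^sub>H]) \<bullet> ds) \<star> (snd p \<star> snd s)) # butlast ((X @ [1\<^sub>H]) \<bullet> ds)) (fst p \<cdot> fst s)))"
          by (rule rl_mult[OF M Rb[OF m] c]) (use q in simp)
        also have "\<dots> = lsum ?S (rl c) (\<lambda>p. lsum ?S (rl (fst q)) (\<lambda>s. ?E p (snd s # ds) (fst s)))"
          by (rule lsum_cong, rule lsum_cong) (use e l in \<open>simp add: H.H_monoid\<close>)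
        finally show "?V ((X @ [1\<^sub>H]) \<bullet> ds) (c \<cdot> fst q) = \<dots>" .
      qed
      also have "\<dots> = lsum ?S (rl c) (\<lambda>p. lsum ?S (H.dn n (snd q)) (\<lambda>ds. lsum ?S (rl (fst q)) (\<lambda>s. ?E p (snd s # ds) (fst s))))"
        by (rule module.lsum_swap[OF M], rule module.lsum_closed[OF M], rule mbilD(3)[OF E]) (use dt[of "snd q"] q in auto)
      also have "\<dots> = lsum ?S (rl c) (\<lambda>p. lsum ?S (rl (fst q)) (\<lambda>s. lsum ?S (H.dn n (snd q)) (\<lambda>ds. ?E p (snd s # ds) (fst s))))"
        by (rule lsum_cong, rule module.lsum_swap[OF M], rule mbilD(3)[OF E]) (use dt[of "snd q"] q in auto)
      finally show "lsum ?S (H.dn n (snd q)) (\<lambda>ds. ?V ((X @ [1\<^sub>H]) \<bullet> ds) (c \<cdot> fst q)) = \<dots>" .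
    qed
    also have "\<dots> = lsum ?S (rl c) (\<lambda>p. lsum ?S (rl z) (\<lambda>q. lsum ?S (rl (fst q)) (\<lambda>s.
        lsum ?S (H.dn n (snd q)) (\<lambda>ds. ?E p (snd s # ds) (fst s)))))"
    proof (rule module.lsum_swap[OF M], rule module.lsum_closed[OF M], rule module.lsum_closed[OF M], rule mbilD(3)[OF E])
      fix q s ds assume s: "q \<in> set (rl z)" "s \<in> set (rl (fst q))" "ds \<in> set (H.dn n (snd q))"
      show "snd s # ds \<in> tuples H (Suc (Suc n))" using dt[OF _ s(3)] s by simp
    qed auto
    also have "\<dots> = lsum ?S (rl c) (\<lambda>p. lsum ?S (rl z) (\<lambda>q. lsum ?S (rl (fst q)) (\<lambda>s.
        lsum ?S (H.dn n (snd s)) (\<lambda>ds. ?E p (ds @ [snd q]) (fst s)))))"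
      \<comment> \<open>The entries of the iterated coproduct are regrouped so that the last one, not the first, is separate.\<close>
      by (rule lsum_cong) (simp only: rl_dn_Cons[OF M E z] rl_dn_snoc[OF M E z])
    also have "\<dots> = lsum ?S (rl c) (\<lambda>p. lsum ?S (rl z) (\<lambda>q. sg n (snd q \<star> snd p # X) (fst q \<cdot> fst p)))"
    proof (rule lsum_cong, rule lsum_cong)
      fix p q assume p: "p \<in> set (rl c)" and q: "q \<in> set (rl z)"
      have "sg n (snd q \<star> snd p # X) (fst q \<cdot> fst p) = asum ?S n (fst q) (sg n) (snd q \<star> snd p # X) (fst p)"
        by (rule sg_key[symmetric]) (use X p q in auto)
      also have "\<dots> = lsum ?S (rl (fst q)) (\<lambda>s. lsum ?S (H.dn n (snd s)) (\<lambda>ds. ?E p (ds @ [snd q]) (fst s)))"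
      proof (rule lsum_cong, rule lsum_cong)
        fix s ds assume s: "s \<in> set (rl (fst q))" "ds \<in> set (H.dn n (snd s))"
        have "ds \<in> tuples H (Suc n)" by (rule dt[OF _ s(2)]) (use s in simp)
        then obtain e es where "ds = e # es" "e \<in> carrier H" by (auto simp: tuples_Suc)
        then show "sg n ((snd q \<star> snd p # X) \<bullet> ds) (fst p \<cdot> fst s) = ?E p (ds @ [snd q]) (fst s)"
          using p q by (simp add: H.H_monoid)
      qed
      finally show "lsum ?S (rl (fst q)) (\<lambda>s. lsum ?S (H.dn n (snd s)) (\<lambda>ds. ?E p (ds @ [snd q]) (fst s)))
          = sg n (snd q \<star> snd p # X) (fst q \<cdot> fst p)" by simp
    qed
    also have "\<dots> = lsum ?S (rl z) (\<lambda>q. lsum ?S (rl c) (\<lambda>p. sg n (snd q \<star> snd p # X) (fst q \<cdot> fst p)))"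
      by (rule module.lsum_swap[OF M], rule sg_closed) (use X in auto)
    also have "\<dots> = lsum ?S (rl (z \<cdot> c)) (\<lambda>r. sg n (snd r # X) (fst r))"
      by (rule rl_mult[OF M mbil_bilin[OF sg_mbil X] z c, symmetric])
    also have "\<dots> = phi_step ?S (sg n) 1\<^sub>A X (z \<cdot> c)" by (rule lsum_cong) simp
    finally show ?thesis .
  qed
  have as1: "as @ [1\<^sub>A] \<in> tuples A (Suc (Suc n))" and o: "1\<^sub>A \<in> carrier A" using as by simp_all
  note la = P.lft_tuples[OF as z]
  obtain us v where u: "P.lft z as = us @ [v]" "us \<in> tuples A n" "v \<in> carrier A" using la by (rule P.tuples_snocE)
  have "psum ?S (as @ [z]) ?V = psum ?S (as @ [1\<^sub>A]) (asum ?S n z ?V)"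
    using psum_act[OF M Vm as1 z] z by simp
  also have "\<dots> = psum ?S as (\<lambda>X c. asum ?S n z ?V (X @ [1\<^sub>H]) c)" by (rule psum_snoc_one[OF M mbil_asum[OF M Vm z] as])
  also have "\<dots> = psum ?S as (\<lambda>X c. phi_step ?S (sg n) 1\<^sub>A X (z \<cdot> c))"
    by (rule lsum_cong, rule step) (use phi_set[OF as] in auto)
  also have "\<dots> = psum ?S (P.lft z as) (phi_step ?S (sg n) 1\<^sub>A)" by (rule psum_lft[OF as z, symmetric])
  also have "\<dots> = psum ?S ((1\<^sub>A # us) @ [v]) (sg n)" using psum_Cons[OF M sg_mbil o la] u(1) by simp
  also have "\<dots> = PhiL n (P.rot (P.lft z as))" using PhiL_snoc[of "1\<^sub>A # us" n v] u by simp
  finally show ?thesis .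
qed

lemma cyc_HC:
  shows cyc_HC_lin: "cyc HC n \<in> lin_hom K (SH n) (SH n)"
    and Phi_cyc: "q \<in> carrier (P.Z n) \<Longrightarrow> Phi n (cyc P.ZZ n q) = cyc HC n (Phi n q)"
proof -
  let ?T = "Tp n"
  let ?S = "SH n"
  note M = SH_module[of n] and T = Tp_module[of n]
  note tg = tensor_power_gen_mlin[OF H.module, of "Suc n"]
  let ?R = "\<lambda>g hs. (last hs \<star> g) # butlast hs"
  let ?r = "\<lambda>g. gen_lift K ?T (\<lambda>hs. gen K ?T (?R g hs))"
  have Rt: "?R g hs \<in> tuples H (Suc n)" if "hs \<in> tuples H (Suc n)" "g \<in> carrier H" for g hs
    using that by (cases hs rule: rev_cases) (auto simp: tuples_def)
  have Rm: "mlin K H ?T (Suc n) (\<lambda>hs. gen K ?T (?R g hs))" if g: "g \<in> carrier H" for g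
  proof -
    have "mlin K H ?T (Suc n) (\<lambda>hs. gen K ?T ((hd hs \<star> g) # tl hs))"
      using tg g by (auto intro: lin_hom_comp[OF H.mult_lin_left])
    from H.mlin_rot[OF this] show ?thesis by simp
  qed
  have rl: "?r g \<in> lin_hom K ?T ?T" if "g \<in> carrier H" for g
    by (rule tensor_power_lift_lin[OF H.module T Rm[OF that]])
  have rg: "(\<lambda>g. ?r g X) \<in> lin_hom K H ?T" if X: "X \<in> carrier ?T" for X
  proof -
    obtain L where L: "set L \<subseteq> tuples H (Suc n)" "X = lsum ?T L (gen K ?T)"
      using tensor_power_rep[OF H.module _ X] by auto
    have "(\<lambda>g. lsum ?T L (\<lambda>hs. gen K ?T (?R g hs))) \<in> lin_hom K H ?T"
    proof (rule module.lin_lsum[OF T])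
      fix hs assume "hs \<in> set L"
      then obtain us v where v: "hs = us @ [v]" "us \<in> tuples H n" "v \<in> carrier H"
        using L(1) by (cases hs rule: rev_cases) (auto simp: tuples_def)
      have "(\<lambda>w. gen K ?T (w # us)) \<in> lin_hom K H ?T" using tg v(2) by simp
      from lin_hom_comp[OF H.mult_lin_right[OF v(3)] this]
      show "(\<lambda>g. gen K ?T (?R g hs)) \<in> lin_hom K H ?T" by (simp add: v(1))
    qed
    then show ?thesis
      by (rule lin_hom_cong[OF H.module]) (simp only: L(2) tensor_power_lift_sum[OF H.module T Rm L(1)])
  qed
  let ?G = "\<lambda>X m g. gen K ?S (?r g X, m)"
  have G: "bilin K AQ H ?S (?G X)" if X: "X \<in> carrier ?T" for X
    by (rule bilinI[OF lin_hom_comp[OF rg[OF X] bilinD(2)[OF SH_gen_bilin]] bilinD(1)[OF SH_gen_bilin lin_hom_closed[OF rl X]]])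
  have GX: "(\<lambda>X. ?G X m g) \<in> lin_hom K ?T ?S" if "m \<in> carrier AQ" "g \<in> carrier H" for m g
    by (rule lin_hom_comp[OF rl[OF that(2)] bilinD(2)[OF SH_gen_bilin that(1)]])
  let ?f = "\<lambda>X m. gen_lift K ?S (\<lambda>(m', g). ?G X m' g) (quot_coaction K H A B \<rho> m)"
  have e: "cyc HC n = gen_lift K ?S (\<lambda>(X, m). ?f X m)" by (simp add: hopf_cyclic_def Let_def)
  have fc: "?f X (cls a) = lsum ?S (rl a) (\<lambda>p. ?G X (cls (fst p)) (snd p))"
    if X: "X \<in> carrier ?T" and a: "a \<in> carrier A" for X a
  proof -
    have "set (map (\<lambda>p. (cls (fst p), snd p)) (rl a)) \<subseteq> carrier AQ \<times> carrier H" by (auto dest!: rl_set_pair)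
    from tensor_lift_sum[OF AQ_module H.module M G[OF X] this] show ?thesis by (simp add: quot_coaction_cls[OF a])
  qed
  have b: "bilin K ?T AQ ?S ?f"
  proof (rule bilinI)
    show "?f X \<in> lin_hom K AQ ?S" if "X \<in> carrier ?T" for X
      by (rule lin_hom_comp[OF quot_coaction_lin tensor_lift_lin[OF AQ_module H.module M G[OF that]]])
    fix m assume "m \<in> carrier AQ"
    then obtain a where a: "a \<in> carrier A" "m = cls a" using cls_surj by auto
    have "(\<lambda>X. lsum ?S (rl a) (\<lambda>p. ?G X (cls (fst p)) (snd p))) \<in> lin_hom K ?T ?S"
      by (rule module.lin_lsum[OF M GX]) (auto dest!: rl_set_pair)
    then show "(\<lambda>X. ?f X m) \<in> lin_hom K ?T ?S"
      unfolding a(2) by (rule lin_hom_cong[OF T]) (simp only: fc[OF _ a(1)])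
  qed
  have eq: "psum ?S zs (\<lambda>X c. ?f (gen K ?T X) (cls c)) = Phi n (cyc P.ZZ n (P.zc n (P.fc (Suc n) (Suc n) zs)))"
    if zs: "zs \<in> tuples A (Suc (Suc n))" for zs
  proof -
    obtain a w z where z: "zs = a # w @ [z]" "a \<in> carrier A" "w \<in> tuples A n" "z \<in> carrier A"
      using zs by (rule P.tuples_endsE)
    note t = P.fc_tuples[OF zs, of "Suc n"]
    have "psum ?S zs (\<lambda>X c. ?f (gen K ?T X) (cls c)) = psum ?S zs (\<lambda>X c. lsum ?S (rl c) (\<lambda>p. sg n (?R (snd p) X) (fst p)))"
    proof (rule lsum_cong)
      fix p assume "p \<in> set (phi zs)"
      then have p: "fst p \<in> tuples H (Suc n)" "snd p \<in> carrier A" using phi_set[OF zs] by auto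
      show "?f (gen K ?T (fst p)) (cls (snd p)) = lsum ?S (rl (snd p)) (\<lambda>r. sg n (?R (snd r) (fst p)) (fst r))"
        unfolding fc[OF Tp_gen_closed[OF p(1)] p(2)] sg_def
        by (rule lsum_cong) (simp only: tensor_power_lift_gen[OF H.module T Rm[OF rl_set(2)] p(1)])
    qed
    also have "\<dots> = PhiL n (P.rot (P.fc (Suc n) (Suc n) zs))"
      using psum_tau[of "a # w" n z] z by (simp add: P.fc_def P.rot_ends)
    also have "\<dots> = Phi n (cyc P.ZZ n (P.zc n (P.fc (Suc n) (Suc n) zs)))"
      unfolding P.cyc_ZZ_zc[OF t] Phi_zc[OF P.rot_tuples[OF t]] ..
    finally show ?thesis .
  qed
  show "cyc HC n \<in> lin_hom K ?S ?S" unfolding e by (rule op_transfer_lin[OF b P.cyc_ZZ_lin eq])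
  show "Phi n (cyc P.ZZ n q) = cyc HC n (Phi n q)" if "q \<in> carrier (P.Z n)"
    unfolding e by (rule op_transfer_comm[OF b P.cyc_ZZ_lin eq that])
qed

end

section \<open>Transport of cyclic objects and of cyclic homology\<close>

lemma lin_isoD:
  assumes "f \<in> lin_iso K M N"
  shows "f \<in> lin_hom K M N" "inj_on f (carrier M)" "f ` carrier M = carrier N"
  using assms by (auto simp: lin_iso_def bij_betw_def)

lemma lin_iso_inv_into: "module K M \<Longrightarrow> f \<in> lin_iso K M N \<Longrightarrow> inv_into (carrier M) f \<in> lin_iso K N M"
  by (simp add: lin_iso_def lin_hom_inv_into bij_betw_inv_into)

text \<open>As every element of \<open>Z'\<close> is an image under \<open>\<phi>\<close>, the identities between the operators of \<open>Z\<close> carry over to those of \<open>Z'\<close>.\<close>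

locale cyclic_transport = Z: cyclic_object K Z
  for K :: "('k,'r) ring_scheme" and Z :: "('k,'x) cyclic_data" +
  fixes Z' :: "('k,'y) cyclic_data" and \<phi> :: "nat \<Rightarrow> 'x \<Rightarrow> 'y"
  assumes module': "module K (space Z' n)"
    and iso: "\<phi> n \<in> lin_iso K (space Z n) (space Z' n)"
    and face_lin': "i \<le> Suc n \<Longrightarrow> face Z' (Suc n) i \<in> lin_hom K (space Z' (Suc n)) (space Z' n)"
    and degen_lin': "i \<le> n \<Longrightarrow> degen Z' n i \<in> lin_hom K (space Z' n) (space Z' (Suc n))"
    and cyc_lin': "cyc Z' n \<in> lin_hom K (space Z' n) (space Z' n)"
    and face_comm: "i \<le> Suc n \<Longrightarrow> x \<in> carrier (space Z (Suc n)) \<Longrightarrow>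
          \<phi> n (face Z (Suc n) i x) = face Z' (Suc n) i (\<phi> (Suc n) x)"
    and degen_comm: "i \<le> n \<Longrightarrow> x \<in> carrier (space Z n) \<Longrightarrow> \<phi> (Suc n) (degen Z n i x) = degen Z' n i (\<phi> n x)"
    and cyc_comm: "x \<in> carrier (space Z n) \<Longrightarrow> \<phi> n (cyc Z n x) = cyc Z' n (\<phi> n x)"
begin

lemma ops_closed [simp]:
  "i \<le> Suc n \<Longrightarrow> x \<in> carrier (space Z (Suc n)) \<Longrightarrow> face Z (Suc n) i x \<in> carrier (space Z n)"
  "i \<le> n \<Longrightarrow> x \<in> carrier (space Z n) \<Longrightarrow> degen Z n i x \<in> carrier (space Z (Suc n))"
  "x \<in> carrier (space Z n) \<Longrightarrow> cyc Z n x \<in> carrier (space Z n)"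
  using lin_hom_closed[OF Z.face_linear[of i n]] lin_hom_closed[OF Z.degen_linear[of i n]] lin_hom_closed[OF Z.cyc_linear[of n]]
  by simp_all

lemma surj: "y \<in> carrier (space Z' n) \<Longrightarrow> (\<And>x. x \<in> carrier (space Z n) \<Longrightarrow> y = \<phi> n x \<Longrightarrow> thesis) \<Longrightarrow> thesis"
  unfolding lin_isoD(3)[OF iso, symmetric] by blast

lemma cyc_pow: "x \<in> carrier (space Z n) \<Longrightarrow> (cyc Z n ^^ j) x \<in> carrier (space Z n) \<and> \<phi> n ((cyc Z n ^^ j) x) = (cyc Z' n ^^ j) (\<phi> n x)"
  by (induction j) (auto simp: cyc_comm)

lemmas comm = face_comm[symmetric] degen_comm[symmetric] cyc_comm[symmetric]

lemma cyclic_object': "cyclic_object K Z'"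
proof (rule cyclic_object.intro, goal_cases)
  case (1 n) show ?case by (rule module')
next
  case (2 i n) then show ?case using face_lin' by simp
next
  case (3 i n) then show ?case using degen_lin' by simp
next
  case (4 n) show ?case by (rule cyc_lin')
next
  case (5 i j n x)
  obtain u where u: "u \<in> carrier (space Z (Suc (Suc n)))" "x = \<phi> (Suc (Suc n)) u" by (rule surj[of x "Suc (Suc n)"]) (use 5 in auto)
  show ?case using Z.face_face[of i j n u] u 5 by (simp add: comm)
next
  case (6 i j n x)
  obtain u where u: "u \<in> carrier (space Z n)" "x = \<phi> n u" by (rule surj[OF 6(3)])
  show ?case using Z.degen_degen[of i j n u] u 6 by (simp add: comm)
next
  case (7 i j n x)
  obtain u where u: "u \<in> carrier (space Z (Suc n))" "x = \<phi> (Suc n) u" by (rule surj[of x "Suc n"]) (use 7 in auto)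
  show ?case using Z.face_degen_less[of i j n u] u 7 by (simp add: comm)
next
  case (8 i j n x)
  obtain u where u: "u \<in> carrier (space Z n)" "x = \<phi> n u" by (rule surj[OF 8(3)])
  show ?case using Z.face_degen_eq[of i j n u] u 8 by (auto simp: comm)
next
  case (9 j i n x)
  obtain u where u: "u \<in> carrier (space Z (Suc n))" "x = \<phi> (Suc n) u" by (rule surj[of x "Suc n"]) (use 9 in auto)
  show ?case using Z.face_degen_greater[of j i n u] u 9 by (simp add: comm)
next
  case (10 i n x)
  obtain u where u: "u \<in> carrier (space Z (Suc n))" "x = \<phi> (Suc n) u" by (rule surj[of x "Suc n"]) (use 10 in auto)
  show ?case using Z.face_cyc[of i n u] u 10 by (simp add: comm)
next
  case (11 x n)
  obtain u where u: "u \<in> carrier (space Z (Suc n))" "x = \<phi> (Suc n) u" by (rule surj[of x "Suc n"]) (use 11 in auto)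
  show ?case using Z.face_0_cyc[of u n] u by (simp add: comm)
next
  case (12 i n x)
  obtain u where u: "u \<in> carrier (space Z n)" "x = \<phi> n u" by (rule surj[OF 12(3)])
  show ?case using Z.degen_cyc[of i n u] u 12 by (simp add: comm)
next
  case (13 x n)
  obtain u where u: "u \<in> carrier (space Z n)" "x = \<phi> n u" by (rule surj[OF 13])
  show ?case using Z.degen_0_cyc[of u n] u by (simp add: comm)
next
  case (14 x n)
  obtain u where u: "u \<in> carrier (space Z n)" "x = \<phi> n u" by (rule surj[OF 14])
  show ?case using Z.cyc_power[of u n] cyc_pow[of u n "n + 1"] u by simp
qed

lemma cyclic_isomorphic': "cyclic_isomorphic K Z' Z"
proof -
  let ?\<psi> = "\<lambda>n. inv_into (carrier (space Z n)) (\<phi> n)"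
  have l: "?\<psi> n (\<phi> n x) = x" if "x \<in> carrier (space Z n)" for n x using lin_isoD(2)[OF iso] that by simp
  have f: "?\<psi> n (face Z' (n + 1) i y) = face Z (n + 1) i (?\<psi> (n + 1) y)" if "i \<le> n + 1" "y \<in> carrier (space Z' (n + 1))" for n i y
    using that(2)
  proof (rule surj)
    fix x assume "x \<in> carrier (space Z (n + 1))" "y = \<phi> (n + 1) x"
    then show ?thesis using that(1) by (simp add: comm l)
  qed
  have d: "?\<psi> (n + 1) (degen Z' n i y) = degen Z n i (?\<psi> n y)" if "i \<le> n" "y \<in> carrier (space Z' n)" for n i y
    using that(2)
  proof (rule surj)
    fix x assume "x \<in> carrier (space Z n)" "y = \<phi> n x"
    then show ?thesis using that(1) by (simp add: comm l)
  qed
  have c: "?\<psi> n (cyc Z' n y) = cyc Z n (?\<psi> n y)" if "y \<in> carrier (space Z' n)" for n y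
    using that
  proof (rule surj)
    fix x assume "x \<in> carrier (space Z n)" "y = \<phi> n x"
    then show ?thesis by (simp add: comm l)
  qed
  show ?thesis
    unfolding cyclic_isomorphic_def
    by (intro conjI exI[of _ ?\<psi>] cyclic_object' Z.cyclic_object_axioms allI impI ballI lin_iso_inv_into Z.space_module iso f d c)
qed

end

text \<open>The operations on cosets are set operations, with which taking images commutes; no representatives need be
  chosen.\<close>

lemma quot_image_iso:
  assumes f: "f \<in> lin_hom K M M'" "inj_on f (carrier M)"
    and cl: "\<And>x y. x \<in> carrier M \<Longrightarrow> y \<in> carrier M \<Longrightarrow> x \<oplus>\<^bsub>M\<^esub> y \<in> carrier M"
      "\<And>c x. c \<in> carrier K \<Longrightarrow> x \<in> carrier M \<Longrightarrow> c \<odot>\<^bsub>M\<^esub> x \<in> carrier M"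
    and C: "C \<subseteq> carrier M" and D: "D \<subseteq> carrier M"
  shows "(`) f \<in> lin_iso K (quot_module (M\<lparr>carrier := C\<rparr>) D) (quot_module (M'\<lparr>carrier := f ` C\<rparr>) (f ` D))"
proof -
  let ?Q = "quot_module (M\<lparr>carrier := C\<rparr>) D" and ?Q' = "quot_module (M'\<lparr>carrier := f ` C\<rparr>) (f ` D)"
  let ?c = "\<lambda>x. (\<lambda>d. d \<oplus>\<^bsub>M\<^esub> x) ` D" and ?c' = "\<lambda>x. (\<lambda>d. d \<oplus>\<^bsub>M'\<^esub> x) ` f ` D"
  have Q: "carrier ?Q = ?c ` C" "carrier ?Q' = ?c' ` f ` C"
    by (auto simp: quot_module_def A_RCOSETS_def' a_r_coset_def')
  have add: "X \<oplus>\<^bsub>?Q\<^esub> Y = (\<Union>x\<in>X. \<Union>y\<in>Y. {x \<oplus>\<^bsub>M\<^esub> y})" "X' \<oplus>\<^bsub>?Q'\<^esub> Y' = (\<Union>x\<in>X'. \<Union>y\<in>Y'. {x \<oplus>\<^bsub>M'\<^esub> y})" for X Y X' Y'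
    by (auto simp: quot_module_def set_add_def')
  have sm: "c \<odot>\<^bsub>?Q\<^esub> X = (\<Union>x\<in>X. ?c (c \<odot>\<^bsub>M\<^esub> x))" "c \<odot>\<^bsub>?Q'\<^esub> X' = (\<Union>x\<in>X'. ?c' (c \<odot>\<^bsub>M'\<^esub> x))" for c X X'
    by (auto simp: quot_module_def a_r_coset_def')
  have fc: "f ` ?c x = ?c' (f x)" if x: "x \<in> carrier M" for x
    unfolding image_image by (rule image_cong) (use lin_hom_add[OF f(1) _ x] D in auto)
  have sub: "X \<subseteq> carrier M" if "X \<in> carrier ?Q" for X
    using that C D cl(1) unfolding Q by auto
  have "(`) f \<in> lin_hom K ?Q ?Q'"
    unfolding lin_hom_def
  proof (intro CollectI conjI funcsetI ballI)
    show "f ` X \<in> carrier ?Q'" if X: "X \<in> carrier ?Q" for X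
    proof -
      obtain x where "x \<in> C" "X = ?c x" using X unfolding Q by blast
      then show ?thesis using fc[of x] C unfolding Q by auto
    qed
    show "f ` (X \<oplus>\<^bsub>?Q\<^esub> Y) = f ` X \<oplus>\<^bsub>?Q'\<^esub> f ` Y" if "X \<in> carrier ?Q" "Y \<in> carrier ?Q" for X Y
    proof -
      have a: "f (x \<oplus>\<^bsub>M\<^esub> y) = f x \<oplus>\<^bsub>M'\<^esub> f y" if "x \<in> X" "y \<in> Y" for x y
        by (rule lin_hom_add[OF f(1)]) (use that sub \<open>X \<in> _\<close> \<open>Y \<in> _\<close> in auto)
      have "f ` (X \<oplus>\<^bsub>?Q\<^esub> Y) = (\<Union>x\<in>X. \<Union>y\<in>Y. {f (x \<oplus>\<^bsub>M\<^esub> y)})" unfolding add by auto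
      also have "\<dots> = (\<Union>x\<in>X. \<Union>y\<in>Y. {f x \<oplus>\<^bsub>M'\<^esub> f y})" using a by simp
      also have "\<dots> = f ` X \<oplus>\<^bsub>?Q'\<^esub> f ` Y" unfolding add by auto
      finally show ?thesis .
    qed
    show "f ` (c \<odot>\<^bsub>?Q\<^esub> X) = c \<odot>\<^bsub>?Q'\<^esub> f ` X" if c: "c \<in> carrier K" and X: "X \<in> carrier ?Q" for c X
    proof -
      have "f ` ?c (c \<odot>\<^bsub>M\<^esub> x) = ?c' (c \<odot>\<^bsub>M'\<^esub> f x)" if "x \<in> X" for x
        using fc[OF cl(2)[OF c], of x] lin_hom_smult[OF f(1) c, of x] sub[OF X] that by (simp add: subset_iff)
      then show ?thesis unfolding sm image_UN by simp
    qed
  qed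
  moreover have "inj_on ((`) f) (carrier ?Q)"
    by (rule inj_onI) (use inj_on_image_eq_iff[OF f(2)] sub in blast)
  moreover have "(`) f ` carrier ?Q = carrier ?Q'"
  proof -
    have "(`) f ` ?c ` C = (\<lambda>x. ?c' (f x)) ` C"
      unfolding image_image[of "(`) f"] by (rule image_cong) (use fc C in \<open>simp_all only: subset_iff\<close>)
    then show ?thesis unfolding Q by (simp only: image_image[of ?c' f])
  qed
  ultimately show ?thesis by (simp add: lin_iso_def bij_betw_def)
qed

lemma lin_hom_finsum:
  assumes "module K M" "module K N" "f \<in> lin_hom K M N" "finite I" "\<And>i. i \<in> I \<Longrightarrow> g i \<in> carrier M"
  shows "f (\<Oplus>\<^bsub>M\<^esub>i\<in>I. g i) = (\<Oplus>\<^bsub>N\<^esub>i\<in>I. f (g i))"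
proof -
  interpret M: module K M by fact
  interpret N: module K N by fact
  show ?thesis using assms(4,5)
  proof (induction rule: finite_induct)
    case empty show ?case using lin_hom_zero[OF assms(1-3)] by simp
  next
    case (insert i I)
    have g: "g \<in> I \<rightarrow> carrier M" "g i \<in> carrier M" using insert.prems by auto
    have fg: "(\<lambda>i. f (g i)) \<in> I \<rightarrow> carrier N" "f (g i) \<in> carrier N" using g lin_hom_closed[OF assms(3)] by auto
    show ?case using insert lin_hom_add[OF assms(3) g(2) M.finsum_closed[OF g(1)]] 
      by (simp add: M.finsum_insert[OF insert(1,2) g] N.finsum_insert[OF insert(1,2) fg])
  qed
qed

text \<open>The differentials of the total complex are built from faces and cyclic operators by linear combinations, so an
  isomorphism of cyclic objects commutes with them and maps cycles and boundaries onto each other.\<close>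

lemma cyclic_isomorphic_homology:
  assumes "cyclic_isomorphic K Z Z'"
  shows "\<exists>f. f \<in> lin_iso K (cyclic_homology K Z n) (cyclic_homology K Z' n)"
proof -
  obtain \<phi> where "cyclic_object K Z" "cyclic_object K Z'" and iso': "\<forall>n. \<phi> n \<in> lin_iso K (space Z n) (space Z' n)"
    and fc': "\<forall>n. \<forall>i\<le>n + 1. \<forall>x\<in>carrier (space Z (n + 1)). \<phi> n (face Z (n + 1) i x) = face Z' (n + 1) i (\<phi> (n + 1) x)"
    and cc': "\<forall>n. \<forall>x\<in>carrier (space Z n). \<phi> n (cyc Z n x) = cyc Z' n (\<phi> n x)"
    using assms unfolding cyclic_isomorphic_def by blast
  have iso: "\<phi> n \<in> lin_iso K (space Z n) (space Z' n)" for n using iso' by blast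
  have fc: "\<phi> n (face Z (Suc n) i x) = face Z' (Suc n) i (\<phi> (Suc n) x)" if "i \<le> Suc n" "x \<in> carrier (space Z (Suc n))" for n i x
    using fc' that by simp
  have cc: "\<phi> n (cyc Z n x) = cyc Z' n (\<phi> n x)" if "x \<in> carrier (space Z n)" for n x using cc' that by blast
  interpret Z: cyclic_object K Z by fact
  interpret Z': cyclic_object K Z' by fact
  interpret M: module K "space Z m" for m by (rule Z.space_module)
  interpret M': module K "space Z' m" for m by (rule Z'.space_module)
  note lin = lin_isoD(1)[OF iso]
  note mm = Z.space_module Z'.space_module lin
  have sg: "sign K i \<in> carrier K" for i by (simp add: sign_def)
  have fcl: "face Z (Suc q) i x \<in> carrier (space Z q)" if "i \<le> Suc q" "x \<in> carrier (space Z (Suc q))" for q i x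
    using lin_hom_closed[OF Z.face_linear[of i q]] that by simp
  have ccl: "cyc Z q x \<in> carrier (space Z q)" if "x \<in> carrier (space Z q)" for q x
    by (rule lin_hom_closed[OF Z.cyc_linear that])
  have alt: "(\<Oplus>\<^bsub>space Z q\<^esub>i\<in>I. sign K i \<odot>\<^bsub>space Z q\<^esub> face Z (Suc q) i x) \<in> carrier (space Z q) \<and>
      \<phi> q (\<Oplus>\<^bsub>space Z q\<^esub>i\<in>I. sign K i \<odot>\<^bsub>space Z q\<^esub> face Z (Suc q) i x)
        = (\<Oplus>\<^bsub>space Z' q\<^esub>i\<in>I. sign K i \<odot>\<^bsub>space Z' q\<^esub> face Z' (Suc q) i (\<phi> (Suc q) x))"
    if x: "x \<in> carrier (space Z (Suc q))" and I: "finite I" "I \<subseteq> {..Suc q}" for q x I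
  proof -
    have c: "sign K i \<odot>\<^bsub>space Z q\<^esub> face Z (Suc q) i x \<in> carrier (space Z q)"
      and v: "\<phi> q (sign K i \<odot>\<^bsub>space Z q\<^esub> face Z (Suc q) i x) = sign K i \<odot>\<^bsub>space Z' q\<^esub> face Z' (Suc q) i (\<phi> (Suc q) x)"
      if "i \<in> I" for i
      using sg fcl[OF _ x, of i] lin_hom_smult[OF lin sg fcl[OF _ x, of i]] fc[OF _ x, of i] that I(2) by auto
    have "\<phi> q (\<Oplus>\<^bsub>space Z q\<^esub>i\<in>I. sign K i \<odot>\<^bsub>space Z q\<^esub> face Z (Suc q) i x)
        = (\<Oplus>\<^bsub>space Z' q\<^esub>i\<in>I. \<phi> q (sign K i \<odot>\<^bsub>space Z q\<^esub> face Z (Suc q) i x))"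
      by (rule lin_hom_finsum[OF mm I(1)]) (use c in auto)
    also have "\<dots> = (\<Oplus>\<^bsub>space Z' q\<^esub>i\<in>I. sign K i \<odot>\<^bsub>space Z' q\<^esub> face Z' (Suc q) i (\<phi> (Suc q) x))"
      by (rule M'.finsum_cong') (use v c lin_hom_closed[OF lin] in \<open>auto simp flip: v\<close>)
    finally show ?thesis using c by (auto intro!: M.finsum_closed)
  qed
  have b: "hoch_b K Z q x \<in> carrier (space Z q) \<and> \<phi> q (hoch_b K Z q x) = hoch_b K Z' q (\<phi> (Suc q) x)"
    and b': "hoch_b' K Z q x \<in> carrier (space Z q) \<and> \<phi> q (hoch_b' K Z q x) = hoch_b' K Z' q (\<phi> (Suc q) x)"
    if "x \<in> carrier (space Z (Suc q))" for q x
    using alt[OF that, of "{..Suc q}"] alt[OF that, of "{..q}"] by (simp_all add: hoch_b_def hoch_b'_def)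
  have t: "signed_cyc K Z q x \<in> carrier (space Z q) \<and> \<phi> q (signed_cyc K Z q x) = signed_cyc K Z' q (\<phi> q x)"
    if x: "x \<in> carrier (space Z q)" for q x
    using lin_hom_smult[OF lin sg ccl[OF x]] sg ccl[OF x] cc[OF x] by (simp add: signed_cyc_def)
  have tp: "(signed_cyc K Z q ^^ j) x \<in> carrier (space Z q) \<and> \<phi> q ((signed_cyc K Z q ^^ j) x) = (signed_cyc K Z' q ^^ j) (\<phi> q x)"
    if x: "x \<in> carrier (space Z q)" for q j x
    using x by (induction j) (auto simp: t)
  have N: "norm_op K Z q x \<in> carrier (space Z q) \<and> \<phi> q (norm_op K Z q x) = norm_op K Z' q (\<phi> q x)"
    if x: "x \<in> carrier (space Z q)" for q x
  proof -
    have "\<phi> q (norm_op K Z q x) = (\<Oplus>\<^bsub>space Z' q\<^esub>j\<in>{..q}. \<phi> q ((signed_cyc K Z q ^^ j) x))"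
      unfolding norm_op_def by (rule lin_hom_finsum[OF mm]) (use tp[OF x] in auto)
    also have "\<dots> = norm_op K Z' q (\<phi> q x)" unfolding norm_op_def using tp[OF x] by simp
    finally show ?thesis unfolding norm_op_def using tp[OF x] by (auto intro!: M.finsum_closed)
  qed
  let ?T = "total_space Z" and ?T' = "total_space Z'"
  let ?F = "\<lambda>n x. \<lambda>q\<in>{..n}. \<phi> q (x q)"
  have cT: "x \<in> carrier (?T n) \<longleftrightarrow> x \<in> extensional {..n} \<and> (\<forall>q\<le>n. x q \<in> carrier (space Z q))" for x n
    by (auto simp: total_space_def PiE_def)
  have cT': "x \<in> carrier (?T' n) \<longleftrightarrow> x \<in> extensional {..n} \<and> (\<forall>q\<le>n. x q \<in> carrier (space Z' q))" for x n
    by (auto simp: total_space_def PiE_def)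
  have Fl: "?F n \<in> lin_hom K (?T n) (?T' n)" for n
    unfolding lin_hom_def
  proof (intro CollectI conjI funcsetI ballI)
    show "?F n x \<in> carrier (?T' n)" if "x \<in> carrier (?T n)" for x
      using that lin_hom_closed[OF lin] unfolding cT cT' by auto
    show "?F n (x \<oplus>\<^bsub>?T n\<^esub> y) = ?F n x \<oplus>\<^bsub>?T' n\<^esub> ?F n y" if "x \<in> carrier (?T n)" "y \<in> carrier (?T n)" for x y
      using that lin_hom_add[OF lin] unfolding cT by (auto simp: total_space_def)
    show "?F n (c \<odot>\<^bsub>?T n\<^esub> x) = c \<odot>\<^bsub>?T' n\<^esub> ?F n x" if "c \<in> carrier K" "x \<in> carrier (?T n)" for c x
      using that lin_hom_smult[OF lin] unfolding cT by (auto simp: total_space_def)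
  qed
  have Fi: "inj_on (?F n) (carrier (?T n))" for n
  proof (rule inj_onI)
    fix x y assume x: "x \<in> carrier (?T n)" "y \<in> carrier (?T n)" and e: "?F n x = ?F n y"
    have "x q = y q" if q: "q \<le> n" for q
      using fun_cong[OF e, of q] q inj_onD[OF lin_isoD(2)[OF iso], of q "x q" "y q"] x unfolding cT by auto
    then show "x = y" using x unfolding cT by (auto intro: extensionalityI)
  qed
  have Fs: "\<exists>x\<in>carrier (?T n). y = ?F n x" if "y \<in> carrier (?T' n)" for y n
  proof -
    have y: "y \<in> extensional {..n}" "\<And>q. q \<le> n \<Longrightarrow> y q \<in> carrier (space Z' q)" using that unfolding cT' by auto
    let ?x = "\<lambda>q\<in>{..n}. inv_into (carrier (space Z q)) (\<phi> q) (y q)"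
    have "inv_into (carrier (space Z q)) (\<phi> q) (y q) \<in> carrier (space Z q)"
        "\<phi> q (inv_into (carrier (space Z q)) (\<phi> q) (y q)) = y q" if "q \<le> n" for q
      using inv_into_into[of "y q" "\<phi> q" "carrier (space Z q)"] f_inv_into_f[of "y q" "\<phi> q" "carrier (space Z q)"]
        lin_isoD(3)[OF iso[of q]] y(2)[OF that] by auto
    then have "?x \<in> carrier (?T n)" "y = ?F n ?x" using y(1) unfolding cT by (auto intro: extensionalityI)
    then show ?thesis by blast
  qed
  have Fz: "?F n \<zero>\<^bsub>?T n\<^esub> = \<zero>\<^bsub>?T' n\<^esub>" for n
    using lin_hom_zero[OF mm] by (auto simp: total_space_def)
  have D: "total_diff K Z n x \<in> carrier (?T n) \<and> ?F n (total_diff K Z n x) = total_diff K Z' n (?F (Suc n) x)"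
    if x: "x \<in> carrier (?T (Suc n))" for n x
  proof -
    have "?F n (total_diff K Z n x) q = total_diff K Z' n (?F (Suc n) x) q \<and> total_diff K Z n x q \<in> carrier (space Z q)" if q: "q \<le> n" for q
    proof -
      have xq: "x q \<in> carrier (space Z q)" "x (Suc q) \<in> carrier (space Z (Suc q))" using x q unfolding cT by auto
      note s = b[OF xq(2)] b'[OF xq(2)] t[OF xq(1)] N[OF xq(1)]
      have h: "\<phi> q (hoch_b K Z q (x (Suc q)) \<oplus>\<^bsub>space Z q\<^esub> (x q \<ominus>\<^bsub>space Z q\<^esub> signed_cyc K Z q (x q)))
          = hoch_b K Z' q (\<phi> (Suc q) (x (Suc q))) \<oplus>\<^bsub>space Z' q\<^esub> (\<phi> q (x q) \<ominus>\<^bsub>space Z' q\<^esub> signed_cyc K Z' q (\<phi> q (x q)))"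
        using lin_hom_add[OF lin, of "hoch_b K Z q (x (Suc q))" q "x q \<ominus>\<^bsub>space Z q\<^esub> signed_cyc K Z q (x q)"]
          lin_hom_minus[OF mm xq(1), of "signed_cyc K Z q (x q)"] s xq by simp
      have m: "\<phi> q (\<ominus>\<^bsub>space Z q\<^esub> u) = \<ominus>\<^bsub>space Z' q\<^esub> \<phi> q u" if "u \<in> carrier (space Z q)" for u
        using lin_hom_minus[OF mm M.zero_closed that] that lin_hom_closed[OF lin that] lin_hom_zero[OF mm]
        by (simp add: M.minus_eq M'.minus_eq)
      have h': "\<phi> q (\<ominus>\<^bsub>space Z q\<^esub> hoch_b' K Z q (x (Suc q)) \<oplus>\<^bsub>space Z q\<^esub> norm_op K Z q (x q))
          = \<ominus>\<^bsub>space Z' q\<^esub> hoch_b' K Z' q (\<phi> (Suc q) (x (Suc q))) \<oplus>\<^bsub>space Z' q\<^esub> norm_op K Z' q (\<phi> q (x q))"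
        using lin_hom_add[OF lin, of "\<ominus>\<^bsub>space Z q\<^esub> hoch_b' K Z q (x (Suc q))" q "norm_op K Z q (x q)"] m s by simp
      show ?thesis using q h h' s xq by (simp add: total_diff_def)
    qed
    then show ?thesis unfolding cT by (auto simp: total_diff_def intro!: extensionalityI[of _ "{..n}"])
  qed
  have cyc: "?F n ` total_cycles K Z n = total_cycles K Z' n"
  proof -
    have "?F n x \<in> total_cycles K Z' n \<longleftrightarrow> x \<in> total_cycles K Z n" if x: "x \<in> carrier (?T n)" for x
    proof (cases n)
      case 0
      then show ?thesis using x lin_hom_closed[OF Fl x] by (simp add: total_cycles_def)
    next
      case (Suc m)
      have "total_diff K Z' m (?F n x) = \<zero>\<^bsub>?T' m\<^esub> \<longleftrightarrow> ?F m (total_diff K Z m x) = ?F m \<zero>\<^bsub>?T m\<^esub>"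
        using D[of x m] x Suc Fz[of m] by simp
      also have "\<dots> \<longleftrightarrow> total_diff K Z m x = \<zero>\<^bsub>?T m\<^esub>"
        by (rule inj_on_eq_iff[OF Fi]) (use D[of x m] x Suc in \<open>auto simp: cT total_space_def\<close>)
      finally show ?thesis using x lin_hom_closed[OF Fl x] Suc by (simp add: total_cycles_def)
    qed
    then show ?thesis using Fs[of _ n] by (fastforce simp: total_cycles_def)
  qed
  have bd: "?F n ` total_boundaries K Z n = total_boundaries K Z' n"
  proof -
    have "carrier (?T' (Suc n)) = ?F (Suc n) ` carrier (?T (Suc n))"
      using Fs[of _ "Suc n"] lin_hom_closed[OF Fl[of "Suc n"]] by blast
    then show ?thesis using D by (simp add: total_boundaries_def image_image)
  qed
  have "(`) (?F n) \<in> lin_iso K (cyclic_homology K Z n) (cyclic_homology K Z' n)"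
    unfolding cyclic_homology_def cyc[symmetric] bd[symmetric]
  proof (rule quot_image_iso[OF Fl Fi])
    show "x \<oplus>\<^bsub>?T n\<^esub> y \<in> carrier (?T n)" if "x \<in> carrier (?T n)" "y \<in> carrier (?T n)" for x y
      using that unfolding cT by (auto simp: total_space_def)
    show "c \<odot>\<^bsub>?T n\<^esub> x \<in> carrier (?T n)" if "c \<in> carrier K" "x \<in> carrier (?T n)" for c x
      using that unfolding cT by (auto simp: total_space_def)
    show "total_cycles K Z n \<subseteq> carrier (?T n)" by (auto simp: total_cycles_def)
    show "total_boundaries K Z n \<subseteq> carrier (?T n)" using D by (auto simp: total_boundaries_def)
  qed
  then show ?thesis by blast
qed

theorem theorem3p7:
  fixes K :: "'k ring" and H :: "('k,'h) hopf" and A :: "('k,'a) module"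
    and B :: "'a set" and \<rho> :: "'a \<Rightarrow> ('a \<times> 'h \<Rightarrow> 'k) set"
  assumes "field K"
    and "hopf_algebra K H"
    and "galois_extension K H A B \<rho>"
  shows "cyclic_object K (hopf_cyclic K H A B \<rho>) \<and>
    cyclic_isomorphic K (hopf_cyclic K H A B \<rho>) (rel_cyclic K A B) \<and>
    (\<forall>n. \<exists>f. f \<in> lin_iso K (cyclic_homology K (hopf_cyclic K H A B \<rho>) n)
                              (cyclic_homology K (rel_cyclic K A B) n))"
proof -
  interpret galois_extension K H A B \<rho> by fact
  interpret cyclic_transport K P.ZZ HC Phi
    by (intro cyclic_transport.intro cyclic_transport_axioms.intro P.rel_cyclic_object)
      (simp_all add: SH_module Phi_iso face_HC_lin degen_HC_lin cyc_HC_lin Phi_face Phi_degen Phi_cyc)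
  show ?thesis using cyclic_object' cyclic_isomorphic' cyclic_isomorphic_homology by blast
qed

end
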